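(* Let $A$, $B$, $C$ be $C^*$-algebras. If $(F,\pi)\in\mathrm{Cor}(B,C)$, then, as functors from $\mathrm{PosCor}(A,B)$ to $\mathrm{PosCor}(A,C)$, $\mathrm{KSGNS}\circ\big((-)\otimes_\pi F\big)$ is naturally isomorphic to $\big((-)\otimes_\pi F\big)\circ\mathrm{KSGNS}$.
   Context: Hilbert modules are right modules with inner product linear in the second variable; $\mathcal{L}(E_1,E_2)$ is the set of adjointable maps and $\mathcal{L}(E)=\mathcal{L}(E,E)$. A completely positive map $\phi:A\to\mathcal{L}(E)$ is strict if there is an approximate unit $(a_\lambda)$ of $A$ such that $(\phi(a_\lambda))$ is Cauchy in the strict topology on $\mathcal{L}(E)$, i.e. the topology generated by the seminorms $T\mapsto\|Tx\|$ and $T\mapsto\|T^*x\|$, $x\in E$. The category $\mathrm{PosCor}(A,B)$: objects are pairs $(E,\phi)$ with $E$ a Hilbert $B$-module and $\phi:A\to\mathcal{L}(E)$ a strict completely positive map; a morphism $(E_1,\phi_1)\to(E_2,\phi_2)$ is a pair $(\eta,\alpha)$ with $\eta\in\mathcal{L}(E_1,E_2)$ and $\alpha$ a $*$-automorphism of $A$ such that $\phi_2(\alpha(a))\circ\eta=\eta\circ\phi_1(a)$ for all $a\in A$; composition is $(\xi,\beta)\circ(\eta,\alpha)=(\xi\circ\eta,\beta\circ\alpha)$. $\mathrm{Cor}(B,C)$ is the full subcategory of $\mathrm{PosCor}(B,C)$ whose objects are pairs $(F,\pi)$ with $F$ a Hilbert $C$-module and $\pi:B\to\mathcal{L}(F)$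 a non-degenerate $*$-homomorphism (the span of $\pi(B)F$ is dense in $F$). Interior tensor product functor: for a Hilbert $B$-module $E$ and $(F,\pi)\in\mathrm{Cor}(B,C)$, $E\otimes_\pi F$ is the Hilbert $C$-module obtained by completing $(E\otimes_{\mathrm{alg}}F)/\langle xb\otimes y-x\otimes\pi(b)y\rangle$ for the inner product $\langle x_1\dot\otimes y_1,x_2\dot\otimes y_2\rangle=\langle y_1,\pi(\langle x_1,x_2\rangle)y_2\rangle$, where $x\dot\otimes y$ is the class of $x\otimes y$. The functor $(-)\otimes_\pi F:\mathrm{PosCor}(A,B)\to\mathrm{PosCor}(A,C)$ sends $(E,\phi)$ to $(E\otimes_\pi F,\tilde\phi)$ with $\tilde\phi(a)(x\dot\otimes f)=\phi(a)x\dot\otimes f$, and $(\eta,\alpha)$ to $(\hat\eta,\alpha)$ with $\hat\eta(x\dot\otimes f)=\eta(x)\dot\otimes f$. KSGNS functor (on $\mathrm{PosCor}(A,B)$, and likewise on $\mathrm{PosCor}(A,C)$): for $(E,\phi)$, $F_\phi=A\otimes_\phi E$ is the Hilbert module obtained from $A\otimes_{\mathrm{alg}}E$ with the semi-inner product $\langle a_1\otimes x_1,a_2\otimes x_2\rangle_\phi=\langle x_1,\phi(a_1^*a_2)x_2\rangle_E$ by quotienting by the null submodule and completing; $a\dot\otimes x$ is the class of $a\otimes x$; $\pi_\phi:A\to\mathcal{L}(F_\phi)$ is the non-degenerate $*$-homomorphism with $\pi_\phi(a')(a\dot\otimes x)=a'a\dot\otimes x$. $\mathrm{KSGNS}$ sends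 $(E,\phi)$ to $(F_\phi,\pi_\phi)$ and a morphism $(\eta,\alpha)$ to $(\tilde\eta,\alpha)$ with $\tilde\eta(a\dot\otimes x)=\alpha(a)\dot\otimes\eta(x)$. *)

theory Defs
  imports "HOL-Analysis.Analysis" "HOL-Library.Poly_Mapping" "HOL-Library.FuncSet"
begin

section \<open>C*-algebras\<close>

text \<open>C*-algebras are not assumed to be unital.\<close>

class cstar_algebra = real_normed_algebra + banach +
  fixes scaleC :: "complex \<Rightarrow> 'a \<Rightarrow> 'a"
    and star :: "'a \<Rightarrow> 'a"
  assumes scaleC_add_right: "scaleC c (x + y) = scaleC c x + scaleC c y"
    and scaleC_add_left: "scaleC (c + d) x = scaleC c x + scaleC d x"
    and scaleC_scaleC: "scaleC c (scaleC d x) = scaleC (c * d) x"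
    and scaleC_of_real: "scaleC (complex_of_real r) x = scaleR r x"
    and mult_scaleC_left: "scaleC c x * y = scaleC c (x * y)"
    and mult_scaleC_right: "x * scaleC c y = scaleC c (x * y)"
    and norm_scaleC: "norm (scaleC c x) = cmod c * norm x"
    and star_add: "star (x + y) = star x + star y"
    and star_scaleC: "star (scaleC c x) = scaleC (cnj c) (star x)"
    and star_mult: "star (x * y) = star y * star x"
    and star_star: "star (star x) = x"
    and norm_star_mult_self: "norm (star x * x) = (norm x)\<^sup>2"

instantiation complex :: cstar_algebra
begin
definition "scaleC_complex (c :: complex) (x :: complex) = c * x"
definition "star_complex (x :: complex) = cnj x"
instance
  by standard
    (simp_all add: scaleC_complex_def star_complex_def algebra_simps norm_mult power2_eq_square
      scaleR_conv_of_real)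
end

definition cstar_positive :: "'a::cstar_algebra \<Rightarrow> bool" where
  "cstar_positive a \<longleftrightarrow> (\<exists>b. a = star b * b)"

definition star_automorphism :: "('a::cstar_algebra \<Rightarrow> 'a) \<Rightarrow> bool" where
  "star_automorphism \<alpha> \<longleftrightarrow> bij \<alpha> \<and>
     (\<forall>a b. \<alpha> (a + b) = \<alpha> a + \<alpha> b) \<and> (\<forall>c a. \<alpha> (scaleC c a) = scaleC c (\<alpha> a)) \<and>
     (\<forall>a b. \<alpha> (a * b) = \<alpha> a * \<alpha> b) \<and> (\<forall>a. \<alpha> (star a) = star (\<alpha> a))"

text \<open>A net is represented by the filter generated by its tails. An approximate unit is a net of
  positive elements of norm at most one; it is not required to be increasing.\<close>

definition approximate_unit :: "'a::cstar_algebra filter \<Rightarrow> bool" where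
  "approximate_unit \<F> \<longleftrightarrow> \<F> \<noteq> bot \<and> (\<forall>\<^sub>F u in \<F>. cstar_positive u \<and> norm u \<le> 1) \<and>
     (\<forall>a. ((\<lambda>u. u * a) \<longlongrightarrow> a) \<F> \<and> ((\<lambda>u. a * u) \<longlongrightarrow> a) \<F>)"


section \<open>Hilbert modules\<close>

record 'e cvec =
  vcarrier :: "'e set"
  vzero :: 'e
  vadd :: "'e \<Rightarrow> 'e \<Rightarrow> 'e"
  vscale :: "complex \<Rightarrow> 'e \<Rightarrow> 'e"

definition complex_vector_space :: "('e, 'm) cvec_scheme \<Rightarrow> bool" where
  "complex_vector_space V \<longleftrightarrow>
     vzero V \<in> vcarrier V \<and>
     (\<forall>x\<in>vcarrier V. \<forall>y\<in>vcarrier V. vadd V x y \<in> vcarrier V) \<and>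
     (\<forall>c. \<forall>x\<in>vcarrier V. vscale V c x \<in> vcarrier V) \<and>
     (\<forall>x\<in>vcarrier V. \<forall>y\<in>vcarrier V. \<forall>z\<in>vcarrier V.
        vadd V (vadd V x y) z = vadd V x (vadd V y z)) \<and>
     (\<forall>x\<in>vcarrier V. \<forall>y\<in>vcarrier V. vadd V x y = vadd V y x) \<and>
     (\<forall>x\<in>vcarrier V. vadd V (vzero V) x = x) \<and>
     (\<forall>x\<in>vcarrier V. vadd V x (vscale V (- 1) x) = vzero V) \<and>
     (\<forall>c. \<forall>x\<in>vcarrier V. \<forall>y\<in>vcarrier V.
        vscale V c (vadd V x y) = vadd V (vscale V c x) (vscale V c y)) \<and>
     (\<forall>c d. \<forall>x\<in>vcarrier V. vscale V (c + d) x = vadd V (vscale V c x) (vscale V d x)) \<and>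
     (\<forall>c d. \<forall>x\<in>vcarrier V. vscale V c (vscale V d x) = vscale V (c * d) x) \<and>
     (\<forall>x\<in>vcarrier V. vscale V 1 x = x)"

definition vdiff :: "('e, 'm) cvec_scheme \<Rightarrow> 'e \<Rightarrow> 'e \<Rightarrow> 'e" where
  "vdiff V x y = vadd V x (vscale V (- 1) y)"

primrec vsum :: "('e, 'm) cvec_scheme \<Rightarrow> nat \<Rightarrow> (nat \<Rightarrow> 'e) \<Rightarrow> 'e" where
  "vsum V 0 f = vzero V"
| "vsum V (Suc n) f = vadd V (vsum V n f) (f n)"

inductive_set vspan :: "('e, 'm) cvec_scheme \<Rightarrow> 'e set \<Rightarrow> 'e set" for V S where
  zero: "vzero V \<in> vspan V S"
| step: "x \<in> S \<Longrightarrow> y \<in> vspan V S \<Longrightarrow> vadd V (vscale V c x) y \<in> vspan V S"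

definition cvec_of_algebra :: "'a::cstar_algebra cvec" where
  "cvec_of_algebra = \<lparr>vcarrier = UNIV, vzero = 0, vadd = (+), vscale = scaleC\<rparr>"

text \<open>The same record serves for modules with a semi-inner product; the predicate
  \<open>hilbert_module\<close> below asks for definiteness and completeness.\<close>

record ('e, 'b) hmod = "'e cvec" +
  hact :: "'e \<Rightarrow> 'b \<Rightarrow> 'e"
  hip :: "'e \<Rightarrow> 'e \<Rightarrow> 'b"

definition hnorm :: "('e, 'b::cstar_algebra) hmod \<Rightarrow> 'e \<Rightarrow> real" where
  "hnorm E x = sqrt (norm (hip E x x))"

definition hCauchy :: "('e, 'b::cstar_algebra) hmod \<Rightarrow> (nat \<Rightarrow> 'e) \<Rightarrow> bool" where
  "hCauchy E s \<longleftrightarrow> (\<forall>n. s n \<in> vcarrier E) \<and>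
     (\<forall>e>0. \<exists>N. \<forall>m\<ge>N. \<forall>n\<ge>N. hnorm E (vdiff E (s m) (s n)) < e)"

definition hilbert_module :: "('e, 'b::cstar_algebra) hmod \<Rightarrow> bool" where
  "hilbert_module E \<longleftrightarrow>
     complex_vector_space E \<and>
     (\<forall>x\<in>vcarrier E. \<forall>b. hact E x b \<in> vcarrier E) \<and>
     (\<forall>x\<in>vcarrier E. \<forall>y\<in>vcarrier E. \<forall>b.
        hact E (vadd E x y) b = vadd E (hact E x b) (hact E y b)) \<and>
     (\<forall>x\<in>vcarrier E. \<forall>a b. hact E x (a + b) = vadd E (hact E x a) (hact E x b)) \<and>
     (\<forall>x\<in>vcarrier E. \<forall>a b. hact E x (a * b) = hact E (hact E x a) b) \<and>
     (\<forall>x\<in>vcarrier E. \<forall>c b. vscale E c (hact E x b) = hact E (vscale E c x) b \<and>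
        vscale E c (hact E x b) = hact E x (scaleC c b)) \<and>
     (\<forall>x\<in>vcarrier E. \<forall>y\<in>vcarrier E. \<forall>z\<in>vcarrier E.
        hip E x (vadd E y z) = hip E x y + hip E x z) \<and>
     (\<forall>x\<in>vcarrier E. \<forall>y\<in>vcarrier E. \<forall>c. hip E x (vscale E c y) = scaleC c (hip E x y)) \<and>
     (\<forall>x\<in>vcarrier E. \<forall>y\<in>vcarrier E. \<forall>b. hip E x (hact E y b) = hip E x y * b) \<and>
     (\<forall>x\<in>vcarrier E. \<forall>y\<in>vcarrier E. hip E y x = star (hip E x y)) \<and>
     (\<forall>x\<in>vcarrier E. cstar_positive (hip E x x)) \<and>
     (\<forall>x\<in>vcarrier E. hip E x x = 0 \<longrightarrow> x = vzero E) \<and>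
     (\<forall>s. hCauchy E s \<longrightarrow> (\<exists>x\<in>vcarrier E. (\<lambda>n. hnorm E (vdiff E (s n) x)) \<longlonglongrightarrow> 0))"


section \<open>Adjointable maps\<close>

text \<open>Maps between modules are extensional (\<open>undefined\<close> off the domain), so that equality of
  functions is equality of maps.\<close>

definition adjoint_of ::
  "('e, 'b) hmod \<Rightarrow> ('f, 'b) hmod \<Rightarrow> ('e \<Rightarrow> 'f) \<Rightarrow> ('f \<Rightarrow> 'e) \<Rightarrow> bool" where
  "adjoint_of E F T S \<longleftrightarrow> S \<in> vcarrier F \<rightarrow>\<^sub>E vcarrier E \<and>
     (\<forall>x\<in>vcarrier E. \<forall>y\<in>vcarrier F. hip F (T x) y = hip E x (S y))"

definition adjointable :: "('e, 'b) hmod \<Rightarrow> ('f, 'b) hmod \<Rightarrow> ('e \<Rightarrow> 'f) set" where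
  "adjointable E F = {T \<in> vcarrier E \<rightarrow>\<^sub>E vcarrier F. \<exists>S. adjoint_of E F T S}"

definition hadj :: "('e, 'b) hmod \<Rightarrow> ('f, 'b) hmod \<Rightarrow> ('e \<Rightarrow> 'f) \<Rightarrow> ('f \<Rightarrow> 'e)" where
  "hadj E F T = (THE S. adjoint_of E F T S)"

definition linear_into_adjointable ::
  "('e, 'b) hmod \<Rightarrow> ('a::cstar_algebra \<Rightarrow> 'e \<Rightarrow> 'e) \<Rightarrow> bool" where
  "linear_into_adjointable E \<phi> \<longleftrightarrow>
     (\<forall>a. \<phi> a \<in> adjointable E E) \<and>
     (\<forall>a b. \<forall>x\<in>vcarrier E. \<phi> (a + b) x = vadd E (\<phi> a x) (\<phi> b x)) \<and>
     (\<forall>c a. \<forall>x\<in>vcarrier E. \<phi> (scaleC c a) x = vscale E c (\<phi> a x))"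

text \<open>An \<open>n \<times> n\<close> matrix is a function of two indices, considered for indices below \<open>n\<close>.
  The positive elements of \<open>M\<^sub>n(A)\<close> and of \<open>M\<^sub>n(\<L>(E))\<close> are those of the form \<open>X\<^sup>* X\<close>.\<close>

definition matrix_positive :: "nat \<Rightarrow> (nat \<Rightarrow> nat \<Rightarrow> 'a::cstar_algebra) \<Rightarrow> bool" where
  "matrix_positive n M \<longleftrightarrow>
     (\<exists>X. \<forall>i<n. \<forall>j<n. M i j = (\<Sum>k<n. star (X k i) * X k j))"

definition operator_matrix_positive ::
  "('e, 'b) hmod \<Rightarrow> nat \<Rightarrow> (nat \<Rightarrow> nat \<Rightarrow> 'e \<Rightarrow> 'e) \<Rightarrow> bool" where
  "operator_matrix_positive E n M \<longleftrightarrow>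
     (\<exists>Y. (\<forall>i<n. \<forall>j<n. Y i j \<in> adjointable E E) \<and>
        (\<forall>i<n. \<forall>j<n. \<forall>x\<in>vcarrier E.
           M i j x = vsum E n (\<lambda>k. hadj E E (Y k i) (Y k j x))))"

definition completely_positive ::
  "('e, 'b) hmod \<Rightarrow> ('a::cstar_algebra \<Rightarrow> 'e \<Rightarrow> 'e) \<Rightarrow> bool" where
  "completely_positive E \<phi> \<longleftrightarrow> linear_into_adjointable E \<phi> \<and>
     (\<forall>n M. matrix_positive n M \<longrightarrow> operator_matrix_positive E n (\<lambda>i j. \<phi> (M i j)))"

definition strictly_Cauchy ::
  "('e, 'b::cstar_algebra) hmod \<Rightarrow> ('a \<Rightarrow> 'e \<Rightarrow> 'e) \<Rightarrow> 'a filter \<Rightarrow> bool" where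
  "strictly_Cauchy E \<phi> \<F> \<longleftrightarrow>
     (\<forall>x\<in>vcarrier E. \<forall>e>0. \<exists>P. eventually P \<F> \<and> (\<forall>u v. P u \<longrightarrow> P v \<longrightarrow>
        hnorm E (vdiff E (\<phi> u x) (\<phi> v x)) < e \<and>
        hnorm E (vdiff E (hadj E E (\<phi> u) x) (hadj E E (\<phi> v) x)) < e))"

definition strict ::
  "('e, 'b::cstar_algebra) hmod \<Rightarrow> ('a::cstar_algebra \<Rightarrow> 'e \<Rightarrow> 'e) \<Rightarrow> bool" where
  "strict E \<phi> \<longleftrightarrow> (\<exists>\<F>. approximate_unit \<F> \<and> strictly_Cauchy E \<phi> \<F>)"

definition star_representation ::
  "('e, 'b) hmod \<Rightarrow> ('a::cstar_algebra \<Rightarrow> 'e \<Rightarrow> 'e) \<Rightarrow> bool" where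
  "star_representation E \<pi> \<longleftrightarrow> linear_into_adjointable E \<pi> \<and>
     (\<forall>a b. \<forall>x\<in>vcarrier E. \<pi> (a * b) x = \<pi> a (\<pi> b x)) \<and>
     (\<forall>a. \<pi> (star a) = hadj E E (\<pi> a))"

definition nondegenerate ::
  "('e, 'b::cstar_algebra) hmod \<Rightarrow> ('a \<Rightarrow> 'e \<Rightarrow> 'e) \<Rightarrow> bool" where
  "nondegenerate E \<pi> \<longleftrightarrow>
     (\<forall>y\<in>vcarrier E. \<forall>e>0. \<exists>z\<in>vspan E {\<pi> a x | a x. x \<in> vcarrier E}.
        hnorm E (vdiff E y z) < e)"


section \<open>Categories and functors\<close>

text \<open>Morphisms do not record their source and target: composition takes the source of its second
  argument as a parameter, and a functor acts on morphisms with given source and target.\<close>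

record ('o, 'm) cat =
  Obj :: "'o set"
  Hom :: "'o \<Rightarrow> 'o \<Rightarrow> 'm set"
  Comp :: "'o \<Rightarrow> 'm \<Rightarrow> 'm \<Rightarrow> 'm"
  Ident :: "'o \<Rightarrow> 'm"

definition category :: "('o, 'm) cat \<Rightarrow> bool" where
  "category C \<longleftrightarrow>
     (\<forall>X\<in>Obj C. Ident C X \<in> Hom C X X) \<and>
     (\<forall>X\<in>Obj C. \<forall>Y\<in>Obj C. \<forall>Z\<in>Obj C. \<forall>f\<in>Hom C X Y. \<forall>g\<in>Hom C Y Z. Comp C X g f \<in> Hom C X Z) \<and>
     (\<forall>X\<in>Obj C. \<forall>Y\<in>Obj C. \<forall>f\<in>Hom C X Y.
        Comp C X f (Ident C X) = f \<and> Comp C X (Ident C Y) f = f) \<and>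
     (\<forall>W\<in>Obj C. \<forall>X\<in>Obj C. \<forall>Y\<in>Obj C. \<forall>Z\<in>Obj C.
        \<forall>f\<in>Hom C W X. \<forall>g\<in>Hom C X Y. \<forall>h\<in>Hom C Y Z.
          Comp C W h (Comp C W g f) = Comp C W (Comp C X h g) f)"

record ('o, 'm, 'p, 'n) ftor =
  on_obj :: "'o \<Rightarrow> 'p"
  on_mor :: "'o \<Rightarrow> 'o \<Rightarrow> 'm \<Rightarrow> 'n"

definition is_functor ::
  "('o, 'm) cat \<Rightarrow> ('p, 'n) cat \<Rightarrow> ('o, 'm, 'p, 'n) ftor \<Rightarrow> bool" where
  "is_functor C D \<Phi> \<longleftrightarrow> category C \<and> category D \<and>
     (\<forall>X\<in>Obj C. on_obj \<Phi> X \<in> Obj D) \<and>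
     (\<forall>X\<in>Obj C. \<forall>Y\<in>Obj C. \<forall>f\<in>Hom C X Y.
        on_mor \<Phi> X Y f \<in> Hom D (on_obj \<Phi> X) (on_obj \<Phi> Y)) \<and>
     (\<forall>X\<in>Obj C. on_mor \<Phi> X X (Ident C X) = Ident D (on_obj \<Phi> X)) \<and>
     (\<forall>X\<in>Obj C. \<forall>Y\<in>Obj C. \<forall>Z\<in>Obj C. \<forall>f\<in>Hom C X Y. \<forall>g\<in>Hom C Y Z.
        on_mor \<Phi> X Z (Comp C X g f) =
          Comp D (on_obj \<Phi> X) (on_mor \<Phi> Y Z g) (on_mor \<Phi> X Y f))"

definition ftor_comp ::
  "('p, 'n, 'q, 'l) ftor \<Rightarrow> ('o, 'm, 'p, 'n) ftor \<Rightarrow> ('o, 'm, 'q, 'l) ftor"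
  (infixr \<open>\<circ>\<^sub>F\<close> 55) where
  "\<Psi> \<circ>\<^sub>F \<Phi> = \<lparr>on_obj = (\<lambda>X. on_obj \<Psi> (on_obj \<Phi> X)),
     on_mor = (\<lambda>X Y f. on_mor \<Psi> (on_obj \<Phi> X) (on_obj \<Phi> Y) (on_mor \<Phi> X Y f))\<rparr>"


section \<open>The categories PosCor(A,B) and Cor(B,C)\<close>

text \<open>The C*-algebras are types, while a Hilbert module is carried by a subset of a type \<open>'e\<close>,
  which is arbitrary. The tensor product and the dilation are carried by types of their own, hence
  homomorphism sets, composition and isomorphism are defined for modules with possibly different
  carrier types; \<open>PosCor\<close> collects the objects with carrier type \<open>'e\<close>.\<close>

type_synonym ('e, 'a, 'b) pos_obj = "('e, 'b) hmod \<times> ('a \<Rightarrow> 'e \<Rightarrow> 'e)"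
type_synonym ('e, 'f, 'a) pos_mor = "('e \<Rightarrow> 'f) \<times> ('a \<Rightarrow> 'a)"

definition pos_hom ::
  "('e, 'a::cstar_algebra, 'b) pos_obj \<Rightarrow> ('f, 'a, 'b) pos_obj \<Rightarrow> ('e, 'f, 'a) pos_mor set" where
  "pos_hom X Y = {(\<eta>, \<alpha>). \<eta> \<in> adjointable (fst X) (fst Y) \<and> star_automorphism \<alpha> \<and>
     (\<forall>a. \<forall>x\<in>vcarrier (fst X). snd Y (\<alpha> a) (\<eta> x) = \<eta> (snd X a x))}"

definition pos_comp ::
  "('e, 'a, 'b) pos_obj \<Rightarrow> ('f, 'g, 'a) pos_mor \<Rightarrow> ('e, 'f, 'a) pos_mor \<Rightarrow> ('e, 'g, 'a) pos_mor"
  where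
  "pos_comp X g f = (compose (vcarrier (fst X)) (fst g) (fst f), snd g \<circ> snd f)"

definition pos_id :: "('e, 'a, 'b) pos_obj \<Rightarrow> ('e, 'e, 'a) pos_mor" where
  "pos_id X = (restrict id (vcarrier (fst X)), id)"

definition pos_iso ::
  "('e, 'a::cstar_algebra, 'b) pos_obj \<Rightarrow> ('f, 'a, 'b) pos_obj \<Rightarrow> ('e, 'f, 'a) pos_mor \<Rightarrow> bool" where
  "pos_iso X Y f \<longleftrightarrow> f \<in> pos_hom X Y \<and>
     (\<exists>g\<in>pos_hom Y X. pos_comp X g f = pos_id X \<and> pos_comp Y f g = pos_id Y)"

definition PosCor ::
  "(('e, 'a::cstar_algebra, 'b::cstar_algebra) pos_obj, ('e, 'e, 'a) pos_mor) cat" where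
  "PosCor = \<lparr>Obj = {(E, \<phi>). hilbert_module E \<and> completely_positive E \<phi> \<and> strict E \<phi>},
     Hom = pos_hom, Comp = pos_comp, Ident = pos_id\<rparr>"

text \<open>Non-degenerate representations are automatically completely positive and strict.\<close>

definition Cor ::
  "(('e, 'a::cstar_algebra, 'b::cstar_algebra) pos_obj, ('e, 'e, 'a) pos_mor) cat" where
  "Cor = PosCor\<lparr>Obj := {(E, \<pi>). hilbert_module E \<and> star_representation E \<pi> \<and> nondegenerate E \<pi>}\<rparr>"

lemma pos_id_in_pos_hom:
  assumes "completely_positive E \<phi>"
  shows "pos_id (E, \<phi>) \<in> pos_hom (E, \<phi>) (E, \<phi>)"
proof -
  have "adjoint_of E E (restrict id (vcarrier E)) (restrict id (vcarrier E))"
    by (auto simp: adjoint_of_def)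
  moreover have "\<phi> a \<in> vcarrier E \<rightarrow> vcarrier E" for a
    using assms unfolding completely_positive_def linear_into_adjointable_def adjointable_def
    by (auto simp: PiE_def)
  ultimately show ?thesis
    by (auto simp: pos_id_def pos_hom_def adjointable_def star_automorphism_def Pi_iff)
qed

lemma pos_homD:
  assumes "f \<in> pos_hom X Y"
  shows "fst f \<in> extensional (vcarrier (fst X))"
    and "x \<in> vcarrier (fst X) \<Longrightarrow> fst f x \<in> vcarrier (fst Y)"
    and "star_automorphism (snd f)"
    and "x \<in> vcarrier (fst X) \<Longrightarrow> snd Y (snd f a) (fst f x) = fst f (snd X a x)"
  using assms by (auto simp: pos_hom_def adjointable_def PiE_def)

lemma pos_comp_in_pos_hom:
  assumes X: "\<And>a x. x \<in> vcarrier (fst X) \<Longrightarrow> snd X a x \<in> vcarrier (fst X)"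
    and f: "f \<in> pos_hom X Y" and g: "g \<in> pos_hom Y Z"
  shows "pos_comp X g f \<in> pos_hom X Z"
proof -
  note f' = pos_homD[OF f] and g' = pos_homD[OF g]
  obtain S T where S: "adjoint_of (fst X) (fst Y) (fst f) S"
    and T: "adjoint_of (fst Y) (fst Z) (fst g) T"
    using f g by (auto simp: pos_hom_def adjointable_def)
  have S': "S y \<in> vcarrier (fst X)" if "y \<in> vcarrier (fst Y)" for y
    using S that by (auto simp: adjoint_of_def)
  have T': "T z \<in> vcarrier (fst Y)" if "z \<in> vcarrier (fst Z)" for z
    using T that by (auto simp: adjoint_of_def)
  have "adjoint_of (fst X) (fst Z) (compose (vcarrier (fst X)) (fst g) (fst f))
          (compose (vcarrier (fst Z)) S T)"
    unfolding adjoint_of_def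
  proof (intro conjI ballI)
    show "compose (vcarrier (fst Z)) S T \<in> vcarrier (fst Z) \<rightarrow>\<^sub>E vcarrier (fst X)"
      by (simp add: compose_def S' T')
  next
    fix x z assume x: "x \<in> vcarrier (fst X)" and z: "z \<in> vcarrier (fst Z)"
    have "hip (fst Z) (fst g (fst f x)) z = hip (fst Y) (fst f x) (T z)"
      using T f'(2)[OF x] z by (simp add: adjoint_of_def)
    also have "\<dots> = hip (fst X) x (S (T z))"
      using S x T'[OF z] by (simp add: adjoint_of_def)
    finally show "hip (fst Z) (compose (vcarrier (fst X)) (fst g) (fst f) x) z =
        hip (fst X) x (compose (vcarrier (fst Z)) S T z)"
      using x z by (simp add: compose_def)
  qed
  moreover have "star_automorphism (snd g \<circ> snd f)"
    using f'(3) g'(3) unfolding star_automorphism_def by (simp add: bij_comp)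
  moreover have "compose (vcarrier (fst X)) (fst g) (fst f) \<in> vcarrier (fst X) \<rightarrow>\<^sub>E vcarrier (fst Z)"
    by (simp add: compose_def f'(2) g'(2))
  moreover have "snd Z ((snd g \<circ> snd f) a) (compose (vcarrier (fst X)) (fst g) (fst f) x) =
      compose (vcarrier (fst X)) (fst g) (fst f) (snd X a x)" if "x \<in> vcarrier (fst X)" for a x
    using that X[OF that] by (simp add: compose_def f'(2,4) g'(4))
  ultimately show ?thesis
    unfolding pos_hom_def pos_comp_def adjointable_def by blast
qed

lemma pos_comp_ident:
  assumes "f \<in> pos_hom X Y"
  shows "pos_comp X f (pos_id X) = f" and "pos_comp X (pos_id Y) f = f"
  using pos_homD(1,2)[OF assms]
  by (auto simp: pos_comp_def pos_id_def compose_def fun_eq_iff extensional_def intro!: prod_eqI)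

lemma pos_comp_assoc:
  assumes "f \<in> pos_hom W X"
  shows "pos_comp W h (pos_comp W g f) = pos_comp W (pos_comp X h g) f"
  using pos_homD(2)[OF assms] by (auto simp: pos_comp_def compose_def fun_eq_iff)

lemma category_PosCor: "category PosCor"
proof -
  have inv: "snd X a x \<in> vcarrier (fst X)" if "X \<in> Obj PosCor" "x \<in> vcarrier (fst X)" for X a x
    using that by (auto simp: PosCor_def completely_positive_def linear_into_adjointable_def
        adjointable_def PiE_iff)
  have sel: "Hom PosCor = pos_hom" "Comp PosCor = pos_comp" "Ident PosCor = pos_id"
    by (simp_all add: PosCor_def)
  have id: "pos_id X \<in> pos_hom X X" if "X \<in> Obj PosCor" for X
    using that pos_id_in_pos_hom by (auto simp: PosCor_def)
  show ?thesis
    unfolding category_def sel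
    by (intro conjI ballI)
      (assumption | rule id pos_comp_in_pos_hom inv pos_comp_ident pos_comp_assoc)+
qed

definition naturally_isomorphic ::
  "('o, 'm) cat \<Rightarrow> ('o, 'm, ('e, 'a::cstar_algebra, 'b::cstar_algebra) pos_obj, ('e, 'e, 'a) pos_mor) ftor
     \<Rightarrow> ('o, 'm, ('f, 'a, 'b) pos_obj, ('f, 'f, 'a) pos_mor) ftor \<Rightarrow> bool" where
  "naturally_isomorphic C \<Phi> \<Psi> \<longleftrightarrow> is_functor C PosCor \<Phi> \<and> is_functor C PosCor \<Psi> \<and>
     (\<exists>\<tau>. (\<forall>X\<in>Obj C. pos_iso (on_obj \<Phi> X) (on_obj \<Psi> X) (\<tau> X)) \<and>
        (\<forall>X\<in>Obj C. \<forall>Y\<in>Obj C. \<forall>f\<in>Hom C X Y.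
           pos_comp (on_obj \<Phi> X) (\<tau> Y) (on_mor \<Phi> X Y f) =
           pos_comp (on_obj \<Phi> X) (on_mor \<Psi> X Y f) (\<tau> X)))"


section \<open>Algebraic tensor products\<close>

text \<open>The algebraic tensor product \<open>V \<otimes> W\<close> is the quotient of the free complex vector space on
  \<open>V \<times> W\<close> by the span of the bilinearity relations, possibly enlarged by further relations.\<close>

type_synonym ('v, 'w) formal = "('v \<times> 'w) \<Rightarrow>\<^sub>0 complex"

abbreviation elem :: "'v \<Rightarrow> 'w \<Rightarrow> ('v, 'w) formal" where
  "elem x y \<equiv> Poly_Mapping.single (x, y) 1"

definition fscale :: "complex \<Rightarrow> ('v, 'w) formal \<Rightarrow> ('v, 'w) formal" where
  "fscale c p = Poly_Mapping.map ((*) c) p"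

definition formal_sums ::
  "('v, 'm) cvec_scheme \<Rightarrow> ('w, 'n) cvec_scheme \<Rightarrow> ('v, 'w) formal set" where
  "formal_sums V W = {p. Poly_Mapping.keys p \<subseteq> vcarrier V \<times> vcarrier W}"

definition bilinear_relations ::
  "('v, 'm) cvec_scheme \<Rightarrow> ('w, 'n) cvec_scheme \<Rightarrow> ('v, 'w) formal set" where
  "bilinear_relations V W =
     {elem (vadd V x x') y - elem x y - elem x' y | x x' y.
        x \<in> vcarrier V \<and> x' \<in> vcarrier V \<and> y \<in> vcarrier W} \<union>
     {elem x (vadd W y y') - elem x y - elem x y' | x y y'.
        x \<in> vcarrier V \<and> y \<in> vcarrier W \<and> y' \<in> vcarrier W} \<union>
     {elem (vscale V c x) y - fscale c (elem x y) | c x y. x \<in> vcarrier V \<and> y \<in> vcarrier W} \<union>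
     {elem x (vscale W c y) - fscale c (elem x y) | c x y. x \<in> vcarrier V \<and> y \<in> vcarrier W}"

definition tclass ::
  "('v, 'm) cvec_scheme \<Rightarrow> ('w, 'n) cvec_scheme \<Rightarrow> ('v, 'w) formal set \<Rightarrow> ('v, 'w) formal
     \<Rightarrow> ('v, 'w) formal set" where
  "tclass V W R p =
     {q \<in> formal_sums V W. q - p \<in> module.span fscale (bilinear_relations V W \<union> R)}"

definition some_rep :: "'x set \<Rightarrow> 'x" where
  "some_rep X = (SOME p. p \<in> X)"

text \<open>The quotient as a right module, acting on the second factor, with the sesquilinear form
  determined by its values \<open>g (x, y) (x', y')\<close> on elementary tensors. The operations are computed on
  representatives; they do not depend on the choice when \<open>g\<close> and the action respect the
  relations.\<close>

definition semi_tensor ::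
  "('v, 'm) cvec_scheme \<Rightarrow> ('w, 'c::cstar_algebra) hmod \<Rightarrow> ('v, 'w) formal set
     \<Rightarrow> ('v \<times> 'w \<Rightarrow> 'v \<times> 'w \<Rightarrow> 'c) \<Rightarrow> (('v, 'w) formal set, 'c) hmod" where
  "semi_tensor V W R g =
    \<lparr>vcarrier = tclass V W R ` formal_sums V W,
     vzero = tclass V W R 0,
     vadd = (\<lambda>X Y. tclass V W R (some_rep X + some_rep Y)),
     vscale = (\<lambda>c X. tclass V W R (fscale c (some_rep X))),
     hact = (\<lambda>X c. tclass V W R
       (\<Sum>k\<in>Poly_Mapping.keys (some_rep X).
          fscale (Poly_Mapping.lookup (some_rep X) k) (elem (fst k) (hact W (snd k) c)))),
     hip = (\<lambda>X Y. \<Sum>k\<in>Poly_Mapping.keys (some_rep X). \<Sum>l\<in>Poly_Mapping.keys (some_rep Y).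
       scaleC (cnj (Poly_Mapping.lookup (some_rep X) k) * Poly_Mapping.lookup (some_rep Y) l) (g k l))\<rparr>"


section \<open>Completion\<close>

text \<open>Classes of Cauchy sequences modulo sequences converging to zero. For a module with a
  semi-inner product this amounts to dividing out the null vectors and then completing.\<close>

definition cauchy_class :: "('v, 'c::cstar_algebra) hmod \<Rightarrow> (nat \<Rightarrow> 'v) \<Rightarrow> (nat \<Rightarrow> 'v) set" where
  "cauchy_class P s = {t. hCauchy P t \<and> (\<lambda>n. hnorm P (vdiff P (s n) (t n))) \<longlonglongrightarrow> 0}"

definition completed_module ::
  "('v, 'c::cstar_algebra) hmod \<Rightarrow> ((nat \<Rightarrow> 'v) set, 'c) hmod" where
  "completed_module P =
    \<lparr>vcarrier = cauchy_class P ` {s. hCauchy P s},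
     vzero = cauchy_class P (\<lambda>n. vzero P),
     vadd = (\<lambda>X Y. cauchy_class P (\<lambda>n. vadd P (some_rep X n) (some_rep Y n))),
     vscale = (\<lambda>c X. cauchy_class P (\<lambda>n. vscale P c (some_rep X n))),
     hact = (\<lambda>X c. cauchy_class P (\<lambda>n. hact P (some_rep X n) c)),
     hip = (\<lambda>X Y. lim (\<lambda>n. hip P (some_rep X n) (some_rep Y n)))\<rparr>"

type_synonym ('v, 'w) completed_tensor = "(nat \<Rightarrow> ('v, 'w) formal set) set"


section \<open>The interior tensor product functor\<close>

definition balanced_relations ::
  "('e, 'b) hmod \<Rightarrow> ('f, 'c) hmod \<Rightarrow> ('b \<Rightarrow> 'f \<Rightarrow> 'f) \<Rightarrow> ('e, 'f) formal set" where
  "balanced_relations E F \<pi> =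
     {elem (hact E x b) y - elem x (\<pi> b y) | x b y. x \<in> vcarrier E \<and> y \<in> vcarrier F}"

definition interior_semi ::
  "('e, 'b) hmod \<Rightarrow> ('f, 'c::cstar_algebra) hmod \<Rightarrow> ('b \<Rightarrow> 'f \<Rightarrow> 'f)
     \<Rightarrow> (('e, 'f) formal set, 'c) hmod" where
  "interior_semi E F \<pi> = semi_tensor E F (balanced_relations E F \<pi>)
     (\<lambda>(x1, y1) (x2, y2). hip F y1 (\<pi> (hip E x1 x2) y2))"

definition interior_tensor ::
  "('e, 'b) hmod \<Rightarrow> ('f, 'c::cstar_algebra) hmod \<Rightarrow> ('b \<Rightarrow> 'f \<Rightarrow> 'f)
     \<Rightarrow> (('e, 'f) completed_tensor, 'c) hmod" where
  "interior_tensor E F \<pi> = completed_module (interior_semi E F \<pi>)"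

definition itensor ::
  "('e, 'b) hmod \<Rightarrow> ('f, 'c::cstar_algebra) hmod \<Rightarrow> ('b \<Rightarrow> 'f \<Rightarrow> 'f) \<Rightarrow> 'e \<Rightarrow> 'f
     \<Rightarrow> ('e, 'f) completed_tensor" where
  "itensor E F \<pi> x y = cauchy_class (interior_semi E F \<pi>)
     (\<lambda>n. tclass E F (balanced_relations E F \<pi>) (elem x y))"

definition interior_map ::
  "('f, 'c::cstar_algebra) hmod \<Rightarrow> ('b \<Rightarrow> 'f \<Rightarrow> 'f) \<Rightarrow> ('e, 'b) hmod \<Rightarrow> ('g, 'b) hmod \<Rightarrow> ('e \<Rightarrow> 'g)
     \<Rightarrow> ('e, 'f) completed_tensor \<Rightarrow> ('g, 'f) completed_tensor" where
  "interior_map F \<pi> E1 E2 \<eta> =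
     (THE T. T \<in> adjointable (interior_tensor E1 F \<pi>) (interior_tensor E2 F \<pi>) \<and>
        (\<forall>x\<in>vcarrier E1. \<forall>y\<in>vcarrier F. T (itensor E1 F \<pi> x y) = itensor E2 F \<pi> (\<eta> x) y))"

definition tensor_functor ::
  "('f, 'c::cstar_algebra) hmod \<Rightarrow> ('b \<Rightarrow> 'f \<Rightarrow> 'f) \<Rightarrow>
     (('e, 'a, 'b) pos_obj, ('e, 'e, 'a) pos_mor,
      (('e, 'f) completed_tensor, 'a, 'c) pos_obj,
      (('e, 'f) completed_tensor, ('e, 'f) completed_tensor, 'a) pos_mor) ftor" where
  "tensor_functor F \<pi> =
    \<lparr>on_obj = (\<lambda>(E, \<phi>). (interior_tensor E F \<pi>, \<lambda>a. interior_map F \<pi> E E (\<phi> a))),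
     on_mor = (\<lambda>X Y (\<eta>, \<alpha>). (interior_map F \<pi> (fst X) (fst Y) \<eta>, \<alpha>))\<rparr>"


section \<open>The KSGNS functor\<close>

definition ksgns_semi ::
  "('e, 'a::cstar_algebra, 'b::cstar_algebra) pos_obj \<Rightarrow> (('a, 'e) formal set, 'b) hmod" where
  "ksgns_semi X = semi_tensor (cvec_of_algebra :: 'a cvec) (fst X) {}
     (\<lambda>(a1, x1) (a2, x2). hip (fst X) x1 (snd X (star a1 * a2) x2))"

definition ksgns_module ::
  "('e, 'a::cstar_algebra, 'b::cstar_algebra) pos_obj \<Rightarrow> (('a, 'e) completed_tensor, 'b) hmod" where
  "ksgns_module X = completed_module (ksgns_semi X)"

definition ktensor ::
  "('e, 'a::cstar_algebra, 'b::cstar_algebra) pos_obj \<Rightarrow> 'a \<Rightarrow> 'e \<Rightarrow> ('a, 'e) completed_tensor" where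
  "ktensor X a x = cauchy_class (ksgns_semi X)
     (\<lambda>n. tclass (cvec_of_algebra :: 'a cvec) (fst X) {} (elem a x))"

definition ksgns_rep ::
  "('e, 'a::cstar_algebra, 'b::cstar_algebra) pos_obj
     \<Rightarrow> 'a \<Rightarrow> ('a, 'e) completed_tensor \<Rightarrow> ('a, 'e) completed_tensor" where
  "ksgns_rep X a' =
     (THE T. T \<in> adjointable (ksgns_module X) (ksgns_module X) \<and>
        (\<forall>a. \<forall>x\<in>vcarrier (fst X). T (ktensor X a x) = ktensor X (a' * a) x))"

definition ksgns_map ::
  "('e, 'a::cstar_algebra, 'b::cstar_algebra) pos_obj \<Rightarrow> ('e, 'a, 'b) pos_obj \<Rightarrow> ('e, 'e, 'a) pos_mor
     \<Rightarrow> ('a, 'e) completed_tensor \<Rightarrow> ('a, 'e) completed_tensor" where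
  "ksgns_map X Y f =
     (THE T. T \<in> adjointable (ksgns_module X) (ksgns_module Y) \<and>
        (\<forall>a. \<forall>x\<in>vcarrier (fst X). T (ktensor X a x) = ktensor Y (snd f a) (fst f x)))"

definition KSGNS ::
  "(('e, 'a::cstar_algebra, 'b::cstar_algebra) pos_obj, ('e, 'e, 'a) pos_mor,
    (('a, 'e) completed_tensor, 'a, 'b) pos_obj,
    (('a, 'e) completed_tensor, ('a, 'e) completed_tensor, 'a) pos_mor) ftor" where
  "KSGNS =
    \<lparr>on_obj = (\<lambda>X. (ksgns_module X, ksgns_rep X)),
     on_mor = (\<lambda>X Y f. (ksgns_map X Y f, snd f))\<rparr>"

end

theory Submission
  imports Defs
begin

text \<open>Both composites are generated by elements indexed by \<open>a \<in> A\<close>, \<open>x \<in> E\<close>, \<open>y \<in> F\<close>, namely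
  \<open>a \<otimes> (x \<otimes> y)\<close> and \<open>(a \<otimes> x) \<otimes> y\<close>, and in both cases the inner product of two such elements is
  \<open>\<langle>y, \<pi>(\<langle>x, \<phi>(a\<^sup>* a') x'\<rangle>) y'\<rangle>\<close>. Matching the generators therefore extends to a unitary, which
  is natural because it is so on generators.

  All maps between completed tensor products are obtained from their values on generators: a map
  with a formal adjoint is bounded as soon as the iterates of its modulus grow geometrically on each
  generator, by repeated use of the Cauchy-Schwarz inequality. Positivity in a C*-algebra is handled
  without spectral theory, through the square root series in the multiplier algebra.\<close>

section \<open>Positive elements of C*-algebras\<close>

text \<open>No operator C*-algebra is formed: \<open>adjointable E E\<close> remains a set of maps
  without norm or order. So neither the operator inequality between
  \<open>\<langle>T x, T x\<rangle>\<close> and \<open>\<langle>x, x\<rangle>\<close> nor the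
  automatic boundedness of positive maps is at hand, and positive operator matrices occur only in
  the factored form of their definition. Boundedness of adjointable maps and of positive forms is
  therefore proved by series arguments, and estimates on tensor products are reduced to single
  generators, where a crude constant is enough because it disappears under 2^n-th roots. The
  functors are definite descriptions, so nothing is known about a value of theirs before existence
  and uniqueness of the map are proved. The operations of the quotients are computed on chosen
  representatives; hence before completion equality of vectors is replaced by equality of inner
  products. Strictness has to survive both constructions. It can be tested on generators, because
  positive elements of norm at most 1 act with a common bound and by self-adjoint maps.\<close>

declare star_star [simp]

lemma star_zero [simp]: "star (0 :: 'a::cstar_algebra) = 0"
  using star_add[of "0::'a" 0] by simp

lemma star_minus [simp]: "star (- x :: 'a::cstar_algebra) = - star x"
  using star_add[of x "- x"] by (simp add: eq_neg_iff_add_eq_0 add.commute)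

lemma star_diff: "star (x - y :: 'a::cstar_algebra) = star x - star y"
  using star_add[of x "- y"] by simp

lemma star_scaleR: "star (r *\<^sub>R x :: 'a::cstar_algebra) = r *\<^sub>R star x"
  using star_scaleC[of "complex_of_real r" x] by (simp add: scaleC_of_real)

lemma star_sum: "star (sum f A :: 'a::cstar_algebra) = (\<Sum>i\<in>A. star (f i))"
  by (induction A rule: infinite_finite_induct) (simp_all add: star_add)

lemma scaleC_one [simp]: "scaleC 1 (x :: 'a::cstar_algebra) = x"
  using scaleC_of_real[of 1 x] by simp

lemma scaleC_zero_left [simp]: "scaleC 0 (x :: 'a::cstar_algebra) = 0"
  using scaleC_of_real[of 0 x] by simp

lemma scaleC_zero_right [simp]: "scaleC c (0 :: 'a::cstar_algebra) = 0"
  using scaleC_add_right[of c "0::'a" 0] by simp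

lemma scaleC_minus_left: "scaleC (- c) (x :: 'a::cstar_algebra) = - scaleC c x"
  using scaleC_add_left[of c "- c" x] by (simp add: eq_neg_iff_add_eq_0 add.commute)

lemma scaleC_minus_right: "scaleC c (- x :: 'a::cstar_algebra) = - scaleC c x"
  using scaleC_add_right[of c x "- x"] by (simp add: eq_neg_iff_add_eq_0 add.commute)

lemma scaleC_diff_right: "scaleC c (x - y :: 'a::cstar_algebra) = scaleC c x - scaleC c y"
  using scaleC_add_right[of c x "- y"] by (simp add: scaleC_minus_right)

lemma scaleC_minus_one [simp]: "scaleC (- 1) (x :: 'a::cstar_algebra) = - x"
  by (simp add: scaleC_minus_left)

lemma scaleC_sum_right: "scaleC c (sum f A :: 'a::cstar_algebra) = (\<Sum>i\<in>A. scaleC c (f i))"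
  by (induction A rule: infinite_finite_induct) (simp_all add: scaleC_add_right)

lemma scaleC_scaleR: "scaleC c (r *\<^sub>R x :: 'a::cstar_algebra) = r *\<^sub>R scaleC c x"
  by (simp add: scaleC_of_real[symmetric] scaleC_scaleC mult.commute)

lemma norm_star [simp]: "norm (star x :: 'a::cstar_algebra) = norm x"
proof -
  have *: "norm y \<le> norm (star y)" for y :: 'a
  proof (cases "y = 0")
    case False
    have "norm y * norm y \<le> norm (star y) * norm y"
      using norm_star_mult_self[of y] norm_mult_ineq[of "star y" y] by (simp add: power2_eq_square)
    with False show ?thesis by simp
  qed simp
  show ?thesis using *[of x] *[of "star x"] by simp
qed

lemma norm_mult_star_self: "norm (x * star x :: 'a::cstar_algebra) = (norm x)\<^sup>2"
  using norm_star_mult_self[of "star x"] by simp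

lemma bounded_linear_star: "bounded_linear (star :: 'a::cstar_algebra \<Rightarrow> 'a)"
  by (rule bounded_linear_intro[where K = 1]) (simp_all add: star_add star_scaleR)

lemmas tendsto_star = bounded_linear.tendsto[OF bounded_linear_star]

lemma bounded_linear_scaleC: "bounded_linear (scaleC c :: 'a::cstar_algebra \<Rightarrow> 'a)"
  by (rule bounded_linear_intro[where K = "cmod c"])
    (simp_all add: scaleC_add_right scaleC_scaleR norm_scaleC)

lemmas tendsto_scaleC = bounded_linear.tendsto[OF bounded_linear_scaleC]

subsection \<open>Unital algebras\<close>

text \<open>The class admits \<open>0 = 1\<close>, since the multipliers of the zero algebra form
  the zero algebra. This is why the norm of the unit is estimated by 1 and not equated with
  it.\<close>

class unital_cstar_algebra = cstar_algebra + monoid_mult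

lemma norm_unit_le: "norm (1 :: 'a::unital_cstar_algebra) \<le> 1"
proof -
  have "star (1::'a) * 1 = 1" using star_mult[of "star (1::'a)" 1] by simp
  then have "norm (1::'a) = norm (1::'a) * norm (1::'a)"
    using norm_star_mult_self[of "1::'a"] by (simp add: power2_eq_square)
  then show ?thesis by auto
qed

lemma star_one [simp]: "star (1 :: 'a::unital_cstar_algebra) = 1"
  using star_mult[of "star (1::'a)" 1] by simp

lemma star_power: "star (x ^ n :: 'a::unital_cstar_algebra) = star x ^ n"
  by (induction n) (simp_all add: star_mult power_commutes)

lemma norm_scaleR_unit_le: "s \<ge> 0 \<Longrightarrow> norm (s *\<^sub>R (1 :: 'a::unital_cstar_algebra)) \<le> s"
  using mult_left_mono[OF norm_unit_le, of s] by simp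

lemma norm_power_le_power: "norm (x ^ n :: 'a::unital_cstar_algebra) \<le> norm x ^ n"
proof (induction n)
  case (Suc n)
  have "norm (x ^ Suc n) \<le> norm x * norm (x ^ n)" by (simp add: norm_mult_ineq)
  also have "\<dots> \<le> norm x * norm x ^ n" using Suc by (simp add: mult_left_mono)
  finally show ?case by simp
qed (simp add: norm_unit_le)

section \<open>The Taylor series of sqrt (1 - t)\<close>

definition sqrt_coeff :: "nat \<Rightarrow> real" where
  "sqrt_coeff n = (- 1) ^ n * ((1/2) gchoose n)"

lemma sqrt_coeff_0 [simp]: "sqrt_coeff 0 = 1"
  by (simp add: sqrt_coeff_def)

text \<open>Up to a factorial the coefficient is the rising factorial of -1/2, whose first factor is
  negative while all others are positive.\<close>

lemma sqrt_coeff_Suc_nonpos: "sqrt_coeff (Suc n) \<le> 0"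
proof -
  have "pochhammer (1/2 :: real) n \<ge> 0" by (rule pochhammer_nonneg) simp
  then have "pochhammer (- (1/2) :: real) (Suc n) \<le> 0" by (simp add: pochhammer_rec)
  moreover have "sqrt_coeff (Suc n) = pochhammer (- (1/2)) (Suc n) / fact (Suc n)"
    unfolding sqrt_coeff_def gbinomial_pochhammer by (simp flip: power_mult_distrib mult.assoc)
  ultimately show ?thesis by (simp add: divide_nonpos_pos del: fact_Suc)
qed

text \<open>Partial sums of the coefficients of \<open>f\<close> are the coefficients of
  \<open>f / (1 - t)\<close>. Here this quotient is 1 - t to the power -1/2, with rising factorials
  of 1/2 over factorials as coefficients.\<close>

lemma sum_sqrt_coeff_nonneg: "(\<Sum>k\<le>m. sqrt_coeff k) \<ge> 0"
proof -
  have "(\<Sum>k\<le>m. sqrt_coeff k) = (- 1) ^ m * (- (1/2) gchoose m)"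
    using gbinomial_sum_lower_neg[of "1/2::real" m] by (simp add: sqrt_coeff_def mult.commute)
  also have "\<dots> = pochhammer (1/2) m / fact m"
    unfolding gbinomial_pochhammer by (simp flip: power_mult_distrib mult.assoc)
  also have "\<dots> \<ge> 0" by (simp add: pochhammer_nonneg)
  finally show ?thesis .
qed

text \<open>All coefficients after the first are at most 0, so their absolute values add up to 1
  minus a partial sum of the whole series. The bound gives absolute convergence on the closed unit
  ball, boundary included.\<close>

lemma sum_abs_sqrt_coeff_le: "(\<Sum>k<m. \<bar>sqrt_coeff (Suc k)\<bar>) \<le> 1"
proof -
  have "(\<Sum>k<m. \<bar>sqrt_coeff (Suc k)\<bar>) = - (\<Sum>k<m. sqrt_coeff (Suc k))"
    by (simp add: sum_negf[symmetric] abs_of_nonpos sqrt_coeff_Suc_nonpos)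
  also have "\<dots> = 1 - (\<Sum>k\<le>m. sqrt_coeff k)"
    by (simp add: sum.atMost_shift)
  finally show ?thesis using sum_sqrt_coeff_nonneg[of m] by linarith
qed

lemma summable_abs_sqrt_coeff: "summable (\<lambda>n. \<bar>sqrt_coeff (Suc n)\<bar>)"
  by (rule summableI_nonneg_bounded[where x = 1]) (auto intro: sum_abs_sqrt_coeff_le)

lemma suminf_abs_sqrt_coeff_le: "suminf (\<lambda>n. \<bar>sqrt_coeff (Suc n)\<bar>) \<le> 1"
  by (rule suminf_le_const[OF summable_abs_sqrt_coeff sum_abs_sqrt_coeff_le])

text \<open>The square of the series has to be 1 - t; on coefficients this is the Vandermonde
  convolution for 1/2 + 1/2 = 1.\<close>

lemma sqrt_coeff_convolution:
  "(\<Sum>i\<le>n. sqrt_coeff i * sqrt_coeff (n - i)) = (if n = 0 then 1 else if n = 1 then - 1 else 0)"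
proof -
  have "(\<Sum>i\<le>n. sqrt_coeff i * sqrt_coeff (n - i)) =
      (- 1) ^ n * (\<Sum>i=0..n. (1/2 gchoose i) * (1/2 gchoose (n - i)))"
    unfolding sum_distrib_left atLeast0AtMost
  proof (rule sum.cong)
    fix i assume "i \<in> {..n}"
    then have "(- 1) ^ n = ((- 1) ^ i * (- 1) ^ (n - i) :: real)" by (simp flip: power_add)
    then show "sqrt_coeff i * sqrt_coeff (n - i) =
        (- 1) ^ n * ((1/2 gchoose i) * (1/2 gchoose (n - i)))"
      by (simp add: sqrt_coeff_def)
  qed simp
  also have "\<dots> = (- 1) ^ n * (1 gchoose n)"
    using gbinomial_Vandermonde[of "1/2::real" "1/2" n] by simp
  also have "\<dots> = (if n = 0 then 1 else if n = 1 then - 1 else 0)"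
    using binomial_gbinomial[of 1 n, where 'a = real] by (auto simp: binomial_eq_0)
  finally show ?thesis .
qed

definition sqrt_series :: "'a::unital_cstar_algebra \<Rightarrow> 'a" where
  "sqrt_series x = suminf (\<lambda>n. sqrt_coeff n *\<^sub>R x ^ n)"

context
  fixes x :: "'a::unital_cstar_algebra"
  assumes x: "norm x \<le> 1"
begin

lemma norm_sqrt_series_term_le: "norm (sqrt_coeff n *\<^sub>R x ^ n) \<le> \<bar>sqrt_coeff n\<bar>"
proof -
  have "norm (x ^ n) \<le> norm x ^ n" by (rule norm_power_le_power)
  also have "\<dots> \<le> 1" by (simp add: x power_le_one)
  finally show ?thesis by (simp add: mult_left_le)
qed

lemma summable_norm_sqrt_series: "summable (\<lambda>n. norm (sqrt_coeff n *\<^sub>R x ^ n))"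
proof -
  have "summable (\<lambda>n. \<bar>sqrt_coeff n\<bar>)"
    using summable_abs_sqrt_coeff summable_Suc_iff[of "\<lambda>n. \<bar>sqrt_coeff n\<bar>"] by simp
  then show ?thesis
    by (rule summable_comparison_test[rotated]) (use norm_sqrt_series_term_le in auto)
qed

lemmas summable_sqrt_series = summable_norm_cancel[OF summable_norm_sqrt_series]

lemma sqrt_series_square: "sqrt_series x * sqrt_series x = 1 - x"
proof -
  have eq: "(\<Sum>i\<le>k. (sqrt_coeff i *\<^sub>R x ^ i) * (sqrt_coeff (k - i) *\<^sub>R x ^ (k - i))) =
      (if k = 0 then 1 else if k = 1 then - 1 else 0) *\<^sub>R x ^ k" for k
    unfolding sqrt_coeff_convolution[symmetric] scaleR_sum_left
    by (rule sum.cong) (simp_all flip: power_add)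
  have "(\<lambda>k. (if k = 0 then 1 else if k = 1 then - 1 else 0) *\<^sub>R x ^ k) sums
      (sqrt_series x * sqrt_series x)"
    using Cauchy_product_sums[OF summable_norm_sqrt_series summable_norm_sqrt_series]
    by (simp only: eq sqrt_series_def)
  moreover have "(\<lambda>k. (if k = 0 then 1 else if k = 1 then - 1 else 0) *\<^sub>R x ^ k) sums
      (\<Sum>k\<in>{0,1::nat}. (if k = 0 then 1 else if k = 1 then - 1 else 0) *\<^sub>R x ^ k)"
    by (rule sums_finite) auto
  ultimately have "sqrt_series x * sqrt_series x =
      (\<Sum>k\<in>{0,1::nat}. (if k = 0 then 1 else if k = 1 then - 1 else 0) *\<^sub>R x ^ k)"
    by (rule sums_unique2)
  then show ?thesis by simp
qed

lemma sqrt_series_commute: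
  assumes "x * y = y * x"
  shows "sqrt_series x * y = y * sqrt_series x"
proof -
  have "x ^ n * y = y * x ^ n" for n
    by (rule power_commuting_commutes[OF assms])
  then show ?thesis
    unfolding sqrt_series_def
    by (simp add: suminf_mult2[OF summable_sqrt_series] suminf_mult[OF summable_sqrt_series, symmetric])
qed

lemma star_sqrt_series: "star x = x \<Longrightarrow> star (sqrt_series x) = sqrt_series x"
  unfolding sqrt_series_def
  by (subst bounded_linear.suminf[OF bounded_linear_star summable_sqrt_series])
    (simp add: star_scaleR star_power)

text \<open>The constant term cancels and the remaining coefficients have total absolute value at
  most 1. This makes the root positive again in the sense of the norm criterion
  \<open>unital_positive\<close>.\<close>

lemma norm_one_minus_sqrt_series_le: "norm (1 - sqrt_series x) \<le> 1"
proof -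
  have s: "summable (\<lambda>n. norm (sqrt_coeff (Suc n) *\<^sub>R x ^ Suc n))"
    using summable_norm_sqrt_series summable_Suc_iff[of "\<lambda>n. norm (sqrt_coeff n *\<^sub>R x ^ n)"] by simp
  have "sqrt_series x - 1 = suminf (\<lambda>n. sqrt_coeff (Suc n) *\<^sub>R x ^ Suc n)"
    unfolding sqrt_series_def by (subst suminf_split_head[OF summable_sqrt_series]) simp
  then have "norm (1 - sqrt_series x) = norm (suminf (\<lambda>n. sqrt_coeff (Suc n) *\<^sub>R x ^ Suc n))"
    by (metis norm_minus_commute)
  also have "\<dots> \<le> suminf (\<lambda>n. norm (sqrt_coeff (Suc n) *\<^sub>R x ^ Suc n))"
    by (rule summable_norm[OF s])
  also have "\<dots> \<le> suminf (\<lambda>n. \<bar>sqrt_coeff (Suc n)\<bar>)"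
    by (rule suminf_le[OF norm_sqrt_series_term_le s summable_abs_sqrt_coeff])
  also have "\<dots> \<le> 1" by (rule suminf_abs_sqrt_coeff_le)
  finally show ?thesis .
qed

end

instance complex :: unital_cstar_algebra ..

text \<open>At the complex number 1 the series squares to 1 - 1, so its value there is 0.\<close>

lemma sqrt_coeff_sums_zero: "sqrt_coeff sums 0"
proof -
  have s: "summable (\<lambda>n. complex_of_real (sqrt_coeff n))"
    using summable_sqrt_series[of "1::complex"] by (simp add: scaleR_conv_of_real)
  have "sqrt_series (1::complex) = 0"
    using sqrt_series_square[of "1::complex"] by simp
  then have "suminf (\<lambda>n. complex_of_real (sqrt_coeff n)) = 0"
    by (simp add: sqrt_series_def scaleR_conv_of_real)
  with s have "(\<lambda>n. complex_of_real (sqrt_coeff n)) sums of_real 0"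
    by (simp add: sums_iff)
  then show ?thesis by (simp only: sums_of_real_iff)
qed

text \<open>Then \<open>h + i k\<close> is a multiple of a unitary.\<close>

lemma norm_le_of_squares_sum_unit:
  fixes h k :: "'a::unital_cstar_algebra"
  assumes h: "star h = h" and k: "star k = k" and hk: "h * k = k * h"
    and eq: "h * h + k * k = s *\<^sub>R 1" and s: "s \<ge> 0"
  shows "(norm h)\<^sup>2 \<le> s"
proof -
  define u where "u = h + scaleC \<i> k"
  have su: "star u = h - scaleC \<i> k"
    by (simp add: u_def star_add star_scaleC h k scaleC_minus_left)
  have "star u * u = s *\<^sub>R 1"
    unfolding su unfolding u_def
    by (simp add: algebra_simps mult_scaleC_left mult_scaleC_right scaleC_scaleC scaleC_diff_right hk eq[symmetric])
  then have "(norm u)\<^sup>2 \<le> s"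
    using norm_star_mult_self[of u] norm_scaleR_unit_le[OF s] by metis
  moreover have "norm h \<le> norm u"
  proof -
    have "2 *\<^sub>R h = u + star u" unfolding su by (simp add: u_def scaleR_2)
    then have "2 * norm h = norm (u + star u)" by (metis norm_scaleR abs_numeral)
    also have "\<dots> \<le> norm u + norm (star u)" by (rule norm_triangle_ineq)
    finally show ?thesis by simp
  qed
  ultimately show ?thesis using power_mono[of "norm h" "norm u" 2] by (meson norm_ge_zero order_trans)
qed

text \<open>For a self-adjoint element the inequality says that the spectrum lies in [0, 2 s]. With
  an existential radius \<open>s\<close> the condition is visibly stable under sums; limits need in
  addition that every radius above the norm will do.\<close>

definition unital_positive :: "'a::unital_cstar_algebra \<Rightarrow> bool" where
  "unital_positive a \<longleftrightarrow> star a = a \<and> (\<exists>s>0. norm (s *\<^sub>R 1 - a) \<le> s)"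

lemma unital_positive_star: "unital_positive a \<Longrightarrow> star a = a"
  by (simp add: unital_positive_def)

text \<open>Writing \<open>a = s *\<^sub>R (1 - x)\<close> brings the root within reach of the
  series. The element \<open>x\<close> is exposed because the case without unit has to inspect the
  single terms of the series in \<open>x\<close>.\<close>

lemma unital_positive_sqrt_within:
  assumes "star a = a" "s > 0" "norm (s *\<^sub>R 1 - a :: 'a::unital_cstar_algebra) \<le> s"
  obtains x where "norm x \<le> 1" "star x = x" "a = s *\<^sub>R (1 - x)" "\<And>y. a * y = y * a \<Longrightarrow> x * y = y * x"
    "sqrt s *\<^sub>R sqrt_series x * (sqrt s *\<^sub>R sqrt_series x) = a"
    "unital_positive (sqrt s *\<^sub>R sqrt_series x)"
proof
  define x where "x = 1 - (1 / s) *\<^sub>R a"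
  have sx: "s *\<^sub>R x = s *\<^sub>R 1 - a" using \<open>s > 0\<close> by (simp add: x_def algebra_simps)
  have "s * norm x = norm (s *\<^sub>R x)" using \<open>s > 0\<close> by simp
  with assms(3) sx have "s * norm x \<le> s * 1" by simp
  with \<open>s > 0\<close> show x1: "norm x \<le> 1" by simp
  show sa: "star x = x" by (simp add: x_def star_diff star_scaleR assms(1))
  show ax: "a = s *\<^sub>R (1 - x)" using \<open>s > 0\<close> by (simp add: x_def)
  show "x * y = y * x" if "a * y = y * a" for y
    using that by (simp add: x_def algebra_simps)
  show "sqrt s *\<^sub>R sqrt_series x * (sqrt s *\<^sub>R sqrt_series x) = a"
    using \<open>s > 0\<close> by (simp add: sqrt_series_square[OF x1] ax)
  have "norm (sqrt s *\<^sub>R 1 - sqrt s *\<^sub>R sqrt_series x) = sqrt s * norm (1 - sqrt_series x)"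
    using \<open>s > 0\<close> by (simp flip: scaleR_diff_right)
  also have "\<dots> \<le> sqrt s * 1"
    by (rule mult_left_mono[OF norm_one_minus_sqrt_series_le[OF x1]]) (use \<open>s > 0\<close> in simp)
  finally show "unital_positive (sqrt s *\<^sub>R sqrt_series x)"
    using \<open>s > 0\<close> by (auto simp: unital_positive_def star_scaleR star_sqrt_series[OF x1 sa] intro!: exI[of _ "sqrt s"])
qed

lemma unital_positive_sqrt:
  assumes "unital_positive (a :: 'a::unital_cstar_algebra)"
  obtains h where "unital_positive h" "star h = h" "h * h = a" "\<And>y. a * y = y * a \<Longrightarrow> h * y = y * h"
proof -
  obtain s where s: "star a = a" "s > 0" "norm (s *\<^sub>R 1 - a) \<le> s"
    using assms by (auto simp: unital_positive_def)
  obtain x where x: "norm x \<le> 1" "star x = x" "\<And>y. a * y = y * a \<Longrightarrow> x * y = y * x"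
    "sqrt s *\<^sub>R sqrt_series x * (sqrt s *\<^sub>R sqrt_series x) = a"
    "unital_positive (sqrt s *\<^sub>R sqrt_series x)"
    using unital_positive_sqrt_within[OF s] by metis
  show thesis
  proof (rule that[OF x(5) unital_positive_star[OF x(5)] x(4)])
    fix y assume "a * y = y * a"
    then show "sqrt s *\<^sub>R sqrt_series x * y = y * (sqrt s *\<^sub>R sqrt_series x)"
      by (simp add: sqrt_series_commute[OF x(1) x(3)])
  qed
qed

text \<open>The element \<open>s - h * h\<close> is itself a square \<open>k * k\<close>, with
  \<open>k\<close> self-adjoint and commuting with \<open>h\<close>. The two squares add up to
  \<open>s\<close>, so \<open>norm_le_of_squares_sum_unit\<close>, with \<open>h\<close> and
  \<open>k\<close> exchanged, bounds \<open>k\<close>.\<close>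

lemma norm_unit_minus_square_le:
  fixes h :: "'a::unital_cstar_algebra"
  assumes "star h = h" "s > 0" "(norm h)\<^sup>2 \<le> s"
  shows "norm (s *\<^sub>R 1 - h * h) \<le> s"
proof -
  define x where "x = (1 / s) *\<^sub>R (h * h)"
  have "norm (h * h) \<le> s" using assms norm_star_mult_self[of h] by simp
  then have x1: "norm x \<le> 1" using assms(2) by (simp add: x_def)
  have sx: "star x = x" by (simp add: x_def star_scaleR star_mult assms)
  define k where "k = sqrt s *\<^sub>R sqrt_series x"
  have kk: "k * k = s *\<^sub>R 1 - h * h"
    using assms(2) by (simp add: k_def sqrt_series_square[OF x1] algebra_simps) (simp add: x_def)
  have "(norm k)\<^sup>2 \<le> s"
  proof (rule norm_le_of_squares_sum_unit)
    show sk: "star k = k" by (simp add: k_def star_scaleR star_sqrt_series[OF x1 sx])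
    have "x * h = h * x" by (simp add: x_def mult.assoc)
    then show "k * h = h * k" by (simp add: k_def sqrt_series_commute[OF x1])
    show "k * k + h * h = s *\<^sub>R 1" by (simp add: kk)
  qed (use assms in auto)
  moreover have "norm (k * k) = (norm k)\<^sup>2"
    using norm_star_mult_self[of k] by (simp add: k_def star_scaleR star_sqrt_series[OF x1 sx])
  ultimately show ?thesis by (simp add: kk)
qed

lemma unital_positive_square:
  fixes h :: "'a::unital_cstar_algebra"
  assumes "star h = h"
  shows "unital_positive (h * h)"
  unfolding unital_positive_def
proof (intro conjI exI)
  show "norm (((norm h)\<^sup>2 + 1) *\<^sub>R 1 - h * h) \<le> (norm h)\<^sup>2 + 1"
    by (rule norm_unit_minus_square_le[OF assms]) (auto simp: add_nonneg_pos)
qed (auto simp: star_mult assms add_nonneg_pos)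

text \<open>The root of \<open>a\<close> does not remember the radius that witnessed positivity, and
  \<open>norm_unit_minus_square_le\<close> accepts any radius above the norm.\<close>

lemma unital_positive_norm_diff_le:
  assumes "unital_positive (a :: 'a::unital_cstar_algebra)" "s > 0" "norm a \<le> s"
  shows "norm (s *\<^sub>R 1 - a) \<le> s"
proof -
  obtain h where h: "star h = h" "h * h = a" using unital_positive_sqrt[OF assms(1)] by metis
  then have "(norm h)\<^sup>2 = norm a" using norm_star_mult_self[of h] by simp
  then show ?thesis using norm_unit_minus_square_le[of h s] h assms by simp
qed

lemma unital_positive_add:
  assumes "unital_positive (a :: 'a::unital_cstar_algebra)" "unital_positive b"
  shows "unital_positive (a + b)"
proof -
  obtain s t where s: "s > 0" "norm (s *\<^sub>R 1 - a) \<le> s" and t: "t > 0" "norm (t *\<^sub>R 1 - b) \<le> t"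
    using assms by (auto simp: unital_positive_def)
  have "norm ((s + t) *\<^sub>R 1 - (a + b)) \<le> norm (s *\<^sub>R 1 - a) + norm (t *\<^sub>R 1 - b)"
    using norm_triangle_ineq[of "s *\<^sub>R 1 - a" "t *\<^sub>R 1 - b"] by (simp add: algebra_simps)
  with s t show ?thesis using assms unfolding unital_positive_def
    by (intro conjI exI[of _ "s + t"]) (auto simp: star_add)
qed

lemma unital_positive_scaleR:
  assumes "unital_positive (a :: 'a::unital_cstar_algebra)" "r \<ge> 0"
  shows "unital_positive (r *\<^sub>R a)"
proof -
  obtain h where h: "star h = h" "h * h = a" using unital_positive_sqrt[OF assms(1)] by metis
  have "unital_positive ((sqrt r *\<^sub>R h) * (sqrt r *\<^sub>R h))"
    by (rule unital_positive_square) (simp add: star_scaleR h)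
  then show ?thesis using h assms(2) by simp
qed

lemma unital_positive_scaleR_unit: "r \<ge> 0 \<Longrightarrow> unital_positive (r *\<^sub>R (1 :: 'a::unital_cstar_algebra))"
  using unital_positive_scaleR[OF unital_positive_square[OF star_one]] by simp

lemma unital_positive_limit:
  fixes a :: "'a::unital_cstar_algebra"
  assumes "\<And>n. unital_positive (f n)" and lim: "f \<longlonglongrightarrow> a"
  shows "unital_positive a"
proof -
  have "(\<lambda>n. star (f n)) \<longlonglongrightarrow> star a" by (rule tendsto_star[OF lim])
  then have "star a = a"
    using lim assms(1) by (simp add: unital_positive_star LIMSEQ_unique)
  moreover
  \<comment> \<open>One radius must serve all late terms; \<open>norm a + 1\<close> eventually
    exceeds their norms and is positive even for \<open>a = 0\<close>.\<close>
  have "norm ((norm a + 1) *\<^sub>R 1 - a) \<le> norm a + 1"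
  proof (rule tendsto_upperbound)
    show "(\<lambda>n. norm ((norm a + 1) *\<^sub>R 1 - f n)) \<longlonglongrightarrow> norm ((norm a + 1) *\<^sub>R 1 - a)"
      by (intro tendsto_intros lim)
    have "\<forall>\<^sub>F n in sequentially. norm (f n) < norm a + 1"
      by (rule order_tendstoD(2)[OF tendsto_norm[OF lim]]) simp
    then show "\<forall>\<^sub>F n in sequentially. norm ((norm a + 1) *\<^sub>R 1 - f n) \<le> norm a + 1"
      by eventually_elim (rule unital_positive_norm_diff_le[OF assms(1)], auto simp: add_nonneg_pos)
  qed simp
  ultimately show ?thesis
    unfolding unital_positive_def by (intro conjI exI[of _ "norm a + 1"]) (auto simp: add_nonneg_pos)
qed

text \<open>The roots \<open>h\<close> of \<open>a\<close> and \<open>k\<close> of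
  \<open>s - a\<close> commute, because \<open>h\<close> commutes with \<open>a\<close> and
  \<open>k\<close> commutes with whatever commutes with \<open>s - a\<close>. Their squares add up
  to \<open>s\<close>, so \<open>h\<close> is bounded by the real part of a multiple of a
  unitary.\<close>

lemma unital_positive_norm_le:
  fixes a :: "'a::unital_cstar_algebra"
  assumes "unital_positive a" "unital_positive (s *\<^sub>R 1 - a)" "s \<ge> 0"
  shows "norm a \<le> s"
proof -
  obtain h where h: "star h = h" "h * h = a" "\<And>y. a * y = y * a \<Longrightarrow> h * y = y * h"
    using unital_positive_sqrt[OF assms(1)] by metis
  obtain k where k: "star k = k" "k * k = s *\<^sub>R 1 - a"
    "\<And>y. (s *\<^sub>R 1 - a) * y = y * (s *\<^sub>R 1 - a) \<Longrightarrow> k * y = y * k"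
    using unital_positive_sqrt[OF assms(2)] by metis
  have "h * a = a * h" using h(2) mult.assoc by metis
  then have "k * h = h * k" by (intro k(3)) (simp add: algebra_simps)
  then have "(norm h)\<^sup>2 \<le> s"
    by (intro norm_le_of_squares_sum_unit[of h k s]) (simp_all add: h(1,2) k(1,2) assms(3))
  then show ?thesis using norm_star_mult_self[of h] h(1,2) by simp
qed

text \<open>As \<open>norm b - b\<close> is positive with radius \<open>norm b\<close>, the element
  \<open>norm b - a\<close> is a sum of two positive ones.\<close>

lemma unital_positive_mono:
  fixes a b :: "'a::unital_cstar_algebra"
  assumes "unital_positive a" "unital_positive (b - a)"
  shows "norm a \<le> norm b"
proof (rule unital_positive_norm_le[OF assms(1)])
  have b: "unital_positive b" using unital_positive_add[OF assms] by simp
  have "unital_positive (norm b *\<^sub>R 1 - b)"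
  proof (cases "b = 0")
    case True
    then show ?thesis using unital_positive_scaleR_unit[of 0] by simp
  next
    case False
    have "norm (norm b *\<^sub>R 1 - (norm b *\<^sub>R 1 - b)) \<le> norm b" by simp
    then show ?thesis using b False
      by (auto simp: unital_positive_def star_diff star_scaleR intro!: exI[of _ "norm b"])
  qed
  from unital_positive_add[OF this assms(2)] show "unital_positive (norm b *\<^sub>R 1 - a)" by simp
qed simp

text \<open>Bernoulli at the exponent \<open>2 ^ m\<close> yields growth like \<open>2 ^ m\<close>,
  which the assumed bound permits. Squared, that is at the exponent \<open>2 ^ Suc m\<close>, it
  yields growth like \<open>4 ^ m\<close>, which the bound excludes.\<close>

lemma le_one_of_power_growth:
  fixes r K :: real
  assumes "\<And>n. r ^ (2 ^ n) \<le> K * 2 ^ n"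
  shows "r \<le> 1"
proof (rule ccontr)
  assume "\<not> r \<le> 1"
  define d where "d = r - 1"
  have d: "d > 0" using \<open>\<not> r \<le> 1\<close> by (simp add: d_def)
  have *: "2 ^ m * d\<^sup>2 \<le> 2 * K" for m :: nat
  proof -
    have "1 + real (2 ^ m) * d \<le> (1 + d) ^ (2 ^ m)"
      by (rule Bernoulli_inequality) (use d in simp)
    then have "2 ^ m * d \<le> r ^ (2 ^ m)" by (simp add: d_def)
    then have "(2 ^ m * d)\<^sup>2 \<le> (r ^ (2 ^ m))\<^sup>2" using d by (intro power_mono) auto
    also have "\<dots> = r ^ (2 ^ Suc m)" by (simp add: power_mult[symmetric] mult.commute)
    also have "\<dots> \<le> K * 2 ^ Suc m" by (rule assms)
    finally have "2 ^ m * (2 ^ m * d\<^sup>2) \<le> 2 ^ m * (2 * K)"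
      by (simp add: power2_eq_square algebra_simps)
    then show ?thesis by (simp only: mult_le_cancel_left_pos zero_less_power zero_less_numeral)
  qed
  obtain m :: nat where "2 * K / d\<^sup>2 < 2 ^ m"
    using real_arch_pow[of 2 "2 * K / d\<^sup>2"] by auto
  with d *[of m] show False by (simp add: field_simps)
qed

text \<open>Since \<open>(s - a)\<^sup>n a = e (s - m)\<^sup>n f\<close>, the norm of \<open>(s - a)\<^sup>n\<close> exceeds \<open>s\<^sup>n\<close> by a factor that
  is only linear in \<open>n\<close>. This takes the place of \<open>\<sigma>(x y) \<union> {0} = \<sigma>(y x) \<union> {0}\<close>.\<close>

lemma unital_positive_transfer:
  fixes a m e f :: "'a::unital_cstar_algebra"
  assumes m: "unital_positive m" and a: "star a = a" and ef: "a = e * f" and ae: "a * e = e * m"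
  shows "unital_positive a"
proof -
  obtain s where s: "s > 0" "norm (s *\<^sub>R 1 - m) \<le> s" using m by (auto simp: unital_positive_def)
  define y where "y = s *\<^sub>R 1 - a"
  define z where "z = s *\<^sub>R 1 - m"
  define C where "C = norm e * norm f"
  have sy: "star y = y" by (simp add: y_def star_diff star_scaleR a)
  have ye: "y ^ n * e = e * z ^ n" for n
  proof (induction n)
    case (Suc n)
    have "y ^ Suc n * e = y * (e * z ^ n)" using Suc by (simp add: mult.assoc)
    also have "\<dots> = e * (z * z ^ n)"
      by (simp add: y_def z_def algebra_simps flip: mult.assoc) (simp add: ae mult.assoc)
    finally show ?case by simp
  qed simp
  have bound: "norm (y ^ n) * s \<le> s ^ n * (s + real n * C)" for n
  proof (induction n)
    case 0
    then show ?case using norm_unit_le[where 'a = 'a] s(1) by simp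
  next
    case (Suc n)
    have "y ^ Suc n = y ^ n * y" by (rule power_Suc2)
    also have "\<dots> = s *\<^sub>R y ^ n - y ^ n * e * f"
      by (subst (2) y_def) (simp add: algebra_simps ef mult.assoc)
    also have "\<dots> = s *\<^sub>R y ^ n - e * z ^ n * f" by (simp add: ye)
    finally have "norm (y ^ Suc n) \<le> norm (s *\<^sub>R y ^ n) + norm (e * z ^ n * f)"
      by (metis norm_triangle_ineq4)
    also have "norm (e * z ^ n * f) \<le> C * s ^ n"
    proof -
      have "norm (e * z ^ n * f) \<le> norm e * norm (z ^ n) * norm f"
        by (meson norm_mult_ineq order_trans mult_right_mono norm_ge_zero)
      also have "norm (z ^ n) \<le> s ^ n"
        using norm_power_le_power[of z n] power_mono[OF s(2), of n] by (simp add: z_def)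
      finally show ?thesis by (simp add: C_def mult_right_mono mult_left_mono algebra_simps)
    qed
    finally have "norm (y ^ Suc n) * s \<le> (s * norm (y ^ n) + C * s ^ n) * s"
      using s(1) by (simp add: mult_right_mono)
    also have "\<dots> = s * (norm (y ^ n) * s) + C * s ^ n * s" by (simp add: algebra_simps)
    also have "\<dots> \<le> s * (s ^ n * (s + real n * C)) + C * s ^ n * s"
      using Suc s(1) by (intro add_right_mono mult_left_mono) auto
    also have "\<dots> = s ^ Suc n * (s + real (Suc n) * C)" by (simp add: algebra_simps)
    finally show ?case .
  qed
  \<comment> \<open>By the C*-identity for self-adjoint elements the norm is exactly multiplicative
    along powers of two, so a bound on powers of \<open>y\<close> becomes one on
    \<open>norm y\<close>.\<close>
  have pow: "norm (y ^ (2 ^ n)) = norm y ^ (2 ^ n)" for n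
  proof (induction n)
    case (Suc n)
    have "y ^ (2 ^ Suc n) = star (y ^ (2 ^ n)) * y ^ (2 ^ n)"
      unfolding star_power sy power_add[symmetric] by (simp add: mult_2)
    then have "norm (y ^ (2 ^ Suc n)) = (norm (y ^ (2 ^ n)))\<^sup>2" by (simp only: norm_star_mult_self)
    then show ?case using Suc by (simp add: power_mult[symmetric] mult.commute)
  qed simp
  have "(norm y / s) ^ (2 ^ n) \<le> (1 + C / s) * 2 ^ n" for n
  proof -
    have "norm y ^ (2 ^ n) * s \<le> s ^ (2 ^ n) * (s + 2 ^ n * C)"
      using bound[of "2 ^ n"] by (simp add: pow)
    then have "(norm y / s) ^ (2 ^ n) \<le> 1 + 2 ^ n * C / s"
      using s(1) by (simp add: power_divide field_simps)
    also have "\<dots> \<le> (1 + C / s) * 2 ^ n" by (simp add: algebra_simps)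
    finally show ?thesis .
  qed
  then have "norm y / s \<le> 1" by (rule le_one_of_power_growth)
  then show ?thesis using s(1) a by (auto simp: unital_positive_def y_def)
qed

text \<open>Here \<open>m\<close> is the absolute value of \<open>x\<close>, and the positive part
  \<open>p = (m + x) / 2\<close> satisfies \<open>p * p = p * m\<close>. So
  \<open>unital_positive_transfer\<close> applies with \<open>e = p\<close> and
  \<open>f = 1\<close>.\<close>

lemma unital_positive_half_add:
  fixes x m :: "'a::unital_cstar_algebra"
  assumes m: "unital_positive m" "m * m = x * x" "x * m = m * x" and x: "star x = x"
  shows "unital_positive ((1/2) *\<^sub>R (m + x))"
proof (rule unital_positive_transfer[OF m(1), of _ "(1/2) *\<^sub>R (m + x)" 1])
  have "(m + x) * (m + x) = 2 *\<^sub>R ((m + x) * m)"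
    by (simp add: algebra_simps m(2,3) scaleR_2)
  then show "(1/2) *\<^sub>R (m + x) * ((1/2) *\<^sub>R (m + x)) = (1/2) *\<^sub>R (m + x) * m"
    by simp
qed (simp_all add: star_scaleR star_add unital_positive_star[OF m(1)] x)

text \<open>Split \<open>x = star b * b\<close> as \<open>p - n\<close> with
  \<open>n * p = 0\<close>. Then \<open>c = b * n\<close> satisfies
  \<open>star c * c = - (n * n * n)\<close>, a negative element. For such a \<open>c\<close> the
  product \<open>c * star c\<close> is positive, hence by transfer \<open>star c * c\<close> is
  positive too; being positive and negative at once it vanishes, and \<open>n = 0\<close>
  follows.\<close>

lemma unital_positive_star_mult_self:
  fixes b :: "'a::unital_cstar_algebra"
  shows "unital_positive (star b * b)"
proof -
  have zero: "c = 0" if neg: "unital_positive (- (star c * c))" for c :: 'a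
  proof -
    define h where "h = (1/2) *\<^sub>R (c + star c)"
    define k where "k = scaleC (\<i> / 2) (star c - c)"
    have h: "star h = h" by (simp add: h_def star_scaleR star_add add.commute)
    have k: "star k = k"
      by (simp add: k_def star_scaleC star_diff scaleC_minus_left scaleC_diff_right)
    \<comment> \<open>With \<open>h\<close> and \<open>k\<close> the real and imaginary parts of
      \<open>c\<close>, the sum of \<open>star c * c\<close> and \<open>c * star c\<close> is twice
      the sum of their squares.\<close>
    have "c * star c = 2 *\<^sub>R (h * h + k * k) + (- (star c * c))"
    proof -
      have r: "scaleC (1/4) z = (1/4) *\<^sub>R z" for z :: 'a
        using scaleC_of_real[of "1/4" z] by simp
      have kk: "k * k = (- 1/4) *\<^sub>R ((star c - c) * (star c - c))"
        by (simp add: k_def mult_scaleC_left mult_scaleC_right scaleC_scaleC scaleC_minus_left r)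
      show ?thesis unfolding kk h_def
        by (simp add: algebra_simps flip: scaleR_add_left)
    qed
    then have "unital_positive (c * star c)"
      using unital_positive_add[OF unital_positive_scaleR[OF unital_positive_add[OF
            unital_positive_square[OF h] unital_positive_square[OF k]], of 2] neg] by simp
    \<comment> \<open>Transfer with \<open>e = star c\<close> and \<open>f = c\<close>, by
      associativity of \<open>star c * c * star c\<close>.\<close>
    then have "unital_positive (star c * c)"
      by (rule unital_positive_transfer[of _ _ "star c" c]) (simp_all add: star_mult mult.assoc)
    then have "norm (star c * c) \<le> 0"
      by (rule unital_positive_norm_le) (use neg in simp_all)
    then show ?thesis by (simp add: norm_star_mult_self)
  qed
  define x where "x = star b * b"
  have sx: "star x = x" by (simp add: x_def star_mult)
  obtain m where m: "unital_positive m" "m * m = x * x" "\<And>y. x * x * y = y * (x * x) \<Longrightarrow> m * y = y * m"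
    using unital_positive_sqrt[OF unital_positive_square[OF sx]] by metis
  have xm: "x * m = m * x" using m(3)[of x] by (simp add: mult.assoc)
  have mp: "unital_positive ((1/2) *\<^sub>R (m + x))"
    by (rule unital_positive_half_add[OF m(1,2) xm sx])
  have mn: "unital_positive ((1/2) *\<^sub>R (m - x))"
    using unital_positive_half_add[of m "- x"] m(1,2) xm sx by simp
  define p where "p = (1/2) *\<^sub>R (m + x)"
  define n where "n = (1/2) *\<^sub>R (m - x)"
  have np: "n * p = 0" by (simp add: n_def p_def algebra_simps m(2) xm)
  have xpn: "x = p - n" by (simp add: n_def p_def algebra_simps flip: scaleR_add_left)
  have sn: "star n = n" using mn by (simp add: n_def unital_positive_star)
  obtain h where h: "star h = h" "h * h = n" "\<And>y. n * y = y * n \<Longrightarrow> h * y = y * h"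
    using unital_positive_sqrt[OF mn] unfolding n_def by metis
  have hn: "h * n = n * h" using h(3)[of n] by simp
  have "star (b * n) * (b * n) = n * x * n" by (simp add: star_mult sn x_def mult.assoc)
  also have "\<dots> = - (n * n * n)" by (simp add: xpn algebra_simps np)
  \<comment> \<open>With \<open>h\<close> the root of \<open>n\<close>, the cube is the square of
    the self-adjoint element \<open>h * n\<close>, hence positive, as \<open>zero\<close>
    demands.\<close>
  also have "n * n * n = (h * n) * (h * n)" using h(2) hn by (metis mult.assoc)
  finally have eq: "star (b * n) * (b * n) = - ((h * n) * (h * n))" .
  have hns: "star (h * n) = h * n" by (simp add: star_mult h(1) sn hn)
  have "b * n = 0"
    by (rule zero) (simp add: eq unital_positive_square[OF hns])
  then have "(h * n) * (h * n) = 0" using eq by simp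
  then have "h * n = 0" using norm_star_mult_self[of "h * n"] hns by simp
  then have "n * n = 0" using h(2) hn by (metis mult.assoc mult_zero_right)
  then have "n = 0" using norm_star_mult_self[of n] sn by simp
  then show ?thesis using mp xpn by (simp add: p_def x_def)
qed

subsection \<open>The multiplier algebra\<close>

text \<open>This is adjointness for the algebra viewed as a Hilbert module over itself, with inner
  product \<open>star x * y\<close>. Complex linearity and compatibility with right multiplication
  follow from it.\<close>

definition multiplier_adjoint :: "('a::cstar_algebra \<Rightarrow>\<^sub>L 'a) \<Rightarrow> ('a \<Rightarrow>\<^sub>L 'a) \<Rightarrow> bool" where
  "multiplier_adjoint T S \<longleftrightarrow> (\<forall>x y. star (T x) * y = star x * S y)"

lemma cstar_zeroI: "(\<And>y. x * y = 0) \<Longrightarrow> x = (0 :: 'a::cstar_algebra)"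
  using norm_mult_star_self[of x] by simp

lemma multiplier_adjoint_sym:
  assumes "multiplier_adjoint T S"
  shows "multiplier_adjoint S T"
  unfolding multiplier_adjoint_def
proof (intro allI)
  fix x y
  have "star (star y * S x) = star (star (T y) * x)"
    using assms by (simp add: multiplier_adjoint_def)
  then show "star (S x) * y = star x * T y" by (simp add: star_mult)
qed

lemma multiplier_adjoint_eqI:
  assumes "\<And>x y. star (T x :: 'a::cstar_algebra) * y = star (S x) * y"
  shows "T x = S x"
proof -
  have "star (T x) - star (S x) = 0"
    by (rule cstar_zeroI) (simp add: left_diff_distrib assms)
  then have "star (star (T x)) = star (star (S x))" by simp
  then show ?thesis by simp
qed

lemma multiplier_adjoint_unique:
  assumes "multiplier_adjoint T S" "multiplier_adjoint T S'"
  shows "S = S'"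
proof (rule blinfun_eqI)
  fix x
  have "star (S x) * y = star (S' x) * y" for x y
    using assms[THEN multiplier_adjoint_sym] by (simp add: multiplier_adjoint_def)
  then show "S x = S' x" by (rule multiplier_adjoint_eqI)
qed

lemma multiplier_adjoint_scaleC:
  assumes "multiplier_adjoint T S"
  shows "T (scaleC c x) = scaleC c (T x)"
  by (rule multiplier_adjoint_eqI[of "\<lambda>x. T (scaleC c x)" "\<lambda>x. scaleC c (T x)"])
    (use assms in \<open>simp add: multiplier_adjoint_def star_scaleC mult_scaleC_left\<close>)

lemma multiplier_adjoint_mult_right:
  assumes "multiplier_adjoint T S"
  shows "T (x * b) = T x * b"
  by (rule multiplier_adjoint_eqI[of "\<lambda>x. T (x * b)" "\<lambda>x. T x * b"])
    (use assms in \<open>simp add: multiplier_adjoint_def star_mult mult.assoc\<close>)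

lemma norm_multiplier_square_le:
  assumes "multiplier_adjoint T S"
  shows "(norm (T x))\<^sup>2 \<le> norm x * norm (S (T x))"
proof -
  have "(norm (T x))\<^sup>2 = norm (star (T x) * T x)" by (simp add: norm_star_mult_self)
  also have "star (T x) * T x = star x * S (T x)" using assms by (simp add: multiplier_adjoint_def)
  also have "norm \<dots> \<le> norm x * norm (S (T x))" using norm_mult_ineq[of "star x"] by simp
  finally show ?thesis .
qed

lemma norm_multiplier_adjoint_le:
  assumes "multiplier_adjoint T S"
  shows "norm T \<le> norm S"
proof (rule norm_blinfun_bound)
  fix x
  have "(norm (T x))\<^sup>2 \<le> norm x * (norm S * norm (T x))"
    using norm_multiplier_square_le[OF assms, of x] norm_blinfun[of S "T x"]
    by (meson mult_left_mono norm_ge_zero order_trans)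
  then show "norm (T x) \<le> norm S * norm x"
    by (cases "T x = 0") (auto simp: power2_eq_square algebra_simps)
qed simp

lemma norm_multiplier_adjoint: "multiplier_adjoint T S \<Longrightarrow> norm S = norm T"
  using norm_multiplier_adjoint_le multiplier_adjoint_sym by (metis antisym)

text \<open>Cauchy-Schwarz for \<open>star x * y\<close> bounds the square of
  \<open>norm (T x)\<close> by \<open>norm x * norm (S (T x))\<close>. This becomes the C*-identity
  of the multiplier algebra.\<close>

lemma norm_multiplier_compose:
  assumes "multiplier_adjoint T S"
  shows "norm (S o\<^sub>L T) = (norm T)\<^sup>2"
proof (rule antisym)
  show "norm (S o\<^sub>L T) \<le> (norm T)\<^sup>2"
    using norm_blinfun_compose[of S T] norm_multiplier_adjoint[OF assms] by (simp add: power2_eq_square)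
  have "norm T \<le> sqrt (norm (S o\<^sub>L T))"
  proof (rule norm_blinfun_bound)
    fix x
    have "norm (S (T x)) \<le> norm (S o\<^sub>L T) * norm x" using norm_blinfun[of "S o\<^sub>L T" x] by simp
    then have "(norm (T x))\<^sup>2 \<le> norm x * (norm (S o\<^sub>L T) * norm x)"
      using norm_multiplier_square_le[OF assms, of x] by (meson mult_left_mono norm_ge_zero order_trans)
    also have "\<dots> = (sqrt (norm (S o\<^sub>L T)) * norm x)\<^sup>2"
      by (simp add: power_mult_distrib) (simp add: power2_eq_square)
    finally show "norm (T x) \<le> sqrt (norm (S o\<^sub>L T)) * norm x"
      by (rule power2_le_imp_le) simp
  qed simp
  then show "(norm T)\<^sup>2 \<le> norm (S o\<^sub>L T)"
    using power_mono[of "norm T" "sqrt (norm (S o\<^sub>L T))" 2] by simp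
qed

text \<open>Multipliers supply the unit: the norm is that of bounded operators, and completeness
  comes from there too, so no norm has to be devised on the sum of the algebra and the
  scalars.\<close>

typedef (overloaded) 'a multiplier =
  "{T :: 'a::cstar_algebra \<Rightarrow>\<^sub>L 'a. \<exists>S. multiplier_adjoint T S}"
  by (rule exI[of _ 0]) (auto simp: multiplier_adjoint_def intro!: exI[of _ 0])

setup_lifting type_definition_multiplier

lift_definition apply_multiplier :: "'a::cstar_algebra multiplier \<Rightarrow> 'a \<Rightarrow> 'a" is blinfun_apply .

instantiation multiplier :: (cstar_algebra) real_normed_vector
begin

lift_definition zero_multiplier :: "'a multiplier" is 0
  by (auto simp: multiplier_adjoint_def intro!: exI[of _ 0])

lift_definition plus_multiplier :: "'a multiplier \<Rightarrow> 'a multiplier \<Rightarrow> 'a multiplier" is "(+)"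
proof clarify
  fix T S T' S' :: "'a \<Rightarrow>\<^sub>L 'a"
  assume "multiplier_adjoint T S" "multiplier_adjoint T' S'"
  then have "multiplier_adjoint (T + T') (S + S')"
    by (simp add: multiplier_adjoint_def blinfun.add_left star_add algebra_simps)
  then show "\<exists>S. multiplier_adjoint (T + T') S" ..
qed

lift_definition minus_multiplier :: "'a multiplier \<Rightarrow> 'a multiplier \<Rightarrow> 'a multiplier" is "(-)"
proof clarify
  fix T S T' S' :: "'a \<Rightarrow>\<^sub>L 'a"
  assume "multiplier_adjoint T S" "multiplier_adjoint T' S'"
  then have "multiplier_adjoint (T - T') (S - S')"
    by (simp add: multiplier_adjoint_def blinfun.diff_left star_diff algebra_simps)
  then show "\<exists>S. multiplier_adjoint (T - T') S" ..
qed

lift_definition uminus_multiplier :: "'a multiplier \<Rightarrow> 'a multiplier" is uminus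
proof clarify
  fix T S :: "'a \<Rightarrow>\<^sub>L 'a"
  assume "multiplier_adjoint T S"
  then have "multiplier_adjoint (- T) (- S)"
    by (simp add: multiplier_adjoint_def blinfun.minus_left)
  then show "\<exists>S. multiplier_adjoint (- T) S" ..
qed

lift_definition scaleR_multiplier :: "real \<Rightarrow> 'a multiplier \<Rightarrow> 'a multiplier" is scaleR
proof clarify
  fix r and T S :: "'a \<Rightarrow>\<^sub>L 'a"
  assume "multiplier_adjoint T S"
  then have "multiplier_adjoint (r *\<^sub>R T) (r *\<^sub>R S)"
    by (simp add: multiplier_adjoint_def blinfun.scaleR_left star_scaleR)
  then show "\<exists>S. multiplier_adjoint (r *\<^sub>R T) S" ..
qed

lift_definition norm_multiplier :: "'a multiplier \<Rightarrow> real" is norm .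

definition dist_multiplier :: "'a multiplier \<Rightarrow> 'a multiplier \<Rightarrow> real" where
  "dist_multiplier S T = norm (S - T)"

definition sgn_multiplier :: "'a multiplier \<Rightarrow> 'a multiplier" where
  "sgn_multiplier T = inverse (norm T) *\<^sub>R T"

definition uniformity_multiplier :: "('a multiplier \<times> 'a multiplier) filter" where
  [code del]: "uniformity_multiplier = (INF e\<in>{0 <..}. principal {(x, y). dist x y < e})"

definition open_multiplier :: "'a multiplier set \<Rightarrow> bool" where
  [code del]: "open_multiplier S = (\<forall>x\<in>S. \<forall>\<^sub>F (x', y) in uniformity. x' = x \<longrightarrow> y \<in> S)"

instance
proof
  fix S T U :: "'a multiplier" and r q :: real
  show "dist S T = norm (S - T)" by (rule dist_multiplier_def)
  show "sgn T = inverse (norm T) *\<^sub>R T" by (rule sgn_multiplier_def)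
  show "uniformity = (INF e\<in>{0 <..}. principal {(x, y :: 'a multiplier). dist x y < e})"
    by (rule uniformity_multiplier_def)
  show "open V \<longleftrightarrow> (\<forall>x\<in>V. \<forall>\<^sub>F (x', y) in uniformity. x' = x \<longrightarrow> y \<in> V)"
    for V :: "'a multiplier set"
    by (rule open_multiplier_def)
  show "S + T + U = S + (T + U)" "S + T = T + S" "0 + T = T" "- T + T = 0" "S - T = S + - T"
    by (transfer; simp)+
  show "r *\<^sub>R (S + T) = r *\<^sub>R S + r *\<^sub>R T" "(r + q) *\<^sub>R T = r *\<^sub>R T + q *\<^sub>R T"
    "r *\<^sub>R q *\<^sub>R T = (r * q) *\<^sub>R T" "1 *\<^sub>R T = T"
    by (transfer; simp add: scaleR_add_right scaleR_add_left)+
  show "norm T = 0 \<longleftrightarrow> T = 0" "norm (S + T) \<le> norm S + norm T" "norm (r *\<^sub>R T) = \<bar>r\<bar> * norm T"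
    by (transfer; simp add: norm_triangle_ineq)+
qed

end

instantiation multiplier :: (cstar_algebra) unital_cstar_algebra
begin

lift_definition one_multiplier :: "'a multiplier" is id_blinfun
  by (auto simp: multiplier_adjoint_def intro!: exI[of _ id_blinfun])

lift_definition times_multiplier :: "'a multiplier \<Rightarrow> 'a multiplier \<Rightarrow> 'a multiplier" is "(o\<^sub>L)"
proof clarify
  fix T S T' S' :: "'a \<Rightarrow>\<^sub>L 'a"
  assume "multiplier_adjoint T S" "multiplier_adjoint T' S'"
  then have "multiplier_adjoint (T o\<^sub>L T') (S' o\<^sub>L S)"
    by (simp add: multiplier_adjoint_def)
  then show "\<exists>S. multiplier_adjoint (T o\<^sub>L T') S" ..
qed

lift_definition scaleC_multiplier :: "complex \<Rightarrow> 'a multiplier \<Rightarrow> 'a multiplier" is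
  "\<lambda>c T. Blinfun (scaleC c) o\<^sub>L T"
proof clarify
  fix c and T S :: "'a \<Rightarrow>\<^sub>L 'a"
  assume "multiplier_adjoint T S"
  then have "multiplier_adjoint (Blinfun (scaleC c) o\<^sub>L T) (Blinfun (scaleC (cnj c)) o\<^sub>L S)"
    by (simp add: multiplier_adjoint_def bounded_linear_Blinfun_apply bounded_linear_scaleC
        star_scaleC mult_scaleC_left mult_scaleC_right)
  then show "\<exists>S'. multiplier_adjoint (Blinfun (scaleC c) o\<^sub>L T) S'" ..
qed

lift_definition star_multiplier :: "'a multiplier \<Rightarrow> 'a multiplier" is
  "\<lambda>T. THE S. multiplier_adjoint T S"
proof clarify
  fix T S :: "'a \<Rightarrow>\<^sub>L 'a"
  assume TS: "multiplier_adjoint T S"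
  then have "(THE S. multiplier_adjoint T S) = S"
    by (blast intro: multiplier_adjoint_unique)
  then show "\<exists>S'. multiplier_adjoint (THE S. multiplier_adjoint T S) S'"
    using multiplier_adjoint_sym[OF TS] by auto
qed

lemma apply_multiplier_star: "star (apply_multiplier T x) * y = star x * apply_multiplier (star T) y"
proof transfer
  fix T :: "'a \<Rightarrow>\<^sub>L 'a" and x y
  assume "\<exists>S. multiplier_adjoint T S"
  then obtain S where S: "multiplier_adjoint T S" ..
  then have "(THE S. multiplier_adjoint T S) = S"
    by (blast intro: multiplier_adjoint_unique)
  with S show "star (T x) * y = star x * (THE S. multiplier_adjoint T S) y"
    by (simp add: multiplier_adjoint_def)
qed

lemma multiplier_eqI: "(\<And>x. apply_multiplier S x = apply_multiplier T x) \<Longrightarrow> S = T"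
  by transfer (rule blinfun_eqI)

lemma star_multiplier_eqI:
  assumes "\<And>x y. star (apply_multiplier T x) * y = star x * apply_multiplier S y"
  shows "star T = S"
proof (rule multiplier_eqI)
  fix x
  have "star (apply_multiplier (star T) z) * y = star (apply_multiplier S z) * y" for z y
  proof -
    have "star (star y * apply_multiplier (star T) z) = star (star y * apply_multiplier S z)"
      using assms[of y z] apply_multiplier_star[of T y z] by simp
    then show ?thesis by (simp add: star_mult)
  qed
  then show "apply_multiplier (star T) x = apply_multiplier S x"
    by (rule multiplier_adjoint_eqI)
qed

lemma apply_multiplier_simps [simp]:
  "apply_multiplier 0 x = (0 :: 'a)"
  "apply_multiplier 1 x = (x :: 'a)"
  "apply_multiplier (S + T) x = apply_multiplier S x + apply_multiplier T x"
  "apply_multiplier (S - T) x = apply_multiplier S x - apply_multiplier T x"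
  "apply_multiplier (S * T) x = apply_multiplier S (apply_multiplier T x)"
  "apply_multiplier (r *\<^sub>R T) x = r *\<^sub>R apply_multiplier T x"
  "apply_multiplier (scaleC c T) x = scaleC c (apply_multiplier T x)"
  by (transfer; simp add: blinfun.bilinear_simps bounded_linear_Blinfun_apply bounded_linear_scaleC)+

lemma apply_multiplier_right:
  "apply_multiplier T (x + y) = apply_multiplier T x + (apply_multiplier T y :: 'a)"
  "apply_multiplier T (r *\<^sub>R x) = r *\<^sub>R (apply_multiplier T x :: 'a)"
  "apply_multiplier T (scaleC c x) = scaleC c (apply_multiplier T x :: 'a)"
  "apply_multiplier T (x * y) = (apply_multiplier T x * y :: 'a)"
  by (transfer; auto simp: blinfun.bilinear_simps multiplier_adjoint_scaleC multiplier_adjoint_mult_right)+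

lemma norm_apply_multiplier_le: "norm (apply_multiplier T x :: 'a) \<le> norm T * norm x"
  by transfer (rule norm_blinfun)

lemma star_star_multiplier: "star (star T) = (T :: 'a multiplier)"
proof (rule star_multiplier_eqI)
  fix x y
  have "star (star y * apply_multiplier (star T) x) = star (star (apply_multiplier T y) * x)"
    by (simp add: apply_multiplier_star)
  then show "star (apply_multiplier (star T) x) * y = star x * apply_multiplier T y"
    by (simp add: star_mult)
qed

lemma norm_star_mult_multiplier: "norm (star T * T :: 'a multiplier) = (norm T)\<^sup>2"
proof transfer
  fix T :: "'a \<Rightarrow>\<^sub>L 'a"
  assume "\<exists>S. multiplier_adjoint T S"
  then obtain S where S: "multiplier_adjoint T S" ..
  then have "(THE S. multiplier_adjoint T S) = S"
    by (blast intro: multiplier_adjoint_unique)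
  then show "norm ((THE S. multiplier_adjoint T S) o\<^sub>L T) = (norm T)\<^sup>2"
    using norm_multiplier_compose[OF S] by simp
qed

lemma norm_star_multiplier: "norm (star T :: 'a multiplier) = norm T"
proof transfer
  fix T :: "'a \<Rightarrow>\<^sub>L 'a"
  assume "\<exists>S. multiplier_adjoint T S"
  then obtain S where S: "multiplier_adjoint T S" ..
  then have "(THE S. multiplier_adjoint T S) = S"
    by (blast intro: multiplier_adjoint_unique)
  then show "norm (THE S. multiplier_adjoint T S) = norm T"
    using norm_multiplier_adjoint[OF S] by simp
qed

lemma star_diff_multiplier: "star (S - T) = star S - (star T :: 'a multiplier)"
  by (rule star_multiplier_eqI) (simp add: star_diff left_diff_distrib right_diff_distrib apply_multiplier_star)

lemma norm_scaleC_multiplier_le: "norm (scaleC c T :: 'a multiplier) \<le> cmod c * norm T"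
proof transfer
  fix c and T :: "'a \<Rightarrow>\<^sub>L 'a"
  show "norm (Blinfun (scaleC c) o\<^sub>L T) \<le> cmod c * norm T"
    by (rule norm_blinfun_bound)
      (simp_all add: bounded_linear_Blinfun_apply bounded_linear_scaleC norm_scaleC mult.assoc
        mult_left_mono norm_blinfun)
qed

instance
proof
  fix X :: "nat \<Rightarrow> 'a multiplier"
  assume X: "Cauchy X"
  have dist: "dist S T = dist (Rep_multiplier S) (Rep_multiplier T)" for S T :: "'a multiplier"
    by (simp add: dist_norm norm_multiplier.rep_eq minus_multiplier.rep_eq)
  have "Cauchy (\<lambda>n. Rep_multiplier (X n))" using X by (simp add: Cauchy_def dist)
  then obtain T where T: "(\<lambda>n. Rep_multiplier (X n)) \<longlonglongrightarrow> T"
    using Cauchy_convergent convergent_def by blast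
  \<comment> \<open>The limit operator still needs an adjoint. As the involution is isometric, the
    adjoints converge as well, and their limit is the adjoint.\<close>
  have "Cauchy (\<lambda>n. star (X n))"
    using X by (simp add: Cauchy_def dist_norm norm_star_multiplier flip: star_diff_multiplier)
  then have "Cauchy (\<lambda>n. Rep_multiplier (star (X n)))" by (simp add: Cauchy_def dist)
  then obtain S where S: "(\<lambda>n. Rep_multiplier (star (X n))) \<longlonglongrightarrow> S"
    using Cauchy_convergent convergent_def by blast
  have "multiplier_adjoint T S"
    unfolding multiplier_adjoint_def
  proof (intro allI)
    fix x y
    have "(\<lambda>n. star (Rep_multiplier (X n) x) * y) \<longlonglongrightarrow> star (T x) * y"
      by (intro tendsto_intros tendsto_star T)
    moreover have "(\<lambda>n. star x * Rep_multiplier (star (X n)) y) \<longlonglongrightarrow> star x * S y"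
      by (intro tendsto_intros S)
    moreover have "star (Rep_multiplier (X n) x) * y = star x * Rep_multiplier (star (X n)) y" for n
      using apply_multiplier_star[of "X n" x y] by (simp add: apply_multiplier.rep_eq)
    ultimately show "star (T x) * y = star x * S y"
      by (simp add: LIMSEQ_unique)
  qed
  then have "Rep_multiplier (Abs_multiplier T) = T" by (subst Abs_multiplier_inverse) auto
  then have "X \<longlonglongrightarrow> Abs_multiplier T"
    using T by (simp add: tendsto_dist_iff[of X] tendsto_dist_iff[of "\<lambda>n. Rep_multiplier (X n)"] dist)
  then show "convergent X" by (auto simp: convergent_def)
next
  fix S T U :: "'a multiplier" and r :: real and c d :: complex
  show "norm (S * T) \<le> norm S * norm T" by transfer (rule norm_blinfun_compose)
  show "scaleC (complex_of_real r) T = r *\<^sub>R T"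
    by (rule multiplier_eqI) (simp add: scaleC_of_real)
  show "star (S + T) = star S + star T"
    by (rule star_multiplier_eqI) (simp add: star_add distrib_left distrib_right apply_multiplier_star)
  show "star (scaleC c T) = scaleC (cnj c) (star T)"
    by (rule star_multiplier_eqI)
      (simp add: star_scaleC mult_scaleC_left mult_scaleC_right apply_multiplier_star)
  show "star (S * T) = star T * star S"
    by (rule star_multiplier_eqI) (simp add: apply_multiplier_star)
  show "star (star T) = T" by (rule star_star_multiplier)
  show "norm (star T * T) = (norm T)\<^sup>2" by (rule norm_star_mult_multiplier)
  show "norm (scaleC c T) = cmod c * norm T"
  proof (rule antisym[OF norm_scaleC_multiplier_le])
    show "cmod c * norm T \<le> norm (scaleC c T)"
    proof (cases "c = 0")
      case False
      have "scaleC (inverse c) (scaleC c T) = T"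
        by (rule multiplier_eqI) (simp add: scaleC_scaleC False)
      then have "norm T \<le> cmod (inverse c) * norm (scaleC c T)"
        using norm_scaleC_multiplier_le[of "inverse c" "scaleC c T"] by simp
      then have "cmod c * norm T \<le> cmod c * (cmod (inverse c) * norm (scaleC c T))"
        by (rule mult_left_mono) simp
      also have "\<dots> = norm (scaleC c T)"
        using False by (simp add: norm_inverse flip: mult.assoc)
      finally show ?thesis .
    qed simp
  qed
qed (rule multiplier_eqI, simp add: apply_multiplier_right scaleC_add_right scaleC_add_left
    scaleC_scaleC algebra_simps)+

end

section \<open>The algebra as an ideal of its multipliers\<close>

lift_definition embed_multiplier :: "'a::cstar_algebra \<Rightarrow> 'a multiplier" is
  "\<lambda>a. Blinfun (\<lambda>x. a * x)"
proof -
  fix a :: 'a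
  have "multiplier_adjoint (Blinfun (\<lambda>x. a * x)) (Blinfun (\<lambda>x. star a * x))"
    by (simp add: multiplier_adjoint_def bounded_linear_Blinfun_apply bounded_linear_mult_right
        star_mult mult.assoc)
  then show "\<exists>S. multiplier_adjoint (Blinfun (\<lambda>x. a * x)) S" ..
qed

lemma apply_embed_multiplier [simp]: "apply_multiplier (embed_multiplier a) x = a * x"
  by transfer (simp add: bounded_linear_Blinfun_apply bounded_linear_mult_right)

lemma embed_multiplier_simps:
  "embed_multiplier (a + b) = embed_multiplier a + embed_multiplier b"
  "embed_multiplier (a - b) = embed_multiplier a - embed_multiplier b"
  "embed_multiplier (a * b) = embed_multiplier a * embed_multiplier b"
  "embed_multiplier (r *\<^sub>R a) = r *\<^sub>R embed_multiplier a"
  "embed_multiplier (star a) = star (embed_multiplier a)"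
proof -
  show "embed_multiplier (star a) = star (embed_multiplier a)"
    by (rule star_multiplier_eqI[symmetric]) (simp add: star_mult mult.assoc)
qed (rule multiplier_eqI; simp add: algebra_simps)+

lemma embed_multiplier_zero [simp]: "embed_multiplier 0 = 0"
  by (rule multiplier_eqI) simp

text \<open>Multipliers commute with right multiplication, so the image is a left ideal. This keeps
  the terms of the root series inside the algebra.\<close>

lemma mult_embed_multiplier: "T * embed_multiplier a = embed_multiplier (apply_multiplier T a)"
  by (rule multiplier_eqI) (simp add: apply_multiplier_right)

lemma norm_embed_multiplier [simp]: "norm (embed_multiplier a) = norm a"
proof (rule antisym)
  show "norm (embed_multiplier a) \<le> norm a"
    by transfer (rule norm_blinfun_bound,
        simp_all add: bounded_linear_Blinfun_apply bounded_linear_mult_right norm_mult_ineq)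
  have "norm a * norm a \<le> norm (embed_multiplier a) * norm a"
    using norm_apply_multiplier_le[of "embed_multiplier a" "star a"]
    by (simp add: norm_mult_star_self power2_eq_square)
  then show "norm a \<le> norm (embed_multiplier a)" by (cases "a = 0") auto
qed

lemma embed_multiplier_eq_iff: "embed_multiplier a = embed_multiplier b \<longleftrightarrow> a = b"
  using norm_embed_multiplier[of "a - b"] by (auto simp: embed_multiplier_simps)

lemma bounded_linear_embed_multiplier: "bounded_linear embed_multiplier"
  by (rule bounded_linear_intro[where K = 1]) (simp_all add: embed_multiplier_simps)

subsection \<open>Positivity without unit\<close>

lemma unital_positive_embed: "cstar_positive a \<Longrightarrow> unital_positive (embed_multiplier a)"
  by (auto simp: cstar_positive_def embed_multiplier_simps unital_positive_star_mult_self)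

text \<open>As \<open>sqrt_coeff\<close> sums to zero, the square root of \<open>s (1 - x)\<close> is the series of the
  \<open>sqrt_coeff n *\<^sub>R (x ^ n - 1)\<close>, whose terms lie in the ideal.\<close>

lemma unital_positive_embed_sqrt:
  fixes a :: "'a::cstar_algebra"
  assumes "unital_positive (embed_multiplier a)"
  obtains h where "unital_positive (embed_multiplier h)" "h * h = a"
    "\<And>y. a * y = y * a \<Longrightarrow> h * y = y * h"
proof -
  obtain s where s: "star (embed_multiplier a) = embed_multiplier a" "s > 0"
      "norm (s *\<^sub>R 1 - embed_multiplier a) \<le> s"
    using assms by (auto simp: unital_positive_def)
  obtain x where x: "norm x \<le> 1" "star x = x" "embed_multiplier a = s *\<^sub>R (1 - x)"
    "\<And>y. embed_multiplier a * y = y * embed_multiplier a \<Longrightarrow> x * y = y * x"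
    "sqrt s *\<^sub>R sqrt_series x * (sqrt s *\<^sub>R sqrt_series x) = embed_multiplier a"
    "unital_positive (sqrt s *\<^sub>R sqrt_series x)"
    using unital_positive_sqrt_within[OF s] by metis
  have "x ^ n - 1 \<in> range embed_multiplier" for n
  proof (induction n)
    case 0
    show ?case by (rule image_eqI[of _ _ 0]) simp_all
  next
    case (Suc n)
    then obtain b where b: "x ^ n - 1 = embed_multiplier b" by auto
    \<comment> \<open>The increment from \<open>x ^ n\<close> to \<open>x ^ Suc n\<close> is a
      multiple of \<open>x ^ n * embed_multiplier a\<close>, which lies in the ideal.\<close>
    have "x ^ n * embed_multiplier a = s *\<^sub>R (x ^ n - x ^ Suc n)"
      unfolding x(3) by (simp add: algebra_simps power_commutes)
    then have "x ^ Suc n = x ^ n - (1 / s) *\<^sub>R (x ^ n * embed_multiplier a)"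
      using \<open>s > 0\<close> by simp
    then have "x ^ Suc n - 1 = embed_multiplier b - (1 / s) *\<^sub>R (x ^ n * embed_multiplier a)"
      using b by simp
    also have "\<dots> = embed_multiplier (b - (1 / s) *\<^sub>R apply_multiplier (x ^ n) a)"
      by (simp add: embed_multiplier_simps mult_embed_multiplier)
    finally show ?case by blast
  qed
  then have "\<forall>n. \<exists>b. x ^ n - 1 = embed_multiplier b" by blast
  then obtain b where b: "\<And>n. x ^ n - 1 = embed_multiplier (b n)" by metis
  define g where "g = (\<lambda>n. sqrt_coeff n *\<^sub>R b n)"
  have g: "embed_multiplier (g n) = sqrt_coeff n *\<^sub>R x ^ n - sqrt_coeff n *\<^sub>R 1" for n
    by (simp add: g_def embed_multiplier_simps flip: b) (simp add: scaleR_diff_right)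
  have one: "norm (1 :: 'a multiplier) \<le> 1" by (rule norm_unit_le)
  have sabs: "summable (\<lambda>n. \<bar>sqrt_coeff n\<bar>)"
    using summable_abs_sqrt_coeff summable_Suc_iff[of "\<lambda>n. \<bar>sqrt_coeff n\<bar>"] by simp
  have "norm (g n) \<le> norm (sqrt_coeff n *\<^sub>R x ^ n) + \<bar>sqrt_coeff n\<bar>" for n
  proof -
    have "norm (g n) = norm (embed_multiplier (g n))" by simp
    also have "\<dots> \<le> norm (sqrt_coeff n *\<^sub>R x ^ n) + norm (sqrt_coeff n *\<^sub>R (1 :: 'a multiplier))"
      unfolding g by (rule norm_triangle_ineq4)
    also have "norm (sqrt_coeff n *\<^sub>R (1 :: 'a multiplier)) \<le> \<bar>sqrt_coeff n\<bar>"
      using mult_left_mono[OF one, of "\<bar>sqrt_coeff n\<bar>"] by simp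
    finally show ?thesis by simp
  qed
  then have "summable (\<lambda>n. norm (g n))"
    by (intro summable_comparison_test[OF _ summable_add[OF summable_norm_sqrt_series[OF x(1)] sabs]]) auto
  then have sg: "summable g" by (rule summable_norm_cancel)
  have "(\<lambda>n. embed_multiplier (g n)) sums embed_multiplier (suminf g)"
    by (rule bounded_linear.sums[OF bounded_linear_embed_multiplier summable_sums[OF sg]])
  moreover have "(\<lambda>n. embed_multiplier (g n)) sums (sqrt_series x - 0 *\<^sub>R 1)"
    unfolding g sqrt_series_def
    by (intro sums_diff summable_sums[OF summable_sqrt_series[OF x(1)]]
        bounded_linear.sums[OF bounded_linear_scaleR_left sqrt_coeff_sums_zero])
  ultimately have e: "embed_multiplier (suminf g) = sqrt_series x"
    using sums_unique2 by fastforce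
  define h where "h = sqrt s *\<^sub>R suminf g"
  have h: "embed_multiplier h = sqrt s *\<^sub>R sqrt_series x"
    by (simp add: h_def e embed_multiplier_simps)
  show thesis
  proof (rule that)
    show "unital_positive (embed_multiplier h)" using x(6) h by simp
    show "h * h = a" using x(5) by (simp flip: h embed_multiplier_simps add: embed_multiplier_eq_iff)
    fix y assume "a * y = y * a"
    then have "embed_multiplier a * embed_multiplier y = embed_multiplier y * embed_multiplier a"
      by (simp flip: embed_multiplier_simps)
    then have "embed_multiplier h * embed_multiplier y = embed_multiplier y * embed_multiplier h"
      unfolding h by (simp add: sqrt_series_commute[OF x(1) x(4)])
    then show "h * y = y * h" by (simp add: embed_multiplier_eq_iff flip: embed_multiplier_simps)
  qed
qed

text \<open>The root found inside the algebra is self-adjoint because its image is, so it serves as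
  the factor in \<open>cstar_positive\<close>. Sums, limits and norm comparison are from here on
  read off from the norm criterion.\<close>

lemma cstar_positive_iff_embed: "cstar_positive a \<longleftrightarrow> unital_positive (embed_multiplier a)"
proof
  assume "unital_positive (embed_multiplier a)"
  then obtain h where "unital_positive (embed_multiplier h)" "h * h = a"
    by (rule unital_positive_embed_sqrt)
  moreover from this have "star h = h"
    using unital_positive_star by (metis embed_multiplier_simps(5) embed_multiplier_eq_iff)
  ultimately show "cstar_positive a" unfolding cstar_positive_def by metis
qed (rule unital_positive_embed)

lemma cstar_positive_star_mult [simp]: "cstar_positive (star b * b)"
  by (auto simp: cstar_positive_def)

lemma cstar_positive_zero [simp]: "cstar_positive 0"
  using cstar_positive_star_mult[of 0] by simp

lemma cstar_positive_star: "cstar_positive a \<Longrightarrow> star a = a"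
  by (auto simp: cstar_positive_def star_mult)

lemma cstar_positive_add: "cstar_positive a \<Longrightarrow> cstar_positive b \<Longrightarrow> cstar_positive (a + b)"
  by (simp add: cstar_positive_iff_embed embed_multiplier_simps unital_positive_add)

lemma cstar_positive_sum: "(\<And>i. i \<in> I \<Longrightarrow> cstar_positive (f i)) \<Longrightarrow> cstar_positive (sum f I)"
  by (induction I rule: infinite_finite_induct) (auto intro: cstar_positive_add)

lemma cstar_positive_scaleR: "cstar_positive a \<Longrightarrow> r \<ge> 0 \<Longrightarrow> cstar_positive (r *\<^sub>R a)"
  by (simp add: cstar_positive_iff_embed embed_multiplier_simps unital_positive_scaleR)

lemma cstar_positive_limit:
  assumes "\<And>n. cstar_positive (f n)" "f \<longlonglongrightarrow> a"
  shows "cstar_positive a"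
  unfolding cstar_positive_iff_embed
  by (rule unital_positive_limit[of "\<lambda>n. embed_multiplier (f n)"])
    (use assms bounded_linear.tendsto[OF bounded_linear_embed_multiplier assms(2)]
      in \<open>auto simp: cstar_positive_iff_embed\<close>)

lemma cstar_positive_norm_mono:
  assumes "cstar_positive a" "cstar_positive (b - a)"
  shows "norm a \<le> norm b"
  using unital_positive_mono[of "embed_multiplier a" "embed_multiplier b"] assms
  by (simp add: cstar_positive_iff_embed embed_multiplier_simps)

lemma unital_positive_unit_diff:
  fixes a :: "'a::unital_cstar_algebra"
  assumes "unital_positive a" "norm a \<le> s"
  shows "unital_positive (s *\<^sub>R 1 - a)"
proof (cases "s = 0")
  case True
  then show ?thesis using assms by simp
next
  case False
  moreover have "s \<ge> 0" using assms(2) norm_ge_zero order_trans by blast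
  ultimately show ?thesis
    using assms by (auto simp: unital_positive_def star_diff star_scaleR intro!: exI[of _ s])
qed

text \<open>Among the multipliers \<open>s - a\<close> is a square \<open>k * k\<close>, and the
  difference is \<open>star z * z\<close> for \<open>z = apply_multiplier k b\<close>, an element of
  the algebra itself.\<close>

lemma cstar_positive_conjugate_le:
  assumes "cstar_positive a" "norm a \<le> s"
  shows "cstar_positive (s *\<^sub>R (star b * b) - star b * a * b)"
proof -
  have "unital_positive (s *\<^sub>R 1 - embed_multiplier a)"
    using assms by (intro unital_positive_unit_diff) (auto simp: cstar_positive_iff_embed)
  then obtain k where k: "star k = k" "k * k = s *\<^sub>R 1 - embed_multiplier a"
    using unital_positive_sqrt by metis
  have "star (apply_multiplier k b) * apply_multiplier k b = star b * apply_multiplier (k * k) b"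
    using apply_multiplier_star[of k b "apply_multiplier k b"] by (simp add: k(1))
  also have "\<dots> = s *\<^sub>R (star b * b) - star b * a * b"
    by (simp add: k(2) right_diff_distrib mult.assoc)
  finally show ?thesis by (metis cstar_positive_star_mult)
qed

text \<open>With \<open>m\<close> the absolute value of \<open>x\<close> the parts are
  \<open>(m + x) / 2\<close> and \<open>(m - x) / 2\<close>. This extends statements about positive
  elements to self-adjoint ones.\<close>

lemma selfadjoint_positive_diff:
  fixes x :: "'a::cstar_algebra"
  assumes "star x = x"
  obtains p n where "cstar_positive p" "cstar_positive n" "x = p - n"
proof -
  have "cstar_positive (x * x)" using cstar_positive_star_mult[of x] assms by simp
  then obtain m where m: "unital_positive (embed_multiplier m)" "m * m = x * x"
    "\<And>y. x * x * y = y * (x * x) \<Longrightarrow> m * y = y * m"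
    using unital_positive_embed_sqrt unfolding cstar_positive_iff_embed by metis
  have xm: "x * m = m * x" using m(3)[of x] by (simp add: mult.assoc)
  have *: "cstar_positive ((1/2) *\<^sub>R (m + z))" if "star z = z" "z * m = m * z" "m * m = z * z" for z
    using unital_positive_half_add[OF m(1), of "embed_multiplier z"] that
    by (simp add: cstar_positive_iff_embed embed_multiplier_simps flip: embed_multiplier_simps(3,5))
  have "x = (1/2) *\<^sub>R (m + x) - (1/2) *\<^sub>R (m - x)" by (simp add: algebra_simps flip: scaleR_add_left)
  with *[of x] *[of "- x"] show thesis
    by (intro that[of "(1/2) *\<^sub>R (m + x)" "(1/2) *\<^sub>R (m - x)"]) (use assms xm m(2) in simp_all)
qed

text \<open>In place of an inverse of \<open>g + e\<close>, which would call for a unit, a fixed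
  point is taken: \<open>d = (c + (s - g) d) / (s + e)\<close> contracts with ratio
  \<open>s / (s + e)\<close>, as \<open>s - g\<close> has norm at most \<open>s\<close> among the
  multipliers.\<close>

lemma cstar_positive_resolvent:
  assumes "cstar_positive g" "e > 0"
  obtains d where "g * d + e *\<^sub>R d = c"
proof -
  obtain s where s: "s > 0" "norm (s *\<^sub>R 1 - embed_multiplier g) \<le> s"
    using assms(1) by (auto simp: cstar_positive_iff_embed unital_positive_def)
  define f where "f = (\<lambda>d. (1 / (s + e)) *\<^sub>R (c + (s *\<^sub>R d - g * d)))"
  have "\<exists>!d. f d = d"
  proof (rule banach_fix_type[of "s / (s + e)"])
    show "\<forall>x y. dist (f x) (f y) \<le> s / (s + e) * dist x y"
    proof (intro allI)
      fix x y
      have "f x - f y = (1 / (s + e)) *\<^sub>R apply_multiplier (s *\<^sub>R 1 - embed_multiplier g) (x - y)"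
        by (simp add: f_def algebra_simps)
      then have "dist (f x) (f y) =
          (1 / (s + e)) * norm (apply_multiplier (s *\<^sub>R 1 - embed_multiplier g) (x - y))"
        using s(1) assms(2) by (simp add: dist_norm)
      also have "\<dots> \<le> (1 / (s + e)) * (s * norm (x - y))"
      proof (rule mult_left_mono)
        show "norm (apply_multiplier (s *\<^sub>R 1 - embed_multiplier g) (x - y)) \<le> s * norm (x - y)"
          using norm_apply_multiplier_le[of "s *\<^sub>R 1 - embed_multiplier g" "x - y"]
            mult_right_mono[OF s(2) norm_ge_zero[of "x - y"]] by linarith
      qed (use s(1) assms(2) in simp)
      finally show "dist (f x) (f y) \<le> s / (s + e) * dist x y" by (simp add: dist_norm)
    qed
  qed (use s(1) assms(2) in auto)
  then obtain d where "f d = d" by blast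
  then have "(s + e) *\<^sub>R f d = (s + e) *\<^sub>R d" by simp
  then have "c + (s *\<^sub>R d - g * d) = (s + e) *\<^sub>R d"
    using s(1) assms(2) by (simp add: f_def)
  then have "g * d + e *\<^sub>R d = c" by (simp add: algebra_simps)
  then show thesis by (rule that)
qed

section \<open>Semi-inner product modules\<close>

abbreviation hdist :: "('e, 'b::cstar_algebra) hmod \<Rightarrow> 'e \<Rightarrow> 'e \<Rightarrow> real" where
  "hdist E x y \<equiv> hnorm E (vdiff E x y)"

text \<open>Only the laws visible through the inner product are assumed; after completion they yield
  all module axioms.\<close>

locale semi_hilbert =
  fixes P :: "('e, 'b::cstar_algebra) hmod"
  assumes zero_closed [simp]: "vzero P \<in> vcarrier P"
    and add_closed [simp]: "x \<in> vcarrier P \<Longrightarrow> y \<in> vcarrier P \<Longrightarrow> vadd P x y \<in> vcarrier P"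
    and scale_closed [simp]: "x \<in> vcarrier P \<Longrightarrow> vscale P c x \<in> vcarrier P"
    and act_closed [simp]: "x \<in> vcarrier P \<Longrightarrow> hact P x b \<in> vcarrier P"
    and ip_zero_right: "z \<in> vcarrier P \<Longrightarrow> hip P z (vzero P) = 0"
    and ip_add_right: "z \<in> vcarrier P \<Longrightarrow> x \<in> vcarrier P \<Longrightarrow> y \<in> vcarrier P \<Longrightarrow>
      hip P z (vadd P x y) = hip P z x + hip P z y"
    and ip_scale_right: "z \<in> vcarrier P \<Longrightarrow> x \<in> vcarrier P \<Longrightarrow>
      hip P z (vscale P c x) = scaleC c (hip P z x)"
    and ip_act_right: "z \<in> vcarrier P \<Longrightarrow> x \<in> vcarrier P \<Longrightarrow> hip P z (hact P x b) = hip P z x * b"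
    and ip_star: "x \<in> vcarrier P \<Longrightarrow> y \<in> vcarrier P \<Longrightarrow> star (hip P x y) = hip P y x"
    and ip_positive: "x \<in> vcarrier P \<Longrightarrow> cstar_positive (hip P x x)"
begin

lemma ip_zero_left: "z \<in> vcarrier P \<Longrightarrow> hip P (vzero P) z = 0"
  by (subst ip_star[symmetric]) (simp_all add: ip_zero_right)

lemma ip_add_left: "z \<in> vcarrier P \<Longrightarrow> x \<in> vcarrier P \<Longrightarrow> y \<in> vcarrier P \<Longrightarrow>
    hip P (vadd P x y) z = hip P x z + hip P y z"
  by (subst (1 2 3) ip_star[symmetric]) (simp_all add: ip_add_right star_add)

lemma ip_scale_left: "z \<in> vcarrier P \<Longrightarrow> x \<in> vcarrier P \<Longrightarrow>
    hip P (vscale P c x) z = scaleC (cnj c) (hip P x z)"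
  by (subst (1 2) ip_star[symmetric]) (simp_all add: ip_scale_right star_scaleC)

lemma ip_act_left: "z \<in> vcarrier P \<Longrightarrow> x \<in> vcarrier P \<Longrightarrow> hip P (hact P x b) z = star b * hip P x z"
  by (subst (1 2) ip_star[symmetric]) (simp_all add: ip_act_right star_mult)

lemma diff_closed [simp]: "x \<in> vcarrier P \<Longrightarrow> y \<in> vcarrier P \<Longrightarrow> vdiff P x y \<in> vcarrier P"
  by (simp add: vdiff_def)

lemma ip_diff_right: "z \<in> vcarrier P \<Longrightarrow> x \<in> vcarrier P \<Longrightarrow> y \<in> vcarrier P \<Longrightarrow>
    hip P z (vdiff P x y) = hip P z x - hip P z y"
  by (simp add: vdiff_def ip_add_right ip_scale_right)

lemma ip_diff_left: "z \<in> vcarrier P \<Longrightarrow> x \<in> vcarrier P \<Longrightarrow> y \<in> vcarrier P \<Longrightarrow>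
    hip P (vdiff P x y) z = hip P x z - hip P y z"
  by (simp add: vdiff_def ip_add_left ip_scale_left)

lemmas ip_simps = ip_zero_right ip_zero_left ip_add_right ip_add_left ip_scale_right ip_scale_left
  ip_act_right ip_act_left ip_diff_right ip_diff_left

lemma hnorm_nonneg [simp]: "hnorm P x \<ge> 0"
  by (simp add: hnorm_def)

lemma hnorm_square: "(hnorm P x)\<^sup>2 = norm (hip P x x)"
  by (simp add: hnorm_def)

text \<open>With \<open>b = \<langle>x, y\<rangle>\<close> the vector \<open>x b - s y\<close> has a
  positive inner square. Enlarging \<open>star b * \<langle>x, x\<rangle> * b\<close> to
  \<open>s\<close> times \<open>star b * b\<close> leaves the positive difference of
  \<open>s * s\<close> times \<open>\<langle>y, y\<rangle>\<close> and \<open>s\<close> times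
  \<open>star b * b\<close>. A free positive \<open>s\<close> also covers null vectors
  \<open>x\<close>, whose norm could not be divided out.\<close>

lemma norm_ip_square_le:
  assumes x: "x \<in> vcarrier P" and y: "y \<in> vcarrier P" and s: "s > 0" "norm (hip P x x) \<le> s"
  shows "(norm (hip P x y))\<^sup>2 \<le> s * norm (hip P y y)"
proof -
  define b where "b = hip P x y"
  define z where "z = vdiff P (hact P x b) (vscale P (of_real s) y)"
  have yx: "hip P y x = star b" using ip_star[OF x y] by (simp add: b_def)
  have "hip P z z = star b * hip P x x * b - (s *\<^sub>R (star b * b) + s *\<^sub>R (star b * b)) + (s * s) *\<^sub>R hip P y y"
    using x y by (simp add: z_def ip_simps yx b_def[symmetric] scaleC_of_real scaleC_diff_right
        algebra_simps)
  moreover have "cstar_positive (hip P z z + (s *\<^sub>R (star b * b) - star b * hip P x x * b))"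
    by (intro cstar_positive_add cstar_positive_conjugate_le ip_positive s(2))
      (simp_all add: z_def x y)
  moreover have "a - (t + t) + c + (t - a) = c - t" for a c t :: 'b
    by (simp add: algebra_simps)
  ultimately have "cstar_positive ((s * s) *\<^sub>R hip P y y - s *\<^sub>R (star b * b))"
    by simp
  then have "norm (s *\<^sub>R (star b * b)) \<le> norm ((s * s) *\<^sub>R hip P y y)"
    by (rule cstar_positive_norm_mono[rotated]) (use s in \<open>simp add: cstar_positive_scaleR\<close>)
  then have "s * (norm b)\<^sup>2 \<le> s * (s * norm (hip P y y))"
    using s(1) by (simp add: norm_star_mult_self)
  then show ?thesis using s(1) by (simp add: b_def)
qed

theorem cauchy_schwarz:
  assumes x: "x \<in> vcarrier P" and y: "y \<in> vcarrier P"
  shows "norm (hip P x y) \<le> hnorm P x * hnorm P y"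
proof (rule power2_le_imp_le)
  let ?m = "norm (hip P y y)"
  have "(norm (hip P x y))\<^sup>2 \<le> norm (hip P x x) * ?m"
  proof (rule field_le_epsilon)
    fix e :: real assume e: "e > 0"
    \<comment> \<open>After multiplication by \<open>?m\<close> the slack
      \<open>e / (?m + 1)\<close> costs at most \<open>e\<close>.\<close>
    have "(norm (hip P x y))\<^sup>2 \<le> (norm (hip P x x) + e / (?m + 1)) * ?m"
      by (rule norm_ip_square_le[OF x y]) (use e in \<open>auto intro!: add_nonneg_pos divide_pos_pos\<close>)
    also have "\<dots> = norm (hip P x x) * ?m + e * (?m / (?m + 1))" by (simp add: algebra_simps)
    also have "e * (?m / (?m + 1)) \<le> e * 1"
      by (rule mult_left_mono) (use e in \<open>auto simp: divide_le_eq_1 add_nonneg_pos\<close>)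
    finally show "(norm (hip P x y))\<^sup>2 \<le> norm (hip P x x) * ?m + e" by simp
  qed
  then show "(norm (hip P x y))\<^sup>2 \<le> (hnorm P x * hnorm P y)\<^sup>2"
    by (simp add: power_mult_distrib hnorm_square)
qed simp

lemma hnorm_le: "norm (hip P x x) \<le> r\<^sup>2 \<Longrightarrow> r \<ge> 0 \<Longrightarrow> hnorm P x \<le> r"
  unfolding hnorm_def by (rule real_le_lsqrt) auto

lemma hnorm_zero [simp]: "hnorm P (vzero P) = 0"
  by (simp add: hnorm_def ip_zero_right)

lemma hnorm_add_le:
  assumes x: "x \<in> vcarrier P" and y: "y \<in> vcarrier P"
  shows "hnorm P (vadd P x y) \<le> hnorm P x + hnorm P y"
proof (rule hnorm_le)
  have "norm (hip P (vadd P x y) (vadd P x y)) =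
      norm (hip P x x + hip P x y + (hip P y x + hip P y y))"
    using x y by (simp add: ip_simps algebra_simps)
  also have "\<dots> \<le> norm (hip P x x) + norm (hip P x y) + (norm (hip P y x) + norm (hip P y y))"
    by (intro norm_triangle_le add_mono) auto
  also have "\<dots> \<le> (hnorm P x)\<^sup>2 + hnorm P x * hnorm P y + (hnorm P y * hnorm P x + (hnorm P y)\<^sup>2)"
    unfolding hnorm_square by (intro add_mono cauchy_schwarz x y order_refl)
  also have "\<dots> = (hnorm P x + hnorm P y)\<^sup>2" by (simp add: power2_eq_square algebra_simps)
  finally show "norm (hip P (vadd P x y) (vadd P x y)) \<le> (hnorm P x + hnorm P y)\<^sup>2" .
qed simp

lemma hnorm_scale:
  assumes x: "x \<in> vcarrier P"
  shows "hnorm P (vscale P c x) = cmod c * hnorm P x"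
proof -
  have "norm (hip P (vscale P c x) (vscale P c x)) = (cmod c)\<^sup>2 * norm (hip P x x)"
    using x by (simp add: ip_simps norm_scaleC scaleC_scaleC norm_mult power2_eq_square)
  then show ?thesis by (simp add: hnorm_def real_sqrt_mult)
qed

lemma hnorm_act_le:
  assumes x: "x \<in> vcarrier P"
  shows "hnorm P (hact P x b) \<le> hnorm P x * norm b"
proof (rule hnorm_le)
  have "norm (hip P (hact P x b) (hact P x b)) = norm (star b * hip P x x * b)"
    using x by (simp add: ip_simps mult.assoc)
  also have "\<dots> \<le> norm (star b) * norm (hip P x x) * norm b"
    by (meson norm_mult_ineq order_trans mult_right_mono norm_ge_zero)
  also have "\<dots> = (hnorm P x * norm b)\<^sup>2"
    by (simp add: power_mult_distrib hnorm_square) (simp add: power2_eq_square)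
  finally show "norm (hip P (hact P x b) (hact P x b)) \<le> (hnorm P x * norm b)\<^sup>2" .
qed simp

text \<open>Without vector space axioms two expressions for the same vector cannot be equated, but
  their inner squares can be expanded and compared.\<close>

lemma hnorm_cong: "hip P x x = hip P y y \<Longrightarrow> hnorm P x = hnorm P y"
  by (simp add: hnorm_def)

lemma hnorm_vdiff_self [simp]: "x \<in> vcarrier P \<Longrightarrow> hdist P x x = 0"
  by (simp add: hnorm_def ip_simps)

lemma hnorm_vdiff_commute:
  "x \<in> vcarrier P \<Longrightarrow> y \<in> vcarrier P \<Longrightarrow> hdist P x y = hdist P y x"
  by (rule hnorm_cong) (simp add: ip_simps)

lemma hnorm_vdiff_triangle:
  assumes "x \<in> vcarrier P" "y \<in> vcarrier P" "z \<in> vcarrier P"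
  shows "hdist P x z \<le> hdist P x y + hdist P y z"
proof -
  have "hdist P x z = hnorm P (vadd P (vdiff P x y) (vdiff P y z))"
    by (rule hnorm_cong) (use assms in \<open>simp add: ip_simps\<close>)
  then show ?thesis using hnorm_add_le[of "vdiff P x y" "vdiff P y z"] assms by simp
qed

lemma hnorm_le_vdiff:
  assumes "x \<in> vcarrier P" "y \<in> vcarrier P"
  shows "hnorm P x \<le> hnorm P y + hdist P x y"
proof -
  have "hnorm P x = hnorm P (vadd P y (vdiff P x y))"
    by (rule hnorm_cong) (use assms in \<open>simp add: ip_simps\<close>)
  then show ?thesis using hnorm_add_le[of y "vdiff P x y"] assms by simp
qed

lemma hnorm_vdiff_add_le:
  assumes "x \<in> vcarrier P" "y \<in> vcarrier P" "x' \<in> vcarrier P" "y' \<in> vcarrier P"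
  shows "hdist P (vadd P x y) (vadd P x' y') \<le> hdist P x x' + hdist P y y'"
proof -
  have "hdist P (vadd P x y) (vadd P x' y') = hnorm P (vadd P (vdiff P x x') (vdiff P y y'))"
    by (rule hnorm_cong) (use assms in \<open>simp add: ip_simps algebra_simps\<close>)
  then show ?thesis using hnorm_add_le[of "vdiff P x x'" "vdiff P y y'"] assms by simp
qed

lemma hnorm_vdiff_scale:
  assumes "x \<in> vcarrier P" "x' \<in> vcarrier P"
  shows "hdist P (vscale P c x) (vscale P c x') = cmod c * hdist P x x'"
proof -
  have "hdist P (vscale P c x) (vscale P c x') = hnorm P (vscale P c (vdiff P x x'))"
    by (rule hnorm_cong) (use assms in \<open>simp add: ip_simps scaleC_diff_right\<close>)
  then show ?thesis using assms by (simp add: hnorm_scale)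
qed

lemma hnorm_vdiff_act_le:
  assumes "x \<in> vcarrier P" "x' \<in> vcarrier P"
  shows "hdist P (hact P x b) (hact P x' b) \<le> hdist P x x' * norm b"
proof -
  have "hdist P (hact P x b) (hact P x' b) = hnorm P (hact P (vdiff P x x') b)"
    by (rule hnorm_cong) (use assms in \<open>simp add: ip_simps algebra_simps\<close>)
  then show ?thesis using hnorm_act_le[of "vdiff P x x'" b] assms by simp
qed

subsection \<open>Completion\<close>

definition null_equivalent :: "(nat \<Rightarrow> 'e) \<Rightarrow> (nat \<Rightarrow> 'e) \<Rightarrow> bool" where
  "null_equivalent s t \<longleftrightarrow> (\<lambda>n. hdist P (s n) (t n)) \<longlonglongrightarrow> 0"

lemma hCauchy_closed: "hCauchy P s \<Longrightarrow> s n \<in> vcarrier P"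
  by (simp add: hCauchy_def)

lemma null_equivalent_bound:
  assumes "f \<longlonglongrightarrow> 0" "\<And>n. hdist P (s n) (t n) \<le> f n"
  shows "null_equivalent s t"
  unfolding null_equivalent_def
  by (rule tendsto_sandwich[OF _ _ tendsto_const assms(1)]) (use assms(2) in auto)

lemma null_equivalent_refl: "(\<And>n. s n \<in> vcarrier P) \<Longrightarrow> null_equivalent s s"
  by (simp add: null_equivalent_def)

lemma null_equivalent_sym:
  assumes "\<And>n. s n \<in> vcarrier P" "\<And>n. t n \<in> vcarrier P" "null_equivalent s t"
  shows "null_equivalent t s"
  using assms by (simp add: null_equivalent_def hnorm_vdiff_commute)

lemma null_equivalent_trans:
  assumes "\<And>n. s n \<in> vcarrier P" "\<And>n. t n \<in> vcarrier P" "\<And>n. u n \<in> vcarrier P"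
    and "null_equivalent s t" "null_equivalent t u"
  shows "null_equivalent s u"
proof (rule null_equivalent_bound)
  show "(\<lambda>n. hdist P (s n) (t n) + hdist P (t n) (u n)) \<longlonglongrightarrow> 0"
    using tendsto_add[of _ 0 sequentially _ 0] assms(4,5) by (simp add: null_equivalent_def)
qed (rule hnorm_vdiff_triangle[OF assms(1-3)])

lemma cauchy_class_eq_iff:
  assumes s: "hCauchy P s" and t: "hCauchy P t"
  shows "cauchy_class P s = cauchy_class P t \<longleftrightarrow> null_equivalent s t"
proof
  assume "cauchy_class P s = cauchy_class P t"
  moreover have "t \<in> cauchy_class P t"
    using t null_equivalent_refl[of t] by (simp add: cauchy_class_def null_equivalent_def hCauchy_closed)
  ultimately have "t \<in> cauchy_class P s" by simp
  then show "null_equivalent s t" by (simp add: cauchy_class_def null_equivalent_def)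
next
  assume st: "null_equivalent s t"
  note c = hCauchy_closed
  have "null_equivalent s u \<longleftrightarrow> null_equivalent t u" if "hCauchy P u" for u
    using null_equivalent_trans[of s t u] null_equivalent_trans[of t s u] null_equivalent_sym[of s t]
      st c[OF s] c[OF t] c[OF that] by blast
  then show "cauchy_class P s = cauchy_class P t"
    by (auto simp: cauchy_class_def null_equivalent_def)
qed

text \<open>The operations of \<open>completed_module\<close> work on an arbitrary member of each
  class; this ties that member to the sequence naming the class.\<close>

lemma some_rep_cauchy_class:
  assumes s: "hCauchy P s"
  shows "hCauchy P (some_rep (cauchy_class P s))" "null_equivalent s (some_rep (cauchy_class P s))"
proof -
  have "s \<in> cauchy_class P s"
    using s null_equivalent_refl[of s] by (simp add: cauchy_class_def null_equivalent_def hCauchy_closed)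
  then have "some_rep (cauchy_class P s) \<in> cauchy_class P s"
    unfolding some_rep_def by (rule someI[of "\<lambda>t. t \<in> cauchy_class P s"])
  then show "hCauchy P (some_rep (cauchy_class P s))" "null_equivalent s (some_rep (cauchy_class P s))"
    by (simp_all add: cauchy_class_def null_equivalent_def)
qed

text \<open>One estimate for all operations: a sum depends on two sequences, a scaling or an action
  on one, which is then entered twice.\<close>

lemma hCauchy_lipschitz:
  assumes s: "hCauchy P s" and t: "hCauchy P t" and u: "\<And>n. u n \<in> vcarrier P" and K: "K > 0" "L > 0"
    and le: "\<And>m n. hdist P (u m) (u n) \<le>
      K * hdist P (s m) (s n) + L * hdist P (t m) (t n)"
  shows "hCauchy P u"
  unfolding hCauchy_def
proof (intro conjI allI impI u)
  fix e :: real assume e: "e > 0"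
  obtain M where M: "\<And>m n. m \<ge> M \<Longrightarrow> n \<ge> M \<Longrightarrow> hdist P (s m) (s n) < e / (2 * K)"
    using s e K unfolding hCauchy_def by (metis divide_pos_pos mult_pos_pos zero_less_numeral)
  obtain N where N: "\<And>m n. m \<ge> N \<Longrightarrow> n \<ge> N \<Longrightarrow> hdist P (t m) (t n) < e / (2 * L)"
    using t e K unfolding hCauchy_def by (metis divide_pos_pos mult_pos_pos zero_less_numeral)
  have "hdist P (u m) (u n) < e" if "m \<ge> max M N" "n \<ge> max M N" for m n
  proof -
    have "K * hdist P (s m) (s n) < e / 2"
      using M[of m n] that K by (simp add: field_simps)
    moreover have "L * hdist P (t m) (t n) < e / 2"
      using N[of m n] that K by (simp add: field_simps)
    ultimately show ?thesis using le[of m n] by linarith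
  qed
  then show "\<exists>N. \<forall>m\<ge>N. \<forall>n\<ge>N. hdist P (u m) (u n) < e" by blast
qed

lemma hCauchy_const: "x \<in> vcarrier P \<Longrightarrow> hCauchy P (\<lambda>n. x)"
  by (simp add: hCauchy_def)

lemma hCauchy_add: "hCauchy P s \<Longrightarrow> hCauchy P t \<Longrightarrow> hCauchy P (\<lambda>n. vadd P (s n) (t n))"
  by (rule hCauchy_lipschitz[of s t _ 1 1])
    (simp_all add: hCauchy_closed hnorm_vdiff_add_le)

lemma hCauchy_scale:
  assumes "hCauchy P s" shows "hCauchy P (\<lambda>n. vscale P c (s n))"
\<comment> \<open>The scalar \<open>c\<close> may be 0 while positive constants are required, hence
  the \<open>+ 1\<close>.\<close>
proof (rule hCauchy_lipschitz[OF assms assms, of _ "cmod c + 1" 1])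
  fix m n
  have "cmod c * hdist P (s m) (s n) \<le> (cmod c + 1) * hdist P (s m) (s n)"
    by (rule mult_right_mono) auto
  then show "hdist P (vscale P c (s m)) (vscale P c (s n)) \<le>
      (cmod c + 1) * hdist P (s m) (s n) + 1 * hdist P (s m) (s n)"
    using assms by (simp add: hnorm_vdiff_scale hCauchy_closed add_increasing2)
qed (use assms in \<open>auto simp: hCauchy_closed add_nonneg_pos\<close>)

lemma hCauchy_act:
  assumes "hCauchy P s" shows "hCauchy P (\<lambda>n. hact P (s n) b)"
proof (rule hCauchy_lipschitz[OF assms assms, of _ "norm b + 1" 1])
  fix m n
  have "hdist P (s m) (s n) * norm b \<le> hdist P (s m) (s n) * (norm b + 1)"
    by (rule mult_left_mono) auto
  then have "hdist P (hact P (s m) b) (hact P (s n) b) \<le> (norm b + 1) * hdist P (s m) (s n)"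
    using hnorm_vdiff_act_le[of "s m" "s n" b] assms by (simp add: hCauchy_closed mult.commute)
  then show "hdist P (hact P (s m) b) (hact P (s n) b) \<le>
      (norm b + 1) * hdist P (s m) (s n) + 1 * hdist P (s m) (s n)"
    by (simp add: add_increasing2)
qed (use assms in \<open>auto simp: hCauchy_closed add_nonneg_pos\<close>)

lemma hCauchy_bounded:
  assumes s: "hCauchy P s"
  obtains B where "B > 0" "\<And>n. hnorm P (s n) \<le> B"
proof -
  obtain N where N: "\<And>m n. m \<ge> N \<Longrightarrow> n \<ge> N \<Longrightarrow> hdist P (s m) (s n) < 1"
    using s unfolding hCauchy_def by (metis zero_less_one)
  define B where "B = (\<Sum>k\<le>N. hnorm P (s k)) + 1"
  have le: "hnorm P (s n) \<le> (\<Sum>k\<le>N. hnorm P (s k))" if "n \<le> N" for n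
    by (rule member_le_sum) (use that in auto)
  have "hnorm P (s n) \<le> B" for n
  proof (cases "n \<le> N")
    case True
    then show ?thesis using le[of n] by (simp add: B_def)
  next
    case False
    then show ?thesis
      using hnorm_le_vdiff[of "s n" "s N"] N[of n N] le[of N] s by (simp add: B_def hCauchy_closed)
  qed
  moreover have "B > 0" by (simp add: B_def add_nonneg_pos sum_nonneg)
  ultimately show thesis using that by blast
qed

lemma norm_ip_diff_le:
  assumes "x \<in> vcarrier P" "x' \<in> vcarrier P" "y \<in> vcarrier P" "y' \<in> vcarrier P"
  shows "norm (hip P x y - hip P x' y') \<le>
    hdist P x x' * hnorm P y + hnorm P x' * hdist P y y'"
proof -
  have "hip P x y - hip P x' y' = hip P (vdiff P x x') y + hip P x' (vdiff P y y')"
    using assms by (simp add: ip_simps)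
  also have "norm \<dots> \<le> norm (hip P (vdiff P x x') y) + norm (hip P x' (vdiff P y y'))"
    by (rule norm_triangle_ineq)
  also have "\<dots> \<le> hdist P x x' * hnorm P y + hnorm P x' * hdist P y y'"
    by (intro add_mono cauchy_schwarz) (use assms in auto)
  finally show ?thesis .
qed

lemma convergent_ip:
  assumes s: "hCauchy P s" and t: "hCauchy P t"
  shows "convergent (\<lambda>n. hip P (s n) (t n))"
proof (rule Cauchy_convergent, rule CauchyI)
  fix e :: real assume e: "e > 0"
  obtain A where A: "A > 0" "\<And>n. hnorm P (s n) \<le> A" using hCauchy_bounded[OF s] by metis
  obtain B where B: "B > 0" "\<And>n. hnorm P (t n) \<le> B" using hCauchy_bounded[OF t] by metis
  obtain M where M: "\<And>m n. m \<ge> M \<Longrightarrow> n \<ge> M \<Longrightarrow> hdist P (s m) (s n) < e / (2 * B)"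
    using s e B unfolding hCauchy_def by (metis divide_pos_pos mult_pos_pos zero_less_numeral)
  obtain N where N: "\<And>m n. m \<ge> N \<Longrightarrow> n \<ge> N \<Longrightarrow> hdist P (t m) (t n) < e / (2 * A)"
    using t e A unfolding hCauchy_def by (metis divide_pos_pos mult_pos_pos zero_less_numeral)
  have "norm (hip P (s m) (t m) - hip P (s n) (t n)) < e" if "m \<ge> max M N" "n \<ge> max M N" for m n
  proof -
    have "hdist P (s m) (s n) * hnorm P (t m) \<le> hdist P (s m) (s n) * B"
      by (rule mult_left_mono) (simp_all add: B)
    also have "\<dots> < e / 2" using M[of m n] that B(1) by (simp add: field_simps)
    finally have 1: "hdist P (s m) (s n) * hnorm P (t m) < e / 2" .
    have "hnorm P (s n) * hdist P (t m) (t n) \<le> A * hdist P (t m) (t n)"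
      by (rule mult_right_mono) (simp_all add: A)
    also have "\<dots> < e / 2" using N[of m n] that A(1) by (simp add: field_simps)
    finally show ?thesis
      using 1 norm_ip_diff_le[of "s m" "s n" "t m" "t n"] s t by (simp add: hCauchy_closed)
  qed
  then show "\<exists>M. \<forall>m\<ge>M. \<forall>n\<ge>M. norm (hip P (s m) (t m) - hip P (s n) (t n)) < e" by blast
qed

lemma tendsto_ip_diff:
  assumes s: "hCauchy P s" "hCauchy P s'" and t: "hCauchy P t" "hCauchy P t'"
    and eq: "null_equivalent s s'" "null_equivalent t t'"
  shows "(\<lambda>n. hip P (s n) (t n) - hip P (s' n) (t' n)) \<longlonglongrightarrow> 0"
proof -
  obtain A where A: "A > 0" "\<And>n. hnorm P (s' n) \<le> A" using hCauchy_bounded[OF s(2)] by metis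
  obtain B where B: "B > 0" "\<And>n. hnorm P (t n) \<le> B" using hCauchy_bounded[OF t(1)] by metis
  have le: "norm (hip P (s n) (t n) - hip P (s' n) (t' n)) \<le>
      hdist P (s n) (s' n) * B + A * hdist P (t n) (t' n)" for n
    using norm_ip_diff_le[of "s n" "s' n" "t n" "t' n"] s t
      mult_left_mono[OF B(2)[of n], of "hdist P (s n) (s' n)"]
      mult_right_mono[OF A(2)[of n], of "hdist P (t n) (t' n)"]
    by (simp add: hCauchy_closed)
  have "(\<lambda>n. hdist P (s n) (s' n) * B + A * hdist P (t n) (t' n))
      \<longlonglongrightarrow> 0 * B + A * 0"
    using eq unfolding null_equivalent_def by (intro tendsto_intros)
  then have lim: "(\<lambda>n. hdist P (s n) (s' n) * B + A * hdist P (t n) (t' n))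
      \<longlonglongrightarrow> 0" by simp
  show ?thesis
    by (rule Lim_null_comparison[OF always_eventually lim]) (simp add: le)
qed

lemma completed_carrier: "vcarrier (completed_module P) = cauchy_class P ` {s. hCauchy P s}"
  by (simp add: completed_module_def)

lemma cauchy_class_in_carrier: "hCauchy P s \<Longrightarrow> cauchy_class P s \<in> vcarrier (completed_module P)"
  by (simp add: completed_carrier)

lemma completed_carrierE:
  assumes "X \<in> vcarrier (completed_module P)"
  obtains s where "hCauchy P s" "X = cauchy_class P s"
  using assms by (auto simp: completed_carrier)

lemma completed_zero: "vzero (completed_module P) = cauchy_class P (\<lambda>n. vzero P)"
  by (simp add: completed_module_def)

lemma completed_add:
  assumes s: "hCauchy P s" and t: "hCauchy P t"
  shows "vadd (completed_module P) (cauchy_class P s) (cauchy_class P t) =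
    cauchy_class P (\<lambda>n. vadd P (s n) (t n))"
proof -
  note s' = some_rep_cauchy_class[OF s] and t' = some_rep_cauchy_class[OF t]
  have "null_equivalent (\<lambda>n. vadd P (s n) (t n))
      (\<lambda>n. vadd P (some_rep (cauchy_class P s) n) (some_rep (cauchy_class P t) n))"
    by (rule null_equivalent_bound[OF tendsto_add_zero[OF s'(2)[unfolded null_equivalent_def]
            t'(2)[unfolded null_equivalent_def]]])
      (rule hnorm_vdiff_add_le; simp add: hCauchy_closed s t s' t')
  then show ?thesis
    using iffD2[OF cauchy_class_eq_iff[OF hCauchy_add[OF s t] hCauchy_add[OF s'(1) t'(1)]]]
    by (simp add: completed_module_def)
qed

lemma completed_scale:
  assumes s: "hCauchy P s"
  shows "vscale (completed_module P) c (cauchy_class P s) = cauchy_class P (\<lambda>n. vscale P c (s n))"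
proof -
  note s' = some_rep_cauchy_class[OF s]
  have "null_equivalent (\<lambda>n. vscale P c (s n)) (\<lambda>n. vscale P c (some_rep (cauchy_class P s) n))"
    by (rule null_equivalent_bound[OF tendsto_mult_right_zero[OF s'(2)[unfolded null_equivalent_def], of "cmod c"]])
      (simp add: hnorm_vdiff_scale hCauchy_closed s s')
  then show ?thesis
    using iffD2[OF cauchy_class_eq_iff[OF hCauchy_scale[OF s] hCauchy_scale[OF s'(1)]]]
    by (simp add: completed_module_def)
qed

lemma completed_act:
  assumes s: "hCauchy P s"
  shows "hact (completed_module P) (cauchy_class P s) b = cauchy_class P (\<lambda>n. hact P (s n) b)"
proof -
  note s' = some_rep_cauchy_class[OF s]
  have "null_equivalent (\<lambda>n. hact P (s n) b) (\<lambda>n. hact P (some_rep (cauchy_class P s) n) b)"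
    by (rule null_equivalent_bound[OF tendsto_mult_left_zero[OF s'(2)[unfolded null_equivalent_def], of "norm b"]])
      (rule hnorm_vdiff_act_le; simp add: hCauchy_closed s s')
  then show ?thesis
    using iffD2[OF cauchy_class_eq_iff[OF hCauchy_act[OF s] hCauchy_act[OF s'(1)]]]
    by (simp add: completed_module_def)
qed

lemma completed_ip:
  assumes s: "hCauchy P s" and t: "hCauchy P t"
  shows "(\<lambda>n. hip P (s n) (t n)) \<longlonglongrightarrow> hip (completed_module P) (cauchy_class P s) (cauchy_class P t)"
proof -
  note s' = some_rep_cauchy_class[OF s] and t' = some_rep_cauchy_class[OF t]
  let ?f = "\<lambda>n. hip P (some_rep (cauchy_class P s) n) (some_rep (cauchy_class P t) n)"
  have "?f \<longlonglongrightarrow> lim ?f"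
    using convergent_ip[OF s'(1) t'(1)] by (simp add: convergent_LIMSEQ_iff)
  from tendsto_add[OF tendsto_ip_diff[OF s s'(1) t t'(1) s'(2) t'(2)] this]
  show ?thesis by (simp add: completed_module_def)
qed

text \<open>Each law passes to the limit of inner products along representing sequences; for
  positivity this uses that the cone is closed.\<close>

lemma semi_hilbert_completed: "semi_hilbert (completed_module P)"
proof
  show "vzero (completed_module P) \<in> vcarrier (completed_module P)"
    by (simp add: completed_zero cauchy_class_in_carrier hCauchy_const)
next
  fix X Y assume "X \<in> vcarrier (completed_module P)" "Y \<in> vcarrier (completed_module P)"
  then show "vadd (completed_module P) X Y \<in> vcarrier (completed_module P)"
    by (elim completed_carrierE) (simp add: completed_add cauchy_class_in_carrier hCauchy_add)
next
  fix X c assume "X \<in> vcarrier (completed_module P)"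
  then show "vscale (completed_module P) c X \<in> vcarrier (completed_module P)"
    by (elim completed_carrierE) (simp add: completed_scale cauchy_class_in_carrier hCauchy_scale)
next
  fix X b assume "X \<in> vcarrier (completed_module P)"
  then show "hact (completed_module P) X b \<in> vcarrier (completed_module P)"
    by (elim completed_carrierE) (simp add: completed_act cauchy_class_in_carrier hCauchy_act)
next
  fix Z assume "Z \<in> vcarrier (completed_module P)"
  then obtain u where u: "hCauchy P u" "Z = cauchy_class P u" by (elim completed_carrierE)
  have "(\<lambda>n. hip P (u n) (vzero P)) \<longlonglongrightarrow> hip (completed_module P) Z (vzero (completed_module P))"
    unfolding u completed_zero by (intro completed_ip u hCauchy_const) simp
  then show "hip (completed_module P) Z (vzero (completed_module P)) = 0"
    using u by (simp add: ip_simps hCauchy_closed LIMSEQ_const_iff)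
next
  fix Z X Y assume "Z \<in> vcarrier (completed_module P)" "X \<in> vcarrier (completed_module P)"
    "Y \<in> vcarrier (completed_module P)"
  then obtain u s t where u: "hCauchy P u" "Z = cauchy_class P u" and s: "hCauchy P s" "X = cauchy_class P s"
    and t: "hCauchy P t" "Y = cauchy_class P t" by (elim completed_carrierE)
  have "(\<lambda>n. hip P (u n) (vadd P (s n) (t n))) \<longlonglongrightarrow>
      hip (completed_module P) Z (vadd (completed_module P) X Y)"
    unfolding u s t by (subst completed_add) (intro completed_ip u hCauchy_add s t)+
  moreover have "(\<lambda>n. hip P (u n) (s n) + hip P (u n) (t n)) \<longlonglongrightarrow>
      hip (completed_module P) Z X + hip (completed_module P) Z Y"
    unfolding u s t by (intro tendsto_add completed_ip u s t)
  ultimately show "hip (completed_module P) Z (vadd (completed_module P) X Y) =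
      hip (completed_module P) Z X + hip (completed_module P) Z Y"
    using u s t by (simp add: ip_simps hCauchy_closed LIMSEQ_unique)
next
  fix Z X c assume "Z \<in> vcarrier (completed_module P)" "X \<in> vcarrier (completed_module P)"
  then obtain u s where u: "hCauchy P u" "Z = cauchy_class P u" and s: "hCauchy P s" "X = cauchy_class P s"
    by (elim completed_carrierE)
  have "(\<lambda>n. hip P (u n) (vscale P c (s n))) \<longlonglongrightarrow>
      hip (completed_module P) Z (vscale (completed_module P) c X)"
    unfolding u s by (subst completed_scale) (intro completed_ip u hCauchy_scale s)+
  moreover have "(\<lambda>n. scaleC c (hip P (u n) (s n))) \<longlonglongrightarrow> scaleC c (hip (completed_module P) Z X)"
    unfolding u s by (intro tendsto_scaleC completed_ip u s)
  ultimately show "hip (completed_module P) Z (vscale (completed_module P) c X) =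
      scaleC c (hip (completed_module P) Z X)"
    using u s by (simp add: ip_simps hCauchy_closed LIMSEQ_unique)
next
  fix Z X b assume "Z \<in> vcarrier (completed_module P)" "X \<in> vcarrier (completed_module P)"
  then obtain u s where u: "hCauchy P u" "Z = cauchy_class P u" and s: "hCauchy P s" "X = cauchy_class P s"
    by (elim completed_carrierE)
  have "(\<lambda>n. hip P (u n) (hact P (s n) b)) \<longlonglongrightarrow>
      hip (completed_module P) Z (hact (completed_module P) X b)"
    unfolding u s by (subst completed_act) (intro completed_ip u hCauchy_act s)+
  moreover have "(\<lambda>n. hip P (u n) (s n) * b) \<longlonglongrightarrow> hip (completed_module P) Z X * b"
    unfolding u s by (intro tendsto_mult_right completed_ip u s)
  ultimately show "hip (completed_module P) Z (hact (completed_module P) X b) =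
      hip (completed_module P) Z X * b"
    using u s by (simp add: ip_simps hCauchy_closed LIMSEQ_unique)
next
  fix X Y assume "X \<in> vcarrier (completed_module P)" "Y \<in> vcarrier (completed_module P)"
  then obtain s t where s: "hCauchy P s" "X = cauchy_class P s" and t: "hCauchy P t" "Y = cauchy_class P t"
    by (elim completed_carrierE)
  have "(\<lambda>n. star (hip P (s n) (t n))) \<longlonglongrightarrow> star (hip (completed_module P) X Y)"
    unfolding s t by (intro tendsto_star completed_ip s t)
  moreover have "(\<lambda>n. hip P (t n) (s n)) \<longlonglongrightarrow> hip (completed_module P) Y X"
    unfolding s t by (intro completed_ip s t)
  ultimately show "star (hip (completed_module P) X Y) = hip (completed_module P) Y X"
    using s t by (simp add: ip_star hCauchy_closed LIMSEQ_unique)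
next
  fix X assume "X \<in> vcarrier (completed_module P)"
  then obtain s where s: "hCauchy P s" "X = cauchy_class P s" by (elim completed_carrierE)
  show "cstar_positive (hip (completed_module P) X X)"
    unfolding s(2)
    by (rule cstar_positive_limit[OF _ completed_ip[OF s(1) s(1)]])
      (simp add: ip_positive hCauchy_closed s)
qed

lemma completed_diff:
  assumes s: "hCauchy P s" and t: "hCauchy P t"
  shows "vdiff (completed_module P) (cauchy_class P s) (cauchy_class P t) =
    cauchy_class P (\<lambda>n. vdiff P (s n) (t n))"
  unfolding vdiff_def by (simp add: completed_scale completed_add hCauchy_scale s t)

lemma hCauchy_diff: "hCauchy P s \<Longrightarrow> hCauchy P t \<Longrightarrow> hCauchy P (\<lambda>n. vdiff P (s n) (t n))"
  unfolding vdiff_def by (intro hCauchy_add hCauchy_scale)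

lemma completed_hnorm:
  assumes s: "hCauchy P s"
  shows "(\<lambda>n. hnorm P (s n)) \<longlonglongrightarrow> hnorm (completed_module P) (cauchy_class P s)"
  unfolding hnorm_def by (intro tendsto_real_sqrt tendsto_norm completed_ip s)

lemma completed_hnorm_eq_0:
  assumes "X \<in> vcarrier (completed_module P)" "Y \<in> vcarrier (completed_module P)"
    and "hdist (completed_module P) X Y = 0"
  shows "X = Y"
proof -
  obtain s t where s: "hCauchy P s" "X = cauchy_class P s" and t: "hCauchy P t" "Y = cauchy_class P t"
    using assms(1,2) by (elim completed_carrierE)
  have "(\<lambda>n. hdist P (s n) (t n)) \<longlonglongrightarrow> 0"
    using completed_hnorm[OF hCauchy_diff[OF s(1) t(1)]] assms(3) by (simp add: s t completed_diff)
  then show ?thesis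
    by (simp add: s t cauchy_class_eq_iff null_equivalent_def)
qed

abbreviation completed_const :: "'e \<Rightarrow> (nat \<Rightarrow> 'e) set" where
  "completed_const x \<equiv> cauchy_class P (\<lambda>n. x)"

lemma completed_const_in: "x \<in> vcarrier P \<Longrightarrow> completed_const x \<in> vcarrier (completed_module P)"
  by (simp add: cauchy_class_in_carrier hCauchy_const)

lemma completed_ip_const:
  "x \<in> vcarrier P \<Longrightarrow> y \<in> vcarrier P \<Longrightarrow>
    hip (completed_module P) (completed_const x) (completed_const y) = hip P x y"
  using completed_ip[OF hCauchy_const hCauchy_const, of x y] by (simp add: LIMSEQ_const_iff)

lemma completed_const_vdiff:
  "x \<in> vcarrier P \<Longrightarrow> y \<in> vcarrier P \<Longrightarrow>
    hdist (completed_module P) (completed_const x) (completed_const y) =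
    hdist P x y"
  by (simp add: completed_diff hCauchy_const hnorm_def completed_ip_const)

lemma completed_tendsto:
  assumes s: "hCauchy P s" and e: "e > 0"
  shows "\<exists>N. \<forall>n\<ge>N. hdist (completed_module P) (cauchy_class P s) (completed_const (s n)) < e"
proof -
  obtain N where N: "\<And>m n. m \<ge> N \<Longrightarrow> n \<ge> N \<Longrightarrow> hdist P (s m) (s n) < e / 2"
    using s e unfolding hCauchy_def by (metis half_gt_zero)
  have "hdist (completed_module P) (cauchy_class P s) (completed_const (s n)) \<le> e / 2" if "n \<ge> N" for n
  proof -
    have "(\<lambda>m. hdist P (s m) (s n)) \<longlonglongrightarrow> hdist (completed_module P) (cauchy_class P s) (completed_const (s n))"
      using completed_hnorm[OF hCauchy_diff[OF s hCauchy_const[OF hCauchy_closed[OF s]]]]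
      by (simp add: completed_diff s hCauchy_const hCauchy_closed)
    then show ?thesis
      by (rule LIMSEQ_le_const2) (use N that in \<open>auto intro!: exI[of _ N] less_imp_le\<close>)
  qed
  then show ?thesis using e by (intro exI[of _ N]) force
qed

lemma completed_dense:
  assumes X: "X \<in> vcarrier (completed_module P)" and e: "e > 0"
  obtains x where "x \<in> vcarrier P"
    "hdist (completed_module P) X (completed_const x) < e"
proof -
  obtain s where s: "hCauchy P s" "X = cauchy_class P s" using X by (elim completed_carrierE)
  show thesis using completed_tendsto[OF s(1) e] that hCauchy_closed[OF s(1)] unfolding s(2) by blast
qed

text \<open>Diagonal choice: the \<open>n\<close>-th term is replaced by a constant class at
  distance less than \<open>1 / (n + 1)\<close>. The chosen vectors of \<open>P\<close> form a
  Cauchy sequence, and its class is the limit.\<close>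

lemma completed_complete:
  assumes X: "hCauchy (completed_module P) X"
  obtains Y where "Y \<in> vcarrier (completed_module P)"
    "(\<lambda>n. hdist (completed_module P) (X n) Y) \<longlonglongrightarrow> 0"
proof -
  interpret C: semi_hilbert "completed_module P" by (rule semi_hilbert_completed)
  let ?d = "\<lambda>Y Z. hdist (completed_module P) Y Z"
  note Xc = C.hCauchy_closed[OF X]
  have "\<exists>x. x \<in> vcarrier P \<and> ?d (X n) (completed_const x) < 1 / real (Suc n)" for n
    using completed_dense[OF Xc, of "1 / real (Suc n)" n] by (metis of_nat_0_less_iff zero_less_Suc zero_less_divide_1_iff)
  then obtain x where x: "\<And>n. x n \<in> vcarrier P" "\<And>n. ?d (X n) (completed_const (x n)) < 1 / real (Suc n)"
    by metis
  note xc = completed_const_in[OF x(1)]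
  have "hCauchy P x"
    unfolding hCauchy_def
  proof (intro conjI allI impI x(1))
    fix e :: real assume e: "e > 0"
    obtain N where N: "\<And>m n. m \<ge> N \<Longrightarrow> n \<ge> N \<Longrightarrow> ?d (X m) (X n) < e / 3"
      using X e unfolding hCauchy_def by (metis divide_pos_pos zero_less_numeral)
    obtain M where M: "1 / real (Suc M) < e / 3"
      using e nat_approx_posE[of "e / 3"] by auto
    have "hdist P (x m) (x n) < e" if "m \<ge> max M N" "n \<ge> max M N" for m n
    proof -
      have small: "?d (X k) (completed_const (x k)) < e / 3" if "k \<ge> M" for k
      proof -
        have "1 / real (Suc k) \<le> 1 / real (Suc M)" using that by (simp add: frac_le)
        then show ?thesis using x(2)[of k] M by linarith
      qed
      have "hdist P (x m) (x n) = ?d (completed_const (x m)) (completed_const (x n))"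
        by (simp add: completed_const_vdiff x)
      also have "\<dots> \<le> ?d (completed_const (x m)) (X m) + ?d (X m) (completed_const (x n))"
        by (intro C.hnorm_vdiff_triangle xc Xc)
      also have "?d (X m) (completed_const (x n)) \<le> ?d (X m) (X n) + ?d (X n) (completed_const (x n))"
        by (intro C.hnorm_vdiff_triangle xc Xc)
      also have "?d (completed_const (x m)) (X m) = ?d (X m) (completed_const (x m))"
        by (intro C.hnorm_vdiff_commute xc Xc)
      finally show ?thesis using small[of m] small[of n] N[of m n] that by simp
    qed
    then show "\<exists>N. \<forall>m\<ge>N. \<forall>n\<ge>N. hdist P (x m) (x n) < e" by blast
  qed
  note xC = this
  let ?Y = "cauchy_class P x"
  have Y: "?Y \<in> vcarrier (completed_module P)" by (rule cauchy_class_in_carrier[OF xC])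
  have "(\<lambda>n. ?d ?Y (completed_const (x n))) \<longlonglongrightarrow> 0"
    using completed_tendsto[OF xC] by (auto simp: LIMSEQ_iff)
  from tendsto_add[OF LIMSEQ_inverse_real_of_nat this]
  have lim: "(\<lambda>n. inverse (real (Suc n)) + ?d ?Y (completed_const (x n))) \<longlonglongrightarrow> 0" by simp
  have "(\<lambda>n. ?d (X n) ?Y) \<longlonglongrightarrow> 0"
  proof (rule tendsto_sandwich[OF _ _ tendsto_const lim])
    show "\<forall>\<^sub>F n in sequentially. ?d (X n) ?Y \<le> inverse (real (Suc n)) + ?d ?Y (completed_const (x n))"
    proof (rule always_eventually, rule allI)
      fix n
      have "?d (X n) ?Y \<le> ?d (X n) (completed_const (x n)) + ?d (completed_const (x n)) ?Y"
        by (intro C.hnorm_vdiff_triangle xc Xc Y)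
      also have "?d (completed_const (x n)) ?Y = ?d ?Y (completed_const (x n))"
        by (intro C.hnorm_vdiff_commute xc Y)
      finally show "?d (X n) ?Y \<le> inverse (real (Suc n)) + ?d ?Y (completed_const (x n))"
        using x(2)[of n] by (simp add: divide_inverse)
    qed
  qed simp
  with Y show thesis by (rule that)
qed

end

section \<open>Hilbert modules\<close>

text \<open>Definiteness is stated as separation of vectors by inner products. In this form it
  yields all vector space and module axioms, each of which holds after pairing with an arbitrary
  \<open>z\<close>.\<close>

locale hilbert = semi_hilbert +
  assumes ip_eqI: "\<And>x y. x \<in> vcarrier P \<Longrightarrow> y \<in> vcarrier P \<Longrightarrow>
      (\<And>z. z \<in> vcarrier P \<Longrightarrow> hip P z x = hip P z y) \<Longrightarrow> x = y"
    and complete: "\<And>s. hCauchy P s \<Longrightarrow> \<exists>x\<in>vcarrier P. (\<lambda>n. hdist P (s n) x) \<longlonglongrightarrow> 0"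
begin

lemma hnorm_eq_0:
  assumes "x \<in> vcarrier P" "y \<in> vcarrier P" "hdist P x y = 0"
  shows "x = y"
proof (rule ip_eqI[OF assms(1,2)])
  fix z assume z: "z \<in> vcarrier P"
  have "norm (hip P z (vdiff P x y)) \<le> hnorm P z * hdist P x y"
    by (rule cauchy_schwarz) (use z assms in auto)
  then show "hip P z x = hip P z y" using assms z by (simp add: ip_simps)
qed

lemma is_hilbert_module: "hilbert_module P"
proof -
  have zero: "x = vzero P" if "x \<in> vcarrier P" "hip P x x = 0" for x
  proof (rule hnorm_eq_0)
    have "hip P (vdiff P x (vzero P)) (vdiff P x (vzero P)) = 0" using that by (simp add: ip_simps)
    then show "hdist P x (vzero P) = 0" by (simp add: hnorm_def)
  qed (use that in auto)
  show ?thesis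
    unfolding hilbert_module_def complex_vector_space_def
    by (intro conjI ballI allI impI; ((rule zero, assumption, assumption) | ((rule ip_eqI)?;
        simp add: ip_simps ip_star ip_positive complete algebra_simps scaleC_add_right
          scaleC_add_left scaleC_scaleC mult_scaleC_left mult_scaleC_right)))
qed

end

lemma hilbertI:
  assumes E: "hilbert_module E"
  shows "hilbert E"
proof -
  have V: "complex_vector_space E" using E by (simp add: hilbert_module_def)
  note E' = E[unfolded hilbert_module_def complex_vector_space_def]
  have semi: "semi_hilbert E"
  proof
    fix z assume z: "z \<in> vcarrier E"
    have "hip E z (vadd E (vzero E) (vzero E)) = hip E z (vzero E) + hip E z (vzero E)"
      using E' z by blast
    moreover have "vadd E (vzero E) (vzero E) = vzero E"
      using V by (simp add: complex_vector_space_def)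
    ultimately show "hip E z (vzero E) = 0" by simp
  next
    fix x y assume "x \<in> vcarrier E" "y \<in> vcarrier E"
    then show "star (hip E x y) = hip E y x" using E' by metis
  qed (use E' in metis)+
  interpret semi_hilbert E by (rule semi)
  show ?thesis
  proof
    fix x y assume x: "x \<in> vcarrier E" and y: "y \<in> vcarrier E"
      and eq: "\<And>z. z \<in> vcarrier E \<Longrightarrow> hip E z x = hip E z y"
    have "hip E (vdiff E x y) (vdiff E x y) = 0"
      using x y eq[of "vdiff E x y"] by (simp add: ip_diff_right)
    then have d: "vadd E x (vscale E (- 1) y) = vzero E"
      using E' diff_closed[OF x y] unfolding vdiff_def by metis
    have "x = vadd E (vzero E) x"
      using V x unfolding complex_vector_space_def by metis
    also have "vzero E = vadd E y (vscale E (- 1) y)"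
      using V y unfolding complex_vector_space_def by metis
    also have "vadd E (vadd E y (vscale E (- 1) y)) x = vadd E y (vadd E x (vscale E (- 1) y))"
      using V x y scale_closed[OF y, of "- 1"] unfolding complex_vector_space_def by metis
    also have "\<dots> = vadd E (vzero E) y"
      using V y d unfolding complex_vector_space_def by metis
    also have "\<dots> = y" using V y unfolding complex_vector_space_def by metis
    finally show "x = y" .
  next
    fix s assume "hCauchy E s"
    then show "\<exists>x\<in>vcarrier E. (\<lambda>n. hdist E (s n) x) \<longlonglongrightarrow> 0"
      using E' by blast
  qed
qed

lemma (in semi_hilbert) hilbert_completed: "hilbert (completed_module P)"
proof -
  interpret C: semi_hilbert "completed_module P" by (rule semi_hilbert_completed)
  show ?thesis
  proof
    fix X Y assume X: "X \<in> vcarrier (completed_module P)" and Y: "Y \<in> vcarrier (completed_module P)"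
      and eq: "\<And>Z. Z \<in> vcarrier (completed_module P) \<Longrightarrow> hip (completed_module P) Z X = hip (completed_module P) Z Y"
    show "X = Y"
      by (rule completed_hnorm_eq_0[OF X Y])
        (simp add: hnorm_def C.ip_diff_right eq X Y)
  next
    fix X assume "hCauchy (completed_module P) X"
    then show "\<exists>Y\<in>vcarrier (completed_module P).
        (\<lambda>n. hdist (completed_module P) (X n) Y) \<longlonglongrightarrow> 0"
      by (elim completed_complete) blast
  qed
qed

subsection \<open>Adjointable maps\<close>

lemma adjoint_of_unique:
  assumes "hilbert E" "adjoint_of E F T S" "adjoint_of E F T S'"
  shows "S = S'"
proof
  interpret E: hilbert E by fact
  fix y
  show "S y = S' y"
  proof (cases "y \<in> vcarrier F")
    case True
    then show ?thesis
      using assms(2,3) by (intro E.ip_eqI) (auto simp: adjoint_of_def)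
  next
    case False
    then show ?thesis using assms(2,3) by (auto simp: adjoint_of_def PiE_def extensional_def)
  qed
qed

lemma hadj_eqI: "hilbert E \<Longrightarrow> adjoint_of E F T S \<Longrightarrow> hadj E F T = S"
  unfolding hadj_def by (rule the_equality) (auto dest: adjoint_of_unique)

lemma adjoint_of_sym:
  assumes "semi_hilbert E" "semi_hilbert F" "T \<in> vcarrier E \<rightarrow>\<^sub>E vcarrier F" "adjoint_of E F T S"
  shows "adjoint_of F E S T"
proof -
  interpret E: semi_hilbert E by fact
  interpret F: semi_hilbert F by fact
  have "hip E (S y) x = hip F y (T x)" if "x \<in> vcarrier E" "y \<in> vcarrier F" for x y
  proof -
    have "T x \<in> vcarrier F" "S y \<in> vcarrier E" "hip F (T x) y = hip E x (S y)"
      using assms that by (auto simp: adjoint_of_def)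
    then show ?thesis using that E.ip_star[of x "S y"] F.ip_star[of "T x" y] by simp
  qed
  then show ?thesis using assms(3) by (auto simp: adjoint_of_def)
qed

locale hilbert_pair = E: hilbert E + F: hilbert F
  for E :: "('e, 'b::cstar_algebra) hmod" and F :: "('f, 'b) hmod"
begin

lemma adjoint_of_hadj: "T \<in> adjointable E F \<Longrightarrow> adjoint_of E F T (hadj E F T)"
  using hadj_eqI[OF E.hilbert_axioms] by (force simp: adjointable_def)

lemma adjointableI:
  assumes "T \<in> vcarrier E \<rightarrow>\<^sub>E vcarrier F" "S \<in> vcarrier F \<rightarrow>\<^sub>E vcarrier E"
    and "\<And>x y. x \<in> vcarrier E \<Longrightarrow> y \<in> vcarrier F \<Longrightarrow> hip F (T x) y = hip E x (S y)"
  shows "T \<in> adjointable E F" "hadj E F T = S"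
proof -
  have "adjoint_of E F T S" using assms by (simp add: adjoint_of_def)
  then show "T \<in> adjointable E F" "hadj E F T = S"
    using assms(1) hadj_eqI[OF E.hilbert_axioms] by (auto simp: adjointable_def)
qed

lemma adjointable_extensional: "T \<in> adjointable E F \<Longrightarrow> T \<in> vcarrier E \<rightarrow>\<^sub>E vcarrier F"
  by (simp add: adjointable_def)

lemma adjointable_closed [simp]: "T \<in> adjointable E F \<Longrightarrow> x \<in> vcarrier E \<Longrightarrow> T x \<in> vcarrier F"
  by (auto simp: adjointable_def)

lemma hadj_extensional: "T \<in> adjointable E F \<Longrightarrow> hadj E F T \<in> vcarrier F \<rightarrow>\<^sub>E vcarrier E"
  using adjoint_of_hadj by (auto simp: adjoint_of_def)

lemma hadj_closed [simp]: "T \<in> adjointable E F \<Longrightarrow> y \<in> vcarrier F \<Longrightarrow> hadj E F T y \<in> vcarrier E"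
  using hadj_extensional by auto

lemma ip_adjointable_left:
  "T \<in> adjointable E F \<Longrightarrow> x \<in> vcarrier E \<Longrightarrow> y \<in> vcarrier F \<Longrightarrow> hip F (T x) y = hip E x (hadj E F T y)"
  using adjoint_of_hadj by (auto simp: adjoint_of_def)

lemma adjoint_of_hadj_sym: "T \<in> adjointable E F \<Longrightarrow> adjoint_of F E (hadj E F T) T"
  by (rule adjoint_of_sym[OF E.semi_hilbert_axioms F.semi_hilbert_axioms adjointable_extensional adjoint_of_hadj])

lemma ip_adjointable_right:
  "T \<in> adjointable E F \<Longrightarrow> x \<in> vcarrier E \<Longrightarrow> y \<in> vcarrier F \<Longrightarrow> hip F y (T x) = hip E (hadj E F T y) x"
  using adjoint_of_hadj_sym by (auto simp: adjoint_of_def)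

lemma hadj_in_adjointable [simp]: "T \<in> adjointable E F \<Longrightarrow> hadj E F T \<in> adjointable F E"
  using adjoint_of_hadj_sym hadj_extensional unfolding adjointable_def by blast

lemma hadj_hadj: "T \<in> adjointable E F \<Longrightarrow> hadj F E (hadj E F T) = T"
  by (rule hadj_eqI[OF F.hilbert_axioms adjoint_of_hadj_sym])

text \<open>Linearity is not part of the definition of \<open>adjointable\<close>. It is forced by
  moving the map to the other argument of the inner product.\<close>

lemma adjointable_add:
  "T \<in> adjointable E F \<Longrightarrow> x \<in> vcarrier E \<Longrightarrow> y \<in> vcarrier E \<Longrightarrow> T (vadd E x y) = vadd F (T x) (T y)"
  by (rule F.ip_eqI) (simp_all add: F.ip_simps E.ip_simps ip_adjointable_right)

lemma adjointable_scale:
  "T \<in> adjointable E F \<Longrightarrow> x \<in> vcarrier E \<Longrightarrow> T (vscale E c x) = vscale F c (T x)"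
  by (rule F.ip_eqI) (simp_all add: F.ip_simps E.ip_simps ip_adjointable_right)

lemma adjointable_act:
  "T \<in> adjointable E F \<Longrightarrow> x \<in> vcarrier E \<Longrightarrow> T (hact E x b) = hact F (T x) b"
  by (rule F.ip_eqI) (simp_all add: F.ip_simps E.ip_simps ip_adjointable_right)

lemma adjointable_zero: "T \<in> adjointable E F \<Longrightarrow> T (vzero E) = vzero F"
  by (rule F.ip_eqI) (simp_all add: F.ip_simps E.ip_simps ip_adjointable_right)

lemma adjointable_diff:
  "T \<in> adjointable E F \<Longrightarrow> x \<in> vcarrier E \<Longrightarrow> y \<in> vcarrier E \<Longrightarrow> T (vdiff E x y) = vdiff F (T x) (T y)"
  by (simp add: vdiff_def adjointable_add adjointable_scale)

text \<open>For \<open>S\<close> the adjoint,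
  \<open>\<langle>S y, S y\<rangle> = \<langle>T (S y), y\<rangle>\<close>; after Cauchy-Schwarz one
  factor, the norm of \<open>S y\<close>, cancels.\<close>

lemma adjoint_bound:
  assumes T: "T \<in> adjointable E F" and K: "K \<ge> 0"
    and le: "\<And>x. x \<in> vcarrier E \<Longrightarrow> hnorm F (T x) \<le> K * hnorm E x" and y: "y \<in> vcarrier F"
  shows "hnorm E (hadj E F T y) \<le> K * hnorm F y"
proof (cases "hnorm E (hadj E F T y) = 0")
  case False
  let ?z = "hadj E F T y"
  have "(hnorm E ?z)\<^sup>2 = norm (hip F (T ?z) y)"
    using T y by (simp add: E.hnorm_square ip_adjointable_left)
  also have "\<dots> \<le> hnorm F (T ?z) * hnorm F y" by (rule F.cauchy_schwarz) (use T y in auto)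
  also have "\<dots> \<le> K * hnorm E ?z * hnorm F y" by (intro mult_right_mono le) (use T y in auto)
  finally have "hnorm E ?z * hnorm E ?z \<le> hnorm E ?z * (K * hnorm F y)"
    by (simp add: power2_eq_square mult_ac)
  moreover have "hnorm E ?z > 0" using False E.hnorm_nonneg[of ?z] by linarith
  ultimately show ?thesis by simp
qed (use K in simp)

text \<open>Uniform boundedness by a gliding hump: if the adjoint \<open>S\<close> were unbounded, there would be unit
  vectors \<open>S (v n)\<close> with \<open>v n\<close> of norm less than \<open>4\<^sup>-\<^sup>n\<close>. Moving by \<open>\<plusminus> 3\<^sup>-\<^sup>n S (v n)\<close> at step \<open>n\<close> one
  reaches an \<open>x\<close> whose products with \<open>S (v n)\<close> are at least \<open>3\<^sup>-\<^sup>n / 2\<close>, but they are at most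
  \<open>4\<^sup>-\<^sup>n \<parallel>T x\<parallel>\<close>.\<close>

lemma hadj_bounded:
  assumes T: "T \<in> adjointable E F"
  shows "\<exists>K. \<forall>y\<in>vcarrier F. hnorm E (hadj E F T y) \<le> K * hnorm F y"
proof (rule ccontr)
  assume *: "\<nexists>K. \<forall>y\<in>vcarrier F. hnorm E (hadj E F T y) \<le> K * hnorm F y"
  let ?S = "hadj E F T"
  have "\<exists>v. v \<in> vcarrier F \<and> hnorm E (?S v) = 1 \<and> hnorm F v < (1/4) ^ n" for n :: nat
  proof -
    obtain y where y: "y \<in> vcarrier F" "4 ^ n * hnorm F y < hnorm E (?S y)"
      using * by (meson linorder_not_less)
    let ?r = "hnorm E (?S y)"
    have r: "?r > 0" using y F.hnorm_nonneg[of y]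
      by (meson less_le_trans mult_nonneg_nonneg not_less zero_le_numeral zero_le_power)
    let ?v = "vscale F (of_real (1 / ?r)) y"
    interpret FE: hilbert_pair F E by (intro hilbert_pair.intro F.hilbert_axioms E.hilbert_axioms)
    have "hnorm E (?S ?v) = 1"
      using T y r by (simp add: FE.adjointable_scale E.hnorm_scale norm_divide)
    moreover have "hnorm F ?v < (1/4) ^ n"
      using y r by (simp add: F.hnorm_scale norm_divide power_one_over field_simps)
    ultimately show ?thesis using y by (intro exI[of _ ?v]) simp
  qed
  then obtain v where v: "\<And>n. v n \<in> vcarrier F" "\<And>n. hnorm E (?S (v n)) = 1"
    "\<And>n. hnorm F (v n) < (1/4) ^ n" by metis
  define e where "e = (\<lambda>n. ?S (v n))"
  have e: "e n \<in> vcarrier E" "hnorm E (e n) = 1" for n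
    using v T by (simp_all add: e_def)
  have ee: "norm (hip E (e n) (e n)) = 1" for n
    using e(2)[of n] E.hnorm_square[of "e n"] by simp
  define w where "w = (\<lambda>n. vscale E (of_real ((1/3) ^ n)) (e n))"
  have w: "w n \<in> vcarrier E" "hnorm E (w n) = (1/3) ^ n" for n
    using e[of n] by (simp_all add: w_def E.hnorm_scale norm_power norm_divide)
  have ip_w: "hip E z (w n) = (1/3) ^ n *\<^sub>R hip E z (e n)" if "z \<in> vcarrier E" for n z
    unfolding w_def E.ip_scale_right[OF that e(1)] by (rule scaleC_of_real)
  define step where "step = (\<lambda>n x.
    if norm (hip E (e n) (vadd E x (w n))) \<ge> (1/3) ^ n then vadd E x (w n) else vdiff E x (w n))"
  define x where "x = rec_nat (vzero E) step"
  have x_Suc: "x (Suc n) = step n (x n)" for n by (simp add: x_def)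
  have step_in: "step n z \<in> vcarrier E" if "z \<in> vcarrier E" for n z
    using that w by (simp add: step_def)
  have x_in: "x n \<in> vcarrier E" for n
    by (induction n) (simp_all add: x_Suc step_in, simp add: x_def)
  have x_step: "hdist E (step n z) z = (1/3) ^ n" if z: "z \<in> vcarrier E" for n z
  proof -
    have "hdist E (vadd E z w) z = hnorm E w" "hdist E (vdiff E z w) z = hnorm E w"
      if "w \<in> vcarrier E" for w
      by (rule E.hnorm_cong, use that z in \<open>simp add: E.ip_simps\<close>)+
    then show ?thesis using w by (simp add: step_def)
  qed
  \<comment> \<open>The inner products of \<open>e n\<close> with the two candidates differ by
    \<open>2 * (1/3) ^ n\<close> times an element of norm 1, so one of them has norm at least
    \<open>(1/3) ^ n\<close>.\<close>
  have hump: "norm (hip E (e n) (step n z)) \<ge> (1/3) ^ n" if z: "z \<in> vcarrier E" for n z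
  proof (cases "norm (hip E (e n) (vadd E z (w n))) \<ge> (1/3) ^ n")
    case False
    let ?b = "hip E (e n) (e n)" and ?a = "hip E (e n) z" and ?r = "(1/3) ^ n :: real"
    have p: "hip E (e n) (vadd E z (w n)) = ?a + ?r *\<^sub>R ?b"
      using z e w by (simp add: E.ip_simps ip_w)
    have m: "hip E (e n) (vdiff E z (w n)) = ?a - ?r *\<^sub>R ?b"
      using z e w by (simp add: E.ip_simps ip_w)
    have "2 * ?r = norm ((2 * ?r) *\<^sub>R ?b)" by (simp add: ee)
    also have "(2 * ?r) *\<^sub>R ?b = (?a + ?r *\<^sub>R ?b) - (?a - ?r *\<^sub>R ?b)"
      by (simp flip: scaleR_add_left)
    also have "norm \<dots> \<le> norm (?a + ?r *\<^sub>R ?b) + norm (?a - ?r *\<^sub>R ?b)" by (rule norm_triangle_ineq4)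
    finally show ?thesis using False by (simp add: step_def p m)
  qed (simp add: step_def)
  \<comment> \<open>The moves form a geometric series of ratio 1/3, and \<open>3/2\<close> is
    \<open>1 / (1 - 1/3)\<close>.\<close>
  have x_dist: "hdist E (x (n + k)) (x n) \<le> (3/2) * ((1/3) ^ n - (1/3) ^ (n + k))" for n k
  proof (induction k)
    case 0
    show ?case by (simp add: x_in)
  next
    case (Suc k)
    have "hdist E (x (n + Suc k)) (x n) \<le>
        hdist E (x (Suc (n + k))) (x (n + k)) + hdist E (x (n + k)) (x n)"
      using E.hnorm_vdiff_triangle[OF x_in x_in x_in] by simp
    also have "\<dots> \<le> (1/3) ^ (n + k) + (3/2) * ((1/3) ^ n - (1/3) ^ (n + k))"
      using Suc by (simp add: x_Suc x_step x_in)
    finally show ?case by (simp add: field_simps)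
  qed
  then have x_dist': "hdist E (x (n + k)) (x n) \<le> (3/2) * (1/3) ^ n" for n k
    by (rule order_trans) simp
  have "hCauchy E x"
    unfolding hCauchy_def
  proof (intro conjI allI impI x_in)
    fix r :: real assume r: "r > 0"
    have "(\<lambda>n. 3 * (1/3) ^ n :: real) \<longlonglongrightarrow> 3 * 0"
      by (intro tendsto_intros LIMSEQ_power_zero) simp
    then have "(\<lambda>n. 3 * (1/3) ^ n :: real) \<longlonglongrightarrow> 0" by (simp only: mult_zero_right)
    then have "\<forall>\<^sub>F n in sequentially. 3 * (1/3) ^ n < r" by (rule order_tendstoD(2)[OF _ r])
    then obtain N where N: "3 * (1/3) ^ N < r" by (auto simp: eventually_sequentially)
    have "hdist E (x m) (x n) < r" if mn: "m \<ge> N" "n \<ge> N" for m n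
    proof -
      have "hdist E (x m) (x n) \<le> hdist E (x m) (x N) + hdist E (x N) (x n)"
        by (intro E.hnorm_vdiff_triangle x_in)
      also have "hdist E (x N) (x n) = hdist E (x n) (x N)"
        by (intro E.hnorm_vdiff_commute x_in)
      finally show ?thesis
        using x_dist'[of N "m - N"] x_dist'[of N "n - N"] mn N by simp
    qed
    then show "\<exists>N. \<forall>m\<ge>N. \<forall>n\<ge>N. hdist E (x m) (x n) < r" by blast
  qed
  then obtain z where z: "z \<in> vcarrier E" "(\<lambda>n. hdist E (x n) z) \<longlonglongrightarrow> 0"
    using E.complete by blast
  have z_dist: "hdist E (x n) z \<le> (3/2) * (1/3) ^ n" for n
  proof (rule LIMSEQ_le_const)
    show "(\<lambda>k. (3/2) * (1/3) ^ n + hdist E (x (k + n)) z) \<longlonglongrightarrow> (3/2) * (1/3) ^ n"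
      using tendsto_add[OF tendsto_const LIMSEQ_ignore_initial_segment[OF z(2), of n]] by simp
    have "hdist E (x n) z \<le> (3/2) * (1/3) ^ n + hdist E (x (k + n)) z" for k
    proof -
      have "hdist E (x n) z \<le> hdist E (x n) (x (k + n)) + hdist E (x (k + n)) z"
        by (intro E.hnorm_vdiff_triangle x_in z)
      also have "hdist E (x n) (x (k + n)) = hdist E (x (n + k)) (x n)"
        by (subst E.hnorm_vdiff_commute) (simp_all add: x_in add.commute)
      finally show ?thesis using x_dist'[of n k] by simp
    qed
    then show "\<exists>N. \<forall>k\<ge>N. hdist E (x n) z \<le> (3/2) * (1/3) ^ n + hdist E (x (k + n)) z"
      by blast
  qed
  \<comment> \<open>The moves after step \<open>n\<close> change the product with \<open>e n\<close>
    by at most \<open>(3/2) * (1/3) ^ Suc n\<close>, half of the hump \<open>(1/3) ^ n\<close>.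
    Comparing the other half with the bound \<open>(1/4) ^ n\<close> on the norm of
    \<open>v n\<close> gives a left side that is unbounded in \<open>n\<close>.\<close>
  have "(1/2) * (4/3) ^ n \<le> hnorm F (T z)" for n
  proof -
    have "(1/3) ^ n \<le> norm (hip E (e n) (x (Suc n)))" by (simp add: x_Suc hump x_in)
    also have "hip E (e n) (x (Suc n)) = hip E (e n) (vdiff E (x (Suc n)) z) + hip E (e n) z"
      by (simp add: E.ip_simps e x_in z)
    also have "norm \<dots> \<le> norm (hip E (e n) (vdiff E (x (Suc n)) z)) + norm (hip E (e n) z)"
      by (rule norm_triangle_ineq)
    also have "norm (hip E (e n) (vdiff E (x (Suc n)) z)) \<le> 1 * ((3/2) * (1/3) ^ Suc n)"
      using E.cauchy_schwarz[OF e(1) E.diff_closed[OF x_in z(1)], of n "Suc n"] e(2)[of n] z_dist[of "Suc n"]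
      by simp
    also have "norm (hip E (e n) z) \<le> (1/4) ^ n * hnorm F (T z)"
    proof -
      have "hip E (e n) z = hip F (v n) (T z)"
        using T v z by (simp add: e_def ip_adjointable_right)
      then have "norm (hip E (e n) z) \<le> hnorm F (v n) * hnorm F (T z)"
        using F.cauchy_schwarz[of "v n" "T z"] T v z by simp
      also have "\<dots> \<le> (1/4) ^ n * hnorm F (T z)"
        using v(3)[of n] by (intro mult_right_mono) auto
      finally show ?thesis .
    qed
    finally have "(1/2) * (1/3) ^ n \<le> (1/4) ^ n * hnorm F (T z)" by simp
    then have "4 ^ n * ((1/2) * (1/3) ^ n) \<le> 4 ^ n * ((1/4) ^ n * hnorm F (T z))"
      by (rule mult_left_mono) simp
    moreover have "(4::real) ^ n * (1/3) ^ n = (4/3) ^ n" "(4::real) ^ n * (1/4) ^ n = 1"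
      by (simp_all flip: power_mult_distrib)
    ultimately show ?thesis by (simp add: mult_ac)
  qed
  moreover obtain n where "2 * hnorm F (T z) < (4/3) ^ n"
    using real_arch_pow[of "4/3" "2 * hnorm F (T z)"] by auto
  ultimately show False by (metis (no_types, lifting) linorder_not_less mult.commute
        divide_le_eq_numeral1(1) times_divide_eq_right mult.right_neutral)
qed

text \<open>A bound is known for the adjoint, by \<open>hadj_bounded\<close>. Since \<open>T\<close>
  is the adjoint of its adjoint, \<open>adjoint_bound\<close> for the reversed pair carries it back
  to \<open>T\<close>.\<close>

lemma adjointable_bounded:
  assumes T: "T \<in> adjointable E F"
  obtains K where "K > 0" "\<And>x. x \<in> vcarrier E \<Longrightarrow> hnorm F (T x) \<le> K * hnorm E x"
proof -
  obtain K where K: "\<And>y. y \<in> vcarrier F \<Longrightarrow> hnorm E (hadj E F T y) \<le> K * hnorm F y"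
    using hadj_bounded[OF T] by blast
  have K': "hnorm E (hadj E F T y) \<le> (\<bar>K\<bar> + 1) * hnorm F y" if "y \<in> vcarrier F" for y
    by (rule order_trans[OF K[OF that]]) (intro mult_right_mono, auto)
  interpret FE: hilbert_pair F E by (intro hilbert_pair.intro F.hilbert_axioms E.hilbert_axioms)
  have "hnorm F (T x) \<le> (\<bar>K\<bar> + 1) * hnorm E x" if "x \<in> vcarrier E" for x
    using FE.adjoint_bound[OF hadj_in_adjointable[OF T] _ K' that] T by (simp add: hadj_hadj)
  then show thesis using that[of "\<bar>K\<bar> + 1"] by simp
qed

lemma adjointable_op_add:
  assumes "T \<in> adjointable E F" "S \<in> adjointable E F"
  shows "(\<lambda>x\<in>vcarrier E. vadd F (T x) (S x)) \<in> adjointable E F"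
  by (rule adjointableI(1)[of _ "\<lambda>y\<in>vcarrier F. vadd E (hadj E F T y) (hadj E F S y)"])
    (use assms in \<open>auto simp: F.ip_simps E.ip_simps ip_adjointable_left\<close>)

lemma adjointable_op_scale:
  assumes "T \<in> adjointable E F"
  shows "(\<lambda>x\<in>vcarrier E. vscale F c (T x)) \<in> adjointable E F"
  by (rule adjointableI(1)[of _ "\<lambda>y\<in>vcarrier F. vscale E (cnj c) (hadj E F T y)"])
    (use assms in \<open>auto simp: F.ip_simps E.ip_simps ip_adjointable_left\<close>)

lemma adjointable_op_zero: "(\<lambda>x\<in>vcarrier E. vzero F) \<in> adjointable E F"
  by (rule adjointableI(1)[of _ "\<lambda>y\<in>vcarrier F. vzero E"]) (auto simp: F.ip_simps E.ip_simps)

lemma adjointable_op_sum: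
  assumes "\<And>k. k < n \<Longrightarrow> T k \<in> adjointable E F"
  shows "(\<lambda>x\<in>vcarrier E. vsum F n (\<lambda>k. T k x)) \<in> adjointable E F"
  using assms
proof (induction n)
  case (Suc n)
  have "(\<lambda>x\<in>vcarrier E. vsum F (Suc n) (\<lambda>k. T k x)) =
      (\<lambda>x\<in>vcarrier E. vadd F ((\<lambda>x\<in>vcarrier E. vsum F n (\<lambda>k. T k x)) x) (T n x))"
    by (auto simp: fun_eq_iff)
  then show ?case
    by (simp only:) (rule adjointable_op_add; use Suc in simp)
qed (simp add: adjointable_op_zero)

end

lemma hilbert_pairI: "hilbert E \<Longrightarrow> hilbert F \<Longrightarrow> hilbert_pair E F"
  by (rule hilbert_pair.intro)

lemma adjointable_compose:
  assumes "hilbert E" "hilbert F" "hilbert G" "T \<in> adjointable E F" "S \<in> adjointable F G"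
  shows "compose (vcarrier E) S T \<in> adjointable E G"
    and "hadj E G (compose (vcarrier E) S T) = compose (vcarrier G) (hadj E F T) (hadj F G S)"
proof -
  interpret EF: hilbert_pair E F by (rule hilbert_pairI) fact+
  interpret FG: hilbert_pair F G by (rule hilbert_pairI) fact+
  interpret EG: hilbert_pair E G by (rule hilbert_pairI) fact+
  note * = EG.adjointableI[of "compose (vcarrier E) S T" "compose (vcarrier G) (hadj E F T) (hadj F G S)"]
  show "compose (vcarrier E) S T \<in> adjointable E G"
    "hadj E G (compose (vcarrier E) S T) = compose (vcarrier G) (hadj E F T) (hadj F G S)"
    by (rule *; use assms(4,5) in \<open>auto simp: compose_def EF.ip_adjointable_left FG.ip_adjointable_left\<close>)+
qed

lemma adjointable_id:
  assumes "hilbert E"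
  shows "restrict id (vcarrier E) \<in> adjointable E E"
  unfolding adjointable_def
  by (auto intro!: exI[of _ "restrict id (vcarrier E)"] simp: adjoint_of_def)

subsection \<open>Maps determined on generators\<close>

text \<open>A combination is kept as a list of coefficients and indices. A map of indices thus acts
  on it before it is known to respect the linear relations among the vectors.\<close>

primrec lincomb :: "('e, 'b) hmod \<Rightarrow> ('i \<Rightarrow> 'e) \<Rightarrow> (complex \<times> 'i) list \<Rightarrow> 'e" where
  "lincomb H h [] = vzero H"
| "lincomb H h (q # L) = vadd H (vscale H (fst q) (h (snd q))) (lincomb H h L)"

definition generated_by :: "('e, 'b::cstar_algebra) hmod \<Rightarrow> 'i set \<Rightarrow> ('i \<Rightarrow> 'e) \<Rightarrow> bool" where
  "generated_by H I h \<longleftrightarrow> hilbert H \<and> (\<forall>i\<in>I. h i \<in> vcarrier H) \<and>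
     (\<forall>X\<in>vcarrier H. \<forall>e>0. \<exists>L. snd ` set L \<subseteq> I \<and> hdist H X (lincomb H h L) < e)"

lemma generated_byD:
  assumes "generated_by H I h" "X \<in> vcarrier H" "e > 0"
  obtains L where "snd ` set L \<subseteq> I" "hdist H X (lincomb H h L) < e"
  using assms unfolding generated_by_def by blast

lemma (in semi_hilbert) lincomb_closed:
  "(\<And>i. i \<in> I \<Longrightarrow> h i \<in> vcarrier P) \<Longrightarrow> snd ` set L \<subseteq> I \<Longrightarrow> lincomb P h L \<in> vcarrier P"
  by (induction L) auto

text \<open>Allowing two families in each module lets one induction cover the norms of images, the
  adjoint relation and the powers of the modulus.\<close>

lemma ip_lincomb_transfer:
  assumes H: "semi_hilbert H" and K: "semi_hilbert K"
    and h: "\<And>i. i \<in> I \<Longrightarrow> h i \<in> vcarrier H" "\<And>j. j \<in> J \<Longrightarrow> h' j \<in> vcarrier H"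
    and k: "\<And>i. i \<in> I \<Longrightarrow> k i \<in> vcarrier K" "\<And>j. j \<in> J \<Longrightarrow> k' j \<in> vcarrier K"
    and eq: "\<And>i j. i \<in> I \<Longrightarrow> j \<in> J \<Longrightarrow> hip K (k i) (k' j) = hip H (h i) (h' j)"
    and L: "snd ` set L \<subseteq> I" "snd ` set L' \<subseteq> J"
  shows "hip K (lincomb K k L) (lincomb K k' L') = hip H (lincomb H h L) (lincomb H h' L')"
proof -
  interpret H: semi_hilbert H by (rule H)
  interpret K: semi_hilbert K by (rule K)
  have hc: "lincomb H h' L' \<in> vcarrier H" and kc: "lincomb K k' L' \<in> vcarrier K"
    using H.lincomb_closed[of J h' L'] K.lincomb_closed[of J k' L'] h k L by auto
  have *: "hip K (k i) (lincomb K k' L') = hip H (h i) (lincomb H h' L')" if i: "i \<in> I" for i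
    using L(2)
  proof (induction L')
    case (Cons q L')
    then have "lincomb H h' L' \<in> vcarrier H" "lincomb K k' L' \<in> vcarrier K"
      using H.lincomb_closed[of J h' L'] K.lincomb_closed[of J k' L'] h k by auto
    with Cons i show ?case by (simp add: H.ip_simps K.ip_simps h k eq)
  qed (simp add: H.ip_simps K.ip_simps h k i)
  show ?thesis
    using L(1)
  proof (induction L)
    case (Cons q L)
    then have "lincomb H h L \<in> vcarrier H" "lincomb K k L \<in> vcarrier K"
      using H.lincomb_closed[of I h L] K.lincomb_closed[of I k L] h k by auto
    with Cons show ?case by (simp add: H.ip_simps K.ip_simps h k * hc kc)
  qed (simp add: H.ip_simps K.ip_simps hc kc)
qed

lemma (in hilbert) lincomb_append:
  assumes "\<And>i. i \<in> I \<Longrightarrow> h i \<in> vcarrier P" "snd ` set L \<subseteq> I" "snd ` set L' \<subseteq> I"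
  shows "lincomb P h (L @ L') = vadd P (lincomb P h L) (lincomb P h L')"
proof (rule ip_eqI)
  have c: "lincomb P h M \<in> vcarrier P" if "snd ` set M \<subseteq> I" for M
    by (rule lincomb_closed[OF assms(1) that])
  show "lincomb P h (L @ L') \<in> vcarrier P" "vadd P (lincomb P h L) (lincomb P h L') \<in> vcarrier P"
    using assms(2,3) by (simp_all add: c image_Un)
  fix z assume "z \<in> vcarrier P"
  then show "hip P z (lincomb P h (L @ L')) = hip P z (vadd P (lincomb P h L) (lincomb P h L'))"
    using assms(2)
  proof (induction L)
    case (Cons q L)
    then have "lincomb P h (L @ L') \<in> vcarrier P" "lincomb P h L \<in> vcarrier P"
      using assms(3) by (simp_all add: c image_Un)
    with Cons assms show ?case by (simp add: ip_simps c)
  qed (use assms in \<open>simp add: ip_simps c\<close>)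
qed

lemma (in hilbert) lincomb_scale:
  assumes "\<And>i. i \<in> I \<Longrightarrow> h i \<in> vcarrier P" "snd ` set L \<subseteq> I"
  shows "lincomb P h (map (\<lambda>q. (c * fst q, snd q)) L) = vscale P c (lincomb P h L)"
  using assms(2)
proof (induction L)
  case Nil
  show ?case by (rule ip_eqI) (simp_all add: ip_simps)
next
  case (Cons q L)
  have "lincomb P h L \<in> vcarrier P" by (rule lincomb_closed[OF assms(1)]) (use Cons in auto)
  with Cons assms show ?case
    by (intro ip_eqI) (simp_all add: ip_simps scaleC_add_right scaleC_scaleC)
qed

lemma (in hilbert) lincomb_diff:
  assumes "\<And>i. i \<in> I \<Longrightarrow> h i \<in> vcarrier P" "snd ` set L \<subseteq> I" "snd ` set L' \<subseteq> I"
  shows "lincomb P h (L @ map (\<lambda>q. (- 1 * fst q, snd q)) L') = vdiff P (lincomb P h L) (lincomb P h L')"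
  unfolding vdiff_def
  by (subst lincomb_append[OF assms(1,2)]) (use assms(3) in \<open>auto simp only: lincomb_scale[OF assms(1,3)]
    image_subset_iff set_map snd_conv\<close>)

lemma (in hilbert) lincomb_single:
  assumes "h i \<in> vcarrier P"
  shows "lincomb P h [(1, i)] = h i"
  by (rule ip_eqI) (use assms in \<open>simp_all add: ip_simps\<close>)

lemma lincomb_comp: "lincomb H h (map (\<lambda>q. (fst q, f (snd q))) L) = lincomb H (\<lambda>i. h (f i)) L"
  by (induction L) auto

text \<open>The difference \<open>X - Y\<close> is orthogonal to all combinations of generators, and
  by Cauchy-Schwarz to their limits.\<close>

lemma generated_by_eqI:
  assumes gen: "generated_by H I h" and X: "X \<in> vcarrier H" and Y: "Y \<in> vcarrier H"
    and eq: "\<And>i. i \<in> I \<Longrightarrow> hip H (h i) X = hip H (h i) Y"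
  shows "X = Y"
proof -
  interpret H: hilbert H using gen by (simp add: generated_by_def)
  have h: "h i \<in> vcarrier H" if "i \<in> I" for i using gen that by (simp add: generated_by_def)
  let ?D = "vdiff H X Y"
  have D: "?D \<in> vcarrier H" using X Y by simp
  have lc: "hip H (lincomb H h L) ?D = 0" if "snd ` set L \<subseteq> I" for L
    using that
  proof (induction L)
    case (Cons q L)
    then have "lincomb H h L \<in> vcarrier H" using H.lincomb_closed[of I h L] h by auto
    with Cons D X Y h eq show ?case by (auto simp: H.ip_simps)
  qed (simp add: H.ip_simps D)
  show ?thesis
  proof (rule H.ip_eqI[OF X Y])
    fix Z assume Z: "Z \<in> vcarrier H"
    have "norm (hip H Z ?D) \<le> 0"
    proof (rule field_le_epsilon)
      fix e :: real assume e: "e > 0"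
      obtain L where L: "snd ` set L \<subseteq> I" "hdist H Z (lincomb H h L) < e / (hnorm H ?D + 1)"
        using gen Z e unfolding generated_by_def
        by (metis H.hnorm_nonneg add_nonneg_pos divide_pos_pos zero_less_one)
      have lcc: "lincomb H h L \<in> vcarrier H" by (rule H.lincomb_closed[OF h L(1)])
      have "hip H Z ?D = hip H (vdiff H Z (lincomb H h L)) ?D"
        using lc[OF L(1)] lcc D Z by (simp add: H.ip_diff_left)
      then have "norm (hip H Z ?D) \<le> hdist H Z (lincomb H h L) * hnorm H ?D"
        using H.cauchy_schwarz[of "vdiff H Z (lincomb H h L)" ?D] lcc D Z by simp
      also have "\<dots> \<le> e / (hnorm H ?D + 1) * (hnorm H ?D + 1)"
        using L(2) e by (intro mult_mono) (auto simp: add_nonneg_pos)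
      also have "\<dots> = e" using H.hnorm_nonneg[of ?D] by (simp add: add_nonneg_eq_0_iff)
      finally show "norm (hip H Z ?D) \<le> 0 + e" by simp
    qed
    then show "hip H Z X = hip H Z Y" using X Y Z by (simp add: H.ip_diff_right)
  qed
qed

text \<open>The adjoints agree: paired with a generator, each reduces to the value of its map at
  that generator. A map is in turn determined by its adjoint.\<close>

lemma adjointable_eqI:
  assumes gen: "generated_by H I h" and K: "hilbert K"
    and T: "T \<in> adjointable H K" "S \<in> adjointable H K"
    and eq: "\<And>i. i \<in> I \<Longrightarrow> T (h i) = S (h i)"
  shows "T = S"
proof (rule PiE_ext)
  interpret H: hilbert H using gen by (simp add: generated_by_def)
  interpret HK: hilbert_pair H K by (rule hilbert_pairI[OF H.hilbert_axioms K])
  have h: "h i \<in> vcarrier H" if "i \<in> I" for i using gen that by (simp add: generated_by_def)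
  show "T \<in> vcarrier H \<rightarrow>\<^sub>E vcarrier K" "S \<in> vcarrier H \<rightarrow>\<^sub>E vcarrier K"
    using T by (simp_all add: HK.adjointable_extensional)
  fix X assume X: "X \<in> vcarrier H"
  show "T X = S X"
  proof (rule HK.F.ip_eqI)
    fix z assume z: "z \<in> vcarrier K"
    have "hadj H K T z = hadj H K S z"
    proof (rule generated_by_eqI[OF gen])
      fix i assume i: "i \<in> I"
      have "hip H (h i) (hadj H K T z) = hip K (T (h i)) z"
        using T z h[OF i] by (simp add: HK.ip_adjointable_left)
      also have "\<dots> = hip H (h i) (hadj H K S z)"
        using T z h[OF i] eq[OF i] by (simp add: HK.ip_adjointable_left)
      finally show "hip H (h i) (hadj H K T z) = hip H (h i) (hadj H K S z)" .
    qed (use T z in auto)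
    then show "hip K z (T X) = hip K z (S X)"
      using T X z by (simp add: HK.ip_adjointable_right)
  qed (use T X in auto)
qed

lemma (in semi_hilbert) tendsto_ip:
  assumes x: "\<And>n. x n \<in> vcarrier P" "X \<in> vcarrier P" "(\<lambda>n. hdist P X (x n)) \<longlonglongrightarrow> 0"
    and y: "\<And>n. y n \<in> vcarrier P" "Y \<in> vcarrier P" "(\<lambda>n. hdist P Y (y n)) \<longlonglongrightarrow> 0"
  shows "(\<lambda>n. hip P (x n) (y n)) \<longlonglongrightarrow> hip P X Y"
proof -
  have "(\<lambda>n. hip P X Y - hip P (x n) (y n)) \<longlonglongrightarrow> 0"
  proof (rule Lim_null_comparison)
    show "\<forall>\<^sub>F n in sequentially. norm (hip P X Y - hip P (x n) (y n)) \<le>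
        hdist P X (x n) * hnorm P Y + (hnorm P X + hdist P X (x n)) * hdist P Y (y n)"
    proof (rule always_eventually, rule allI)
      fix n
      have "hnorm P (x n) \<le> hnorm P X + hdist P X (x n)"
        using hnorm_le_vdiff[of "x n" X] hnorm_vdiff_commute[of "x n" X] x by simp
      then have "hnorm P (x n) * hdist P Y (y n) \<le>
          (hnorm P X + hdist P X (x n)) * hdist P Y (y n)"
        by (rule mult_right_mono) simp
      then show "norm (hip P X Y - hip P (x n) (y n)) \<le> hdist P X (x n) * hnorm P Y +
          (hnorm P X + hdist P X (x n)) * hdist P Y (y n)"
        using norm_ip_diff_le[OF x(2) x(1) y(2) y(1), of n n] by linarith
    qed
    have "(\<lambda>n. hdist P X (x n) * hnorm P Y +
        (hnorm P X + hdist P X (x n)) * hdist P Y (y n)) \<longlonglongrightarrow>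
        0 * hnorm P Y + (hnorm P X + 0) * 0"
      by (intro tendsto_intros x(3) y(3))
    then show "(\<lambda>n. hdist P X (x n) * hnorm P Y +
        (hnorm P X + hdist P X (x n)) * hdist P Y (y n)) \<longlonglongrightarrow> 0" by simp
  qed
  from tendsto_diff[OF tendsto_const[of "hip P X Y"] this] show ?thesis by simp
qed

lemma (in semi_hilbert) tendsto_hnorm:
  assumes "\<And>n. x n \<in> vcarrier P" "X \<in> vcarrier P" "(\<lambda>n. hdist P X (x n)) \<longlonglongrightarrow> 0"
  shows "(\<lambda>n. hnorm P (x n)) \<longlonglongrightarrow> hnorm P X"
  unfolding hnorm_def by (intro tendsto_real_sqrt tendsto_norm tendsto_ip assms)

text \<open>Beyond the extension by density, the last conclusion exposes a sequence of combinations
  that converges together with its images. Identities between combinations, such as adjointness, can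
  thus be passed to the limit.\<close>

lemma extend_bounded:
  assumes gen: "generated_by H I h" and K: "hilbert K" and f: "\<And>i. i \<in> I \<Longrightarrow> f i \<in> vcarrier K"
    and c: "c \<ge> 0"
    and bound: "\<And>L. snd ` set L \<subseteq> I \<Longrightarrow> hnorm K (lincomb K f L) \<le> c * hnorm H (lincomb H h L)"
  obtains T where "T \<in> vcarrier H \<rightarrow>\<^sub>E vcarrier K" "\<And>i. i \<in> I \<Longrightarrow> T (h i) = f i"
    "\<And>X. X \<in> vcarrier H \<Longrightarrow> hnorm K (T X) \<le> c * hnorm H X"
    "\<And>X. X \<in> vcarrier H \<Longrightarrow> \<exists>L. (\<forall>n::nat. snd ` set (L n) \<subseteq> I) \<and>
       (\<lambda>n. hdist H X (lincomb H h (L n))) \<longlonglongrightarrow> 0 \<and>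
       (\<lambda>n. hdist K (T X) (lincomb K f (L n))) \<longlonglongrightarrow> 0"
proof -
  interpret H: hilbert H using gen by (simp add: generated_by_def)
  interpret K: hilbert K by fact
  have h: "h i \<in> vcarrier H" if "i \<in> I" for i using gen that by (simp add: generated_by_def)
  have hc: "lincomb H h L \<in> vcarrier H" if "snd ` set L \<subseteq> I" for L
    by (rule H.lincomb_closed[OF _ that]) (rule h)
  have fc: "lincomb K f L \<in> vcarrier K" if "snd ` set L \<subseteq> I" for L
    by (rule K.lincomb_closed[OF _ that]) (rule f)
  have diff: "hdist K (lincomb K f L) (lincomb K f L') \<le>
      c * hdist H (lincomb H h L) (lincomb H h L')"
    if "snd ` set L \<subseteq> I" "snd ` set L' \<subseteq> I" for L L'
  proof -
    have "snd ` set (L @ map (\<lambda>q. (- 1 * fst q, snd q)) L') \<subseteq> I"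
      using that by (simp add: image_Un image_image)
    moreover have "lincomb H h (L @ map (\<lambda>q. (- 1 * fst q, snd q)) L') =
        vdiff H (lincomb H h L) (lincomb H h L')" by (rule H.lincomb_diff[OF h that])
    moreover have "lincomb K f (L @ map (\<lambda>q. (- 1 * fst q, snd q)) L') =
        vdiff K (lincomb K f L) (lincomb K f L')" by (rule K.lincomb_diff[OF f that])
    ultimately show ?thesis using bound by metis
  qed
  have "\<exists>Y. Y \<in> vcarrier K \<and> (\<exists>L. (\<forall>n::nat. snd ` set (L n) \<subseteq> I) \<and>
       (\<lambda>n. hdist H X (lincomb H h (L n))) \<longlonglongrightarrow> 0 \<and>
       (\<lambda>n. hdist K Y (lincomb K f (L n))) \<longlonglongrightarrow> 0)" if X: "X \<in> vcarrier H" for X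
  proof -
    have "\<exists>L. snd ` set L \<subseteq> I \<and> hdist H X (lincomb H h L) < inverse (real (Suc n))" for n
      using gen X unfolding generated_by_def by simp
    then obtain L where L: "\<And>n. snd ` set (L n) \<subseteq> I"
      "\<And>n. hdist H X (lincomb H h (L n)) < inverse (real (Suc n))" by metis
    have lim: "(\<lambda>n. hdist H X (lincomb H h (L n))) \<longlonglongrightarrow> 0"
      by (rule tendsto_sandwich[OF always_eventually always_eventually tendsto_const
            LIMSEQ_inverse_real_of_nat]) (auto simp del: of_nat_Suc intro: less_imp_le L)
    have "hCauchy K (\<lambda>n. lincomb K f (L n))"
      unfolding hCauchy_def
    proof (intro conjI allI impI fc L(1))
      fix e :: real assume e: "e > 0"
      then have "e / (2 * (c + 1)) > 0" using c by simp
      then have "\<forall>\<^sub>F n in sequentially. hdist H X (lincomb H h (L n)) < e / (2 * (c + 1))"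
        by (rule order_tendstoD(2)[OF lim])
      then obtain N where N: "\<And>n. n \<ge> N \<Longrightarrow> hdist H X (lincomb H h (L n)) < e / (2 * (c + 1))"
        by (auto simp: eventually_sequentially)
      have half: "e / (2 * (c + 1)) = e / (c + 1) / 2" by (simp add: mult.commute)
      have "hdist K (lincomb K f (L m)) (lincomb K f (L n)) < e" if "m \<ge> N" "n \<ge> N" for m n
      proof -
        have "hdist H (lincomb H h (L m)) (lincomb H h (L n)) \<le>
            hdist H (lincomb H h (L m)) X + hdist H X (lincomb H h (L n))"
          by (rule H.hnorm_vdiff_triangle[OF hc[OF L(1)] X hc[OF L(1)]])
        also have "hdist H (lincomb H h (L m)) X = hdist H X (lincomb H h (L m))"
          by (rule H.hnorm_vdiff_commute[OF hc[OF L(1)] X])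
        finally have *: "hdist H (lincomb H h (L m)) (lincomb H h (L n)) < e / (c + 1)"
          using N[OF that(1)] N[OF that(2)] unfolding half by linarith
        have "c * hdist H (lincomb H h (L m)) (lincomb H h (L n)) \<le>
            (c + 1) * hdist H (lincomb H h (L m)) (lincomb H h (L n))"
          by (rule mult_right_mono) auto
        also have "\<dots> < e" using * c by (simp add: field_simps)
        finally show ?thesis using diff[OF L(1) L(1), of m n] by linarith
      qed
      then show "\<exists>N. \<forall>m\<ge>N. \<forall>n\<ge>N. hdist K (lincomb K f (L m)) (lincomb K f (L n)) < e"
        by blast
    qed
    then obtain Y where Y: "Y \<in> vcarrier K" "(\<lambda>n. hdist K (lincomb K f (L n)) Y) \<longlonglongrightarrow> 0"
      using K.complete by blast
    have "(\<lambda>n. hdist K Y (lincomb K f (L n))) \<longlonglongrightarrow> 0"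
      using Y(2) K.hnorm_vdiff_commute[OF Y(1) fc[OF L(1)]] by (simp add: f)
    with Y(1) lim L(1) show ?thesis by blast
  qed
  then obtain T0 where T0: "\<And>X. X \<in> vcarrier H \<Longrightarrow> T0 X \<in> vcarrier K"
    "\<And>X. X \<in> vcarrier H \<Longrightarrow> \<exists>L. (\<forall>n::nat. snd ` set (L n) \<subseteq> I) \<and>
       (\<lambda>n. hdist H X (lincomb H h (L n))) \<longlonglongrightarrow> 0 \<and>
       (\<lambda>n. hdist K (T0 X) (lincomb K f (L n))) \<longlonglongrightarrow> 0"
    by metis
  define T where "T = restrict T0 (vcarrier H)"
  have T: "X \<in> vcarrier H \<Longrightarrow> T X = T0 X" for X by (simp add: T_def)
  show thesis
  proof (rule that)
    show "T \<in> vcarrier H \<rightarrow>\<^sub>E vcarrier K" by (simp add: T_def T0)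
    show "\<exists>L. (\<forall>n::nat. snd ` set (L n) \<subseteq> I) \<and>
       (\<lambda>n. hdist H X (lincomb H h (L n))) \<longlonglongrightarrow> 0 \<and>
       (\<lambda>n. hdist K (T X) (lincomb K f (L n))) \<longlonglongrightarrow> 0" if "X \<in> vcarrier H" for X
      using T0(2)[OF that] that by (simp add: T)
    show "hnorm K (T X) \<le> c * hnorm H X" if X: "X \<in> vcarrier H" for X
    proof -
      obtain L where L: "\<And>n::nat. snd ` set (L n) \<subseteq> I"
        "(\<lambda>n. hdist H X (lincomb H h (L n))) \<longlonglongrightarrow> 0"
        "(\<lambda>n. hdist K (T X) (lincomb K f (L n))) \<longlonglongrightarrow> 0"
        using T0(2)[OF X] X by (auto simp: T)
      have "(\<lambda>n. hnorm K (lincomb K f (L n))) \<longlonglongrightarrow> hnorm K (T X)"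
        by (rule K.tendsto_hnorm[OF fc[OF L(1)] _ L(3)]) (use T0 X in \<open>auto simp: T\<close>)
      moreover have "(\<lambda>n. c * hnorm H (lincomb H h (L n))) \<longlonglongrightarrow> c * hnorm H X"
        by (intro tendsto_mult_left H.tendsto_hnorm[OF hc[OF L(1)] _ L(2)]) (use X in auto)
      ultimately show ?thesis
        by (rule LIMSEQ_le) (use bound[OF L(1)] in auto)
    qed
    show "T (h i) = f i" if i: "i \<in> I" for i
    proof -
      obtain L where L: "\<And>n::nat. snd ` set (L n) \<subseteq> I"
        "(\<lambda>n. hdist H (h i) (lincomb H h (L n))) \<longlonglongrightarrow> 0"
        "(\<lambda>n. hdist K (T (h i)) (lincomb K f (L n))) \<longlonglongrightarrow> 0"
        using T0(2)[OF h[OF i]] h[OF i] by (auto simp: T)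
      have Ti: "T (h i) \<in> vcarrier K" using T0 h[OF i] by (simp add: T)
      \<comment> \<open>\<open>T\<close> is defined through some approximating sequence. Comparing
        it with the one-term combination shows that the prescribed value is attained.\<close>
      have "hdist K (T (h i)) (f i) \<le> 0"
      proof (rule LIMSEQ_le_const)
        have "(\<lambda>n. hdist K (T (h i)) (lincomb K f (L n)) +
            c * hdist H (h i) (lincomb H h (L n))) \<longlonglongrightarrow> 0 + c * 0"
          by (intro tendsto_intros L)
        then show "(\<lambda>n. hdist K (T (h i)) (lincomb K f (L n)) +
            c * hdist H (h i) (lincomb H h (L n))) \<longlonglongrightarrow> 0" by simp
        have "hdist K (T (h i)) (f i) \<le> hdist K (T (h i)) (lincomb K f (L n)) +
            c * hdist H (h i) (lincomb H h (L n))" for n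
        proof -
          have "hdist K (T (h i)) (f i) \<le> hdist K (T (h i)) (lincomb K f (L n)) +
              hdist K (lincomb K f (L n)) (f i)"
            by (rule K.hnorm_vdiff_triangle[OF Ti fc[OF L(1)] f[OF i]])
          also have "hdist K (lincomb K f (L n)) (f i) = hdist K (f i) (lincomb K f (L n))"
            by (rule K.hnorm_vdiff_commute[OF fc[OF L(1)] f[OF i]])
          also have "\<dots> \<le> c * hdist H (h i) (lincomb H h (L n))"
            using diff[OF _ L(1), of "[(1, i)]" n] i h[OF i] f[OF i]
            by (simp only: H.lincomb_single K.lincomb_single) simp
          finally show ?thesis by simp
        qed
        then show "\<exists>N. \<forall>n\<ge>N. hdist K (T (h i)) (f i) \<le>
            hdist K (T (h i)) (lincomb K f (L n)) + c * hdist H (h i) (lincomb H h (L n))"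
          by blast
      qed
      then show ?thesis using K.hnorm_nonneg[of "vdiff K (T (h i)) (f i)"]
        by (intro K.hnorm_eq_0 Ti f i) linarith
    qed
  qed
qed

text \<open>With \<open>a n\<close> the norm of the \<open>n\<close>-th iterate and \<open>p\<close>
  that of the starting vector, repeated squaring gives
  \<open>(a 1 / p) ^ (2 ^ k) \<le> a (2 ^ k) / p\<close>, which is at most
  \<open>(C / p) * M ^ (2 ^ k)\<close>. Roots remove \<open>C\<close>, so \<open>C\<close> may
  depend on the vector.\<close>

lemma power_iteration_bound:
  fixes a :: "nat \<Rightarrow> real"
  assumes a: "\<And>n. a n \<ge> 0" and p: "p \<ge> 0" and M: "M \<ge> 0"
    and sq: "\<And>n. (a n)\<^sup>2 \<le> p * a (2 * n)" and le: "\<And>n. a n \<le> C * M ^ n"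
  shows "a 1 \<le> M * p"
proof (cases "p = 0")
  case True
  then show ?thesis using sq[of 1] by simp
next
  case False
  with p have p: "p > 0" by simp
  have b: "(a 1 / p) ^ (2 ^ k) \<le> a (2 ^ k) / p" for k
  proof (induction k)
    case (Suc k)
    have "(a 1 / p) ^ (2 ^ Suc k) = ((a 1 / p) ^ (2 ^ k))\<^sup>2"
      by (simp add: power_mult[symmetric] mult.commute)
    also have "\<dots> \<le> (a (2 ^ k) / p)\<^sup>2"
      by (rule power_mono[OF Suc]) (use a p in simp)
    also have "\<dots> \<le> p * a (2 * 2 ^ k) / p\<^sup>2"
      using sq[of "2 ^ k"] by (simp add: power_divide divide_right_mono)
    also have "\<dots> = a (2 ^ Suc k) / p" using p by (simp add: power2_eq_square)
    finally show ?case .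
  qed simp
  have C: "C / p \<ge> 0" using le[of 0] a[of 0] p by simp
  show ?thesis
  proof (cases "M = 0")
    case True
    then show ?thesis using le[of 1] by simp
  next
    case False
    with M have M: "M > 0" by simp
    have "(a 1 / p / M) ^ (2 ^ k) \<le> (C / p) * 2 ^ k" for k
    proof -
      have "(a 1 / p / M) ^ (2 ^ k) = (a 1 / p) ^ (2 ^ k) / M ^ (2 ^ k)" by (rule power_divide)
      also have "\<dots> \<le> C * M ^ (2 ^ k) / p / M ^ (2 ^ k)"
        using order_trans[OF b divide_right_mono[OF le]] p M by (intro divide_right_mono) auto
      also have "\<dots> = C / p * 1" using M by simp
      also have "\<dots> \<le> (C / p) * 2 ^ k" by (rule mult_left_mono[OF _ C]) simp
      finally show ?thesis .
    qed
    then have "a 1 / p / M \<le> 1" by (rule le_one_of_power_growth)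
    then show ?thesis using p M by (simp add: field_simps)
  qed
qed

text \<open>The bound on the iterates replaces the inequality \<open>\<langle>T x, T x\<rangle> \<le> \<parallel>T\<parallel>\<^sup>2 \<langle>x, x\<rangle>\<close>: by Cauchy-Schwarz
  \<open>\<parallel>R\<^sup>n x\<parallel>\<^sup>2 \<le> \<parallel>x\<parallel> \<parallel>R\<^sup>2\<^sup>n x\<parallel>\<close> for the symmetric map \<open>R\<close> induced by \<open>\<tau> \<circ> \<sigma>\<close>.\<close>

theorem adjointable_on_generators:
  assumes gH: "generated_by H I h" and gK: "generated_by K J k"
    and \<sigma>: "\<And>i. i \<in> I \<Longrightarrow> \<sigma> i \<in> J" and \<tau>: "\<And>j. j \<in> J \<Longrightarrow> \<tau> j \<in> I"
    and ip: "\<And>i j. i \<in> I \<Longrightarrow> j \<in> J \<Longrightarrow> hip K (k (\<sigma> i)) (k j) = hip H (h i) (h (\<tau> j))"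
    and M: "M \<ge> 0"
    and bound: "\<And>i. i \<in> I \<Longrightarrow> \<exists>C. \<forall>n. hnorm H (h (((\<tau> \<circ> \<sigma>) ^^ n) i)) \<le> C * M ^ n"
  obtains T where "T \<in> adjointable H K" "\<And>i. i \<in> I \<Longrightarrow> T (h i) = k (\<sigma> i)"
    "\<And>j. j \<in> J \<Longrightarrow> hadj H K T (k j) = h (\<tau> j)"
    "\<And>X. X \<in> vcarrier H \<Longrightarrow> hnorm K (T X) \<le> sqrt M * hnorm H X"
proof -
  interpret HK: hilbert_pair H K using gH gK by (intro hilbert_pairI) (simp_all add: generated_by_def)
  define \<rho> where "\<rho> = \<tau> \<circ> \<sigma>"
  note bound = bound[folded \<rho>_def]
  have h: "h i \<in> vcarrier H" if "i \<in> I" for i using gH that by (simp add: generated_by_def)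
  have k: "k j \<in> vcarrier K" if "j \<in> J" for j using gK that by (simp add: generated_by_def)
  have \<rho>: "(\<rho> ^^ n) i \<in> I" if "i \<in> I" for n i
    by (induction n) (use that \<sigma> \<tau> in \<open>auto simp: \<rho>_def\<close>)
  have kk: "hip K (k (\<sigma> i)) (k (\<sigma> j)) = hip H (h i) (h (\<rho> j))" if "i \<in> I" "j \<in> I" for i j
    using ip[OF that(1) \<sigma>[OF that(2)]] by (simp add: \<rho>_def)
  have sym: "hip H (h (\<rho> i)) (h j) = hip H (h i) (h (\<rho> j))" if i: "i \<in> I" and j: "j \<in> I" for i j
  proof -
    have "hip H (h (\<rho> i)) (h j) = star (hip H (h j) (h (\<rho> i)))"
      using HK.E.ip_star[of "h j" "h (\<rho> i)"] h[OF j] h[OF \<rho>[OF i, of 1]] by simp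
    also have "\<dots> = star (hip K (k (\<sigma> j)) (k (\<sigma> i)))" by (simp only: kk[OF j i])
    also have "\<dots> = hip K (k (\<sigma> i)) (k (\<sigma> j))"
      using HK.F.ip_star[OF k[OF \<sigma>[OF j]] k[OF \<sigma>[OF i]]] by simp
    finally show ?thesis by (simp only: kk[OF i j])
  qed
  have sym_pow: "hip H (h ((\<rho> ^^ m) i)) (h ((\<rho> ^^ n) j)) = hip H (h i) (h ((\<rho> ^^ (m + n)) j))"
    if i: "i \<in> I" and j: "j \<in> I" for m n i j
  proof (induction m arbitrary: n)
    case (Suc m)
    have "hip H (h ((\<rho> ^^ Suc m) i)) (h ((\<rho> ^^ n) j)) = hip H (h ((\<rho> ^^ m) i)) (h ((\<rho> ^^ Suc n) j))"
      using sym[OF \<rho>[OF i, of m] \<rho>[OF j, of n]] by simp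
    then show ?case using Suc[of "Suc n"] by simp
  qed simp
  \<comment> \<open>The constant depends on the combination and only the rate \<open>M\<close> is
    uniform, which is what \<open>power_iteration_bound\<close> asks for.\<close>
  have bnd: "\<exists>C. \<forall>n. hnorm H (lincomb H (\<lambda>i. h ((\<rho> ^^ n) i)) L) \<le> C * M ^ n" if "snd ` set L \<subseteq> I" for L
    using that
  proof (induction L)
    case Nil
    show ?case by (rule exI[of _ 0]) simp
  next
    case (Cons q L)
    then obtain C where C: "\<And>n. hnorm H (lincomb H (\<lambda>i. h ((\<rho> ^^ n) i)) L) \<le> C * M ^ n" by auto
    have q: "snd q \<in> I" and L: "snd ` set L \<subseteq> I" using Cons by auto
    obtain D where D: "\<And>n. hnorm H (h ((\<rho> ^^ n) (snd q))) \<le> D * M ^ n" using bound[OF q] by auto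
    have "hnorm H (lincomb H (\<lambda>i. h ((\<rho> ^^ n) i)) (q # L)) \<le> (cmod (fst q) * D + C) * M ^ n" for n
    proof -
      have "hnorm H (lincomb H (\<lambda>i. h ((\<rho> ^^ n) i)) (q # L)) \<le>
          hnorm H (vscale H (fst q) (h ((\<rho> ^^ n) (snd q)))) + hnorm H (lincomb H (\<lambda>i. h ((\<rho> ^^ n) i)) L)"
        unfolding lincomb.simps
        by (rule HK.E.hnorm_add_le) (use h[OF \<rho>] q L in \<open>auto intro!: HK.E.lincomb_closed[of I]\<close>)
      also have "\<dots> \<le> cmod (fst q) * (D * M ^ n) + C * M ^ n"
        using mult_left_mono[OF D[of n], of "cmod (fst q)"] C[of n] h[OF \<rho>[OF q]]
        by (simp add: HK.E.hnorm_scale)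
      finally show ?thesis by (simp add: algebra_simps)
    qed
    then show ?case by blast
  qed
  have boundT: "hnorm K (lincomb K (\<lambda>i. k (\<sigma> i)) L) \<le> sqrt M * hnorm H (lincomb H h L)"
    if L: "snd ` set L \<subseteq> I" for L
  proof -
    define x where "x = (\<lambda>n. lincomb H (\<lambda>i. h ((\<rho> ^^ n) i)) L)"
    have x_in: "x n \<in> vcarrier H" for n
      unfolding x_def by (rule HK.E.lincomb_closed[OF h[OF \<rho>] L])
    have x0: "x 0 = lincomb H h L" by (simp add: x_def)
    obtain C where C: "\<And>n. hnorm H (x n) \<le> C * M ^ n" using bnd[OF L] unfolding x_def by auto
    have "(hnorm H (x n))\<^sup>2 \<le> hnorm H (x 0) * hnorm H (x (2 * n))" for n
    proof -
      have "hip H (x n) (x n) = hip H (x 0) (x (2 * n))"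
        unfolding x_def
        by (rule ip_lincomb_transfer[OF HK.E.semi_hilbert_axioms HK.E.semi_hilbert_axioms, of I _ I])
          (use L h[OF \<rho>] h in \<open>auto simp: sym_pow mult_2\<close>)
      then show ?thesis using HK.E.cauchy_schwarz[OF x_in x_in, of 0 "2 * n"] by (simp add: HK.E.hnorm_square)
    qed
    then have x1: "hnorm H (x 1) \<le> M * hnorm H (x 0)"
      by (intro power_iteration_bound[of "\<lambda>n. hnorm H (x n)", OF _ _ M _ C]) auto
    \<comment> \<open>The inner square of the image is \<open>\<langle>x, R x\<rangle>\<close> with
      \<open>R\<close> the symmetric map of the iteration. The bound \<open>M\<close> for
      \<open>R\<close> thus becomes \<open>sqrt M\<close> for the map itself.\<close>
    have "hip K (lincomb K (\<lambda>i. k (\<sigma> i)) L) (lincomb K (\<lambda>i. k (\<sigma> i)) L) = hip H (x 0) (x 1)"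
      unfolding x_def
      by (rule ip_lincomb_transfer[OF HK.E.semi_hilbert_axioms HK.F.semi_hilbert_axioms, of I _ I])
        (use L h[OF \<rho>[of _ 1]] h k \<sigma> kk in auto)
    then have "norm (hip K (lincomb K (\<lambda>i. k (\<sigma> i)) L) (lincomb K (\<lambda>i. k (\<sigma> i)) L)) \<le>
        hnorm H (x 0) * hnorm H (x 1)" using HK.E.cauchy_schwarz[OF x_in x_in] by simp
    also have "\<dots> \<le> hnorm H (x 0) * (M * hnorm H (x 0))" by (rule mult_left_mono[OF x1]) simp
    also have "\<dots> = (sqrt M * hnorm H (x 0))\<^sup>2" using M by (simp add: power_mult_distrib) (simp add: power2_eq_square)
    finally show ?thesis unfolding x0[symmetric] by (rule HK.F.hnorm_le) (use M in simp)
  qed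
  have ipLL: "hip K (lincomb K (\<lambda>i. k (\<sigma> i)) L) (lincomb K k L') =
      hip H (lincomb H h L) (lincomb H (\<lambda>j. h (\<tau> j)) L')" if "snd ` set L \<subseteq> I" "snd ` set L' \<subseteq> J" for L L'
    by (rule ip_lincomb_transfer[OF HK.E.semi_hilbert_axioms HK.F.semi_hilbert_axioms, of I _ J])
      (use that h k \<sigma> \<tau> ip in auto)
  have boundS: "hnorm H (lincomb H (\<lambda>j. h (\<tau> j)) L') \<le> sqrt M * hnorm K (lincomb K k L')"
    if L': "snd ` set L' \<subseteq> J" for L'
  proof (cases "hnorm H (lincomb H (\<lambda>j. h (\<tau> j)) L') = 0")
    case False
    \<comment> \<open>The image of \<open>L'\<close> under the prospective adjoint is again a
      combination \<open>?L\<close> of generators of \<open>H\<close>. Pairing it with itself and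
      moving one side to \<open>K\<close> makes \<open>boundT\<close> applicable.\<close>
    let ?v = "lincomb H (\<lambda>j. h (\<tau> j)) L'" and ?L = "map (\<lambda>q. (fst q, \<tau> (snd q))) L'"
    have L: "snd ` set ?L \<subseteq> I" using L' \<tau> by auto
    have v: "lincomb H h ?L = ?v" by (rule lincomb_comp)
    have "(hnorm H ?v)\<^sup>2 = norm (hip K (lincomb K (\<lambda>i. k (\<sigma> i)) ?L) (lincomb K k L'))"
      using ipLL[OF L L'] by (simp add: v HK.E.hnorm_square)
    also have "\<dots> \<le> hnorm K (lincomb K (\<lambda>i. k (\<sigma> i)) ?L) * hnorm K (lincomb K k L')"
      by (rule HK.F.cauchy_schwarz) (use HK.F.lincomb_closed[OF k[OF \<sigma>] L] HK.F.lincomb_closed[OF k L'] in auto)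
    also have "\<dots> \<le> sqrt M * hnorm H ?v * hnorm K (lincomb K k L')"
      using boundT[OF L] by (intro mult_right_mono) (simp_all add: v)
    finally have "hnorm H ?v * hnorm H ?v \<le> hnorm H ?v * (sqrt M * hnorm K (lincomb K k L'))"
      by (simp add: power2_eq_square mult_ac)
    moreover have "hnorm H ?v > 0" using False HK.E.hnorm_nonneg[of ?v] by linarith
    ultimately show ?thesis by simp
  qed (use M in simp)
  obtain T where T: "T \<in> vcarrier H \<rightarrow>\<^sub>E vcarrier K" "\<And>i. i \<in> I \<Longrightarrow> T (h i) = k (\<sigma> i)"
    "\<And>X. X \<in> vcarrier H \<Longrightarrow> hnorm K (T X) \<le> sqrt M * hnorm H X"
    "\<And>X. X \<in> vcarrier H \<Longrightarrow> \<exists>L. (\<forall>n::nat. snd ` set (L n) \<subseteq> I) \<and>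
       (\<lambda>n. hdist H X (lincomb H h (L n))) \<longlonglongrightarrow> 0 \<and>
       (\<lambda>n. hdist K (T X) (lincomb K (\<lambda>i. k (\<sigma> i)) (L n))) \<longlonglongrightarrow> 0"
    by (rule extend_bounded[OF gH HK.F.hilbert_axioms k[OF \<sigma>] _ boundT]) (use M in auto)
  obtain S where S: "S \<in> vcarrier K \<rightarrow>\<^sub>E vcarrier H" "\<And>j. j \<in> J \<Longrightarrow> S (k j) = h (\<tau> j)"
    "\<And>Y. Y \<in> vcarrier K \<Longrightarrow> \<exists>L. (\<forall>n::nat. snd ` set (L n) \<subseteq> J) \<and>
       (\<lambda>n. hdist K Y (lincomb K k (L n))) \<longlonglongrightarrow> 0 \<and>
       (\<lambda>n. hdist H (S Y) (lincomb H (\<lambda>j. h (\<tau> j)) (L n))) \<longlonglongrightarrow> 0"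
    by (rule extend_bounded[OF gK HK.E.hilbert_axioms h[OF \<tau>] _ boundS]) (use M in auto)
  have TS: "hip K (T X) Y = hip H X (S Y)" if X: "X \<in> vcarrier H" and Y: "Y \<in> vcarrier K" for X Y
  proof -
    obtain L where L: "\<And>n::nat. snd ` set (L n) \<subseteq> I"
      "(\<lambda>n. hdist H X (lincomb H h (L n))) \<longlonglongrightarrow> 0"
      "(\<lambda>n. hdist K (T X) (lincomb K (\<lambda>i. k (\<sigma> i)) (L n))) \<longlonglongrightarrow> 0" using T(4)[OF X] by auto
    obtain L' where L': "\<And>n::nat. snd ` set (L' n) \<subseteq> J"
      "(\<lambda>n. hdist K Y (lincomb K k (L' n))) \<longlonglongrightarrow> 0"
      "(\<lambda>n. hdist H (S Y) (lincomb H (\<lambda>j. h (\<tau> j)) (L' n))) \<longlonglongrightarrow> 0" using S(3)[OF Y] by auto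
    have "T X \<in> vcarrier K" "S Y \<in> vcarrier H" using T(1) S(1) X Y by auto
    then have "(\<lambda>n. hip K (lincomb K (\<lambda>i. k (\<sigma> i)) (L n)) (lincomb K k (L' n))) \<longlonglongrightarrow> hip K (T X) Y"
      "(\<lambda>n. hip H (lincomb H h (L n)) (lincomb H (\<lambda>j. h (\<tau> j)) (L' n))) \<longlonglongrightarrow> hip H X (S Y)"
      using X Y by (auto intro!: HK.F.tendsto_ip HK.E.tendsto_ip L(2,3) L'(2,3)
          HK.E.lincomb_closed[OF h L(1)] HK.E.lincomb_closed[OF h[OF \<tau>] L'(1)]
          HK.F.lincomb_closed[OF k L'(1)] HK.F.lincomb_closed[OF k[OF \<sigma>] L(1)])
    then show ?thesis by (simp add: ipLL[OF L(1) L'(1)] LIMSEQ_unique)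
  qed
  show thesis
    by (rule that[of T]) (use HK.adjointableI[OF T(1) S(1) TS] T S in auto)
qed

subsection \<open>Completely positive maps\<close>

lemma (in semi_hilbert) vsum_closed:
  "(\<And>k. k < n \<Longrightarrow> f k \<in> vcarrier P) \<Longrightarrow> vsum P n f \<in> vcarrier P"
  by (induction n) auto

lemma (in semi_hilbert) ip_vsum_right:
  assumes "z \<in> vcarrier P" "\<And>k. k < n \<Longrightarrow> f k \<in> vcarrier P"
  shows "hip P z (vsum P n f) = (\<Sum>k<n. hip P z (f k))"
  using assms(2) by (induction n) (simp_all add: ip_simps vsum_closed assms(1))

lemma (in semi_hilbert) ip_vsum_left:
  assumes "z \<in> vcarrier P" "\<And>k. k < n \<Longrightarrow> f k \<in> vcarrier P"
  shows "hip P (vsum P n f) z = (\<Sum>k<n. hip P (f k) z)"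
  using assms(2) by (induction n) (simp_all add: ip_simps vsum_closed assms(1))

locale adjointable_family = hilbert_pair E E for E :: "('e, 'b::cstar_algebra) hmod" +
  fixes \<phi> :: "'a::cstar_algebra \<Rightarrow> 'e \<Rightarrow> 'e"
  assumes linear: "linear_into_adjointable E \<phi>"
begin

lemma family_adjointable [simp]: "\<phi> a \<in> adjointable E E"
  using linear by (simp add: linear_into_adjointable_def)

lemma family_closed [simp]: "x \<in> vcarrier E \<Longrightarrow> \<phi> a x \<in> vcarrier E"
  by (rule adjointable_closed) simp_all

lemma family_add: "x \<in> vcarrier E \<Longrightarrow> \<phi> (a + b) x = vadd E (\<phi> a x) (\<phi> b x)"
  using linear by (simp add: linear_into_adjointable_def)

lemma family_scaleC: "x \<in> vcarrier E \<Longrightarrow> \<phi> (scaleC c a) x = vscale E c (\<phi> a x)"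
  using linear by (simp add: linear_into_adjointable_def)

lemma ip_family_add: "x \<in> vcarrier E \<Longrightarrow> y \<in> vcarrier E \<Longrightarrow>
    hip E y (\<phi> (a + b) x) = hip E y (\<phi> a x) + hip E y (\<phi> b x)"
  by (simp add: family_add E.ip_simps)

lemma ip_family_scaleC: "x \<in> vcarrier E \<Longrightarrow> y \<in> vcarrier E \<Longrightarrow>
    hip E y (\<phi> (scaleC c a) x) = scaleC c (hip E y (\<phi> a x))"
  by (simp add: family_scaleC E.ip_simps)

lemma ip_family_scaleR: "x \<in> vcarrier E \<Longrightarrow> y \<in> vcarrier E \<Longrightarrow>
    hip E y (\<phi> (r *\<^sub>R a) x) = r *\<^sub>R hip E y (\<phi> a x)"
  using ip_family_scaleC[of x y "of_real r" a] by (simp add: scaleC_of_real)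

lemma ip_family_zero: "x \<in> vcarrier E \<Longrightarrow> y \<in> vcarrier E \<Longrightarrow> hip E y (\<phi> 0 x) = 0"
  using ip_family_scaleC[of x y 0 0] by simp

lemma ip_family_diff: "x \<in> vcarrier E \<Longrightarrow> y \<in> vcarrier E \<Longrightarrow>
    hip E y (\<phi> (a - b) x) = hip E y (\<phi> a x) - hip E y (\<phi> b x)"
  using ip_family_add[of x y "a - b" b] by simp

lemma family_sum: "x \<in> vcarrier E \<Longrightarrow> \<phi> (\<Sum>k<n. f k) x = vsum E n (\<lambda>k. \<phi> (f k) x)"
proof (induction n)
  case 0
  then show ?case by (intro E.ip_eqI) (simp_all add: ip_family_zero E.ip_simps)
qed (simp add: family_add)

text \<open>A positive map is bounded on the positive cone: otherwise pick positive \<open>a\<^sub>n\<close> of norm one with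
  \<open>\<phi> (a\<^sub>n)\<close> larger than \<open>4\<^sup>n\<close>; then \<open>\<phi> (\<Sum> 2\<^sup>-\<^sup>k a\<^sub>k) \<ge> 2\<^sup>-\<^sup>n \<phi> (a\<^sub>n)\<close> for all \<open>n\<close>.\<close>

lemma positive_form_bounded:
  assumes pos: "\<And>a x. cstar_positive a \<Longrightarrow> x \<in> vcarrier E \<Longrightarrow> cstar_positive (hip E x (\<phi> a x))"
  shows "\<exists>K>0. \<forall>a x. cstar_positive a \<longrightarrow> x \<in> vcarrier E \<longrightarrow>
    norm (hip E x (\<phi> a x)) \<le> K * norm a * (hnorm E x)\<^sup>2"
proof (rule ccontr)
  assume *: "\<not> ?thesis"
  have "\<exists>a x. cstar_positive a \<and> norm a = 1 \<and> x \<in> vcarrier E \<and>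
      4 ^ n * (hnorm E x)\<^sup>2 < norm (hip E x (\<phi> a x))" for n :: nat
  proof -
    have "(4::real) ^ n > 0" by simp
    then obtain a x where a: "cstar_positive a" and x: "x \<in> vcarrier E"
      and less: "4 ^ n * norm a * (hnorm E x)\<^sup>2 < norm (hip E x (\<phi> a x))"
      using * by (meson linorder_not_less)
    have "a \<noteq> 0" using less x by (auto simp: ip_family_zero)
    then have na: "norm a > 0" by simp
    have "norm (hip E x (\<phi> ((1 / norm a) *\<^sub>R a) x)) = norm (hip E x (\<phi> a x)) / norm a"
      using x by (simp add: ip_family_scaleR)
    moreover have "4 ^ n * (hnorm E x)\<^sup>2 < norm (hip E x (\<phi> a x)) / norm a"
      using less na by (simp add: pos_less_divide_eq mult_ac)
    moreover have "cstar_positive ((1 / norm a) *\<^sub>R a)" using a by (simp add: cstar_positive_scaleR)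
    ultimately show ?thesis using x na by (intro exI[of _ "(1 / norm a) *\<^sub>R a"] exI[of _ x]) simp
  qed
  then obtain a x where a: "\<And>n. cstar_positive (a n)" "\<And>n. norm (a n) = 1"
    and x: "\<And>n. x n \<in> vcarrier E" "\<And>n::nat. 4 ^ n * (hnorm E (x n))\<^sup>2 < norm (hip E (x n) (\<phi> (a n) (x n)))"
    by metis
  let ?f = "\<lambda>k::nat. (1/2) ^ k *\<^sub>R a k"
  have "summable (\<lambda>k. norm (?f k))" using a(2) summable_geometric[of "1/2::real"] by simp
  then have sf: "summable ?f" by (rule summable_norm_cancel)
  define s where "s = suminf ?f"
  have rest: "cstar_positive (s - ?f n)" for n
  proof (rule cstar_positive_limit)
    have "(\<lambda>N. \<Sum>k<N. ?f k) \<longlonglongrightarrow> s"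
      using summable_sums[OF sf] by (simp add: sums_def s_def)
    \<comment> \<open>With at least \<open>Suc n\<close> summands every partial sum contains the
      \<open>n\<close>-th term, whose removal leaves a sum of positive elements.\<close>
    then have "(\<lambda>N. \<Sum>k<N + Suc n. ?f k) \<longlonglongrightarrow> s" by (rule LIMSEQ_ignore_initial_segment)
    then show "(\<lambda>N. (\<Sum>k<N + Suc n. ?f k) - ?f n) \<longlonglongrightarrow> s - ?f n" by (intro tendsto_diff tendsto_const)
    fix N
    have "(\<Sum>k<N + Suc n. ?f k) - ?f n = (\<Sum>k\<in>{..<N + Suc n} - {n}. ?f k)"
      by (subst sum_diff1) auto
    then show "cstar_positive ((\<Sum>k<N + Suc n. ?f k) - ?f n)"
      by (simp add: cstar_positive_sum cstar_positive_scaleR a)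
  qed
  obtain C where C: "C > 0" "\<And>z. z \<in> vcarrier E \<Longrightarrow> hnorm E (\<phi> s z) \<le> C * hnorm E z"
    using adjointable_bounded[OF family_adjointable[of s]] by blast
  have "2 ^ n < C" for n
  proof -
    have fn: "cstar_positive (?f n)" using a by (simp add: cstar_positive_scaleR)
    have "cstar_positive (hip E (x n) (\<phi> s (x n)) - hip E (x n) (\<phi> (?f n) (x n)))"
      using pos[OF rest x(1), of n n] x by (simp add: ip_family_diff)
    then have "norm (hip E (x n) (\<phi> (?f n) (x n))) \<le> norm (hip E (x n) (\<phi> s (x n)))"
      by (rule cstar_positive_norm_mono[OF pos[OF fn x(1)]])
    also have "\<dots> \<le> hnorm E (x n) * (C * hnorm E (x n))"
      using E.cauchy_schwarz[of "x n" "\<phi> s (x n)"] mult_left_mono[OF C(2)[OF x(1)[of n]], of "hnorm E (x n)"] x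
      by simp
    finally have le: "(1/2) ^ n * norm (hip E (x n) (\<phi> (a n) (x n))) \<le> C * (hnorm E (x n))\<^sup>2"
      using x by (simp add: ip_family_scaleR power2_eq_square mult_ac)
    have "2 ^ n * (hnorm E (x n))\<^sup>2 = (1/2) ^ n * (4 ^ n * (hnorm E (x n))\<^sup>2)"
      by (simp flip: mult.assoc power_mult_distrib)
    also have "\<dots> < (1/2) ^ n * norm (hip E (x n) (\<phi> (a n) (x n)))"
      using x(2)[of n] by (intro mult_strict_left_mono) auto
    also note le
    finally show ?thesis
      by (metis mult_less_cancel_right not_less zero_le_power2)
  qed
  moreover obtain n where "C < 2 ^ n" using real_arch_pow[of 2 C] by auto
  ultimately show False by (metis less_asym)
qed

end

locale cp_family = adjointable_family E \<phi>
  for E :: "('e, 'b::cstar_algebra) hmod" and \<phi> :: "'a::cstar_algebra \<Rightarrow> 'e \<Rightarrow> 'e" +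
  assumes cp: "completely_positive E \<phi>"
begin

text \<open>Complete positivity for 1 by 1 matrices already provides \<open>Y\<close>, which stands
  in for a square root of the operator \<open>\<phi> a\<close>.\<close>

lemma cp_factor:
  assumes "cstar_positive a"
  obtains Y where "Y \<in> adjointable E E" "\<And>x. x \<in> vcarrier E \<Longrightarrow> \<phi> a x = hadj E E Y (Y x)"
proof -
  obtain b where b: "a = star b * b" using assms by (auto simp: cstar_positive_def)
  have "matrix_positive 1 (\<lambda>i j. a)"
    unfolding matrix_positive_def by (intro exI[of _ "\<lambda>i j. b"]) (simp add: b)
  then have "operator_matrix_positive E 1 (\<lambda>i j. \<phi> a)"
    using cp unfolding completely_positive_def by blast
  then obtain Y where Y: "Y (0::nat) (0::nat) \<in> adjointable E E"
    "\<And>x. x \<in> vcarrier E \<Longrightarrow> \<phi> a x = vsum E 1 (\<lambda>k. hadj E E (Y k 0) (Y k 0 x))"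
    unfolding operator_matrix_positive_def by auto
  have "\<phi> a x = hadj E E (Y 0 0) (Y 0 0 x)" if x: "x \<in> vcarrier E" for x
    unfolding Y(2)[OF x] by (rule E.ip_eqI) (use Y(1) x in \<open>simp_all add: E.ip_simps\<close>)
  with Y(1) show thesis by (rule that)
qed

lemma cp_positive:
  assumes "cstar_positive a" "x \<in> vcarrier E"
  shows "cstar_positive (hip E x (\<phi> a x))"
proof -
  obtain Y where Y: "Y \<in> adjointable E E" "\<And>x. x \<in> vcarrier E \<Longrightarrow> \<phi> a x = hadj E E Y (Y x)"
    using cp_factor[OF assms(1)] by blast
  have "hip E x (\<phi> a x) = hip E (Y x) (Y x)"
    using Y assms(2) by (simp add: ip_adjointable_left)
  then show ?thesis using E.ip_positive Y assms(2) by simp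
qed

lemma cp_symmetric_positive:
  assumes "cstar_positive a" "x \<in> vcarrier E" "y \<in> vcarrier E"
  shows "hip E (\<phi> a x) y = hip E x (\<phi> a y)"
proof -
  obtain Y where Y: "Y \<in> adjointable E E" "\<And>x. x \<in> vcarrier E \<Longrightarrow> \<phi> a x = hadj E E Y (Y x)"
    using cp_factor[OF assms(1)] by blast
  show ?thesis
    using ip_adjointable_right[OF Y(1) assms(3), of "Y x"] ip_adjointable_left[OF Y(1) assms(2), of "Y y"]
      Y assms by simp
qed

text \<open>For positive elements the factored form is symmetric, self-adjoint elements are
  differences of positive ones, and a general element is \<open>h + \<i> k\<close> with
  \<open>h\<close> and \<open>k\<close> self-adjoint.\<close>

lemma ip_cp_left:
  assumes x: "x \<in> vcarrier E" and y: "y \<in> vcarrier E"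
  shows "hip E (\<phi> a x) y = hip E x (\<phi> (star a) y)"
proof -
  have sa: "hip E (\<phi> h x) y = hip E x (\<phi> h y)" if h: "star h = h" for h
  proof -
    obtain p n where pn: "cstar_positive p" "cstar_positive n" "h = p - n"
      using selfadjoint_positive_diff[OF h] by blast
    have "hip E (\<phi> h x) y = star (hip E y (\<phi> h x))"
      using E.ip_star[of y "\<phi> h x"] x y by simp
    also have "\<dots> = star (hip E y (\<phi> p x)) - star (hip E y (\<phi> n x))"
      using x y by (simp add: pn(3) ip_family_diff star_diff)
    also have "\<dots> = hip E (\<phi> p x) y - hip E (\<phi> n x) y"
      using E.ip_star[of y "\<phi> p x"] E.ip_star[of y "\<phi> n x"] x y by simp
    also have "\<dots> = hip E x (\<phi> h y)"
      using x y by (simp add: pn(3) cp_symmetric_positive[OF pn(1) x y] cp_symmetric_positive[OF pn(2) x y] ip_family_diff)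
    finally show ?thesis .
  qed
  define h where "h = (1/2) *\<^sub>R (a + star a)"
  define k where "k = scaleC (- \<i> / 2) (a - star a)"
  have h: "star h = h" by (simp add: h_def star_scaleR star_add add.commute)
  have k: "star k = k" by (simp add: k_def star_scaleC star_diff scaleC_diff_right scaleC_minus_left)
  have ik: "scaleC \<i> k = (1/2) *\<^sub>R (a - star a)"
    using scaleC_of_real[of "1/2" "a - star a"] by (simp add: k_def scaleC_scaleC)
  have a: "a = h + scaleC \<i> k" by (simp add: ik h_def algebra_simps flip: scaleR_add_left)
  have sta: "star a = h + scaleC (- \<i>) k" by (simp add: a star_add star_scaleC h k)
  have "hip E (\<phi> a x) y = hip E (\<phi> h x) y + scaleC (- \<i>) (hip E (\<phi> k x) y)"
    using x y by (simp add: a family_add family_scaleC E.ip_simps)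
  also have "\<dots> = hip E x (\<phi> (star a) y)"
    using x y by (simp add: sta sa[OF h] sa[OF k] ip_family_add ip_family_scaleC)
  finally show ?thesis .
qed

lemma hadj_cp: "hadj E E (\<phi> a) = \<phi> (star a)"
  by (rule adjointableI(2)) (simp_all add: adjointable_extensional ip_cp_left)

text \<open>The bound on the quadratic form says that the factor \<open>Y\<close> of
  \<open>\<phi> a\<close> has norm at most the root of \<open>K * norm a\<close>. Its adjoint has
  the same bound, and \<open>\<phi> a\<close> is \<open>Y\<close> followed by this adjoint.\<close>

lemma cp_bounded:
  obtains K where "K > 0" "\<And>a x. cstar_positive a \<Longrightarrow> x \<in> vcarrier E \<Longrightarrow>
    hnorm E (\<phi> a x) \<le> K * norm a * hnorm E x"
proof -
  obtain K where K: "K > 0" "\<And>a x. cstar_positive a \<Longrightarrow> x \<in> vcarrier E \<Longrightarrow>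
      norm (hip E x (\<phi> a x)) \<le> K * norm a * (hnorm E x)\<^sup>2"
    using positive_form_bounded[OF cp_positive] by blast
  have "hnorm E (\<phi> a x) \<le> K * norm a * hnorm E x" if a: "cstar_positive a" and x: "x \<in> vcarrier E" for a x
  proof -
    obtain Y where Y: "Y \<in> adjointable E E" "\<And>x. x \<in> vcarrier E \<Longrightarrow> \<phi> a x = hadj E E Y (Y x)"
      using cp_factor[OF a] by blast
    let ?r = "sqrt (K * norm a)"
    have r: "?r \<ge> 0" "?r * ?r = K * norm a" using K by simp_all
    have Yb: "hnorm E (Y z) \<le> ?r * hnorm E z" if z: "z \<in> vcarrier E" for z
    proof (rule E.hnorm_le)
      have "hip E (Y z) (Y z) = hip E z (\<phi> a z)" using Y z by (simp add: ip_adjointable_left)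
      then show "norm (hip E (Y z) (Y z)) \<le> (?r * hnorm E z)\<^sup>2"
        using K(2)[OF a z] K(1) by (simp add: power_mult_distrib)
    qed (use K in simp)
    have "hnorm E (\<phi> a x) \<le> ?r * hnorm E (Y x)"
      unfolding Y(2)[OF x] by (rule adjoint_bound[OF Y(1) r(1) Yb]) (use Y(1) x in auto)
    also have "\<dots> \<le> ?r * (?r * hnorm E x)" by (rule mult_left_mono[OF Yb[OF x] r(1)])
    finally show ?thesis using r(2) by (simp flip: mult.assoc)
  qed
  with K(1) show thesis by (rule that)
qed

text \<open>The matrix of the \<open>star (a i) * a j\<close> is \<open>X\<^sup>* X\<close> for the
  matrix whose only nonzero row consists of the \<open>a i\<close>. The entries of the operator
  factor \<open>Y\<close> then collect into vectors \<open>u k\<close>, and the double sum is the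
  sum of the \<open>\<langle>u k, u k\<rangle>\<close>.\<close>

lemma cp_gram_positive:
  fixes n :: nat
  assumes x: "\<And>i. i < n \<Longrightarrow> x i \<in> vcarrier E"
  shows "cstar_positive (\<Sum>i<n. \<Sum>j<n. hip E (x i) (\<phi> (star (a i) * a j) (x j)))"
proof -
  have "matrix_positive n (\<lambda>i j. star (a i) * a j)"
    unfolding matrix_positive_def
  proof (intro exI[of _ "\<lambda>k i. if k = 0 then a i else 0"] allI impI)
    fix i j assume "i < n" "j < n"
    have "(\<Sum>k<n. star (if k = 0 then a i else 0) * (if k = 0 then a j else 0)) =
        (\<Sum>k<n. if k = 0 then star (a i) * a j else 0)"
      by (rule sum.cong) auto
    then show "star (a i) * a j = (\<Sum>k<n. star (if k = 0 then a i else 0) * (if k = 0 then a j else 0))"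
      using \<open>i < n\<close> by simp
  qed
  then have "operator_matrix_positive E n (\<lambda>i j. \<phi> (star (a i) * a j))"
    using cp unfolding completely_positive_def by blast
  then obtain Y where Y: "\<And>i j. i < n \<Longrightarrow> j < n \<Longrightarrow> Y i j \<in> adjointable E E"
    "\<And>i j z. i < n \<Longrightarrow> j < n \<Longrightarrow> z \<in> vcarrier E \<Longrightarrow>
      \<phi> (star (a i) * a j) z = vsum E n (\<lambda>k. hadj E E (Y k i) (Y k j z))"
    unfolding operator_matrix_positive_def by blast
  define u where "u = (\<lambda>k. vsum E n (\<lambda>i. Y k i (x i)))"
  have Yx: "Y k i (x i) \<in> vcarrier E" if "k < n" "i < n" for k i
    using Y(1) x that by simp
  have "(\<Sum>i<n. \<Sum>j<n. hip E (x i) (\<phi> (star (a i) * a j) (x j))) =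
      (\<Sum>i<n. \<Sum>j<n. \<Sum>k<n. hip E (Y k i (x i)) (Y k j (x j)))"
    by (intro sum.cong refl)
      (simp add: Y x Yx E.ip_vsum_right ip_adjointable_left)
  also have "\<dots> = (\<Sum>i<n. \<Sum>k<n. \<Sum>j<n. hip E (Y k i (x i)) (Y k j (x j)))"
    by (intro sum.cong refl sum.swap)
  also have "\<dots> = (\<Sum>k<n. \<Sum>i<n. \<Sum>j<n. hip E (Y k i (x i)) (Y k j (x j)))"
    by (rule sum.swap)
  also have "\<dots> = (\<Sum>k<n. hip E (u k) (u k))"
    by (intro sum.cong refl) (simp add: u_def Yx E.ip_vsum_right E.ip_vsum_left E.vsum_closed, rule sum.swap)
  also have "cstar_positive \<dots>"
    by (intro cstar_positive_sum E.ip_positive) (simp add: u_def E.vsum_closed Yx)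
  finally show ?thesis .
qed

end

lemma cp_familyI: "hilbert E \<Longrightarrow> completely_positive E \<phi> \<Longrightarrow> cp_family E \<phi>"
  by (intro cp_family.intro adjointable_family.intro hilbert_pairI)
    (simp_all add: completely_positive_def adjointable_family_axioms_def cp_family_axioms_def)

text \<open>A representation respects products and adjoints, so it carries a factorization of a
  matrix entry by entry to one of the operator matrix.\<close>

lemma star_representation_completely_positive:
  assumes E: "hilbert E" and \<pi>: "star_representation E \<pi>"
  shows "completely_positive E \<pi>"
proof -
  interpret adjointable_family E \<pi>
    using \<pi> by (intro adjointable_family.intro hilbert_pairI E)
      (simp add: adjointable_family_axioms_def star_representation_def)
  have "operator_matrix_positive E n (\<lambda>i j. \<pi> (M i j))" if M: "matrix_positive n M" for n M
  proof -
    obtain X where X: "\<And>i j. i < n \<Longrightarrow> j < n \<Longrightarrow> M i j = (\<Sum>k<n. star (X k i) * X k j)"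
      using M unfolding matrix_positive_def by blast
    have "\<pi> (M i j) x = vsum E n (\<lambda>k. hadj E E (\<pi> (X k i)) (\<pi> (X k j) x))"
      if "i < n" "j < n" "x \<in> vcarrier E" for i j x
      using \<pi> that by (simp add: X family_sum star_representation_def)
    then show ?thesis
      unfolding operator_matrix_positive_def by (intro exI[of _ "\<lambda>i j. \<pi> (X i j)"]) simp
  qed
  then show ?thesis using linear by (simp add: completely_positive_def)
qed

section \<open>Completed tensor products\<close>

lemma lookup_fscale [simp]: "Poly_Mapping.lookup (fscale c p) k = c * Poly_Mapping.lookup p k"
  by (simp add: fscale_def Poly_Mapping.map.rep_eq when_def)

lemma module_fscale: "module fscale"
  by standard (rule poly_mapping_eqI; simp add: lookup_add algebra_simps)+

section \<open>Sesquilinear extension of a kernel to formal sums\<close>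

definition sesquilinear_form ::
  "('k \<Rightarrow> 'k \<Rightarrow> 'c::cstar_algebra) \<Rightarrow> ('k \<Rightarrow>\<^sub>0 complex) \<Rightarrow> ('k \<Rightarrow>\<^sub>0 complex) \<Rightarrow> 'c" where
  "sesquilinear_form g p q = (\<Sum>k\<in>Poly_Mapping.keys p. \<Sum>l\<in>Poly_Mapping.keys q.
     scaleC (cnj (Poly_Mapping.lookup p k) * Poly_Mapping.lookup q l) (g k l))"

lemma sesquilinear_form_superset:
  assumes "finite A" "finite B" "Poly_Mapping.keys p \<subseteq> A" "Poly_Mapping.keys q \<subseteq> B"
  shows "sesquilinear_form g p q =
    (\<Sum>k\<in>A. \<Sum>l\<in>B. scaleC (cnj (Poly_Mapping.lookup p k) * Poly_Mapping.lookup q l) (g k l))"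
proof -
  have "sesquilinear_form g p q = (\<Sum>k\<in>Poly_Mapping.keys p. \<Sum>l\<in>B.
      scaleC (cnj (Poly_Mapping.lookup p k) * Poly_Mapping.lookup q l) (g k l))"
    unfolding sesquilinear_form_def
    by (intro sum.cong refl sum.mono_neutral_left) (use assms in \<open>auto simp: in_keys_iff\<close>)
  also have "\<dots> = (\<Sum>k\<in>A. \<Sum>l\<in>B.
      scaleC (cnj (Poly_Mapping.lookup p k) * Poly_Mapping.lookup q l) (g k l))"
    by (intro sum.mono_neutral_left) (use assms in \<open>auto simp: in_keys_iff\<close>)
  finally show ?thesis .
qed

lemma sesquilinear_form_add_right:
  "sesquilinear_form g z (p + q) = sesquilinear_form g z p + sesquilinear_form g z q"
proof -
  let ?B = "Poly_Mapping.keys p \<union> Poly_Mapping.keys q"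
  note * = sesquilinear_form_superset[of "Poly_Mapping.keys z" ?B z]
  have "Poly_Mapping.keys (p + q) \<subseteq> ?B" by (auto simp: in_keys_iff lookup_add)
  then show ?thesis
    by (simp add: *[of p] *[of q] *[of "p + q"] lookup_add distrib_left scaleC_add_left sum.distrib)
qed

lemma sesquilinear_form_fscale_right:
  "sesquilinear_form g z (fscale c p) = scaleC c (sesquilinear_form g z p)"
proof -
  have "Poly_Mapping.keys (fscale c p) \<subseteq> Poly_Mapping.keys p" by (auto simp: in_keys_iff)
  then show ?thesis
    by (subst (1) sesquilinear_form_superset[of "Poly_Mapping.keys z" "Poly_Mapping.keys p"])
      (simp_all add: sesquilinear_form_def scaleC_sum_right scaleC_scaleC mult_ac)
qed

lemma sesquilinear_form_zero_right [simp]: "sesquilinear_form g z 0 = 0"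
  by (simp add: sesquilinear_form_def)

lemma sesquilinear_form_diff_right:
  "sesquilinear_form g z (p - q) = sesquilinear_form g z p - sesquilinear_form g z q"
  using sesquilinear_form_add_right[of g z "p - q" q] by simp

lemma sesquilinear_form_sum_right:
  "sesquilinear_form g z (sum f A) = (\<Sum>a\<in>A. sesquilinear_form g z (f a))"
  by (induction A rule: infinite_finite_induct) (simp_all add: sesquilinear_form_add_right)

lemma sesquilinear_form_single [simp]:
  "sesquilinear_form g (Poly_Mapping.single k 1) (Poly_Mapping.single l 1) = g k l"
  by (simp add: sesquilinear_form_def)

lemma sesquilinear_form_expand_left:
  "sesquilinear_form g p q = (\<Sum>k\<in>Poly_Mapping.keys p.
     scaleC (cnj (Poly_Mapping.lookup p k)) (sesquilinear_form g (Poly_Mapping.single k 1) q))"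
  by (simp add: sesquilinear_form_def scaleC_sum_right scaleC_scaleC)

lemma sesquilinear_form_expand_right:
  "sesquilinear_form g p q = (\<Sum>l\<in>Poly_Mapping.keys q.
     scaleC (Poly_Mapping.lookup q l) (sesquilinear_form g p (Poly_Mapping.single l 1)))"
  unfolding sesquilinear_form_def
  by (subst sum.swap) (simp add: scaleC_sum_right scaleC_scaleC mult_ac)

text \<open>These conditions make the extension of \<open>g\<close> descend to the quotient, so that
  the choice of representatives becomes invisible. Vanishing on relations is asked in the second
  argument and \<open>hermitian\<close> carries it to the first. The interior tensor product and the
  KSGNS module are the two instances.\<close>

locale tensor_form =
  fixes V :: "('v, 'm) cvec_scheme" and W :: "('w, 'c::cstar_algebra) hmod"
    and R :: "('v, 'w) formal set" and g :: "'v \<times> 'w \<Rightarrow> 'v \<times> 'w \<Rightarrow> 'c"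
  assumes vanish: "k \<in> vcarrier V \<times> vcarrier W \<Longrightarrow> r \<in> bilinear_relations V W \<union> R \<Longrightarrow>
      sesquilinear_form g (Poly_Mapping.single k 1) r = 0"
    and hermitian: "k \<in> vcarrier V \<times> vcarrier W \<Longrightarrow> l \<in> vcarrier V \<times> vcarrier W \<Longrightarrow> star (g k l) = g l k"
    and act_closed: "y \<in> vcarrier W \<Longrightarrow> hact W y c \<in> vcarrier W"
    and act: "k \<in> vcarrier V \<times> vcarrier W \<Longrightarrow> x \<in> vcarrier V \<Longrightarrow> y \<in> vcarrier W \<Longrightarrow>
      g k (x, hact W y c) = g k (x, y) * c"
    and positive: "p \<in> formal_sums V W \<Longrightarrow> cstar_positive (sesquilinear_form g p p)"
begin

abbreviation "form \<equiv> sesquilinear_form g"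
abbreviation "cls \<equiv> tclass V W R"
abbreviation "S \<equiv> semi_tensor V W R g"

lemma form_span:
  assumes "z \<in> formal_sums V W" "r \<in> module.span fscale (bilinear_relations V W \<union> R)"
  shows "form z r = 0"
proof -
  interpret module fscale by (rule module_fscale)
  have zero: "form z s = 0" if "s \<in> bilinear_relations V W \<union> R" for s
    unfolding sesquilinear_form_expand_left[of g z]
    by (rule sum.neutral) (use assms(1) vanish[OF _ that] in \<open>auto simp: formal_sums_def\<close>)
  obtain t c where "t \<subseteq> bilinear_relations V W \<union> R" "r = (\<Sum>s\<in>t. fscale (c s) s)"
    using assms(2) unfolding span_explicit by blast
  moreover from this have "(\<Sum>s\<in>t. scaleC (c s) (form z s)) = 0"
    by (intro sum.neutral ballI) (simp add: zero subset_iff)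
  ultimately show ?thesis
    by (simp add: sesquilinear_form_sum_right sesquilinear_form_fscale_right)
qed

lemma form_hermitian:
  assumes "p \<in> formal_sums V W" "q \<in> formal_sums V W"
  shows "star (form p q) = form q p"
proof -
  have "star (form p q) = (\<Sum>k\<in>Poly_Mapping.keys p. \<Sum>l\<in>Poly_Mapping.keys q.
      scaleC (cnj (Poly_Mapping.lookup q l) * Poly_Mapping.lookup p k) (g l k))"
    unfolding sesquilinear_form_def star_sum
  proof (intro sum.cong refl)
    fix k l assume "k \<in> Poly_Mapping.keys p" "l \<in> Poly_Mapping.keys q"
    then have "star (g k l) = g l k" using assms by (intro hermitian) (auto simp: formal_sums_def)
    then show "star (scaleC (cnj (Poly_Mapping.lookup p k) * Poly_Mapping.lookup q l) (g k l)) =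
        scaleC (cnj (Poly_Mapping.lookup q l) * Poly_Mapping.lookup p k) (g l k)"
      by (simp add: star_scaleC mult.commute)
  qed
  then show ?thesis unfolding sesquilinear_form_def by (subst sum.swap)
qed

text \<open>Two representatives of a class differ by an element of the span of the relations, on
  which the form vanishes.\<close>

lemma some_rep_cls:
  assumes "p \<in> formal_sums V W"
  shows "some_rep (cls p) \<in> formal_sums V W"
    and "z \<in> formal_sums V W \<Longrightarrow> form z (some_rep (cls p)) = form z p"
proof -
  interpret module fscale by (rule module_fscale)
  have "p \<in> cls p" using assms by (simp add: tclass_def span_zero)
  then have "some_rep (cls p) \<in> cls p" unfolding some_rep_def by (rule someI[of "\<lambda>q. q \<in> cls p"])
  then have *: "some_rep (cls p) \<in> formal_sums V W"
    "some_rep (cls p) - p \<in> span (bilinear_relations V W \<union> R)" by (auto simp: tclass_def)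
  show "some_rep (cls p) \<in> formal_sums V W" by fact
  show "form z (some_rep (cls p)) = form z p" if "z \<in> formal_sums V W"
    using form_span[OF that *(2)] by (simp add: sesquilinear_form_diff_right)
qed

lemma formal_sums_closed:
  "0 \<in> formal_sums V W"
  "p \<in> formal_sums V W \<Longrightarrow> q \<in> formal_sums V W \<Longrightarrow> p + q \<in> formal_sums V W"
  "p \<in> formal_sums V W \<Longrightarrow> fscale c p \<in> formal_sums V W"
  "k \<in> vcarrier V \<times> vcarrier W \<Longrightarrow> Poly_Mapping.single k 1 \<in> formal_sums V W"
proof -
  show "p + q \<in> formal_sums V W" if "p \<in> formal_sums V W" "q \<in> formal_sums V W"
    using that Poly_Mapping.keys_add[of p q] by (auto simp: formal_sums_def)
  have "Poly_Mapping.keys (fscale c p) \<subseteq> Poly_Mapping.keys p" by (auto simp: in_keys_iff)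
  then show "fscale c p \<in> formal_sums V W" if "p \<in> formal_sums V W"
    using that by (auto simp: formal_sums_def)
qed (auto simp: formal_sums_def)

lemma formal_sums_sum:
  "(\<And>a. a \<in> A \<Longrightarrow> f a \<in> formal_sums V W) \<Longrightarrow> sum f A \<in> formal_sums V W"
  by (induction A rule: infinite_finite_induct) (auto intro: formal_sums_closed)

definition formal_act :: "('v, 'w) formal \<Rightarrow> 'c \<Rightarrow> ('v, 'w) formal" where
  "formal_act p c = (\<Sum>k\<in>Poly_Mapping.keys p.
     fscale (Poly_Mapping.lookup p k) (elem (fst k) (hact W (snd k) c)))"

lemma formal_act_closed: "p \<in> formal_sums V W \<Longrightarrow> formal_act p c \<in> formal_sums V W"
  unfolding formal_act_def
  by (intro formal_sums_sum formal_sums_closed) (auto simp: formal_sums_def act_closed)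

lemma form_act:
  assumes z: "z \<in> formal_sums V W" and p: "p \<in> formal_sums V W"
  shows "form z (formal_act p c) = form z p * c"
proof -
  have "form z (elem (fst l) (hact W (snd l) c)) = form z (Poly_Mapping.single l 1) * c"
    if l: "l \<in> Poly_Mapping.keys p" for l
  proof -
    have "l \<in> vcarrier V \<times> vcarrier W" using p l by (auto simp: formal_sums_def)
    then have "g k (fst l, hact W (snd l) c) = g k l * c" if "k \<in> Poly_Mapping.keys z" for k
      using act[of k "fst l" "snd l" c] z that by (auto simp: formal_sums_def)
    then show ?thesis
      by (simp add: sesquilinear_form_expand_left[of g z] sum_distrib_right mult_scaleC_left cong: sum.cong)
  qed
  then show ?thesis
    by (simp add: formal_act_def sesquilinear_form_sum_right sesquilinear_form_fscale_right
        sesquilinear_form_expand_right[of g z p] sum_distrib_right mult_scaleC_left cong: sum.cong)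
qed

lemma semi_tensor_simps:
  "vcarrier S = cls ` formal_sums V W"
  "vzero S = cls 0"
  "vadd S X Y = cls (some_rep X + some_rep Y)"
  "vscale S c X = cls (fscale c (some_rep X))"
  "hact S X b = cls (formal_act (some_rep X) b)"
  by (simp_all add: semi_tensor_def formal_act_def)

lemma ip_cls:
  assumes p: "p \<in> formal_sums V W" and q: "q \<in> formal_sums V W"
  shows "hip S (cls p) (cls q) = form p q"
proof -
  note p' = some_rep_cls[OF p] and q' = some_rep_cls[OF q]
  have "hip S (cls p) (cls q) = form (some_rep (cls p)) (some_rep (cls q))"
    by (simp add: semi_tensor_def sesquilinear_form_def)
  also have "\<dots> = star (form q (some_rep (cls p)))"
    using q'(2)[OF p'(1)] form_hermitian[OF q p'(1)] by simp
  also have "\<dots> = form p q" by (simp add: p'(2)[OF q] form_hermitian[OF q p])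
  finally show ?thesis .
qed

lemma semi_hilbert_semi_tensor: "semi_hilbert S"
  by standard
    (auto simp: semi_tensor_simps ip_cls formal_sums_closed some_rep_cls formal_act_closed form_act
      sesquilinear_form_add_right sesquilinear_form_fscale_right form_hermitian positive)

abbreviation "generator k \<equiv> cauchy_class S (\<lambda>n. cls (Poly_Mapping.single k 1))"

lemma single_in_carrier: "k \<in> vcarrier V \<times> vcarrier W \<Longrightarrow> cls (Poly_Mapping.single k 1) \<in> vcarrier S"
  by (auto simp: semi_tensor_simps intro!: imageI formal_sums_closed)

lemma ip_generator:
  assumes "k \<in> vcarrier V \<times> vcarrier W" "l \<in> vcarrier V \<times> vcarrier W"
  shows "hip (completed_module S) (generator k) (generator l) = g k l"
proof -
  interpret S: semi_hilbert S by (rule semi_hilbert_semi_tensor)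
  show ?thesis
    using assms by (simp add: S.completed_ip_const single_in_carrier ip_cls formal_sums_closed)
qed

text \<open>A class and the combination of elementary tensors read off from a representative have
  the same inner products with all classes. Their difference therefore has norm 0, and the
  completion does not see it.\<close>

theorem generated_by_tensors:
  "generated_by (completed_module S) (vcarrier V \<times> vcarrier W) generator"
  unfolding generated_by_def
proof (intro conjI ballI allI impI)
  interpret S: semi_hilbert S by (rule semi_hilbert_semi_tensor)
  interpret H: hilbert "completed_module S" by (rule S.hilbert_completed)
  show "hilbert (completed_module S)" by (rule S.hilbert_completed)
  show gc: "generator k \<in> vcarrier (completed_module S)" if "k \<in> vcarrier V \<times> vcarrier W" for k
    by (rule S.completed_const_in[OF single_in_carrier[OF that]])
  fix X and e :: real assume X: "X \<in> vcarrier (completed_module S)" and e: "e > 0"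
  obtain x where x: "x \<in> vcarrier S"
    "hdist (completed_module S) X (S.completed_const x) < e"
    using S.completed_dense[OF X e] by blast
  obtain p where p: "p \<in> formal_sums V W" "x = cls p" using x(1) by (auto simp: semi_tensor_simps)
  obtain ks where ks: "set ks = Poly_Mapping.keys p" "distinct ks"
    using finite_distinct_list[OF finite_keys[of p]] by auto
  define L where "L = map (\<lambda>k. (Poly_Mapping.lookup p k, k)) ks"
  have kL: "snd ` set L \<subseteq> vcarrier V \<times> vcarrier W"
  proof -
    have "snd ` set L = set ks" unfolding L_def by (induction ks) auto
    then show ?thesis using p(1) unfolding ks(1) formal_sums_def by blast
  qed
  let ?s = "\<lambda>k. cls (Poly_Mapping.single k 1)"
  have sL: "lincomb S ?s M \<in> vcarrier S" if "snd ` set M \<subseteq> vcarrier V \<times> vcarrier W" for M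
    by (rule S.lincomb_closed[OF _ that]) (rule single_in_carrier)
  have lc: "lincomb (completed_module S) generator M = S.completed_const (lincomb S ?s M)"
    if "snd ` set M \<subseteq> vcarrier V \<times> vcarrier W" for M
    using that
  proof (induction M)
    case Nil
    show ?case by (simp add: S.completed_zero)
  next
    case (Cons q M)
    then have "?s (snd q) \<in> vcarrier S" "lincomb S ?s M \<in> vcarrier S"
      by (auto intro!: single_in_carrier sL)
    with Cons show ?case
      by (simp add: S.completed_scale S.completed_add S.hCauchy_const)
  qed
  have ip_lc: "hip S (cls q) (lincomb S ?s L) = form q p" if q: "q \<in> formal_sums V W" for q
  proof -
    have qS: "cls q \<in> vcarrier S" using q by (simp add: semi_tensor_simps)
    have "hip S (cls q) (lincomb S ?s M) = (\<Sum>m\<leftarrow>M. scaleC (fst m) (form q (Poly_Mapping.single (snd m) 1)))"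
      if "snd ` set M \<subseteq> vcarrier V \<times> vcarrier W" for M
      using that
    proof (induction M)
      case Nil
      show ?case using q by (simp add: semi_tensor_simps ip_cls formal_sums_closed)
    next
      case (Cons m M)
      then have "?s (snd m) \<in> vcarrier S" "lincomb S ?s M \<in> vcarrier S" "snd m \<in> vcarrier V \<times> vcarrier W"
        by (auto intro!: single_in_carrier sL)
      with Cons q show ?case
        by (simp add: S.ip_simps ip_cls formal_sums_closed qS)
    qed
    from this[OF kL] show ?thesis
      by (simp add: L_def o_def sesquilinear_form_expand_right[of g q p] ks(2) sum_list_distinct_conv_sum_set flip: ks(1))
  qed
  let ?d = "vdiff S x (lincomb S ?s L)"
  have d: "?d \<in> vcarrier S" using x sL[OF kL] by simp
  then obtain q where q: "q \<in> formal_sums V W" "?d = cls q" by (auto simp: semi_tensor_simps)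
  have "hip S ?d ?d = hip S ?d x - hip S ?d (lincomb S ?s L)"
    by (rule S.ip_diff_right[OF d x(1) sL[OF kL]])
  also have "\<dots> = hip S (cls q) x - hip S (cls q) (lincomb S ?s L)" by (simp only: q(2))
  also have "\<dots> = 0" by (simp add: p(2) ip_lc[OF q(1)] ip_cls[OF q(1) p(1)])
  finally have "hnorm S ?d = 0" by (simp add: hnorm_def)
  then have "hdist (completed_module S) (S.completed_const x) (lincomb (completed_module S) generator L) = 0"
    by (simp add: lc[OF kL] S.completed_const_vdiff x sL[OF kL])
  moreover have "hdist (completed_module S) X (lincomb (completed_module S) generator L) \<le>
      hdist (completed_module S) X (S.completed_const x) +
      hdist (completed_module S) (S.completed_const x) (lincomb (completed_module S) generator L)"
    by (rule H.hnorm_vdiff_triangle[OF X S.completed_const_in[OF x(1)]])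
      (simp add: lc[OF kL] S.completed_const_in sL[OF kL])
  ultimately show "\<exists>L. snd ` set L \<subseteq> vcarrier V \<times> vcarrier W \<and>
      hdist (completed_module S) X (lincomb (completed_module S) generator L) < e"
    using x(2) kL by (intro exI[of _ L]) simp
qed

end

text \<open>Positivity of Gram sums is proved for families indexed by an initial segment of the
  naturals; the support of a formal sum is enumerated to match.\<close>

lemma sesquilinear_form_enum:
  obtains n :: nat and k :: "nat \<Rightarrow> 'k" where "\<And>i. i < n \<Longrightarrow> k i \<in> Poly_Mapping.keys p"
    "sesquilinear_form g p p = (\<Sum>i<n. \<Sum>j<n.
       scaleC (cnj (Poly_Mapping.lookup p (k i)) * Poly_Mapping.lookup p (k j)) (g (k i) (k j)))"
proof -
  obtain k where k: "bij_betw k {0..<card (Poly_Mapping.keys p)} (Poly_Mapping.keys p)"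
    using ex_bij_betw_nat_finite[OF finite_keys] by blast
  then have k: "bij_betw k {..<card (Poly_Mapping.keys p)} (Poly_Mapping.keys p)"
    by (simp add: atLeast0LessThan)
  show thesis
  proof (rule that)
    show "k i \<in> Poly_Mapping.keys p" if "i < card (Poly_Mapping.keys p)" for i
      using bij_betw_apply[OF k] that by simp
    show "sesquilinear_form g p p = (\<Sum>i<card (Poly_Mapping.keys p). \<Sum>j<card (Poly_Mapping.keys p).
        scaleC (cnj (Poly_Mapping.lookup p (k i)) * Poly_Mapping.lookup p (k j)) (g (k i) (k j)))"
      unfolding sesquilinear_form_def
      by (subst (1 2) sum.reindex_bij_betw[OF k, symmetric]) (rule refl)
  qed
qed

lemma form_bilinear_relations:
  assumes "\<And>x x' y. x \<in> vcarrier V \<Longrightarrow> x' \<in> vcarrier V \<Longrightarrow> y \<in> vcarrier W \<Longrightarrow>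
      g k (vadd V x x', y) = g k (x, y) + g k (x', y)"
    and "\<And>x y y'. x \<in> vcarrier V \<Longrightarrow> y \<in> vcarrier W \<Longrightarrow> y' \<in> vcarrier W \<Longrightarrow>
      g k (x, vadd W y y') = g k (x, y) + g k (x, y')"
    and "\<And>c x y. x \<in> vcarrier V \<Longrightarrow> y \<in> vcarrier W \<Longrightarrow> g k (vscale V c x, y) = scaleC c (g k (x, y))"
    and "\<And>c x y. x \<in> vcarrier V \<Longrightarrow> y \<in> vcarrier W \<Longrightarrow> g k (x, vscale W c y) = scaleC c (g k (x, y))"
    and "r \<in> bilinear_relations V W"
  shows "sesquilinear_form g (Poly_Mapping.single k 1) r = 0"
  using assms(5) unfolding bilinear_relations_def
  by (auto simp: sesquilinear_form_diff_right sesquilinear_form_fscale_right assms(1-4))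

section \<open>Strictness on generators\<close>

text \<open>Positive elements of norm at most 1 act with one common bound, so the Cauchy condition
  spreads from generators to the closure of their span. For such \<open>u\<close> the adjoint of
  \<open>\<phi> u\<close> is \<open>\<phi> u\<close>, and the two seminorms coincide.\<close>

lemma (in cp_family) strict_on_generators:
  assumes gen: "generated_by E I h" and unit: "approximate_unit \<F>"
    and cauchy: "\<And>i e. i \<in> I \<Longrightarrow> e > 0 \<Longrightarrow> \<exists>P. eventually P \<F> \<and>
      (\<forall>u v. P u \<longrightarrow> P v \<longrightarrow> hdist E (\<phi> u (h i)) (\<phi> v (h i)) < e)"
  shows "strict E \<phi>"
proof -
  obtain K where K: "K > 0" "\<And>a x. cstar_positive a \<Longrightarrow> x \<in> vcarrier E \<Longrightarrow>
      hnorm E (\<phi> a x) \<le> K * norm a * hnorm E x" using cp_bounded by blast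
  have h: "h i \<in> vcarrier E" if "i \<in> I" for i using gen that by (simp add: generated_by_def)
  have lc: "lincomb E h L \<in> vcarrier E" if "snd ` set L \<subseteq> I" for L
    by (rule E.lincomb_closed[OF _ that]) (rule h)
  have comb: "\<exists>P. eventually P \<F> \<and> (\<forall>u v. P u \<longrightarrow> P v \<longrightarrow>
      hdist E (\<phi> u (lincomb E h L)) (\<phi> v (lincomb E h L)) < e)"
    if "snd ` set L \<subseteq> I" "e > 0" for L e
    using that
  proof (induction L arbitrary: e)
    case Nil
    have "\<phi> u (vzero E) = vzero E" for u by (rule adjointable_zero) simp
    then show ?case using Nil by (intro exI[of _ "\<lambda>u. True"]) simp
  next
    case (Cons q L)
    have q: "snd q \<in> I" and L: "snd ` set L \<subseteq> I" using Cons.prems by auto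
    define c where "c = cmod (fst q) + 1"
    have c: "c > 0" "cmod (fst q) \<le> c" by (simp_all add: c_def add_nonneg_pos)
    obtain P where P: "eventually P \<F>" "\<And>u v. P u \<Longrightarrow> P v \<Longrightarrow>
        hdist E (\<phi> u (h (snd q))) (\<phi> v (h (snd q))) < e / (2 * c)"
      using cauchy[OF q, of "e / (2 * c)"] Cons.prems(2) c by auto
    obtain Q where Q: "eventually Q \<F>" "\<And>u v. Q u \<Longrightarrow> Q v \<Longrightarrow>
        hdist E (\<phi> u (lincomb E h L)) (\<phi> v (lincomb E h L)) < e / 2"
      using Cons.IH[OF L, of "e / 2"] Cons.prems(2) by auto
    have "hdist E (\<phi> u (lincomb E h (q # L))) (\<phi> v (lincomb E h (q # L))) < e"
      if "P u \<and> Q u" "P v \<and> Q v" for u v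
    proof -
      have "hdist E (\<phi> u (lincomb E h (q # L))) (\<phi> v (lincomb E h (q # L))) \<le>
          hdist E (vscale E (fst q) (\<phi> u (h (snd q)))) (vscale E (fst q) (\<phi> v (h (snd q)))) +
          hdist E (\<phi> u (lincomb E h L)) (\<phi> v (lincomb E h L))"
        using E.hnorm_vdiff_add_le h[OF q] lc[OF L] by (simp add: adjointable_add adjointable_scale)
      also have "hdist E (vscale E (fst q) (\<phi> u (h (snd q)))) (vscale E (fst q) (\<phi> v (h (snd q)))) \<le>
          c * hdist E (\<phi> u (h (snd q))) (\<phi> v (h (snd q)))"
        using h[OF q] c by (simp add: E.hnorm_vdiff_scale mult_right_mono)
      also have "\<dots> \<le> e / 2"
        using P(2)[of u v] that c(1) by (simp add: field_simps)
      also have "hdist E (\<phi> u (lincomb E h L)) (\<phi> v (lincomb E h L)) < e / 2"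
        using Q(2) that by blast
      finally show ?thesis by simp
    qed
    then show ?case using eventually_conj[OF P(1) Q(1)]
      by (intro exI[of _ "\<lambda>u. P u \<and> Q u"]) blast
  qed
  have ev: "\<forall>\<^sub>F u in \<F>. cstar_positive u \<and> norm u \<le> 1" using unit by (simp add: approximate_unit_def)
  have "strictly_Cauchy E \<phi> \<F>"
    unfolding strictly_Cauchy_def
  proof (intro ballI allI impI)
    fix x and e :: real assume x: "x \<in> vcarrier E" and e: "e > 0"
    \<comment> \<open>Three errors of size \<open>e / 3\<close>: from \<open>x\<close> to the
      combination under \<open>\<phi> u\<close>, from \<open>u\<close> to \<open>v\<close> on the
      combination, and back to \<open>x\<close> under \<open>\<phi> v\<close>.\<close>
    obtain L where L: "snd ` set L \<subseteq> I" "hdist E x (lincomb E h L) < e / (3 * K)"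
      using gen x e K(1) unfolding generated_by_def
      by (metis divide_pos_pos mult_pos_pos zero_less_numeral)
    obtain P where P: "eventually P \<F>" "\<And>u v. P u \<Longrightarrow> P v \<Longrightarrow>
        hdist E (\<phi> u (lincomb E h L)) (\<phi> v (lincomb E h L)) < e / 3"
      using comb[OF L(1), of "e / 3"] e by auto
    let ?Q = "\<lambda>u. P u \<and> cstar_positive u \<and> norm u \<le> 1"
    have near: "hdist E (\<phi> u x) (\<phi> u (lincomb E h L)) < e / 3" if "?Q u" for u
    proof -
      have "hdist E (\<phi> u x) (\<phi> u (lincomb E h L)) = hnorm E (\<phi> u (vdiff E x (lincomb E h L)))"
        using x lc[OF L(1)] by (simp add: adjointable_diff)
      also have "\<dots> \<le> K * norm u * hdist E x (lincomb E h L)"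
        using K(2)[of u "vdiff E x (lincomb E h L)"] that x lc[OF L(1)] by simp
      also have "\<dots> \<le> K * 1 * hdist E x (lincomb E h L)"
        using that K(1) by (intro mult_right_mono mult_left_mono) auto
      also have "\<dots> < e / 3" using L(2) K(1) by (simp add: field_simps)
      finally show ?thesis .
    qed
    have main: "hdist E (\<phi> u x) (\<phi> v x) < e" if u: "?Q u" and v: "?Q v" for u v
    proof -
      note c = family_closed[OF x] family_closed[OF lc[OF L(1)]]
      have "hdist E (\<phi> u x) (\<phi> v x) \<le> hdist E (\<phi> u x) (\<phi> u (lincomb E h L)) +
          hdist E (\<phi> u (lincomb E h L)) (\<phi> v x)"
        by (intro E.hnorm_vdiff_triangle c)
      also have "hdist E (\<phi> u (lincomb E h L)) (\<phi> v x) \<le>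
          hdist E (\<phi> u (lincomb E h L)) (\<phi> v (lincomb E h L)) +
          hdist E (\<phi> v (lincomb E h L)) (\<phi> v x)"
        by (intro E.hnorm_vdiff_triangle c)
      also have "hdist E (\<phi> v (lincomb E h L)) (\<phi> v x) =
          hdist E (\<phi> v x) (\<phi> v (lincomb E h L))"
        by (intro E.hnorm_vdiff_commute c)
      finally show ?thesis using near[OF u] near[OF v] P(2)[of u v] u v by simp
    qed
    have "hadj E E (\<phi> u) = \<phi> u" if "?Q u" for u
      using that by (simp add: hadj_cp cstar_positive_star)
    then show "\<exists>P. eventually P \<F> \<and> (\<forall>u v. P u \<longrightarrow> P v \<longrightarrow>
        hdist E (\<phi> u x) (\<phi> v x) < e \<and>
        hdist E (hadj E E (\<phi> u) x) (hadj E E (\<phi> v) x) < e)"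
      using main eventually_conj[OF P(1) ev] by (intro exI[of _ ?Q]) simp
  qed
  with unit show ?thesis unfolding strict_def by blast
qed

section \<open>The interior tensor product\<close>

locale star_rep = adjointable_family F \<pi>
  for F :: "('f, 'c::cstar_algebra) hmod" and \<pi> :: "'b::cstar_algebra \<Rightarrow> 'f \<Rightarrow> 'f" +
  assumes rep: "star_representation F \<pi>"
begin

sublocale cp_family F \<pi>
  by (rule cp_familyI[OF E.hilbert_axioms star_representation_completely_positive[OF E.hilbert_axioms rep]])

lemma rep_mult: "y \<in> vcarrier F \<Longrightarrow> \<pi> (a * b) y = \<pi> a (\<pi> b y)"
  using rep by (simp add: star_representation_def)

text \<open>Positivity of \<open>\<Sum> \<langle>y\<^sub>i, \<pi>(\<langle>x\<^sub>i, x\<^sub>j\<rangle>) y\<^sub>j\<rangle>\<close> by an approximate Gram-Schmidt step. With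
  \<open>g = \<langle>x\<^sub>n, x\<^sub>n\<rangle>\<close>, \<open>c\<^sub>j = \<langle>x\<^sub>n, x\<^sub>j\<rangle>\<close>, \<open>(g + e) d\<^sub>j = c\<^sub>j\<close> and \<open>w = \<Sum>\<^sub>j \<pi>(d\<^sub>j) y\<^sub>j\<close>, the sum equals the one for
  the shorter family \<open>x\<^sub>j - x\<^sub>n d\<^sub>j\<close> plus
  \<open>\<langle>w + y\<^sub>n, \<pi>(g) (w + y\<^sub>n)\<rangle> + 2 e \<langle>w + y\<^sub>n / 2, w + y\<^sub>n / 2\<rangle> - e / 2 \<langle>y\<^sub>n, y\<^sub>n\<rangle>\<close>.\<close>

lemma interior_gram_positive:
  fixes E :: "('e, 'b) hmod" and n :: nat
  assumes E: "semi_hilbert E"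
    and "\<And>i. i < n \<Longrightarrow> x i \<in> vcarrier E" "\<And>i. i < n \<Longrightarrow> y i \<in> vcarrier F"
  shows "cstar_positive (\<Sum>i<n. \<Sum>j<n. hip F (y i) (\<pi> (hip E (x i) (x j)) (y j)))"
  using assms(2,3)
\<comment> \<open>The reduction alters the vectors \<open>x j\<close> and keeps the
  \<open>y j\<close>.\<close>
proof (induction n arbitrary: x)
  case (Suc n)
  interpret X: semi_hilbert E by (rule E)
  define Q where "Q = (\<lambda>m x. \<Sum>i<m. \<Sum>j<m. hip F (y i) (\<pi> (hip E (x i) (x j)) (y j)))"
  have x: "x i \<in> vcarrier E" and y: "y i \<in> vcarrier F" if "i \<le> n" for i
    using Suc.prems that by simp_all
  define g where "g = hip E (x n) (x n)"
  define c where "c = (\<lambda>j. hip E (x n) (x j))"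
  have g: "cstar_positive g" "star g = g"
    using X.ip_positive[OF x] cstar_positive_star by (auto simp: g_def)
  have key: "cstar_positive (Q (Suc n) x + (e / 2) *\<^sub>R hip F (y n) (y n))" if e: "e > 0" for e :: real
  proof -
    have "\<exists>d. g * d + e *\<^sub>R d = c j" for j
      using cstar_positive_resolvent[OF g(1) e, of "c j"] by blast
    then obtain d where d: "\<And>j. g * d j + e *\<^sub>R d j = c j" by metis
    define x' where "x' = (\<lambda>j. vdiff E (x j) (hact E (x n) (d j)))"
    define w where "w = vsum F n (\<lambda>j. \<pi> (d j) (y j))"
    have x': "x' i \<in> vcarrier E" if "i \<le> n" for i using x that by (simp add: x'_def)
    have dy: "\<pi> (d j) (y j) \<in> vcarrier F" if "j < n" for j using y that by simp
    have w: "w \<in> vcarrier F" unfolding w_def by (rule E.vsum_closed[OF dy])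
    have yn: "y n \<in> vcarrier F" using y by simp
    have star_c: "star (c i) = star (d i) * g + e *\<^sub>R star (d i)" for i
      by (simp add: d[symmetric] star_add star_mult star_scaleR g(2))
    have two: "(2 * e) *\<^sub>R z = e *\<^sub>R z + e *\<^sub>R z" for z :: 'b by (simp flip: scaleR_add_left)
    have gram: "hip E (x i) (x j) =
        hip E (x' i) (x' j) + star (d i) * (g * d j) + (2 * e) *\<^sub>R (star (d i) * d j)"
      if "i < n" "j < n" for i j
    proof -
      have "hip E (x i) (x n) = star (c i)" using X.ip_star[of "x n" "x i"] x that by (simp add: c_def)
      then have "hip E (x' i) (x' j) =
          hip E (x i) (x j) - star (c i) * d j - star (d i) * c j + star (d i) * (g * d j)"
        using x that by (simp add: x'_def X.ip_simps c_def g_def algebra_simps)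
      also have "\<dots> = hip E (x i) (x j) - star (d i) * (g * d j) - (2 * e) *\<^sub>R (star (d i) * d j)"
        by (simp only: star_c two) (simp add: d[symmetric] algebra_simps)
      finally show ?thesis by simp
    qed
    have ip_dd': "hip F (y i) (\<pi> (star (d i)) z) = hip F (\<pi> (d i) (y i)) z"
      if "i < n" "z \<in> vcarrier F" for i z
      using y that by (simp add: ip_cp_left)
    have inner: "Q n x = Q n x' + hip F w (\<pi> g w) + (2 * e) *\<^sub>R hip F w w"
    proof -
      have "hip F (y i) (\<pi> (hip E (x i) (x j)) (y j)) =
          hip F (y i) (\<pi> (hip E (x' i) (x' j)) (y j)) +
          hip F (\<pi> (d i) (y i)) (\<pi> g (\<pi> (d j) (y j))) +
          (2 * e) *\<^sub>R hip F (\<pi> (d i) (y i)) (\<pi> (d j) (y j))" if "i < n" "j < n" for i j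
        using that y by (simp add: gram ip_family_add ip_family_scaleR ip_dd' rep_mult)
      then have "Q n x = Q n x' +
          (\<Sum>i<n. \<Sum>j<n. hip F (\<pi> (d i) (y i)) (\<pi> g (\<pi> (d j) (y j)))) +
          (2 * e) *\<^sub>R (\<Sum>i<n. \<Sum>j<n. hip F (\<pi> (d i) (y i)) (\<pi> (d j) (y j)))"
        by (simp add: Q_def sum.distrib scaleR_sum_right)
      moreover have "(\<Sum>i<n. \<Sum>j<n. hip F (\<pi> (d i) (y i)) (\<pi> (d j) (y j))) = hip F w w"
        by (simp add: E.ip_vsum_left dy w flip: E.ip_vsum_right w_def) (simp add: w_def E.ip_vsum_left dy w[unfolded w_def])
      moreover have "(\<Sum>i<n. \<Sum>j<n. hip F (\<pi> (d i) (y i)) (\<pi> g (\<pi> (d j) (y j)))) = hip F w (\<pi> g w)"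
      proof -
        have "hip F z (\<pi> g w) = (\<Sum>j<n. hip F z (\<pi> g (\<pi> (d j) (y j))))" if z: "z \<in> vcarrier F" for z
        proof -
          have "hip F z (\<pi> g w) = hip F (\<pi> g z) w" using z w by (simp add: ip_cp_left g(2))
          also have "\<dots> = (\<Sum>j<n. hip F (\<pi> g z) (\<pi> (d j) (y j)))"
            unfolding w_def by (rule E.ip_vsum_right) (use z dy in auto)
          also have "\<dots> = (\<Sum>j<n. hip F z (\<pi> g (\<pi> (d j) (y j))))"
            using z dy by (simp add: ip_cp_left g(2))
          finally show ?thesis .
        qed
        moreover have "hip F w (\<pi> g w) = (\<Sum>i<n. hip F (\<pi> (d i) (y i)) (\<pi> g w))"
          unfolding w_def by (subst E.ip_vsum_left) (use dy w[unfolded w_def] in auto)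
        ultimately show ?thesis by (simp add: dy)
      qed
      ultimately show ?thesis by simp
    qed
    have cross1: "(\<Sum>i<n. hip F (y i) (\<pi> (hip E (x i) (x n)) (y n))) = hip F w (\<pi> g (y n)) + e *\<^sub>R hip F w (y n)"
    proof -
      have "hip F (y i) (\<pi> (hip E (x i) (x n)) (y n)) =
          hip F (\<pi> (d i) (y i)) (\<pi> g (y n)) + e *\<^sub>R hip F (\<pi> (d i) (y i)) (y n)" if "i < n" for i
      proof -
        have "hip E (x i) (x n) = star (c i)" using X.ip_star[of "x n" "x i"] x that by (simp add: c_def)
        then show ?thesis
          using that y by (simp add: star_c ip_family_add ip_family_scaleR ip_dd' rep_mult)
      qed
      then show ?thesis
        by (simp add: sum.distrib w_def E.ip_vsum_left dy y flip: scaleR_sum_right)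
    qed
    have cross2: "(\<Sum>j<n. hip F (y n) (\<pi> (hip E (x n) (x j)) (y j))) = hip F (y n) (\<pi> g w) + e *\<^sub>R hip F (y n) w"
    proof -
      have "hip F (y n) (\<pi> (hip E (x n) (x j)) (y j)) = star (hip F (y j) (\<pi> (hip E (x j) (x n)) (y n)))"
        if "j < n" for j
      proof -
        have "hip F (y j) (\<pi> (hip E (x j) (x n)) (y n)) = hip F (\<pi> (hip E (x n) (x j)) (y j)) (y n)"
          using y x that X.ip_star[of "x n" "x j"] by (simp add: ip_cp_left)
        then show ?thesis using E.ip_star[of "\<pi> (hip E (x n) (x j)) (y j)" "y n"] y that by simp
      qed
      then have "(\<Sum>j<n. hip F (y n) (\<pi> (hip E (x n) (x j)) (y j))) =
          star (hip F w (\<pi> g (y n)) + e *\<^sub>R hip F w (y n))"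
        by (simp add: cross1[symmetric] star_sum)
      also have "\<dots> = hip F (\<pi> g (y n)) w + e *\<^sub>R hip F (y n) w"
        using w yn by (simp add: star_add star_scaleR E.ip_star)
      finally show ?thesis using w yn by (simp add: ip_cp_left g(2))
    qed
    have split: "Q (Suc n) x = Q n x + (\<Sum>i<n. hip F (y i) (\<pi> (hip E (x i) (x n)) (y n))) +
        (\<Sum>j<n. hip F (y n) (\<pi> (hip E (x n) (x j)) (y j))) + hip F (y n) (\<pi> g (y n))"
      by (simp add: Q_def sum.distrib g_def algebra_simps)
    define v where "v = vadd F w (y n)"
    define u where "u = vadd F w (vscale F (of_real (1/2)) (y n))"
    have v: "v \<in> vcarrier F" and u: "u \<in> vcarrier F" using w yn by (simp_all add: v_def u_def)
    have vv: "hip F v (\<pi> g v) = hip F w (\<pi> g w) + hip F w (\<pi> g (y n)) + hip F (y n) (\<pi> g w) + hip F (y n) (\<pi> g (y n))"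
      using w yn by (simp add: v_def adjointable_add E.ip_simps algebra_simps)
    have half: "scaleC (complex_of_real (1/2)) z = (1/2) *\<^sub>R z" for z :: 'c by (rule scaleC_of_real)
    have uu: "hip F u u = hip F w w + (1/2) *\<^sub>R hip F w (y n) + (1/2) *\<^sub>R hip F (y n) w + (1/4) *\<^sub>R hip F (y n) (y n)"
      using w yn by (simp only: u_def E.ip_simps E.scale_closed E.add_closed half complex_cnj_complex_of_real)
        (simp add: algebra_simps)
    have "Q (Suc n) x + (e / 2) *\<^sub>R hip F (y n) (y n) = Q n x' + hip F v (\<pi> g v) + (2 * e) *\<^sub>R hip F u u"
      unfolding split inner cross1 cross2 vv uu by (simp add: algebra_simps flip: scaleR_add_left)
    moreover have "cstar_positive (Q n x')"
      unfolding Q_def by (rule Suc.IH) (use x' y in auto)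
    ultimately show ?thesis
      using e by (simp add: cstar_positive_add cstar_positive_scaleR E.ip_positive u cp_positive g(1) v)
  qed
  \<comment> \<open>The error \<open>e / 2\<close> times \<open>\<langle>y n, y n\<rangle>\<close>
    is the price for using \<open>g + e\<close> in place of an invertible \<open>g\<close>; it tends
    to 0 along \<open>e = 1 / (k + 1)\<close>.\<close>
  have "cstar_positive (Q (Suc n) x)"
  proof (rule cstar_positive_limit)
    show "cstar_positive (Q (Suc n) x + (inverse (real (Suc k)) / 2) *\<^sub>R hip F (y n) (y n))" for k
      by (rule key) simp
    have "(\<lambda>k. Q (Suc n) x + (inverse (real (Suc k)) / 2) *\<^sub>R hip F (y n) (y n)) \<longlonglongrightarrow>
        Q (Suc n) x + (0 / 2) *\<^sub>R hip F (y n) (y n)"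
      by (intro tendsto_intros LIMSEQ_inverse_real_of_nat) simp
    then show "(\<lambda>k. Q (Suc n) x + (inverse (real (Suc k)) / 2) *\<^sub>R hip F (y n) (y n)) \<longlonglongrightarrow> Q (Suc n) x"
      by simp
  qed
  then show ?case by (simp only: Q_def)
qed simp

lemma tensor_form_interior:
  fixes E :: "('e, 'b) hmod"
  assumes "hilbert E"
  shows "tensor_form E F (balanced_relations E F \<pi>) (\<lambda>(x1, y1) (x2, y2). hip F y1 (\<pi> (hip E x1 x2) y2))"
    (is "tensor_form E F ?R ?g")
proof
  interpret X: hilbert E by fact
  fix k r assume k: "k \<in> vcarrier E \<times> vcarrier F" and r: "r \<in> bilinear_relations E F \<union> balanced_relations E F \<pi>"
  show "sesquilinear_form ?g (Poly_Mapping.single k 1) r = 0"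
  proof (cases "r \<in> bilinear_relations E F")
    case True
    show ?thesis
      by (rule form_bilinear_relations[OF _ _ _ _ True])
        (use k in \<open>auto simp: X.ip_simps E.ip_simps ip_family_add ip_family_scaleC adjointable_add adjointable_scale\<close>)
  next
    case False
    then show ?thesis
      using r k by (auto simp: balanced_relations_def sesquilinear_form_diff_right X.ip_simps rep_mult)
  qed
next
  interpret X: hilbert E by fact
  fix k l assume "k \<in> vcarrier E \<times> vcarrier F" "l \<in> vcarrier E \<times> vcarrier F"
  then show "star (?g k l) = ?g l k"
    by (auto simp: E.ip_star ip_cp_left X.ip_star)
next
  interpret X: hilbert E by fact
  fix k x y c assume "k \<in> vcarrier E \<times> vcarrier F" "x \<in> vcarrier E" "y \<in> vcarrier F"
  then show "?g k (x, hact F y c) = ?g k (x, y) * c"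
    by (auto simp: adjointable_act E.ip_simps)
next
  fix p assume p: "p \<in> formal_sums E F"
  obtain n :: nat and k where k: "\<And>i. i < n \<Longrightarrow> k i \<in> Poly_Mapping.keys p"
    and eq: "sesquilinear_form ?g p p = (\<Sum>i<n. \<Sum>j<n.
       scaleC (cnj (Poly_Mapping.lookup p (k i)) * Poly_Mapping.lookup p (k j)) (?g (k i) (k j)))"
    using sesquilinear_form_enum[of p ?g] by blast
  have kc: "fst (k i) \<in> vcarrier E" "snd (k i) \<in> vcarrier F" if "i < n" for i
    using k[OF that] p by (auto simp: formal_sums_def)
  \<comment> \<open>Absorbing the complex coefficients into the vectors of \<open>F\<close> leaves a
    Gram sum without scalars.\<close>
  have "sesquilinear_form ?g p p = (\<Sum>i<n. \<Sum>j<n.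
      hip F (vscale F (Poly_Mapping.lookup p (k i)) (snd (k i)))
        (\<pi> (hip E (fst (k i)) (fst (k j))) (vscale F (Poly_Mapping.lookup p (k j)) (snd (k j)))))"
    unfolding eq
    by (intro sum.cong refl)
      (use kc in \<open>auto simp: case_prod_unfold adjointable_scale E.ip_simps scaleC_scaleC mult.commute\<close>)
  also have "cstar_positive \<dots>"
    using assms kc by (intro interior_gram_positive) (auto simp: hilbert_def)
  finally show "cstar_positive (sesquilinear_form ?g p p)" .
qed simp

end

locale interior = star_rep F \<pi> + X: hilbert E
  for F :: "('f, 'c::cstar_algebra) hmod" and \<pi> :: "'b::cstar_algebra \<Rightarrow> 'f \<Rightarrow> 'f"
    and E :: "('e, 'b) hmod"
begin

sublocale T: tensor_form E F "balanced_relations E F \<pi>" "\<lambda>(x1, y1) (x2, y2). hip F y1 (\<pi> (hip E x1 x2) y2)"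
  by (rule tensor_form_interior[OF X.hilbert_axioms])

abbreviation "H \<equiv> interior_tensor E F \<pi>"

lemma generated: "generated_by H (vcarrier E \<times> vcarrier F) (\<lambda>k. itensor E F \<pi> (fst k) (snd k))"
  using T.generated_by_tensors by (simp add: interior_tensor_def interior_semi_def itensor_def)

lemma hilbert_H: "hilbert H"
  by (rule generated[unfolded generated_by_def, THEN conjunct1])

interpretation H: hilbert H
  by (rule hilbert_H)

lemma itensor_closed [simp]: "x \<in> vcarrier E \<Longrightarrow> y \<in> vcarrier F \<Longrightarrow> itensor E F \<pi> x y \<in> vcarrier H"
  using bspec[OF generated[unfolded generated_by_def, THEN conjunct2, THEN conjunct1], of "(x, y)"]
  by simp

lemma ip_itensor:
  "x \<in> vcarrier E \<Longrightarrow> y \<in> vcarrier F \<Longrightarrow> x' \<in> vcarrier E \<Longrightarrow> y' \<in> vcarrier F \<Longrightarrow>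
    hip H (itensor E F \<pi> x y) (itensor E F \<pi> x' y') = hip F y (\<pi> (hip E x x') y')"
  using T.ip_generator[of "(x, y)" "(x', y')"] by (simp add: interior_tensor_def interior_semi_def itensor_def)

lemma itensor_eqI:
  assumes "Z \<in> vcarrier H" "Z' \<in> vcarrier H"
    and "\<And>x y. x \<in> vcarrier E \<Longrightarrow> y \<in> vcarrier F \<Longrightarrow>
      hip H (itensor E F \<pi> x y) Z = hip H (itensor E F \<pi> x y) Z'"
  shows "Z = Z'"
  by (rule generated_by_eqI[OF generated assms(1,2)]) (use assms(3) in auto)

text \<open>The relations among elementary tensors are recovered from inner products with
  generators, so neither the quotient nor the completion has to be opened again.\<close>

lemma itensor_add_left:
  "x \<in> vcarrier E \<Longrightarrow> x' \<in> vcarrier E \<Longrightarrow> y \<in> vcarrier F \<Longrightarrow>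
    itensor E F \<pi> (vadd E x x') y = vadd H (itensor E F \<pi> x y) (itensor E F \<pi> x' y)"
  by (rule itensor_eqI) (simp_all add: ip_itensor H.ip_simps X.ip_simps ip_family_add)

lemma itensor_scale_left:
  "x \<in> vcarrier E \<Longrightarrow> y \<in> vcarrier F \<Longrightarrow>
    itensor E F \<pi> (vscale E c x) y = vscale H c (itensor E F \<pi> x y)"
  by (rule itensor_eqI) (simp_all add: ip_itensor H.ip_simps X.ip_simps ip_family_scaleC)

lemma itensor_zero_left: "y \<in> vcarrier F \<Longrightarrow> itensor E F \<pi> (vzero E) y = vzero H"
  by (rule itensor_eqI) (simp_all add: ip_itensor H.ip_simps X.ip_simps ip_family_zero)

lemma itensor_sum_left:
  "(\<And>k. k < n \<Longrightarrow> f k \<in> vcarrier E) \<Longrightarrow> y \<in> vcarrier F \<Longrightarrow>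
    itensor E F \<pi> (vsum E n f) y = vsum H n (\<lambda>k. itensor E F \<pi> (f k) y)"
  by (induction n) (simp_all add: itensor_zero_left itensor_add_left X.vsum_closed)

lemma itensor_diff_left:
  "x \<in> vcarrier E \<Longrightarrow> x' \<in> vcarrier E \<Longrightarrow> y \<in> vcarrier F \<Longrightarrow>
    itensor E F \<pi> (vdiff E x x') y = vdiff H (itensor E F \<pi> x y) (itensor E F \<pi> x' y)"
  by (simp add: vdiff_def itensor_add_left itensor_scale_left)

text \<open>Cauchy-Schwarz in \<open>F\<close>, together with the bound of \<open>\<pi>\<close> at
  the positive element \<open>hip E x x\<close>. In growth estimates the constant is only a factor
  in front of the geometric rate.\<close>

lemma itensor_bounded:
  obtains C where "C > 0" "\<And>x y. x \<in> vcarrier E \<Longrightarrow> y \<in> vcarrier F \<Longrightarrow>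
    hnorm H (itensor E F \<pi> x y) \<le> C * hnorm E x * hnorm F y"
proof -
  obtain K where K: "K > 0" "\<And>a y. cstar_positive a \<Longrightarrow> y \<in> vcarrier F \<Longrightarrow>
      hnorm F (\<pi> a y) \<le> K * norm a * hnorm F y" using cp_bounded by blast
  have "hnorm H (itensor E F \<pi> x y) \<le> sqrt K * hnorm E x * hnorm F y"
    if x: "x \<in> vcarrier E" and y: "y \<in> vcarrier F" for x y
  proof (rule H.hnorm_le)
    have "norm (hip H (itensor E F \<pi> x y) (itensor E F \<pi> x y)) \<le> hnorm F y * hnorm F (\<pi> (hip E x x) y)"
      using x y by (simp add: ip_itensor E.cauchy_schwarz)
    also have "\<dots> \<le> hnorm F y * (K * norm (hip E x x) * hnorm F y)"
      by (intro mult_left_mono K X.ip_positive x y) simp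
    also have "\<dots> = (sqrt K * hnorm E x * hnorm F y)\<^sup>2"
      using K(1) by (simp add: power_mult_distrib X.hnorm_square) (simp add: power2_eq_square)
    finally show "norm (hip H (itensor E F \<pi> x y) (itensor E F \<pi> x y)) \<le> (sqrt K * hnorm E x * hnorm F y)\<^sup>2" .
  qed (use K in simp)
  then show thesis using K(1) by (intro that[of "sqrt K"]) auto
qed

end

section \<open>Maps induced on interior tensor products\<close>

locale interior_pair = I1: interior F \<pi> E1 + I2: interior F \<pi> E2
  for F :: "('f, 'c::cstar_algebra) hmod" and \<pi> :: "'b::cstar_algebra \<Rightarrow> 'f \<Rightarrow> 'f"
    and E1 :: "('e, 'b) hmod" and E2 :: "('g, 'b) hmod"
begin

lemma pair_E: "hilbert_pair E1 E2"
  by (intro hilbert_pairI I1.X.hilbert_axioms I2.X.hilbert_axioms)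

lemma pair_H: "hilbert_pair I1.H I2.H"
  by (intro hilbert_pairI I1.hilbert_H I2.hilbert_H)

interpretation EE: hilbert_pair E1 E2
  by (rule pair_E)

interpretation HH: hilbert_pair I1.H I2.H
  by (rule pair_H)

text \<open>On generators the modulus applies \<open>\<eta>\<close> and then its adjoint to the
  first factor, so its iterates grow at rate \<open>c\<^sup>2\<close> whenever \<open>c\<close>
  bounds \<open>\<eta>\<close>. The usual proof would instead use positivity of
  \<open>c\<^sup>2\<close> minus that operator.\<close>

lemma interior_map_exists:
  assumes \<eta>: "\<eta> \<in> adjointable E1 E2"
  obtains T where "T \<in> adjointable I1.H I2.H"
    "\<And>x y. x \<in> vcarrier E1 \<Longrightarrow> y \<in> vcarrier F \<Longrightarrow> T (itensor E1 F \<pi> x y) = itensor E2 F \<pi> (\<eta> x) y"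
    "\<And>x y. x \<in> vcarrier E2 \<Longrightarrow> y \<in> vcarrier F \<Longrightarrow>
      hadj I1.H I2.H T (itensor E2 F \<pi> x y) = itensor E1 F \<pi> (hadj E1 E2 \<eta> x) y"
proof -
  obtain c where c: "c > 0" "\<And>x. x \<in> vcarrier E1 \<Longrightarrow> hnorm E2 (\<eta> x) \<le> c * hnorm E1 x"
    using EE.adjointable_bounded[OF \<eta>] by blast
  have c': "hnorm E1 (hadj E1 E2 \<eta> x) \<le> c * hnorm E2 x" if "x \<in> vcarrier E2" for x
    by (rule EE.adjoint_bound[OF \<eta> _ c(2) that]) (use c in auto)
  obtain C where C: "C > 0" "\<And>x y. x \<in> vcarrier E1 \<Longrightarrow> y \<in> vcarrier F \<Longrightarrow>
      hnorm I1.H (itensor E1 F \<pi> x y) \<le> C * hnorm E1 x * hnorm F y"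
    using I1.itensor_bounded by blast
  define \<sigma> where "\<sigma> = (\<lambda>k::'e \<times> 'f. (\<eta> (fst k), snd k))"
  define \<tau> where "\<tau> = (\<lambda>k::'g \<times> 'f. (hadj E1 E2 \<eta> (fst k), snd k))"
  define \<rho> where "\<rho> = \<tau> \<circ> \<sigma>"
  have \<rho>: "\<rho> k = (hadj E1 E2 \<eta> (\<eta> (fst k)), snd k)" for k
    by (simp add: \<rho>_def \<sigma>_def \<tau>_def)
  have iter: "fst ((\<rho> ^^ n) k) \<in> vcarrier E1 \<and> snd ((\<rho> ^^ n) k) = snd k \<and>
      hnorm E1 (fst ((\<rho> ^^ n) k)) \<le> (c\<^sup>2) ^ n * hnorm E1 (fst k)"
    if "fst k \<in> vcarrier E1" for n k
  proof (induction n)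
    case (Suc n)
    let ?z = "fst ((\<rho> ^^ n) k)"
    have z: "?z \<in> vcarrier E1" by (rule conjunct1[OF Suc])
    have "hnorm E1 (hadj E1 E2 \<eta> (\<eta> ?z)) \<le> c * hnorm E2 (\<eta> ?z)" using c' \<eta> z by simp
    also have "\<dots> \<le> c * (c * hnorm E1 ?z)" using c z by simp
    also have "\<dots> \<le> c * (c * ((c\<^sup>2) ^ n * hnorm E1 (fst k)))"
      by (intro mult_left_mono conjunct2[OF conjunct2[OF Suc]]) (use c in auto)
    finally have le: "hnorm E1 (hadj E1 E2 \<eta> (\<eta> ?z)) \<le> (c\<^sup>2) ^ Suc n * hnorm E1 (fst k)"
      by (simp add: power2_eq_square mult.assoc)
    have step: "(\<rho> ^^ Suc n) k = (hadj E1 E2 \<eta> (\<eta> ?z), snd ((\<rho> ^^ n) k))"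
      unfolding funpow.simps o_apply by (rule \<rho>)
    show ?case unfolding step fst_conv snd_conv using le Suc \<eta> z by simp
  qed (use that in simp)
  note iter = iter[unfolded \<rho>_def]
  show thesis
  proof (rule adjointable_on_generators[OF I1.generated I2.generated, of \<sigma> \<tau> "c\<^sup>2"])
    fix i assume i: "i \<in> vcarrier E1 \<times> vcarrier F"
    show "\<exists>C. \<forall>n. hnorm I1.H (itensor E1 F \<pi> (fst (((\<tau> \<circ> \<sigma>) ^^ n) i)) (snd (((\<tau> \<circ> \<sigma>) ^^ n) i))) \<le> C * (c\<^sup>2) ^ n"
    proof (intro exI allI)
      fix n
      let ?z = "fst (((\<tau> \<circ> \<sigma>) ^^ n) i)"
      have z: "?z \<in> vcarrier E1" "snd (((\<tau> \<circ> \<sigma>) ^^ n) i) = snd i"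
        "hnorm E1 ?z \<le> (c\<^sup>2) ^ n * hnorm E1 (fst i)"
        using iter[of i n] i by auto
      have "hnorm I1.H (itensor E1 F \<pi> ?z (snd i)) \<le> C * hnorm E1 ?z * hnorm F (snd i)"
        using C(2) z i by auto
      also have "\<dots> \<le> C * ((c\<^sup>2) ^ n * hnorm E1 (fst i)) * hnorm F (snd i)"
        using C(1) z by (intro mult_right_mono mult_left_mono) auto
      finally show "hnorm I1.H (itensor E1 F \<pi> ?z (snd (((\<tau> \<circ> \<sigma>) ^^ n) i))) \<le>
          (C * hnorm E1 (fst i) * hnorm F (snd i)) * (c\<^sup>2) ^ n"
        by (simp add: z(2) mult_ac)
    qed
  next
    fix T
    assume "T \<in> adjointable I1.H I2.H"
      "\<And>i. i \<in> vcarrier E1 \<times> vcarrier F \<Longrightarrow> T (itensor E1 F \<pi> (fst i) (snd i)) =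
        itensor E2 F \<pi> (fst (\<sigma> i)) (snd (\<sigma> i))"
      "\<And>j. j \<in> vcarrier E2 \<times> vcarrier F \<Longrightarrow> hadj I1.H I2.H T (itensor E2 F \<pi> (fst j) (snd j)) =
        itensor E1 F \<pi> (fst (\<tau> j)) (snd (\<tau> j))"
    then show thesis by (intro that[of T]) (force simp: \<sigma>_def \<tau>_def)+
  qed (use \<eta> in \<open>auto simp: \<sigma>_def \<tau>_def I1.ip_itensor I2.ip_itensor EE.ip_adjointable_left\<close>)
qed

lemma interior_map_eqI:
  assumes "T \<in> adjointable I1.H I2.H"
    and "\<And>x y. x \<in> vcarrier E1 \<Longrightarrow> y \<in> vcarrier F \<Longrightarrow> T (itensor E1 F \<pi> x y) = itensor E2 F \<pi> (\<eta> x) y"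
  shows "interior_map F \<pi> E1 E2 \<eta> = T"
  unfolding interior_map_def
proof (rule the_equality)
  fix S assume S: "S \<in> adjointable I1.H I2.H \<and>
    (\<forall>x\<in>vcarrier E1. \<forall>y\<in>vcarrier F. S (itensor E1 F \<pi> x y) = itensor E2 F \<pi> (\<eta> x) y)"
  show "S = T"
    by (rule adjointable_eqI[OF I1.generated I2.hilbert_H]) (use S assms in auto)
qed (use assms in auto)

lemma interior_map:
  assumes "\<eta> \<in> adjointable E1 E2"
  shows "interior_map F \<pi> E1 E2 \<eta> \<in> adjointable I1.H I2.H"
    and "\<And>x y. x \<in> vcarrier E1 \<Longrightarrow> y \<in> vcarrier F \<Longrightarrow>
      interior_map F \<pi> E1 E2 \<eta> (itensor E1 F \<pi> x y) = itensor E2 F \<pi> (\<eta> x) y"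
    and "\<And>x y. x \<in> vcarrier E2 \<Longrightarrow> y \<in> vcarrier F \<Longrightarrow>
      hadj I1.H I2.H (interior_map F \<pi> E1 E2 \<eta>) (itensor E2 F \<pi> x y) = itensor E1 F \<pi> (hadj E1 E2 \<eta> x) y"
proof -
  obtain T where T: "T \<in> adjointable I1.H I2.H"
    "\<And>x y. x \<in> vcarrier E1 \<Longrightarrow> y \<in> vcarrier F \<Longrightarrow> T (itensor E1 F \<pi> x y) = itensor E2 F \<pi> (\<eta> x) y"
    "\<And>x y. x \<in> vcarrier E2 \<Longrightarrow> y \<in> vcarrier F \<Longrightarrow>
      hadj I1.H I2.H T (itensor E2 F \<pi> x y) = itensor E1 F \<pi> (hadj E1 E2 \<eta> x) y"
    using interior_map_exists[OF assms] by blast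
  have "interior_map F \<pi> E1 E2 \<eta> = T" by (rule interior_map_eqI[OF T(1,2)])
  with T show "interior_map F \<pi> E1 E2 \<eta> \<in> adjointable I1.H I2.H"
    "\<And>x y. x \<in> vcarrier E1 \<Longrightarrow> y \<in> vcarrier F \<Longrightarrow>
      interior_map F \<pi> E1 E2 \<eta> (itensor E1 F \<pi> x y) = itensor E2 F \<pi> (\<eta> x) y"
    "\<And>x y. x \<in> vcarrier E2 \<Longrightarrow> y \<in> vcarrier F \<Longrightarrow>
      hadj I1.H I2.H (interior_map F \<pi> E1 E2 \<eta>) (itensor E2 F \<pi> x y) = itensor E1 F \<pi> (hadj E1 E2 \<eta> x) y"
    by simp_all
qed

lemma eq_on_itensor:
  assumes "T \<in> adjointable I1.H I2.H" "S \<in> adjointable I1.H I2.H"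
    and "\<And>x y. x \<in> vcarrier E1 \<Longrightarrow> y \<in> vcarrier F \<Longrightarrow> T (itensor E1 F \<pi> x y) = S (itensor E1 F \<pi> x y)"
  shows "T = S"
  by (rule adjointable_eqI[OF I1.generated I2.hilbert_H assms(1,2)]) (use assms(3) in auto)

end

lemma (in star_rep) interior_pairI:
  assumes "hilbert E1" "hilbert E2"
  shows "interior_pair F \<pi> E1 E2"
  by (intro interior_pair.intro interior.intro star_rep_axioms assms)

text \<open>Induced maps respect sums, adjoints and composites. A factor \<open>Y\<close> of the
  operator matrix on \<open>E\<close> thus induces, entry by entry, a factor on the tensor product;
  each identity is tested on generators.\<close>

lemma (in star_rep) interior_cp_family:
  fixes \<phi> :: "'a::cstar_algebra \<Rightarrow> 'e \<Rightarrow> 'e"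
  assumes "cp_family E \<phi>"
  shows "cp_family (interior_tensor E F \<pi>) (\<lambda>a. interior_map F \<pi> E E (\<phi> a))"
proof -
  interpret A: cp_family E \<phi> by fact
  interpret interior_pair F \<pi> E E by (rule interior_pairI[OF A.E.hilbert_axioms A.E.hilbert_axioms])
  interpret HH: hilbert_pair I1.H I1.H by (rule pair_H)
  let ?\<phi> = "\<lambda>a. interior_map F \<pi> E E (\<phi> a)"
  note im = interior_map[OF A.family_adjointable]
  have lin: "linear_into_adjointable I1.H ?\<phi>"
    unfolding linear_into_adjointable_def
  proof (intro conjI allI ballI)
    show "?\<phi> a \<in> adjointable I1.H I1.H" for a by (rule im)
  next
    fix a b Z assume Z: "Z \<in> vcarrier I1.H"
    have "?\<phi> (a + b) = (\<lambda>Z\<in>vcarrier I1.H. vadd I1.H (?\<phi> a Z) (?\<phi> b Z))"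
      by (rule eq_on_itensor[OF im(1) HH.adjointable_op_add[OF im(1) im(1)]])
        (simp add: im(2) A.family_add I1.itensor_add_left)
    then show "?\<phi> (a + b) Z = vadd I1.H (?\<phi> a Z) (?\<phi> b Z)" using Z by simp
  next
    fix c a Z assume Z: "Z \<in> vcarrier I1.H"
    have "?\<phi> (scaleC c a) = (\<lambda>Z\<in>vcarrier I1.H. vscale I1.H c (?\<phi> a Z))"
      by (rule eq_on_itensor[OF im(1) HH.adjointable_op_scale[OF im(1)]])
        (simp add: im(2) A.family_scaleC I1.itensor_scale_left)
    then show "?\<phi> (scaleC c a) Z = vscale I1.H c (?\<phi> a Z)" using Z by simp
  qed
  have "operator_matrix_positive I1.H n (\<lambda>i j. ?\<phi> (M i j))" if M: "matrix_positive n M" for n M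
  proof -
    have "operator_matrix_positive E n (\<lambda>i j. \<phi> (M i j))"
      using A.cp M unfolding completely_positive_def by blast
    then obtain Y where Y: "\<And>i j. i < n \<Longrightarrow> j < n \<Longrightarrow> Y i j \<in> adjointable E E"
      "\<And>i j x. i < n \<Longrightarrow> j < n \<Longrightarrow> x \<in> vcarrier E \<Longrightarrow>
        \<phi> (M i j) x = vsum E n (\<lambda>k. hadj E E (Y k i) (Y k j x))"
      unfolding operator_matrix_positive_def by blast
    let ?Y = "\<lambda>i j. interior_map F \<pi> E E (Y i j)"
    note yim = interior_map[OF Y(1)]
    have "?\<phi> (M i j) Z = vsum I1.H n (\<lambda>k. hadj I1.H I1.H (?Y k i) (?Y k j Z))"
      if ij: "i < n" "j < n" and Z: "Z \<in> vcarrier I1.H" for i j Z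
    proof -
      define S where "S = (\<lambda>k. compose (vcarrier I1.H) (hadj I1.H I1.H (?Y k i)) (?Y k j))"
      have S: "S k \<in> adjointable I1.H I1.H" if "k < n" for k
        unfolding S_def
        by (rule adjointable_compose(1)[OF I1.hilbert_H I1.hilbert_H I1.hilbert_H
              yim(1)[OF that ij(2)] HH.hadj_in_adjointable[OF yim(1)[OF that ij(1)]]])
      have Sk: "S k (itensor E F \<pi> x y) = itensor E F \<pi> (hadj E E (Y k i) (Y k j x)) y"
        if "k < n" "x \<in> vcarrier E" "y \<in> vcarrier F" for k x y
        using that ij Y(1) by (simp add: S_def compose_def yim(2,3))
      have vcong: "vsum I1.H m f = vsum I1.H m f'" if "\<And>k. k < m \<Longrightarrow> f k = f' k" for m f f'
        using that by (induction m) auto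
      have "?\<phi> (M i j) = (\<lambda>Z\<in>vcarrier I1.H. vsum I1.H n (\<lambda>k. S k Z))"
      proof (rule eq_on_itensor[OF im(1) HH.adjointable_op_sum[OF S]])
        fix x y assume x: "x \<in> vcarrier E" and y: "y \<in> vcarrier F"
        have "?\<phi> (M i j) (itensor E F \<pi> x y) = vsum I1.H n (\<lambda>k. itensor E F \<pi> (hadj E E (Y k i) (Y k j x)) y)"
          using ij x y Y(1) by (simp add: im(2) Y(2) I1.itensor_sum_left)
        also have "\<dots> = vsum I1.H n (\<lambda>k. S k (itensor E F \<pi> x y))"
          by (rule vcong) (simp add: Sk x y)
        finally show "?\<phi> (M i j) (itensor E F \<pi> x y) =
            (\<lambda>Z\<in>vcarrier I1.H. vsum I1.H n (\<lambda>k. S k Z)) (itensor E F \<pi> x y)" using x y by simp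
      qed
      then show ?thesis using Z by (simp add: S_def compose_def)
    qed
    then show ?thesis
      unfolding operator_matrix_positive_def by (intro exI[of _ ?Y]) (simp add: yim(1))
  qed
  then show ?thesis
    by (intro cp_familyI I1.hilbert_H) (simp add: completely_positive_def lin)
qed

text \<open>The approximate unit is kept: for fixed \<open>y\<close> the tensor
  \<open>itensor E F \<pi> x y\<close> depends linearly and boundedly on \<open>x\<close>, so the
  Cauchy condition passes from \<open>x\<close> to the tensor.\<close>

lemma (in star_rep) interior_strict:
  fixes \<phi> :: "'a::cstar_algebra \<Rightarrow> 'e \<Rightarrow> 'e"
  assumes "cp_family E \<phi>" "strict E \<phi>"
  shows "strict (interior_tensor E F \<pi>) (\<lambda>a. interior_map F \<pi> E E (\<phi> a))"
proof -
  interpret A: cp_family E \<phi> by fact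
  interpret interior_pair F \<pi> E E by (rule interior_pairI[OF A.E.hilbert_axioms A.E.hilbert_axioms])
  interpret B: cp_family I1.H "\<lambda>a. interior_map F \<pi> E E (\<phi> a)" by (rule interior_cp_family[OF assms(1)])
  note im = interior_map[OF A.family_adjointable]
  obtain \<F> where \<F>: "approximate_unit \<F>" "strictly_Cauchy E \<phi> \<F>" using assms(2) by (auto simp: strict_def)
  obtain C where C: "C > 0" "\<And>x y. x \<in> vcarrier E \<Longrightarrow> y \<in> vcarrier F \<Longrightarrow>
      hnorm I1.H (itensor E F \<pi> x y) \<le> C * hnorm E x * hnorm F y"
    using I1.itensor_bounded by blast
  show ?thesis
  proof (rule B.strict_on_generators[OF I1.generated \<F>(1)])
    fix k and e :: real assume k: "k \<in> vcarrier E \<times> vcarrier F" and e: "e > 0"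
    define x where "x = fst k"
    define y where "y = snd k"
    have x: "x \<in> vcarrier E" and y: "y \<in> vcarrier F" using k by (auto simp: x_def y_def)
    define r where "r = C * (hnorm F y + 1)"
    have r: "r > 0" using C by (simp add: r_def add_nonneg_pos)
    obtain P where P: "eventually P \<F>" "\<And>u v. P u \<Longrightarrow> P v \<Longrightarrow> hdist E (\<phi> u x) (\<phi> v x) < e / r"
      using \<F>(2) x e r unfolding strictly_Cauchy_def by (metis divide_pos_pos)
    have "hdist I1.H (interior_map F \<pi> E E (\<phi> u) (itensor E F \<pi> x y))
        (interior_map F \<pi> E E (\<phi> v) (itensor E F \<pi> x y)) < e" if "P u" "P v" for u v
    proof -
      have "hdist I1.H (interior_map F \<pi> E E (\<phi> u) (itensor E F \<pi> x y))
          (interior_map F \<pi> E E (\<phi> v) (itensor E F \<pi> x y)) =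
          hnorm I1.H (itensor E F \<pi> (vdiff E (\<phi> u x) (\<phi> v x)) y)"
        using x y by (simp add: im(2) I1.itensor_diff_left)
      also have "\<dots> \<le> C * hdist E (\<phi> u x) (\<phi> v x) * hnorm F y"
        using C(2) x y by simp
      also have "\<dots> \<le> r * hdist E (\<phi> u x) (\<phi> v x)"
        using C(1) by (simp add: r_def algebra_simps)
      also have "\<dots> < e" using P(2)[OF that] r by (simp add: field_simps)
      finally show ?thesis .
    qed
    then show "\<exists>P. eventually P \<F> \<and> (\<forall>u v. P u \<longrightarrow> P v \<longrightarrow>
        hdist I1.H (interior_map F \<pi> E E (\<phi> u) (itensor E F \<pi> (fst k) (snd k)))
          (interior_map F \<pi> E E (\<phi> v) (itensor E F \<pi> (fst k) (snd k))) < e)"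
      using P(1) unfolding x_def y_def by blast
  qed
qed

section \<open>The interior tensor product as a functor\<close>

lemma PosCor_obj: "(E, \<phi>) \<in> Obj PosCor \<longleftrightarrow> cp_family E \<phi> \<and> strict E \<phi>"
proof
  assume "(E, \<phi>) \<in> Obj PosCor"
  then show "cp_family E \<phi> \<and> strict E \<phi>" by (simp add: PosCor_def cp_familyI hilbertI)
next
  assume *: "cp_family E \<phi> \<and> strict E \<phi>"
  then interpret cp_family E \<phi> by simp
  show "(E, \<phi>) \<in> Obj PosCor" using * E.is_hilbert_module cp by (simp add: PosCor_def)
qed

lemma PosCor_simps: "Hom PosCor = pos_hom" "Comp PosCor = pos_comp" "Ident PosCor = pos_id"
  by (simp_all add: PosCor_def)

text \<open>Both sides of the intertwining relation are adjointable, so agreement on generators is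
  enough.\<close>

lemma pos_homI:
  assumes "hilbert E1" "hilbert E2" "\<eta> \<in> adjointable E1 E2" "star_automorphism \<alpha>"
    and gen: "generated_by E1 I h"
    and "\<And>a. \<phi>1 a \<in> adjointable E1 E1" "\<And>a. \<phi>2 a \<in> adjointable E2 E2"
    and eq: "\<And>a i. i \<in> I \<Longrightarrow> \<phi>2 (\<alpha> a) (\<eta> (h i)) = \<eta> (\<phi>1 a (h i))"
  shows "(\<eta>, \<alpha>) \<in> pos_hom (E1, \<phi>1) (E2, \<phi>2)"
proof -
  have h: "h i \<in> vcarrier E1" if "i \<in> I" for i using gen that by (simp add: generated_by_def)
  have "\<phi>2 (\<alpha> a) (\<eta> x) = \<eta> (\<phi>1 a x)" if x: "x \<in> vcarrier E1" for a x
  proof -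
    have "compose (vcarrier E1) (\<phi>2 (\<alpha> a)) \<eta> = compose (vcarrier E1) \<eta> (\<phi>1 a)"
      by (rule adjointable_eqI[OF gen assms(2)]; (rule adjointable_compose(1); fact)?)
        (simp add: compose_def h eq)
    from fun_cong[OF this, of x] show ?thesis using x by (simp add: compose_def)
  qed
  then show ?thesis using assms(3,4) by (simp add: pos_hom_def)
qed

text \<open>The definite description is evaluated by \<open>interior_map_eqI\<close>: an identity or
  a composite is recognized by being adjointable with the prescribed values on generators.\<close>

theorem (in star_rep) is_functor_tensor:
  "is_functor (PosCor :: (('e, 'a::cstar_algebra, 'b) pos_obj, ('e, 'e, 'a) pos_mor) cat) PosCor (tensor_functor F \<pi>)"
  unfolding is_functor_def PosCor_simps
proof (intro conjI ballI category_PosCor)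
  fix X :: "('e, 'a, 'b) pos_obj" assume X: "X \<in> Obj PosCor"
  obtain E \<phi> where X': "X = (E, \<phi>)" by (cases X)
  have cp: "cp_family E \<phi>" "strict E \<phi>" using X by (simp_all add: X' PosCor_obj)
  interpret A: cp_family E \<phi> by fact
  interpret interior_pair F \<pi> E E by (rule interior_pairI[OF A.E.hilbert_axioms A.E.hilbert_axioms])
  show "on_obj (tensor_functor F \<pi>) X \<in> Obj PosCor"
    by (simp add: X' tensor_functor_def PosCor_obj interior_cp_family[OF cp(1)] interior_strict[OF cp])
  have "interior_map F \<pi> E E (restrict id (vcarrier E)) = restrict id (vcarrier I1.H)"
    by (rule interior_map_eqI) (simp_all add: adjointable_id I1.hilbert_H)
  then show "on_mor (tensor_functor F \<pi>) X X (pos_id X) = pos_id (on_obj (tensor_functor F \<pi>) X)"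
    by (simp add: X' tensor_functor_def pos_id_def)
next
  fix X Y :: "('e, 'a, 'b) pos_obj" and f
  assume X: "X \<in> Obj PosCor" and Y: "Y \<in> Obj PosCor" and f: "f \<in> pos_hom X Y"
  obtain E1 \<phi>1 where X': "X = (E1, \<phi>1)" by (cases X)
  obtain E2 \<phi>2 where Y': "Y = (E2, \<phi>2)" by (cases Y)
  obtain \<eta> \<alpha> where f': "f = (\<eta>, \<alpha>)" by (cases f)
  have cp1: "cp_family E1 \<phi>1" using X by (simp add: X' PosCor_obj)
  have cp2: "cp_family E2 \<phi>2" using Y by (simp add: Y' PosCor_obj)
  interpret A1: cp_family E1 \<phi>1 by fact
  interpret A2: cp_family E2 \<phi>2 by fact
  interpret P: interior_pair F \<pi> E1 E2 by (rule interior_pairI[OF A1.E.hilbert_axioms A2.E.hilbert_axioms])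
  interpret P1: interior_pair F \<pi> E1 E1 by (rule interior_pairI[OF A1.E.hilbert_axioms A1.E.hilbert_axioms])
  interpret P2: interior_pair F \<pi> E2 E2 by (rule interior_pairI[OF A2.E.hilbert_axioms A2.E.hilbert_axioms])
  have \<eta>: "\<eta> \<in> adjointable E1 E2" and \<alpha>: "star_automorphism \<alpha>"
    and eq: "\<And>a x. x \<in> vcarrier E1 \<Longrightarrow> \<phi>2 (\<alpha> a) (\<eta> x) = \<eta> (\<phi>1 a x)"
    using f by (auto simp: X' Y' f' pos_hom_def)
  have \<eta>_closed: "\<eta> x \<in> vcarrier E2" if "x \<in> vcarrier E1" for x
    using \<eta> that by (auto simp: adjointable_def)
  have "(interior_map F \<pi> E1 E2 \<eta>, \<alpha>) \<in>
      pos_hom (P.I1.H, \<lambda>a. interior_map F \<pi> E1 E1 (\<phi>1 a)) (P.I2.H, \<lambda>a. interior_map F \<pi> E2 E2 (\<phi>2 a))"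
  proof (rule pos_homI[OF P.I1.hilbert_H P.I2.hilbert_H P.interior_map(1)[OF \<eta>] \<alpha> P.I1.generated])
    show "interior_map F \<pi> E1 E1 (\<phi>1 a) \<in> adjointable P.I1.H P.I1.H" for a
      by (rule P1.interior_map(1)) simp
    show "interior_map F \<pi> E2 E2 (\<phi>2 a) \<in> adjointable P.I2.H P.I2.H" for a
      by (rule P2.interior_map(1)) simp
    fix a i assume "i \<in> vcarrier E1 \<times> vcarrier F"
    then show "interior_map F \<pi> E2 E2 (\<phi>2 (\<alpha> a)) (interior_map F \<pi> E1 E2 \<eta> (itensor E1 F \<pi> (fst i) (snd i))) =
        interior_map F \<pi> E1 E2 \<eta> (interior_map F \<pi> E1 E1 (\<phi>1 a) (itensor E1 F \<pi> (fst i) (snd i)))"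
      using \<eta>_closed by (auto simp: P.interior_map(2)[OF \<eta>] P1.interior_map(2) P2.interior_map(2) eq)
  qed
  then show "on_mor (tensor_functor F \<pi>) X Y f \<in> pos_hom (on_obj (tensor_functor F \<pi>) X) (on_obj (tensor_functor F \<pi>) Y)"
    by (simp add: X' Y' f' tensor_functor_def)
next
  fix X Y Z :: "('e, 'a, 'b) pos_obj" and f g
  assume X: "X \<in> Obj PosCor" and Y: "Y \<in> Obj PosCor" and Z: "Z \<in> Obj PosCor"
    and f: "f \<in> pos_hom X Y" and g: "g \<in> pos_hom Y Z"
  have hil: "hilbert (fst W)" if "W \<in> Obj PosCor" for W :: "('e, 'a, 'b) pos_obj"
    using that hilbertI by (auto simp: PosCor_def)
  let ?E1 = "fst X" and ?E2 = "fst Y" and ?E3 = "fst Z"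
  interpret P12: interior_pair F \<pi> ?E1 ?E2 by (intro interior_pairI hil X Y)
  interpret P23: interior_pair F \<pi> ?E2 ?E3 by (intro interior_pairI hil Z Y)
  interpret P13: interior_pair F \<pi> ?E1 ?E3 by (intro interior_pairI hil X Z)
  have f1: "fst f \<in> adjointable ?E1 ?E2" and g1: "fst g \<in> adjointable ?E2 ?E3"
    using f g by (auto simp: pos_hom_def)
  have f1_closed: "fst f x \<in> vcarrier ?E2" if "x \<in> vcarrier ?E1" for x
    using f1 that by (auto simp: adjointable_def)
  have "interior_map F \<pi> ?E1 ?E3 (compose (vcarrier ?E1) (fst g) (fst f)) =
      compose (vcarrier P12.I1.H) (interior_map F \<pi> ?E2 ?E3 (fst g)) (interior_map F \<pi> ?E1 ?E2 (fst f))"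
  proof (rule P13.interior_map_eqI)
    show "compose (vcarrier P12.I1.H) (interior_map F \<pi> ?E2 ?E3 (fst g)) (interior_map F \<pi> ?E1 ?E2 (fst f))
        \<in> adjointable P12.I1.H P23.I2.H"
      by (rule adjointable_compose(1)[OF P12.I1.hilbert_H P12.I2.hilbert_H P23.I2.hilbert_H
            P12.interior_map(1)[OF f1] P23.interior_map(1)[OF g1]])
    fix x y assume "x \<in> vcarrier ?E1" "y \<in> vcarrier F"
    then show "compose (vcarrier P12.I1.H) (interior_map F \<pi> ?E2 ?E3 (fst g)) (interior_map F \<pi> ?E1 ?E2 (fst f))
        (itensor ?E1 F \<pi> x y) = itensor ?E3 F \<pi> (compose (vcarrier ?E1) (fst g) (fst f) x) y"
      using f1_closed by (simp add: compose_def P12.interior_map(2)[OF f1] P23.interior_map(2)[OF g1])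
  qed
  then show "on_mor (tensor_functor F \<pi>) X Z (pos_comp X g f) =
      pos_comp (on_obj (tensor_functor F \<pi>) X) (on_mor (tensor_functor F \<pi>) Y Z g) (on_mor (tensor_functor F \<pi>) X Y f)"
    by (simp add: tensor_functor_def pos_comp_def case_prod_unfold)
qed

section \<open>The KSGNS construction\<close>

lemma cvec_of_algebra_simps [simp]:
  "vcarrier cvec_of_algebra = UNIV" "vadd cvec_of_algebra = (+)" "vscale cvec_of_algebra = scaleC"
  by (simp_all add: cvec_of_algebra_def)

lemma star_automorphismD:
  assumes "star_automorphism \<alpha>"
  shows "\<alpha> (a * b) = \<alpha> a * \<alpha> b" "\<alpha> (star a) = star (\<alpha> a)" "\<alpha> (inv \<alpha> a) = a" "inv \<alpha> (\<alpha> a) = a"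
  using assms by (auto simp: star_automorphism_def bij_def surj_f_inv_f)

lemma star_automorphism_id: "star_automorphism id"
  by (simp add: star_automorphism_def)

context cp_family
begin

text \<open>Here the complex coefficients are absorbed into the algebra elements, after which
  positivity is \<open>cp_gram_positive\<close>.\<close>

lemma tensor_form_ksgns:
  "tensor_form (cvec_of_algebra :: 'a cvec) E {} (\<lambda>(a1, x1) (a2, x2). hip E x1 (\<phi> (star a1 * a2) x2))"
    (is "tensor_form ?A E {} ?g")
proof
  fix k r assume k: "k \<in> vcarrier ?A \<times> vcarrier E" and r: "r \<in> bilinear_relations ?A E \<union> {}"
  then have r: "r \<in> bilinear_relations ?A E" by simp
  show "sesquilinear_form ?g (Poly_Mapping.single k 1) r = 0"
    by (rule form_bilinear_relations[OF _ _ _ _ r])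
      (use k in \<open>auto simp: E.ip_simps distrib_left mult_scaleC_right ip_family_add ip_family_scaleC
        adjointable_add adjointable_scale\<close>)
next
  fix k l assume "k \<in> vcarrier ?A \<times> vcarrier E" "l \<in> vcarrier ?A \<times> vcarrier E"
  then show "star (?g k l) = ?g l k"
    by (auto simp: E.ip_star ip_cp_left star_mult)
next
  fix k x y c assume "k \<in> vcarrier ?A \<times> vcarrier E" "x \<in> vcarrier ?A" "y \<in> vcarrier E"
  then show "?g k (x, hact E y c) = ?g k (x, y) * c"
    by (auto simp: adjointable_act E.ip_simps)
next
  fix p assume p: "p \<in> formal_sums ?A E"
  obtain n :: nat and k where k: "\<And>i. i < n \<Longrightarrow> k i \<in> Poly_Mapping.keys p"
    and eq: "sesquilinear_form ?g p p = (\<Sum>i<n. \<Sum>j<n.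
       scaleC (cnj (Poly_Mapping.lookup p (k i)) * Poly_Mapping.lookup p (k j)) (?g (k i) (k j)))"
    using sesquilinear_form_enum[of p ?g] by blast
  have kc: "snd (k i) \<in> vcarrier E" if "i < n" for i
    using k[OF that] p by (auto simp: formal_sums_def)
  have "sesquilinear_form ?g p p = (\<Sum>i<n. \<Sum>j<n. hip E (snd (k i))
      (\<phi> (star (scaleC (Poly_Mapping.lookup p (k i)) (fst (k i))) *
        scaleC (Poly_Mapping.lookup p (k j)) (fst (k j))) (snd (k j))))"
    unfolding eq
    by (intro sum.cong refl)
      (use kc in \<open>auto simp: case_prod_unfold star_scaleC mult_scaleC_left mult_scaleC_right
        ip_family_scaleC scaleC_scaleC mult.commute[of "cnj _"]\<close>)
  also have "cstar_positive \<dots>" by (rule cp_gram_positive) (rule kc)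
  finally show "cstar_positive (sesquilinear_form ?g p p)" .
qed simp

abbreviation "K \<equiv> ksgns_module (E, \<phi>)"

interpretation T: tensor_form "cvec_of_algebra :: 'a cvec" E "{}"
  "\<lambda>(a1, x1) (a2, x2). hip E x1 (\<phi> (star a1 * a2) x2)"
  by (rule tensor_form_ksgns)

lemma generated_ksgns:
  "generated_by K (UNIV \<times> vcarrier E) (\<lambda>k. ktensor (E, \<phi>) (fst k) (snd k))"
  using T.generated_by_tensors by (simp add: ksgns_module_def ksgns_semi_def ktensor_def)

lemma hilbert_ksgns: "hilbert K"
  by (rule generated_ksgns[unfolded generated_by_def, THEN conjunct1])

interpretation K: hilbert K
  by (rule hilbert_ksgns)

interpretation KK: hilbert_pair K K
  by (rule hilbert_pairI[OF hilbert_ksgns hilbert_ksgns])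

lemma ktensor_closed [simp]: "x \<in> vcarrier E \<Longrightarrow> ktensor (E, \<phi>) a x \<in> vcarrier K"
  using bspec[OF generated_ksgns[unfolded generated_by_def, THEN conjunct2, THEN conjunct1], of "(a, x)"]
  by simp

lemma ip_ktensor:
  "x \<in> vcarrier E \<Longrightarrow> y \<in> vcarrier E \<Longrightarrow>
    hip K (ktensor (E, \<phi>) a x) (ktensor (E, \<phi>) b y) = hip E x (\<phi> (star a * b) y)"
  using T.ip_generator[of "(a, x)" "(b, y)"] by (simp add: ksgns_module_def ksgns_semi_def ktensor_def)

lemma ktensor_eqI:
  assumes "Z \<in> vcarrier K" "Z' \<in> vcarrier K"
    and "\<And>a x. x \<in> vcarrier E \<Longrightarrow> hip K (ktensor (E, \<phi>) a x) Z = hip K (ktensor (E, \<phi>) a x) Z'"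
  shows "Z = Z'"
  by (rule generated_by_eqI[OF generated_ksgns assms(1,2)]) (use assms(3) in auto)

lemma ktensor_add_left:
  "x \<in> vcarrier E \<Longrightarrow> ktensor (E, \<phi>) (a + b) x = vadd K (ktensor (E, \<phi>) a x) (ktensor (E, \<phi>) b x)"
  by (rule ktensor_eqI) (simp_all add: ip_ktensor K.ip_simps distrib_left ip_family_add)

lemma ktensor_scale_left:
  "x \<in> vcarrier E \<Longrightarrow> ktensor (E, \<phi>) (scaleC c a) x = vscale K c (ktensor (E, \<phi>) a x)"
  by (rule ktensor_eqI) (simp_all add: ip_ktensor K.ip_simps mult_scaleC_right ip_family_scaleC)

lemma ktensor_diff_left:
  "x \<in> vcarrier E \<Longrightarrow> ktensor (E, \<phi>) (a - b) x = vdiff K (ktensor (E, \<phi>) a x) (ktensor (E, \<phi>) b x)"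
  by (rule ktensor_eqI) (simp_all add: ip_ktensor K.ip_simps right_diff_distrib ip_family_diff)

lemma ktensor_add_right:
  "x \<in> vcarrier E \<Longrightarrow> y \<in> vcarrier E \<Longrightarrow>
    ktensor (E, \<phi>) a (vadd E x y) = vadd K (ktensor (E, \<phi>) a x) (ktensor (E, \<phi>) a y)"
  by (rule ktensor_eqI) (simp_all add: ip_ktensor K.ip_simps adjointable_add E.ip_simps)

lemma ktensor_scale_right:
  "x \<in> vcarrier E \<Longrightarrow> ktensor (E, \<phi>) a (vscale E c x) = vscale K c (ktensor (E, \<phi>) a x)"
  by (rule ktensor_eqI) (simp_all add: ip_ktensor K.ip_simps adjointable_scale E.ip_simps)

lemma ktensor_zero_right: "ktensor (E, \<phi>) a (vzero E) = vzero K"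
  by (rule ktensor_eqI) (simp_all add: ip_ktensor K.ip_simps adjointable_zero E.ip_simps)

lemma ktensor_diff_right:
  "x \<in> vcarrier E \<Longrightarrow> y \<in> vcarrier E \<Longrightarrow>
    ktensor (E, \<phi>) a (vdiff E x y) = vdiff K (ktensor (E, \<phi>) a x) (ktensor (E, \<phi>) a y)"
  by (simp add: vdiff_def ktensor_add_right ktensor_scale_right)

lemma ktensor_bounded:
  obtains C where "C > 0" "\<And>a x. x \<in> vcarrier E \<Longrightarrow>
    hnorm K (ktensor (E, \<phi>) a x) \<le> C * norm a * hnorm E x"
proof -
  obtain M where M: "M > 0" "\<And>a x. cstar_positive a \<Longrightarrow> x \<in> vcarrier E \<Longrightarrow>
      hnorm E (\<phi> a x) \<le> M * norm a * hnorm E x" using cp_bounded by blast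
  have "hnorm K (ktensor (E, \<phi>) a x) \<le> sqrt M * norm a * hnorm E x" if x: "x \<in> vcarrier E" for a x
  proof (rule K.hnorm_le)
    have "norm (hip K (ktensor (E, \<phi>) a x) (ktensor (E, \<phi>) a x)) \<le> hnorm E x * hnorm E (\<phi> (star a * a) x)"
      using x by (simp add: ip_ktensor E.cauchy_schwarz)
    also have "\<dots> \<le> hnorm E x * (M * norm (star a * a) * hnorm E x)"
      by (intro mult_left_mono M x) simp_all
    also have "\<dots> = (sqrt M * norm a * hnorm E x)\<^sup>2"
      using M(1) by (simp add: power_mult_distrib norm_star_mult_self) (simp add: power2_eq_square)
    finally show "norm (hip K (ktensor (E, \<phi>) a x) (ktensor (E, \<phi>) a x)) \<le> (sqrt M * norm a * hnorm E x)\<^sup>2" .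
  qed (use M in simp)
  then show thesis using M(1) by (intro that[of "sqrt M"]) auto
qed

text \<open>Left multiplications by \<open>b\<close> and by \<open>star b\<close> are formally
  adjoint. The modulus multiplies by \<open>star b * b\<close>, so submultiplicativity of the norm
  gives growth at rate \<open>(norm b)\<^sup>2\<close>.\<close>

lemma ksgns_rep_exists:
  obtains T where "T \<in> adjointable K K"
    "\<And>a x. x \<in> vcarrier E \<Longrightarrow> T (ktensor (E, \<phi>) a x) = ktensor (E, \<phi>) (b * a) x"
    "\<And>a x. x \<in> vcarrier E \<Longrightarrow> hadj K K T (ktensor (E, \<phi>) a x) = ktensor (E, \<phi>) (star b * a) x"
proof -
  obtain C where C: "C > 0" "\<And>a x. x \<in> vcarrier E \<Longrightarrow>
      hnorm K (ktensor (E, \<phi>) a x) \<le> C * norm a * hnorm E x" using ktensor_bounded by blast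
  define \<sigma> where "\<sigma> = (\<lambda>k::'a \<times> 'e. (b * fst k, snd k))"
  define \<tau> where "\<tau> = (\<lambda>k::'a \<times> 'e. (star b * fst k, snd k))"
  define \<rho> where "\<rho> = \<tau> \<circ> \<sigma>"
  have \<rho>: "\<rho> k = (star b * (b * fst k), snd k)" for k by (simp add: \<rho>_def \<sigma>_def \<tau>_def)
  have iter: "snd ((\<rho> ^^ n) k) = snd k \<and> norm (fst ((\<rho> ^^ n) k)) \<le> ((norm b)\<^sup>2) ^ n * norm (fst k)" for n k
  proof (induction n)
    case (Suc n)
    let ?z = "fst ((\<rho> ^^ n) k)"
    have "norm (star b * (b * ?z)) \<le> norm (star b * b) * norm ?z"
      by (simp add: norm_mult_ineq flip: mult.assoc)
    also have "\<dots> = (norm b)\<^sup>2 * norm ?z" by (simp add: norm_star_mult_self)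
    also have "\<dots> \<le> (norm b)\<^sup>2 * (((norm b)\<^sup>2) ^ n * norm (fst k))"
      by (rule mult_left_mono[OF conjunct2[OF Suc]]) simp
    finally have le: "norm (star b * (b * ?z)) \<le> ((norm b)\<^sup>2) ^ Suc n * norm (fst k)"
      by (simp add: mult.assoc)
    have step: "(\<rho> ^^ Suc n) k = (star b * (b * ?z), snd ((\<rho> ^^ n) k))"
      unfolding funpow.simps o_apply by (rule \<rho>)
    show ?case unfolding step fst_conv snd_conv using le Suc by simp
  qed simp
  note iter = iter[unfolded \<rho>_def]
  show thesis
  proof (rule adjointable_on_generators[OF generated_ksgns generated_ksgns, of \<sigma> \<tau> "(norm b)\<^sup>2"])
    fix i :: "'a \<times> 'e" assume i: "i \<in> UNIV \<times> vcarrier E"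
    show "\<exists>C. \<forall>n. hnorm K (ktensor (E, \<phi>) (fst (((\<tau> \<circ> \<sigma>) ^^ n) i)) (snd (((\<tau> \<circ> \<sigma>) ^^ n) i))) \<le> C * ((norm b)\<^sup>2) ^ n"
    proof (intro exI allI)
      fix n
      let ?z = "fst (((\<tau> \<circ> \<sigma>) ^^ n) i)"
      have z: "snd (((\<tau> \<circ> \<sigma>) ^^ n) i) = snd i" "norm ?z \<le> ((norm b)\<^sup>2) ^ n * norm (fst i)"
        using iter[of n i] by auto
      have "hnorm K (ktensor (E, \<phi>) ?z (snd i)) \<le> C * norm ?z * hnorm E (snd i)"
        using C(2) i by auto
      also have "\<dots> \<le> C * (((norm b)\<^sup>2) ^ n * norm (fst i)) * hnorm E (snd i)"
        using C(1) z by (intro mult_right_mono mult_left_mono) auto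
      finally show "hnorm K (ktensor (E, \<phi>) ?z (snd (((\<tau> \<circ> \<sigma>) ^^ n) i))) \<le>
          (C * norm (fst i) * hnorm E (snd i)) * ((norm b)\<^sup>2) ^ n"
        by (simp add: z(1) mult_ac)
    qed
  next
    fix T
    assume "T \<in> adjointable K K"
      "\<And>i. i \<in> UNIV \<times> vcarrier E \<Longrightarrow> T (ktensor (E, \<phi>) (fst i) (snd i)) = ktensor (E, \<phi>) (fst (\<sigma> i)) (snd (\<sigma> i))"
      "\<And>j. j \<in> UNIV \<times> vcarrier E \<Longrightarrow> hadj K K T (ktensor (E, \<phi>) (fst j) (snd j)) =
        ktensor (E, \<phi>) (fst (\<tau> j)) (snd (\<tau> j))"
    then show thesis by (intro that[of T]) (force simp: \<sigma>_def \<tau>_def)+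
  qed (auto simp: \<sigma>_def \<tau>_def ip_ktensor star_mult mult.assoc)
qed

lemma eq_on_ktensor:
  assumes "hilbert G" "T \<in> adjointable K G" "S \<in> adjointable K G"
    and "\<And>a x. x \<in> vcarrier E \<Longrightarrow> T (ktensor (E, \<phi>) a x) = S (ktensor (E, \<phi>) a x)"
  shows "T = S"
  by (rule adjointable_eqI[OF generated_ksgns assms(1-3)]) (use assms(4) in auto)

lemma ksgns_rep_eqI:
  assumes "T \<in> adjointable K K"
    and "\<And>a x. x \<in> vcarrier E \<Longrightarrow> T (ktensor (E, \<phi>) a x) = ktensor (E, \<phi>) (b * a) x"
  shows "ksgns_rep (E, \<phi>) b = T"
  unfolding ksgns_rep_def
proof (rule the_equality)
  fix S assume S: "S \<in> adjointable K K \<and>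
    (\<forall>a. \<forall>x\<in>vcarrier (fst (E, \<phi>)). S (ktensor (E, \<phi>) a x) = ktensor (E, \<phi>) (b * a) x)"
  show "S = T" by (rule eq_on_ktensor[OF hilbert_ksgns]) (use S assms in auto)
qed (use assms in auto)

lemma ksgns_rep:
  shows "ksgns_rep (E, \<phi>) b \<in> adjointable K K"
    and "\<And>a x. x \<in> vcarrier E \<Longrightarrow> ksgns_rep (E, \<phi>) b (ktensor (E, \<phi>) a x) = ktensor (E, \<phi>) (b * a) x"
    and "hadj K K (ksgns_rep (E, \<phi>) b) = ksgns_rep (E, \<phi>) (star b)"
proof -
  obtain T where T: "T \<in> adjointable K K"
    "\<And>a x. x \<in> vcarrier E \<Longrightarrow> T (ktensor (E, \<phi>) a x) = ktensor (E, \<phi>) (b * a) x"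
    "\<And>a x. x \<in> vcarrier E \<Longrightarrow> hadj K K T (ktensor (E, \<phi>) a x) = ktensor (E, \<phi>) (star b * a) x"
    using ksgns_rep_exists[of b] by blast
  have eq: "ksgns_rep (E, \<phi>) b = T" by (rule ksgns_rep_eqI[OF T(1,2)])
  show "ksgns_rep (E, \<phi>) b \<in> adjointable K K"
    "\<And>a x. x \<in> vcarrier E \<Longrightarrow> ksgns_rep (E, \<phi>) b (ktensor (E, \<phi>) a x) = ktensor (E, \<phi>) (b * a) x"
    by (simp_all add: eq T)
  show "hadj K K (ksgns_rep (E, \<phi>) b) = ksgns_rep (E, \<phi>) (star b)"
    unfolding eq by (rule ksgns_rep_eqI[symmetric, OF KK.hadj_in_adjointable[OF T(1)] T(3)])
qed

text \<open>Each law equates adjointable maps and reduces on generators to an identity in the first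
  tensor factor.\<close>

lemma star_representation_ksgns: "star_representation K (ksgns_rep (E, \<phi>))"
  unfolding star_representation_def linear_into_adjointable_def
proof (intro conjI allI ballI)
  show "ksgns_rep (E, \<phi>) a \<in> adjointable K K" for a by (rule ksgns_rep)
  show "ksgns_rep (E, \<phi>) (star a) = hadj K K (ksgns_rep (E, \<phi>) a)" for a by (simp add: ksgns_rep(3))
next
  fix a b Z assume Z: "Z \<in> vcarrier K"
  have "ksgns_rep (E, \<phi>) (a + b) = (\<lambda>Z\<in>vcarrier K. vadd K (ksgns_rep (E, \<phi>) a Z) (ksgns_rep (E, \<phi>) b Z))"
    by (rule eq_on_ktensor[OF hilbert_ksgns ksgns_rep(1) KK.adjointable_op_add[OF ksgns_rep(1) ksgns_rep(1)]])
      (simp add: ksgns_rep(2) distrib_right ktensor_add_left)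
  then show "ksgns_rep (E, \<phi>) (a + b) Z = vadd K (ksgns_rep (E, \<phi>) a Z) (ksgns_rep (E, \<phi>) b Z)"
    using Z by simp
next
  fix c a Z assume Z: "Z \<in> vcarrier K"
  have "ksgns_rep (E, \<phi>) (scaleC c a) = (\<lambda>Z\<in>vcarrier K. vscale K c (ksgns_rep (E, \<phi>) a Z))"
    by (rule eq_on_ktensor[OF hilbert_ksgns ksgns_rep(1) KK.adjointable_op_scale[OF ksgns_rep(1)]])
      (simp add: ksgns_rep(2) mult_scaleC_left ktensor_scale_left)
  then show "ksgns_rep (E, \<phi>) (scaleC c a) Z = vscale K c (ksgns_rep (E, \<phi>) a Z)"
    using Z by simp
next
  fix a b Z assume Z: "Z \<in> vcarrier K"
  have "ksgns_rep (E, \<phi>) (a * b) = compose (vcarrier K) (ksgns_rep (E, \<phi>) a) (ksgns_rep (E, \<phi>) b)"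
    by (rule eq_on_ktensor[OF hilbert_ksgns ksgns_rep(1) adjointable_compose(1)[OF hilbert_ksgns
            hilbert_ksgns hilbert_ksgns ksgns_rep(1) ksgns_rep(1)]])
      (simp add: ksgns_rep(2) compose_def mult.assoc)
  then show "ksgns_rep (E, \<phi>) (a * b) Z = ksgns_rep (E, \<phi>) a (ksgns_rep (E, \<phi>) b Z)"
    using Z by (simp add: compose_def)
qed

lemma cp_family_ksgns: "cp_family K (ksgns_rep (E, \<phi>))"
  by (rule cp_familyI[OF hilbert_ksgns star_representation_completely_positive[OF hilbert_ksgns
          star_representation_ksgns]])

text \<open>On a generator \<open>u\<close> acts by \<open>a \<mapsto> u * a\<close> in the first
  factor, and \<open>u * a\<close> converges to \<open>a\<close> along any approximate unit.\<close>

lemma strict_ksgns: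
  assumes unit: "approximate_unit (\<F> :: 'a filter)"
  shows "strict K (ksgns_rep (E, \<phi>))"
proof -
  interpret B: cp_family K "ksgns_rep (E, \<phi>)" by (rule cp_family_ksgns)
  obtain C where C: "C > 0" "\<And>a x. x \<in> vcarrier E \<Longrightarrow>
      hnorm K (ktensor (E, \<phi>) a x) \<le> C * norm a * hnorm E x" using ktensor_bounded by blast
  show ?thesis
  proof (rule B.strict_on_generators[OF generated_ksgns unit])
    fix k :: "'a \<times> 'e" and e :: real assume k: "k \<in> UNIV \<times> vcarrier E" and e: "e > 0"
    define a where "a = fst k"
    define x where "x = snd k"
    have x: "x \<in> vcarrier E" using k by (auto simp: x_def)
    define r where "r = C * (hnorm E x + 1)"
    have r: "r > 0" using C by (simp add: r_def add_nonneg_pos)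
    have "((\<lambda>u. u * a) \<longlongrightarrow> a) \<F>" using unit by (simp add: approximate_unit_def)
    then have ev: "\<forall>\<^sub>F u in \<F>. dist (u * a) a < e / (2 * r)"
      by (rule tendstoD) (use e r in simp)
    have "hdist K (ksgns_rep (E, \<phi>) u (ktensor (E, \<phi>) a x)) (ksgns_rep (E, \<phi>) v (ktensor (E, \<phi>) a x)) < e"
      if "dist (u * a) a < e / (2 * r)" "dist (v * a) a < e / (2 * r)" for u v
    proof -
      have "hdist K (ksgns_rep (E, \<phi>) u (ktensor (E, \<phi>) a x)) (ksgns_rep (E, \<phi>) v (ktensor (E, \<phi>) a x)) =
          hnorm K (ktensor (E, \<phi>) (u * a - v * a) x)"
        using x by (simp add: ksgns_rep(2) ktensor_diff_left)
      also have "\<dots> \<le> C * norm (u * a - v * a) * hnorm E x" by (rule C(2)[OF x])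
      also have "\<dots> \<le> r * norm (u * a - v * a)"
        using C(1) by (simp add: r_def algebra_simps)
      also have "norm (u * a - v * a) \<le> dist (u * a) a + dist (v * a) a"
        using dist_triangle2[of "u * a" "v * a" a] by (simp add: dist_norm)
      also have "\<dots> < e / (2 * r) + e / (2 * r)" using that by (rule add_strict_mono)
      also have "r * (e / (2 * r) + e / (2 * r)) = e" using r by (simp add: field_simps)
      finally show ?thesis using r by simp
    qed
    then show "\<exists>P. eventually P \<F> \<and> (\<forall>u v. P u \<longrightarrow> P v \<longrightarrow>
        hdist K (ksgns_rep (E, \<phi>) u (ktensor (E, \<phi>) (fst k) (snd k)))
          (ksgns_rep (E, \<phi>) v (ktensor (E, \<phi>) (fst k) (snd k))) < e)"
      using ev unfolding a_def x_def by blast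
  qed
qed

end

section \<open>The KSGNS construction on morphisms\<close>

locale ksgns_pair = A1: cp_family E1 \<phi>1 + A2: cp_family E2 \<phi>2
  for E1 :: "('e, 'b::cstar_algebra) hmod" and \<phi>1 :: "'a::cstar_algebra \<Rightarrow> 'e \<Rightarrow> 'e"
    and E2 :: "('e, 'b) hmod" and \<phi>2 :: "'a \<Rightarrow> 'e \<Rightarrow> 'e"
begin

interpretation EE: hilbert_pair E1 E2
  by (intro hilbert_pairI A1.E.hilbert_axioms A2.E.hilbert_axioms)

text \<open>The formal adjoint applies \<open>inv \<alpha>\<close> to the algebra factor, so the
  modulus fixes that factor and iterates only \<open>\<eta>\<close> followed by its adjoint. The
  growth rate is thus the one known from \<open>\<eta>\<close>.\<close>

lemma ksgns_map_exists:
  assumes f: "(\<eta>, \<alpha>) \<in> pos_hom (E1, \<phi>1) (E2, \<phi>2)"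
  obtains T where "T \<in> adjointable A1.K A2.K"
    "\<And>a x. x \<in> vcarrier E1 \<Longrightarrow> T (ktensor (E1, \<phi>1) a x) = ktensor (E2, \<phi>2) (\<alpha> a) (\<eta> x)"
proof -
  have \<eta>: "\<eta> \<in> adjointable E1 E2" and \<alpha>: "star_automorphism \<alpha>"
    and eq: "\<And>a x. x \<in> vcarrier E1 \<Longrightarrow> \<phi>2 (\<alpha> a) (\<eta> x) = \<eta> (\<phi>1 a x)"
    using f by (auto simp: pos_hom_def)
  note \<alpha>' = star_automorphismD[OF \<alpha>]
  obtain c where c: "c > 0" "\<And>x. x \<in> vcarrier E1 \<Longrightarrow> hnorm E2 (\<eta> x) \<le> c * hnorm E1 x"
    using EE.adjointable_bounded[OF \<eta>] by blast
  have c': "hnorm E1 (hadj E1 E2 \<eta> x) \<le> c * hnorm E2 x" if "x \<in> vcarrier E2" for x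
    by (rule EE.adjoint_bound[OF \<eta> _ c(2) that]) (use c in auto)
  obtain C where C: "C > 0" "\<And>a x. x \<in> vcarrier E1 \<Longrightarrow>
      hnorm A1.K (ktensor (E1, \<phi>1) a x) \<le> C * norm a * hnorm E1 x"
    using A1.ktensor_bounded by blast
  define \<sigma> where "\<sigma> = (\<lambda>k::'a \<times> 'e. (\<alpha> (fst k), \<eta> (snd k)))"
  define \<tau> where "\<tau> = (\<lambda>k::'a \<times> 'e. (inv \<alpha> (fst k), hadj E1 E2 \<eta> (snd k)))"
  define \<rho> where "\<rho> = \<tau> \<circ> \<sigma>"
  have \<rho>: "\<rho> k = (fst k, hadj E1 E2 \<eta> (\<eta> (snd k)))" for k by (simp add: \<rho>_def \<sigma>_def \<tau>_def \<alpha>')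
  have iter: "snd ((\<rho> ^^ n) k) \<in> vcarrier E1 \<and> fst ((\<rho> ^^ n) k) = fst k \<and>
      hnorm E1 (snd ((\<rho> ^^ n) k)) \<le> (c\<^sup>2) ^ n * hnorm E1 (snd k)"
    if "snd k \<in> vcarrier E1" for n k
  proof (induction n)
    case (Suc n)
    let ?z = "snd ((\<rho> ^^ n) k)"
    have z: "?z \<in> vcarrier E1" by (rule conjunct1[OF Suc])
    have "hnorm E1 (hadj E1 E2 \<eta> (\<eta> ?z)) \<le> c * hnorm E2 (\<eta> ?z)" using c' \<eta> z by simp
    also have "\<dots> \<le> c * (c * hnorm E1 ?z)" using c z by simp
    also have "\<dots> \<le> c * (c * ((c\<^sup>2) ^ n * hnorm E1 (snd k)))"
      by (intro mult_left_mono conjunct2[OF conjunct2[OF Suc]]) (use c in auto)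
    finally have le: "hnorm E1 (hadj E1 E2 \<eta> (\<eta> ?z)) \<le> (c\<^sup>2) ^ Suc n * hnorm E1 (snd k)"
      by (simp add: power2_eq_square mult.assoc)
    have step: "(\<rho> ^^ Suc n) k = (fst ((\<rho> ^^ n) k), hadj E1 E2 \<eta> (\<eta> ?z))"
      unfolding funpow.simps o_apply by (rule \<rho>)
    show ?case unfolding step fst_conv snd_conv using le Suc \<eta> z by simp
  qed (use that in simp)
  note iter = iter[unfolded \<rho>_def]
  have ip: "hip E2 (\<eta> x) (\<phi>2 (star (\<alpha> a) * b) y) = hip E1 x (\<phi>1 (star a * inv \<alpha> b) (hadj E1 E2 \<eta> y))"
    if x: "x \<in> vcarrier E1" and y: "y \<in> vcarrier E2" for a b x y
  proof -
    \<comment> \<open>Chosen so that \<open>\<alpha> d = star (\<alpha> a) * b\<close>. Written as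
      \<open>star (\<alpha> (star d))\<close> it moves to the left argument, where the intertwining
      relation applies.\<close>
    define d where "d = star a * inv \<alpha> b"
    have d: "star (\<alpha> a) * b = star (\<alpha> (star d))"
      by (simp add: d_def \<alpha>' star_mult)
    have "hip E2 (\<eta> x) (\<phi>2 (star (\<alpha> a) * b) y) = hip E2 (\<phi>2 (\<alpha> (star d)) (\<eta> x)) y"
      using \<eta> x y unfolding d by (simp add: A2.ip_cp_left)
    also have "\<dots> = hip E1 (\<phi>1 (star d) x) (hadj E1 E2 \<eta> y)"
      using \<eta> x y by (simp add: eq EE.ip_adjointable_left)
    also have "\<dots> = hip E1 x (\<phi>1 d (hadj E1 E2 \<eta> y))"
      using \<eta> x y by (simp add: A1.ip_cp_left)
    finally show ?thesis by (simp add: d_def)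
  qed
  show thesis
  proof (rule adjointable_on_generators[OF A1.generated_ksgns A2.generated_ksgns, of \<sigma> \<tau> "c\<^sup>2"])
    fix i :: "'a \<times> 'e" assume i: "i \<in> UNIV \<times> vcarrier E1"
    show "\<exists>C. \<forall>n. hnorm A1.K (ktensor (E1, \<phi>1) (fst (((\<tau> \<circ> \<sigma>) ^^ n) i)) (snd (((\<tau> \<circ> \<sigma>) ^^ n) i))) \<le> C * (c\<^sup>2) ^ n"
    proof (intro exI allI)
      fix n
      let ?z = "snd (((\<tau> \<circ> \<sigma>) ^^ n) i)"
      have z: "?z \<in> vcarrier E1" "fst (((\<tau> \<circ> \<sigma>) ^^ n) i) = fst i"
        "hnorm E1 ?z \<le> (c\<^sup>2) ^ n * hnorm E1 (snd i)"
        using iter[of i n] i by auto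
      have "hnorm A1.K (ktensor (E1, \<phi>1) (fst i) ?z) \<le> C * norm (fst i) * hnorm E1 ?z"
        using C(2) z i by auto
      also have "\<dots> \<le> C * norm (fst i) * ((c\<^sup>2) ^ n * hnorm E1 (snd i))"
        using C(1) z by (intro mult_left_mono) auto
      finally show "hnorm A1.K (ktensor (E1, \<phi>1) (fst (((\<tau> \<circ> \<sigma>) ^^ n) i)) ?z) \<le>
          (C * norm (fst i) * hnorm E1 (snd i)) * (c\<^sup>2) ^ n"
        by (simp add: z(2) mult_ac)
    qed
  next
    fix T
    assume "T \<in> adjointable A1.K A2.K"
      "\<And>i. i \<in> UNIV \<times> vcarrier E1 \<Longrightarrow> T (ktensor (E1, \<phi>1) (fst i) (snd i)) =
        ktensor (E2, \<phi>2) (fst (\<sigma> i)) (snd (\<sigma> i))"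
    then show thesis by (intro that[of T]) (force simp: \<sigma>_def)+
  qed (use \<eta> in \<open>auto simp: \<sigma>_def \<tau>_def A1.ip_ktensor A2.ip_ktensor ip\<close>)
qed

lemma ksgns_map_eqI:
  assumes "T \<in> adjointable A1.K A2.K"
    and "\<And>a x. x \<in> vcarrier E1 \<Longrightarrow> T (ktensor (E1, \<phi>1) a x) = ktensor (E2, \<phi>2) (snd f a) (fst f x)"
  shows "ksgns_map (E1, \<phi>1) (E2, \<phi>2) f = T"
  unfolding ksgns_map_def
proof (rule the_equality)
  fix S assume S: "S \<in> adjointable A1.K A2.K \<and> (\<forall>a. \<forall>x\<in>vcarrier (fst (E1, \<phi>1)).
    S (ktensor (E1, \<phi>1) a x) = ktensor (E2, \<phi>2) (snd f a) (fst f x))"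
  show "S = T" by (rule A1.eq_on_ktensor[OF A2.hilbert_ksgns]) (use S assms in auto)
qed (use assms in auto)

lemma ksgns_map:
  assumes "f \<in> pos_hom (E1, \<phi>1) (E2, \<phi>2)"
  shows "ksgns_map (E1, \<phi>1) (E2, \<phi>2) f \<in> adjointable A1.K A2.K"
    and "\<And>a x. x \<in> vcarrier E1 \<Longrightarrow>
      ksgns_map (E1, \<phi>1) (E2, \<phi>2) f (ktensor (E1, \<phi>1) a x) = ktensor (E2, \<phi>2) (snd f a) (fst f x)"
proof -
  have "(fst f, snd f) \<in> pos_hom (E1, \<phi>1) (E2, \<phi>2)" using assms by simp
  then obtain T where T: "T \<in> adjointable A1.K A2.K"
    "\<And>a x. x \<in> vcarrier E1 \<Longrightarrow> T (ktensor (E1, \<phi>1) a x) = ktensor (E2, \<phi>2) (snd f a) (fst f x)"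
    using ksgns_map_exists by blast
  have "ksgns_map (E1, \<phi>1) (E2, \<phi>2) f = T" by (rule ksgns_map_eqI[OF T])
  with T show "ksgns_map (E1, \<phi>1) (E2, \<phi>2) f \<in> adjointable A1.K A2.K"
    "\<And>a x. x \<in> vcarrier E1 \<Longrightarrow>
      ksgns_map (E1, \<phi>1) (E2, \<phi>2) f (ktensor (E1, \<phi>1) a x) = ktensor (E2, \<phi>2) (snd f a) (fst f x)"
    by simp_all
qed

end

lemma ksgns_pairI: "cp_family E1 \<phi>1 \<Longrightarrow> cp_family E2 \<phi>2 \<Longrightarrow> ksgns_pair E1 \<phi>1 E2 \<phi>2"
  by (rule ksgns_pair.intro)

theorem is_functor_KSGNS:
  "is_functor (PosCor :: (('e, 'a::cstar_algebra, 'b::cstar_algebra) pos_obj, ('e, 'e, 'a) pos_mor) cat) PosCor KSGNS"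
  unfolding is_functor_def PosCor_simps
proof (intro conjI ballI category_PosCor)
  fix X :: "('e, 'a, 'b) pos_obj" assume X: "X \<in> Obj PosCor"
  obtain E \<phi> where X': "X = (E, \<phi>)" by (cases X)
  have cp: "cp_family E \<phi>" and "strict E \<phi>" using X by (simp_all add: X' PosCor_obj)
  \<comment> \<open>Strictness of \<open>\<phi>\<close> is the source of an approximate unit of the
    algebra.\<close>
  then obtain \<F> :: "'a filter" where \<F>: "approximate_unit \<F>" by (auto simp: strict_def)
  interpret A: cp_family E \<phi> by fact
  interpret ksgns_pair E \<phi> E \<phi> by (rule ksgns_pairI[OF cp cp])
  show "on_obj KSGNS X \<in> Obj PosCor"
    by (simp add: X' KSGNS_def PosCor_obj A.cp_family_ksgns A.strict_ksgns[OF \<F>])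
  have "ksgns_map (E, \<phi>) (E, \<phi>) (restrict id (vcarrier E), id) = restrict id (vcarrier A.K)"
    by (rule ksgns_map_eqI) (simp_all add: adjointable_id A.hilbert_ksgns)
  then show "on_mor KSGNS X X (pos_id X) = pos_id (on_obj KSGNS X)"
    by (simp add: X' KSGNS_def pos_id_def)
next
  fix X Y :: "('e, 'a, 'b) pos_obj" and f
  assume X: "X \<in> Obj PosCor" and Y: "Y \<in> Obj PosCor" and f: "f \<in> pos_hom X Y"
  obtain E1 \<phi>1 where X': "X = (E1, \<phi>1)" by (cases X)
  obtain E2 \<phi>2 where Y': "Y = (E2, \<phi>2)" by (cases Y)
  have cp1: "cp_family E1 \<phi>1" using X by (simp add: X' PosCor_obj)
  have cp2: "cp_family E2 \<phi>2" using Y by (simp add: Y' PosCor_obj)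
  interpret P: ksgns_pair E1 \<phi>1 E2 \<phi>2 by (rule ksgns_pairI[OF cp1 cp2])
  have f': "f \<in> pos_hom (E1, \<phi>1) (E2, \<phi>2)" using f by (simp add: X' Y')
  have \<alpha>: "star_automorphism (snd f)" by (rule pos_homD(3)[OF f])
  have fc: "fst f x \<in> vcarrier E2" if "x \<in> vcarrier E1" for x
    using pos_homD(2)[OF f'] that by simp
  have "(ksgns_map (E1, \<phi>1) (E2, \<phi>2) f, snd f) \<in>
      pos_hom (P.A1.K, ksgns_rep (E1, \<phi>1)) (P.A2.K, ksgns_rep (E2, \<phi>2))"
  proof (rule pos_homI[OF P.A1.hilbert_ksgns P.A2.hilbert_ksgns P.ksgns_map(1)[OF f'] \<alpha> P.A1.generated_ksgns
        P.A1.ksgns_rep(1) P.A2.ksgns_rep(1)])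
    fix a and i :: "'a \<times> 'e" assume "i \<in> UNIV \<times> vcarrier E1"
    then show "ksgns_rep (E2, \<phi>2) (snd f a) (ksgns_map (E1, \<phi>1) (E2, \<phi>2) f (ktensor (E1, \<phi>1) (fst i) (snd i))) =
        ksgns_map (E1, \<phi>1) (E2, \<phi>2) f (ksgns_rep (E1, \<phi>1) a (ktensor (E1, \<phi>1) (fst i) (snd i)))"
      by (auto simp: P.ksgns_map(2)[OF f'] P.A1.ksgns_rep(2) P.A2.ksgns_rep(2) fc star_automorphismD(1)[OF \<alpha>])
  qed
  then show "on_mor KSGNS X Y f \<in> pos_hom (on_obj KSGNS X) (on_obj KSGNS Y)"
    by (simp add: X' Y' KSGNS_def)
next
  fix X Y Z :: "('e, 'a, 'b) pos_obj" and f g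
  assume X: "X \<in> Obj PosCor" and Y: "Y \<in> Obj PosCor" and Z: "Z \<in> Obj PosCor"
    and f: "f \<in> pos_hom X Y" and g: "g \<in> pos_hom Y Z"
  obtain E1 \<phi>1 where X': "X = (E1, \<phi>1)" by (cases X)
  obtain E2 \<phi>2 where Y': "Y = (E2, \<phi>2)" by (cases Y)
  obtain E3 \<phi>3 where Z': "Z = (E3, \<phi>3)" by (cases Z)
  have cp1: "cp_family E1 \<phi>1" using X by (simp add: X' PosCor_obj)
  have cp2: "cp_family E2 \<phi>2" using Y by (simp add: Y' PosCor_obj)
  have cp3: "cp_family E3 \<phi>3" using Z by (simp add: Z' PosCor_obj)
  interpret P12: ksgns_pair E1 \<phi>1 E2 \<phi>2 by (rule ksgns_pairI[OF cp1 cp2])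
  interpret P23: ksgns_pair E2 \<phi>2 E3 \<phi>3 by (rule ksgns_pairI[OF cp2 cp3])
  interpret P13: ksgns_pair E1 \<phi>1 E3 \<phi>3 by (rule ksgns_pairI[OF cp1 cp3])
  have f': "f \<in> pos_hom (E1, \<phi>1) (E2, \<phi>2)" and g': "g \<in> pos_hom (E2, \<phi>2) (E3, \<phi>3)"
    using f g by (simp_all add: X' Y' Z')
  have fc: "fst f x \<in> vcarrier E2" if "x \<in> vcarrier E1" for x
    using pos_homD(2)[OF f'] that by simp
  have "ksgns_map (E1, \<phi>1) (E3, \<phi>3) (pos_comp (E1, \<phi>1) g f) =
      compose (vcarrier P12.A1.K) (ksgns_map (E2, \<phi>2) (E3, \<phi>3) g) (ksgns_map (E1, \<phi>1) (E2, \<phi>2) f)"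
  proof (rule P13.ksgns_map_eqI)
    show "compose (vcarrier P12.A1.K) (ksgns_map (E2, \<phi>2) (E3, \<phi>3) g) (ksgns_map (E1, \<phi>1) (E2, \<phi>2) f)
        \<in> adjointable P12.A1.K P23.A2.K"
      by (rule adjointable_compose(1)[OF P12.A1.hilbert_ksgns P12.A2.hilbert_ksgns P23.A2.hilbert_ksgns
            P12.ksgns_map(1)[OF f'] P23.ksgns_map(1)[OF g']])
    fix a x assume "x \<in> vcarrier E1"
    then show "compose (vcarrier P12.A1.K) (ksgns_map (E2, \<phi>2) (E3, \<phi>3) g) (ksgns_map (E1, \<phi>1) (E2, \<phi>2) f)
        (ktensor (E1, \<phi>1) a x) =
        ktensor (E3, \<phi>3) (snd (pos_comp (E1, \<phi>1) g f) a) (fst (pos_comp (E1, \<phi>1) g f) x)"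
      by (simp add: compose_def P12.ksgns_map(2)[OF f'] P23.ksgns_map(2)[OF g'] fc pos_comp_def)
  qed
  then show "on_mor KSGNS X Z (pos_comp X g f) = pos_comp (on_obj KSGNS X) (on_mor KSGNS Y Z g) (on_mor KSGNS X Y f)"
    by (simp add: X' Y' Z' KSGNS_def pos_comp_def)
qed

section \<open>The natural isomorphism\<close>

text \<open>Density is transitive: in a given combination each old generator is approximated with a
  tolerance scaled by its coefficient.\<close>

lemma generated_by_approximation:
  assumes gen: "generated_by H I h" and k: "\<And>j. j \<in> J \<Longrightarrow> k j \<in> vcarrier H"
    and approx: "\<And>i e. i \<in> I \<Longrightarrow> e > 0 \<Longrightarrow>
      \<exists>L. snd ` set L \<subseteq> J \<and> hdist H (h i) (lincomb H k L) < e"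
  shows "generated_by H J k"
proof -
  interpret H: hilbert H using gen by (simp add: generated_by_def)
  have h: "h i \<in> vcarrier H" if "i \<in> I" for i using gen that by (simp add: generated_by_def)
  have hc: "lincomb H h L \<in> vcarrier H" if "snd ` set L \<subseteq> I" for L
    by (rule H.lincomb_closed[OF _ that]) (rule h)
  have kc: "lincomb H k L \<in> vcarrier H" if "snd ` set L \<subseteq> J" for L
    by (rule H.lincomb_closed[OF _ that]) (rule k)
  have comb: "\<exists>L'. snd ` set L' \<subseteq> J \<and> hdist H (lincomb H h L) (lincomb H k L') < e"
    if "snd ` set L \<subseteq> I" "e > 0" for L e
    using that
  proof (induction L arbitrary: e)
    case Nil
    then show ?case by (intro exI[of _ "[]"]) simp
  next
    case (Cons q L)
    have q: "snd q \<in> I" and L: "snd ` set L \<subseteq> I" using Cons.prems by auto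
    define c where "c = cmod (fst q) + 1"
    have c: "c > 0" "cmod (fst q) \<le> c" by (simp_all add: c_def add_nonneg_pos)
    obtain M where M: "snd ` set M \<subseteq> J" "hdist H (h (snd q)) (lincomb H k M) < e / (2 * c)"
      using approx[OF q, of "e / (2 * c)"] Cons.prems(2) c by auto
    obtain N where N: "snd ` set N \<subseteq> J" "hdist H (lincomb H h L) (lincomb H k N) < e / 2"
      using Cons.IH[OF L, of "e / 2"] Cons.prems(2) by auto
    let ?M = "map (\<lambda>m. (fst q * fst m, snd m)) M"
    have M': "snd ` set ?M \<subseteq> J" using M(1) by (simp add: image_image)
    have sc: "lincomb H k ?M = vscale H (fst q) (lincomb H k M)" by (rule H.lincomb_scale[OF k M(1)])
    have ap: "lincomb H k (?M @ N) = vadd H (lincomb H k ?M) (lincomb H k N)"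
      by (rule H.lincomb_append[OF k M' N(1)])
    have "hdist H (lincomb H h (q # L)) (lincomb H k (?M @ N)) \<le>
        hdist H (vscale H (fst q) (h (snd q))) (vscale H (fst q) (lincomb H k M)) +
        hdist H (lincomb H h L) (lincomb H k N)"
      unfolding ap sc lincomb.simps
      by (rule H.hnorm_vdiff_add_le) (simp_all add: h q hc L kc M N)
    also have "hdist H (vscale H (fst q) (h (snd q))) (vscale H (fst q) (lincomb H k M)) \<le>
        c * hdist H (h (snd q)) (lincomb H k M)"
      using c(2) h[OF q] kc[OF M(1)] by (simp add: H.hnorm_vdiff_scale mult_right_mono)
    also have "\<dots> \<le> e / 2" using M(2) c(1) by (simp add: field_simps)
    finally have "hdist H (lincomb H h (q # L)) (lincomb H k (?M @ N)) < e" using N(2) by simp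
    moreover have "snd ` set (?M @ N) \<subseteq> J" using M' N(1) by (simp add: image_Un)
    ultimately show ?case by blast
  qed
  show ?thesis
    unfolding generated_by_def
  proof (intro conjI ballI allI impI H.hilbert_axioms k)
    fix X and e :: real assume X: "X \<in> vcarrier H" and e: "e > 0"
    obtain L where L: "snd ` set L \<subseteq> I" "hdist H X (lincomb H h L) < e / 2"
      by (rule generated_byD[OF gen X half_gt_zero[OF e]])
    obtain L' where L': "snd ` set L' \<subseteq> J" "hdist H (lincomb H h L) (lincomb H k L') < e / 2"
      using comb[OF L(1), of "e / 2"] e by auto
    have "hdist H X (lincomb H k L') < e"
      using H.hnorm_vdiff_triangle[OF X hc[OF L(1)] kc[OF L'(1)]] L(2) L'(2) by simp
    with L'(1) show "\<exists>L. snd ` set L \<subseteq> J \<and> hdist H X (lincomb H k L) < e" by blast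
  qed
qed

lemma lincomb_linear:
  assumes "hilbert G" "\<And>j. j \<in> J \<Longrightarrow> g j \<in> vcarrier G" "snd ` set L \<subseteq> J"
    and "f (vzero G) = vzero H"
    and "\<And>x y. x \<in> vcarrier G \<Longrightarrow> y \<in> vcarrier G \<Longrightarrow> f (vadd G x y) = vadd H (f x) (f y)"
    and "\<And>c x. x \<in> vcarrier G \<Longrightarrow> f (vscale G c x) = vscale H c (f x)"
  shows "f (lincomb G g L) = lincomb H (\<lambda>j. f (g j)) L"
  using assms(3)
proof (induction L)
  case (Cons q L)
  interpret G: hilbert G by fact
  have "lincomb G g L \<in> vcarrier G" by (rule G.lincomb_closed[OF assms(2)]) (use Cons in auto)
  with Cons assms show ?case by simp
qed (simp add: assms)

context star_rep
begin

context
  fixes E :: "('e, 'b) hmod" and \<phi> :: "'a::cstar_algebra \<Rightarrow> 'e \<Rightarrow> 'e"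
  assumes cp_E: "cp_family E \<phi>"
begin

interpretation A: cp_family E \<phi> by (rule cp_E)
interpretation I: interior F \<pi> E
  by (intro interior.intro star_rep_axioms A.E.hilbert_axioms)
interpretation B: cp_family "interior_tensor E F \<pi>" "\<lambda>a. interior_map F \<pi> E E (\<phi> a)"
  by (rule interior_cp_family[OF cp_E])
interpretation J: interior F \<pi> "ksgns_module (E, \<phi>)"
  by (intro interior.intro star_rep_axioms A.hilbert_ksgns)
interpretation II: interior_pair F \<pi> E E
  by (rule interior_pairI[OF A.E.hilbert_axioms A.E.hilbert_axioms])
interpretation BJ: hilbert_pair B.K J.H by (rule hilbert_pairI[OF B.hilbert_ksgns J.hilbert_H])

abbreviation "tensor_ksgns k \<equiv> ktensor (interior_tensor E F \<pi>, \<lambda>a. interior_map F \<pi> E E (\<phi> a))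
  (fst k) (itensor E F \<pi> (fst (snd k)) (snd (snd k)))"

abbreviation "ksgns_tensor k \<equiv> itensor (ksgns_module (E, \<phi>)) F \<pi>
  (ktensor (E, \<phi>) (fst k) (fst (snd k))) (snd (snd k))"

text \<open>For fixed \<open>a\<close> the tensor \<open>a \<otimes> Z\<close> is linear and bounded
  in \<open>Z\<close>, so it is enough to approximate \<open>Z\<close> by combinations of
  \<open>x \<otimes> y\<close>. This gives the first composite generators indexed by
  triples.\<close>

lemma generated_tensor_ksgns:
  "generated_by B.K (UNIV \<times> vcarrier E \<times> vcarrier F) tensor_ksgns"
proof (rule generated_by_approximation[OF B.generated_ksgns])
  fix i :: "'a \<times> ('e, 'f) completed_tensor" and e :: real
  assume "i \<in> UNIV \<times> vcarrier I.H" and e: "e > 0"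
  then obtain a Z where i: "i = (a, Z)" and Z: "Z \<in> vcarrier I.H" by auto
  obtain C where C: "C > 0" "\<And>a Z. Z \<in> vcarrier I.H \<Longrightarrow> hnorm B.K
      (ktensor (I.H, \<lambda>a. interior_map F \<pi> E E (\<phi> a)) a Z) \<le> C * norm a * hnorm I.H Z"
    using B.ktensor_bounded by blast
  define r where "r = C * (norm a + 1)"
  have r: "r > 0" using C by (simp add: r_def add_nonneg_pos)
  let ?t = "ktensor (I.H, \<lambda>a. interior_map F \<pi> E E (\<phi> a)) a"
  obtain L where L: "snd ` set L \<subseteq> vcarrier E \<times> vcarrier F"
    "hdist I.H Z (lincomb I.H (\<lambda>k. itensor E F \<pi> (fst k) (snd k)) L) < e / r"
    by (rule generated_byD[OF I.generated Z divide_pos_pos[OF e r]])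
  let ?z = "lincomb I.H (\<lambda>k. itensor E F \<pi> (fst k) (snd k)) L"
  have z: "?z \<in> vcarrier I.H"
    by (rule B.E.lincomb_closed[OF _ L(1)]) auto
  have eq: "?t ?z = lincomb B.K tensor_ksgns (map (\<lambda>q. (fst q, (a, snd q))) L)"
    unfolding lincomb_comp fst_conv snd_conv
    by (rule lincomb_linear[OF I.hilbert_H _ L(1)])
      (auto simp: B.ktensor_zero_right B.ktensor_add_right B.ktensor_scale_right)
  have "hdist B.K (?t Z) (?t ?z) = hnorm B.K (?t (vdiff I.H Z ?z))"
    by (simp add: B.ktensor_diff_right[OF Z z])
  also have "\<dots> \<le> C * norm a * hdist I.H Z ?z" using C(2) Z z by simp
  also have "\<dots> \<le> r * hdist I.H Z ?z"
    using C(1) by (intro mult_right_mono) (simp_all add: r_def)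
  also have "\<dots> < e" using L(2) r by (simp add: field_simps)
  finally show "\<exists>L. snd ` set L \<subseteq> UNIV \<times> vcarrier E \<times> vcarrier F \<and>
      hdist B.K (ktensor (I.H, \<lambda>a. interior_map F \<pi> E E (\<phi> a)) (fst i) (snd i))
        (lincomb B.K tensor_ksgns L) < e"
    using L(1) unfolding eq i fst_conv snd_conv
    by (intro exI[of _ "map (\<lambda>q. (fst q, (a, snd q))) L"]) auto
qed auto

text \<open>The mirror image: for fixed \<open>y\<close> the tensor \<open>Z \<otimes> y\<close> is
  linear and bounded in \<open>Z\<close>, and \<open>Z\<close> is approximated by combinations of
  \<open>a \<otimes> x\<close>. The index set is the same as for the other composite.\<close>

lemma generated_ksgns_tensor:
  "generated_by J.H (UNIV \<times> vcarrier E \<times> vcarrier F) ksgns_tensor"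
proof (rule generated_by_approximation[OF J.generated])
  fix i :: "('a, 'e) completed_tensor \<times> 'f" and e :: real
  assume "i \<in> vcarrier A.K \<times> vcarrier F" and e: "e > 0"
  then obtain Z y where i: "i = (Z, y)" and Z: "Z \<in> vcarrier A.K" and y: "y \<in> vcarrier F" by auto
  obtain C where C: "C > 0" "\<And>Z y. Z \<in> vcarrier A.K \<Longrightarrow> y \<in> vcarrier F \<Longrightarrow>
      hnorm J.H (itensor A.K F \<pi> Z y) \<le> C * hnorm A.K Z * hnorm F y"
    using J.itensor_bounded by blast
  define r where "r = C * (hnorm F y + 1)"
  have r: "r > 0" using C by (simp add: r_def add_nonneg_pos)
  let ?t = "\<lambda>Z. itensor A.K F \<pi> Z y"
  obtain L where L: "snd ` set L \<subseteq> UNIV \<times> vcarrier E"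
    "hdist A.K Z (lincomb A.K (\<lambda>k. ktensor (E, \<phi>) (fst k) (snd k)) L) < e / r"
    by (rule generated_byD[OF A.generated_ksgns Z divide_pos_pos[OF e r]])
  let ?z = "lincomb A.K (\<lambda>k. ktensor (E, \<phi>) (fst k) (snd k)) L"
  have z: "?z \<in> vcarrier A.K"
    by (rule J.X.lincomb_closed[OF _ L(1)]) auto
  have "lincomb J.H ksgns_tensor (map (\<lambda>q. (fst q, (fst (snd q), snd (snd q), y))) L) =
      lincomb J.H (\<lambda>k. ?t (ktensor (E, \<phi>) (fst k) (snd k))) L"
    using lincomb_comp[of J.H ksgns_tensor "\<lambda>k. (fst k, snd k, y)" L] by simp
  then have eq: "?t ?z = lincomb J.H ksgns_tensor (map (\<lambda>q. (fst q, (fst (snd q), snd (snd q), y))) L)"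
    by (simp only:, intro lincomb_linear[OF A.hilbert_ksgns _ L(1), where f = ?t])
      (auto simp: y J.itensor_zero_left J.itensor_add_left J.itensor_scale_left)
  have "hdist J.H (?t Z) (?t ?z) = hnorm J.H (?t (vdiff A.K Z ?z))"
    by (simp add: J.itensor_diff_left[OF Z z y])
  also have "\<dots> \<le> C * hdist A.K Z ?z * hnorm F y" using C(2) Z z y by simp
  also have "\<dots> \<le> r * hdist A.K Z ?z"
    using C(1) by (simp add: r_def algebra_simps)
  also have "\<dots> < e" using L(2) r by (simp add: field_simps)
  finally have "hdist J.H (?t Z) (?t ?z) < e" .
  moreover have "snd ` set (map (\<lambda>q. (fst q, (fst (snd q), snd (snd q), y))) L) \<subseteq>
      UNIV \<times> vcarrier E \<times> vcarrier F"
    using L(1) y by auto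
  ultimately show "\<exists>L. snd ` set L \<subseteq> UNIV \<times> vcarrier E \<times> vcarrier F \<and>
      hdist J.H (itensor A.K F \<pi> (fst i) (snd i)) (lincomb J.H ksgns_tensor L) < e"
    unfolding eq i fst_conv snd_conv by blast
qed auto

text \<open>Equal Gram matrices over one index set make the identity of indices its own formal
  adjoint. The modulus is then trivial and \<open>M = 1\<close> works; the values of the adjoint
  will exhibit it as the inverse.\<close>

lemma tensor_ksgns_unitary:
  obtains U where "U \<in> adjointable B.K J.H"
    "\<And>a x y. x \<in> vcarrier E \<Longrightarrow> y \<in> vcarrier F \<Longrightarrow> U (tensor_ksgns (a, x, y)) = ksgns_tensor (a, x, y)"
    "\<And>a x y. x \<in> vcarrier E \<Longrightarrow> y \<in> vcarrier F \<Longrightarrow>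
      hadj B.K J.H U (ksgns_tensor (a, x, y)) = tensor_ksgns (a, x, y)"
proof (rule adjointable_on_generators[OF generated_tensor_ksgns generated_ksgns_tensor, of id id 1])
  fix i j :: "'a \<times> 'e \<times> 'f"
  assume "i \<in> UNIV \<times> vcarrier E \<times> vcarrier F" "j \<in> UNIV \<times> vcarrier E \<times> vcarrier F"
  then show "hip J.H (ksgns_tensor (id i)) (ksgns_tensor j) = hip B.K (tensor_ksgns i) (tensor_ksgns (id j))"
    by (auto simp: J.ip_itensor B.ip_ktensor II.interior_map(2) I.ip_itensor A.ip_ktensor)
next
  fix i :: "'a \<times> 'e \<times> 'f"
  show "\<exists>C. \<forall>n. hnorm B.K (tensor_ksgns (((id \<circ> id) ^^ n) i)) \<le> C * 1 ^ n"
  proof -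
    have "((id \<circ> id) ^^ n) i = i" for n by (induction n) auto
    then show ?thesis by auto
  qed
next
  fix U
  assume U: "U \<in> adjointable B.K J.H"
    "\<And>i. i \<in> UNIV \<times> vcarrier E \<times> vcarrier F \<Longrightarrow> U (tensor_ksgns i) = ksgns_tensor (id i)"
    "\<And>j. j \<in> UNIV \<times> vcarrier E \<times> vcarrier F \<Longrightarrow> hadj B.K J.H U (ksgns_tensor j) = tensor_ksgns (id j)"
  show thesis
    by (rule that[OF U(1)]) (use U(2)[of "(_, _, _)"] U(3)[of "(_, _, _)"] in auto)
qed auto

text \<open>Both actions multiply the algebra factor of a generator from the left, so the unitary
  and its adjoint intertwine them. The automorphism component of the isomorphism can then be
  \<open>id\<close>.\<close>

lemma tensor_ksgns_iso:
  obtains U where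
    "pos_iso (on_obj (KSGNS \<circ>\<^sub>F tensor_functor F \<pi>) (E, \<phi>)) (on_obj (tensor_functor F \<pi> \<circ>\<^sub>F KSGNS) (E, \<phi>)) (U, id)"
    "U \<in> adjointable B.K J.H"
    "\<And>a x y. x \<in> vcarrier E \<Longrightarrow> y \<in> vcarrier F \<Longrightarrow>
      U (ktensor (interior_tensor E F \<pi>, \<lambda>a. interior_map F \<pi> E E (\<phi> a)) a (itensor E F \<pi> x y)) =
      itensor (ksgns_module (E, \<phi>)) F \<pi> (ktensor (E, \<phi>) a x) y"
proof -
  obtain U where U: "U \<in> adjointable B.K J.H"
    "\<And>a x y. x \<in> vcarrier E \<Longrightarrow> y \<in> vcarrier F \<Longrightarrow> U (tensor_ksgns (a, x, y)) = ksgns_tensor (a, x, y)"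
    "\<And>a x y. x \<in> vcarrier E \<Longrightarrow> y \<in> vcarrier F \<Longrightarrow>
      hadj B.K J.H U (ksgns_tensor (a, x, y)) = tensor_ksgns (a, x, y)"
    using tensor_ksgns_unitary by blast
  let ?V = "hadj B.K J.H U"
  have V: "?V \<in> adjointable J.H B.K" by (rule BJ.hadj_in_adjointable[OF U(1)])
  let ?\<psi> = "ksgns_rep (I.H, \<lambda>a. interior_map F \<pi> E E (\<phi> a))"
  let ?\<chi> = "\<lambda>a. interior_map F \<pi> A.K A.K (ksgns_rep (E, \<phi>) a)"
  interpret JJ: interior_pair F \<pi> A.K A.K by (rule interior_pairI[OF A.hilbert_ksgns A.hilbert_ksgns])
  note \<chi> = JJ.interior_map[OF A.ksgns_rep(1)]
  have obj: "on_obj (KSGNS \<circ>\<^sub>F tensor_functor F \<pi>) (E, \<phi>) = (B.K, ?\<psi>)"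
    "on_obj (tensor_functor F \<pi> \<circ>\<^sub>F KSGNS) (E, \<phi>) = (J.H, ?\<chi>)"
    by (simp_all add: ftor_comp_def KSGNS_def tensor_functor_def)
  have "(U, id) \<in> pos_hom (B.K, ?\<psi>) (J.H, ?\<chi>)"
  proof (rule pos_homI[OF B.hilbert_ksgns J.hilbert_H U(1) star_automorphism_id generated_tensor_ksgns
        B.ksgns_rep(1) \<chi>(1)])
    fix a and i :: "'a \<times> 'e \<times> 'f" assume i: "i \<in> UNIV \<times> vcarrier E \<times> vcarrier F"
    obtain b x y where i': "i = (b, x, y)" by (cases i)
    have "x \<in> vcarrier E" "y \<in> vcarrier F" using i by (simp_all add: i')
    then show "?\<chi> (id a) (U (tensor_ksgns i)) = U (?\<psi> a (tensor_ksgns i))"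
      using U(2)[of x y b] U(2)[of x y "a * b"] by (simp add: i' \<chi>(2) A.ksgns_rep(2) B.ksgns_rep(2))
  qed
  moreover have "(?V, id) \<in> pos_hom (J.H, ?\<chi>) (B.K, ?\<psi>)"
  proof (rule pos_homI[OF J.hilbert_H B.hilbert_ksgns V star_automorphism_id generated_ksgns_tensor
        \<chi>(1) B.ksgns_rep(1)])
    fix a and i :: "'a \<times> 'e \<times> 'f" assume i: "i \<in> UNIV \<times> vcarrier E \<times> vcarrier F"
    obtain b x y where i': "i = (b, x, y)" by (cases i)
    have "x \<in> vcarrier E" "y \<in> vcarrier F" using i by (simp_all add: i')
    then show "?\<psi> (id a) (?V (ksgns_tensor i)) = ?V (?\<chi> a (ksgns_tensor i))"
      using U(3)[of x y b] U(3)[of x y "a * b"] by (simp add: i' \<chi>(2) A.ksgns_rep(2) B.ksgns_rep(2))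
  qed
  moreover have "compose (vcarrier B.K) ?V U = restrict id (vcarrier B.K)"
    by (rule adjointable_eqI[OF generated_tensor_ksgns B.hilbert_ksgns
          adjointable_compose(1)[OF B.hilbert_ksgns J.hilbert_H B.hilbert_ksgns U(1) V]
          adjointable_id[OF B.hilbert_ksgns]])
      (use U(2,3) in \<open>auto simp: compose_def\<close>)
  moreover have "compose (vcarrier J.H) U ?V = restrict id (vcarrier J.H)"
    by (rule adjointable_eqI[OF generated_ksgns_tensor J.hilbert_H
          adjointable_compose(1)[OF J.hilbert_H B.hilbert_ksgns J.hilbert_H V U(1)]
          adjointable_id[OF J.hilbert_H]])
      (use U(2,3) in \<open>auto simp: compose_def\<close>)
  ultimately have "pos_iso (B.K, ?\<psi>) (J.H, ?\<chi>) (U, id)"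
    unfolding pos_iso_def by (intro conjI bexI[of _ "(?V, id)"]) (simp_all add: pos_comp_def pos_id_def)
  then show thesis
    by (intro that[of U] U(1) U(2)[unfolded fst_conv snd_conv]) (simp_all add: obj)
qed

end

end

section \<open>Naturality\<close>

lemma is_functor_comp:
  assumes "is_functor C D \<Phi>" "is_functor D E \<Psi>"
  shows "is_functor C E (\<Psi> \<circ>\<^sub>F \<Phi>)"
  using assms unfolding is_functor_def ftor_comp_def by simp

theorem theorem4p6:
  fixes F :: "('f, 'c::cstar_algebra) hmod"
    and \<pi> :: "'b::cstar_algebra \<Rightarrow> 'f \<Rightarrow> 'f"
  assumes "(F, \<pi>) \<in> Obj Cor"
  shows "naturally_isomorphic
    (PosCor :: (('e, 'a::cstar_algebra, 'b) pos_obj, ('e, 'e, 'a) pos_mor) cat)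
    (KSGNS \<circ>\<^sub>F tensor_functor F \<pi>)
    (tensor_functor F \<pi> \<circ>\<^sub>F KSGNS)"
proof -
  have F: "hilbert F" and rep: "star_representation F \<pi>"
    using assms hilbertI by (auto simp: Cor_def)
  interpret star_rep F \<pi>
    using F rep by (intro star_rep.intro adjointable_family.intro hilbert_pairI)
      (simp_all add: adjointable_family_axioms_def star_rep_axioms_def star_representation_def)
  let ?\<Phi> = "KSGNS \<circ>\<^sub>F tensor_functor F \<pi>" and ?\<Psi> = "tensor_functor F \<pi> \<circ>\<^sub>F KSGNS"
  let ?C = "PosCor :: (('e, 'a, 'b) pos_obj, ('e, 'e, 'a) pos_mor) cat"
  define T where "T = (\<lambda>E. interior_tensor E F \<pi> :: (('e, 'f) completed_tensor, 'c) hmod)"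
  define tilde where "tilde = (\<lambda>(E :: ('e, 'b) hmod) (\<phi> :: 'a \<Rightarrow> 'e \<Rightarrow> 'e) a. interior_map F \<pi> E E (\<phi> a))"
  \<comment> \<open>Besides being an isomorphism, the chosen component must keep its values on
    generators, where naturality is tested.\<close>
  define P where "P = (\<lambda>(X :: ('e, 'a, 'b) pos_obj) U. pos_iso (on_obj ?\<Phi> X) (on_obj ?\<Psi> X) (U, id) \<and>
    U \<in> adjointable (fst (on_obj ?\<Phi> X)) (fst (on_obj ?\<Psi> X)) \<and>
    (\<forall>a. \<forall>x\<in>vcarrier (fst X). \<forall>y\<in>vcarrier F.
      U (ktensor (T (fst X), tilde (fst X) (snd X)) a (itensor (fst X) F \<pi> x y)) =
      itensor (ksgns_module X) F \<pi> (ktensor X a x) y))"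
  have "\<exists>U. P X U" if X: "X \<in> Obj ?C" for X
  proof -
    obtain E \<phi> where X': "X = (E, \<phi>)" by (cases X)
    have cp: "cp_family E \<phi>" using X by (simp add: X' PosCor_obj)
    obtain U where "pos_iso (on_obj ?\<Phi> (E, \<phi>)) (on_obj ?\<Psi> (E, \<phi>)) (U, id)"
      "U \<in> adjointable (ksgns_module (interior_tensor E F \<pi>, \<lambda>a. interior_map F \<pi> E E (\<phi> a)))
        (interior_tensor (ksgns_module (E, \<phi>)) F \<pi>)"
      "\<And>a x y. x \<in> vcarrier E \<Longrightarrow> y \<in> vcarrier F \<Longrightarrow>
        U (ktensor (interior_tensor E F \<pi>, \<lambda>a. interior_map F \<pi> E E (\<phi> a)) a (itensor E F \<pi> x y)) =
        itensor (ksgns_module (E, \<phi>)) F \<pi> (ktensor (E, \<phi>) a x) y"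
      by (rule tensor_ksgns_iso[OF cp]) (rule that)
    then show ?thesis
      unfolding P_def X' T_def tilde_def
      by (intro exI[of _ U]) (simp add: ftor_comp_def KSGNS_def tensor_functor_def)
  qed
  then obtain U where U: "\<And>X. X \<in> Obj ?C \<Longrightarrow> P X (U X)" by metis
  have nat: "pos_comp (on_obj ?\<Phi> X) (U Y, id) (on_mor ?\<Phi> X Y f) =
      pos_comp (on_obj ?\<Phi> X) (on_mor ?\<Psi> X Y f) (U X, id)"
    if X: "X \<in> Obj ?C" and Y: "Y \<in> Obj ?C" and f: "f \<in> Hom ?C X Y" for X Y f
  proof -
    obtain E1 \<phi>1 where X': "X = (E1, \<phi>1)" by (cases X)
    obtain E2 \<phi>2 where Y': "Y = (E2, \<phi>2)" by (cases Y)
    obtain \<eta> \<alpha> where f': "f = (\<eta>, \<alpha>)" by (cases f)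
    have cp1: "cp_family E1 \<phi>1" using X by (simp add: X' PosCor_obj)
    have cp2: "cp_family E2 \<phi>2" using Y by (simp add: Y' PosCor_obj)
    interpret A1: cp_family E1 \<phi>1 by fact
    interpret A2: cp_family E2 \<phi>2 by fact
    have hom: "(\<eta>, \<alpha>) \<in> pos_hom (E1, \<phi>1) (E2, \<phi>2)" using f by (simp add: X' Y' f' PosCor_simps)
    then have \<eta>: "\<eta> \<in> adjointable E1 E2" by (simp add: pos_hom_def)
    have \<eta>_closed: "\<eta> x \<in> vcarrier E2" if "x \<in> vcarrier E1" for x
      using \<eta> that by (auto simp: adjointable_def)
    interpret KP: ksgns_pair E1 \<phi>1 E2 \<phi>2 by (rule ksgns_pairI[OF cp1 cp2])
    interpret IP: interior_pair F \<pi> E1 E2 by (rule interior_pairI[OF A1.E.hilbert_axioms A2.E.hilbert_axioms])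
    interpret KI: interior_pair F \<pi> "ksgns_module (E1, \<phi>1)" "ksgns_module (E2, \<phi>2)"
      by (rule interior_pairI[OF A1.hilbert_ksgns A2.hilbert_ksgns])
    interpret B: ksgns_pair "interior_tensor E1 F \<pi>" "tilde E1 \<phi>1" "interior_tensor E2 F \<pi>" "tilde E2 \<phi>2"
      unfolding tilde_def by (intro ksgns_pairI interior_cp_family cp1 cp2)
    let ?f1 = "(interior_map F \<pi> E1 E2 \<eta>, \<alpha>)"
    let ?k = "ksgns_map (E1, \<phi>1) (E2, \<phi>2) (\<eta>, \<alpha>)"
    let ?k1 = "ksgns_map (interior_tensor E1 F \<pi>, tilde E1 \<phi>1) (interior_tensor E2 F \<pi>, tilde E2 \<phi>2) ?f1"
    have "on_mor (tensor_functor F \<pi>) X Y f \<in>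
        pos_hom (on_obj (tensor_functor F \<pi>) X) (on_obj (tensor_functor F \<pi>) Y)"
      using is_functor_tensor X Y f unfolding is_functor_def PosCor_simps by blast
    then have hom1: "?f1 \<in> pos_hom (interior_tensor E1 F \<pi>, tilde E1 \<phi>1) (interior_tensor E2 F \<pi>, tilde E2 \<phi>2)"
      by (simp add: X' Y' f' tensor_functor_def tilde_def)
    note k = KP.ksgns_map[OF hom] and k1 = B.ksgns_map[OF hom1]
    note ik = KI.interior_map[OF k(1)]
    have obj: "fst (on_obj ?\<Phi> X) = B.A1.K" "fst (on_obj ?\<Psi> X) = KI.I1.H"
      "fst (on_obj ?\<Phi> Y) = B.A2.K" "fst (on_obj ?\<Psi> Y) = KI.I2.H"
      by (simp_all add: X' Y' ftor_comp_def KSGNS_def tensor_functor_def tilde_def)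
    have mor: "on_mor ?\<Phi> X Y f = (?k1, \<alpha>)"
      "on_mor ?\<Psi> X Y f = (interior_map F \<pi> A1.K A2.K ?k, \<alpha>)"
      by (simp_all add: X' Y' f' ftor_comp_def KSGNS_def tensor_functor_def tilde_def)
    have UX: "U X \<in> adjointable B.A1.K KI.I1.H" and UY: "U Y \<in> adjointable B.A2.K KI.I2.H"
      using U[OF X] U[OF Y] unfolding P_def obj by simp_all
    have UXg: "U X (ktensor (interior_tensor E1 F \<pi>, tilde E1 \<phi>1) a (itensor E1 F \<pi> x y)) =
        itensor A1.K F \<pi> (ktensor (E1, \<phi>1) a x) y" if "x \<in> vcarrier E1" "y \<in> vcarrier F" for a x y
      using U[OF X] that unfolding P_def by (simp add: X' T_def)
    have UYg: "U Y (ktensor (interior_tensor E2 F \<pi>, tilde E2 \<phi>2) a (itensor E2 F \<pi> x y)) =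
        itensor A2.K F \<pi> (ktensor (E2, \<phi>2) a x) y" if "x \<in> vcarrier E2" "y \<in> vcarrier F" for a x y
      using U[OF Y] that unfolding P_def by (simp add: Y' T_def)
    have gen: "generated_by B.A1.K (UNIV \<times> vcarrier E1 \<times> vcarrier F)
        (\<lambda>k. ktensor (interior_tensor E1 F \<pi>, tilde E1 \<phi>1) (fst k)
          (itensor E1 F \<pi> (fst (snd k)) (snd (snd k))))"
      using generated_tensor_ksgns[OF cp1] by (simp add: tilde_def)
    \<comment> \<open>On \<open>a \<otimes> (x \<otimes> y)\<close> both sides give
      \<open>(\<alpha> a \<otimes> \<eta> x) \<otimes> y\<close>.\<close>
    have "compose (vcarrier B.A1.K) (U Y) ?k1 =
        compose (vcarrier B.A1.K) (interior_map F \<pi> A1.K A2.K ?k) (U X)"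
    proof (rule adjointable_eqI[OF gen KI.I2.hilbert_H])
      show "compose (vcarrier B.A1.K) (U Y) ?k1 \<in> adjointable B.A1.K KI.I2.H"
        by (rule adjointable_compose(1)[OF B.A1.hilbert_ksgns B.A2.hilbert_ksgns KI.I2.hilbert_H k1(1) UY])
      show "compose (vcarrier B.A1.K) (interior_map F \<pi> A1.K A2.K ?k) (U X) \<in> adjointable B.A1.K KI.I2.H"
        by (rule adjointable_compose(1)[OF B.A1.hilbert_ksgns KI.I1.hilbert_H KI.I2.hilbert_H UX ik(1)])
      fix i :: "'a \<times> 'e \<times> 'f" assume i: "i \<in> UNIV \<times> vcarrier E1 \<times> vcarrier F"
      obtain a x y where i': "i = (a, x, y)" by (cases i)
      have xy: "x \<in> vcarrier E1" "y \<in> vcarrier F" using i by (simp_all add: i')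
      then show "compose (vcarrier B.A1.K) (U Y) ?k1
          (ktensor (interior_tensor E1 F \<pi>, tilde E1 \<phi>1) (fst i) (itensor E1 F \<pi> (fst (snd i)) (snd (snd i)))) =
        compose (vcarrier B.A1.K) (interior_map F \<pi> A1.K A2.K ?k) (U X)
          (ktensor (interior_tensor E1 F \<pi>, tilde E1 \<phi>1) (fst i) (itensor E1 F \<pi> (fst (snd i)) (snd (snd i))))"
        by (simp add: i' compose_def k1(2) k(2) ik(2) IP.interior_map(2)[OF \<eta>] UXg UYg \<eta>_closed)
    qed
    then show ?thesis by (simp add: mor pos_comp_def obj)
  qed
  have "is_functor ?C PosCor ?\<Phi>" "is_functor ?C PosCor ?\<Psi>"
    by (rule is_functor_comp[OF is_functor_tensor is_functor_KSGNS]
        is_functor_comp[OF is_functor_KSGNS is_functor_tensor])+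
  moreover have "pos_iso (on_obj ?\<Phi> X) (on_obj ?\<Psi> X) (U X, id)" if "X \<in> Obj ?C" for X
    using U[OF that] by (simp add: P_def)
  ultimately show ?thesis
    unfolding naturally_isomorphic_def using nat
    by (intro conjI exI[of _ "\<lambda>X. (U X, id)"] ballI) simp_all
qed

end
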